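(* Let $\Gamma\subset\mathrm{PSL}(2,\mathbb R)$ be a discrete subgroup of finite covolume. Then (as $\mathfrak{sl}_2(\mathbb C)$-modules) $$\widetilde M_*(\Gamma)=\bigoplus_{k=0}^{\infty}M_k(\Gamma)\otimes\mathcal U_k\;\oplus\;\begin{cases}0&\text{if }\delta(\widetilde M_2(\Gamma))=0,\\[1mm]\widehat U_2&\text{if there exists }\phi\in\widetilde M_2(\Gamma)\text{ such that }\delta(\phi)=1.\end{cases}$$
   Context: $\mathcal H$ is the upper half plane. A modular form of weight $k$ over $\Gamma$ is a holomorphic $f:\mathcal H\to\mathbb C$ of moderate growth with $(cz+d)^{-k}f(\frac{az+b}{cz+d})=f(z)$ for all $\begin{pmatrix}a&b\\c&d\end{pmatrix}\in\Gamma$ and $z\in\mathcal H$. A quasimodular form of weight $k$ and depth $\le p$ over $\Gamma$ is a holomorphic $f:\mathcal H\to\mathbb C$ of moderate growth for which there are functions $f_0,\dots,f_p:\mathcal H\to\mathbb C$ with $(cz+d)^{-k}f(\frac{az+b}{cz+d})=\sum_{j=0}^p f_j(z)\left(\frac{c}{cz+d}\right)^j$ for all $z\in\mathcal H$ and all $\begin{pmatrix}a&b\\c&d\end{pmatrix}\in\Gamma$. The $f_j$ are determined by $f$, and $f_0=f$. $M_k$ and $\widetilde M_k$ are the spaces of modular and quasimodular forms of weight $k$, and $\widetilde M_*=\bigoplus_{k\ge0}\widetilde M_k$. On $\widetilde M_*$ the Lie algebra $\mathfrak{sl}_2(\mathbb C)$, with basis $D,\delta,H$ and relations $[H,D]=2D$,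 $[H,\delta]=-2\delta$, $[\delta,D]=H$, acts by $D=d/dz$, $\delta(f)=f_1$, and $H(f)=kf$ for $f\in\widetilde M_k$. For $k>0$, $\mathcal U_k$ is the $\mathfrak{sl}_2(\mathbb C)$-module with basis $(x^{(k)}_j)_{j\ge0}$ and action $Dx^{(k)}_j=x^{(k)}_{j+1}$, $Hx^{(k)}_j=(k+2j)x^{(k)}_j$, $\delta x^{(k)}_j=j(k+j-1)x^{(k)}_{j-1}$ for $j\ge1$, $\delta x^{(k)}_0=0$. $\mathcal U_0=\mathbb C$ with trivial action. If there exists $\phi\in\widetilde M_2(\Gamma)$ with $\delta(\phi)=1$, $\widehat U_2$ denotes the extension of $\mathcal U_2$ (as a vector space $\widehat U_2\simeq\mathbb C\oplus\mathcal U_2$) spanned by $1$ and elements $(\hat x_j)_{j\ge0}$, on which $\mathfrak{sl}_2(\mathbb C)$ acts on the $\hat x_j$ by the same formulas as on the basis $x^{(2)}_j$ of $\mathcal U_2$, except that $\delta\hat x_0=1$. The summands are related to $\widetilde M_*$ by the following maps: for $k>0$ the embedding $M_k\otimes\mathcal U_k\to\widetilde M_*$, $f\otimes x^{(k)}_j\mapsto D^jf$; for $k=0$ the map $\mathbb C\otimes\mathbb C\to\mathbb C$; and, when $\phi$ exists, a map $\mathbb C\phi\otimes\widehat U_2\to\widetilde M_*$ given by $\phi\otimes\hat x_i\mapsto D^i\phi$ for $i\ge1$ and $\phi\otimes1\mapsto1$.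
   Formalization: When φ exists, the sum of M_k⊗U_k is taken over k≥1 rather than k≥0: the constants M_0⊗U_0 already occur in Û_2 as the span of 1, so the sum as printed counts them twice, while the weight 0 part of the left side is one-dimensional (e.g. for PSL(2,Z)). *)

theory Defs
  imports
    "HOL-Complex_Analysis.Complex_Analysis"
    "HOL-Algebra.Coset"
    "HOL-Library.Function_Algebras"
begin

section \<open>Complex vector spaces of functions\<close>

text \<open>
  All vector spaces below are subspaces of some function space \<^typ>\<open>'x \<Rightarrow> complex\<close>
  with pointwise operations. A space with a given basis indexed by \<^typ>\<open>'x\<close> is
  represented by the finitely supported coefficient functions.
\<close>

definition cscale :: "complex \<Rightarrow> ('x \<Rightarrow> complex) \<Rightarrow> 'x \<Rightarrow> complex" where
  "cscale c u = (\<lambda>x. c * u x)"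

interpretation cfun: vector_space cscale
  by unfold_locales (auto simp: cscale_def fun_eq_iff algebra_simps)

definition linear_between ::
  "('x \<Rightarrow> complex) set \<Rightarrow> ('y \<Rightarrow> complex) set \<Rightarrow> (('x \<Rightarrow> complex) \<Rightarrow> 'y \<Rightarrow> complex) \<Rightarrow> bool" where
  "linear_between V W T \<longleftrightarrow>
     (\<forall>u\<in>V. T u \<in> W) \<and>
     (\<forall>u\<in>V. \<forall>v\<in>V. T (u + v) = T u + T v) \<and>
     (\<forall>c. \<forall>u\<in>V. T (cscale c u) = cscale c (T u))"

definition finsupp :: "('x \<Rightarrow> complex) set" where
  "finsupp = {u. finite {x. u x \<noteq> 0}}"

definition bvec :: "'x \<Rightarrow> 'x \<Rightarrow> complex" where
  "bvec i = (\<lambda>x. if x = i then 1 else 0)"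

text \<open>\<open>lin_ext b\<close> is the linear map on \<^const>\<open>finsupp\<close> with \<open>bvec i \<mapsto> b i\<close>.\<close>

definition lin_ext :: "('x \<Rightarrow> 'y \<Rightarrow> complex) \<Rightarrow> ('x \<Rightarrow> complex) \<Rightarrow> 'y \<Rightarrow> complex" where
  "lin_ext b u = (\<Sum>i | u i \<noteq> 0. cscale (u i) (b i))"

lemma lin_ext_bvec: "lin_ext b (bvec i) = b i"
proof -
  have "{j. bvec i j \<noteq> (0::complex)} = {i}" by (auto simp: bvec_def)
  then show ?thesis by (simp add: lin_ext_def bvec_def cscale_def)
qed

lemma lin_ext_superset:
  assumes "finite A" "{i. u i \<noteq> 0} \<subseteq> A"
  shows "lin_ext b u = (\<Sum>i\<in>A. cscale (u i) (b i))"
  unfolding lin_ext_def using assms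
  by (intro sum.mono_neutral_left) (auto simp: cscale_def fun_eq_iff)

lemma lin_ext_linear: "linear_between finsupp UNIV (lin_ext b)"
  unfolding linear_between_def
proof (intro conjI ballI allI)
  fix u v :: "'a \<Rightarrow> complex" assume u: "u \<in> finsupp" and v: "v \<in> finsupp"
  define A where "A = {i. u i \<noteq> 0} \<union> {i. v i \<noteq> 0}"
  have A: "finite A" using u v by (auto simp: A_def finsupp_def)
  have "lin_ext b (u + v) = (\<Sum>i\<in>A. cscale ((u + v) i) (b i))"
    by (rule lin_ext_superset[OF A]) (auto simp: A_def)
  also have "\<dots> = (\<Sum>i\<in>A. cscale (u i) (b i)) + (\<Sum>i\<in>A. cscale (v i) (b i))"
    by (simp add: cfun.scale_left_distrib sum.distrib)
  also have "\<dots> = lin_ext b u + lin_ext b v"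
    by (subst (1 2) lin_ext_superset[OF A]) (auto simp: A_def)
  finally show "lin_ext b (u + v) = lin_ext b u + lin_ext b v" .
next
  fix c and u :: "'a \<Rightarrow> complex" assume u: "u \<in> finsupp"
  define A where "A = {i. u i \<noteq> 0}"
  have A: "finite A" using u by (auto simp: A_def finsupp_def)
  have "lin_ext b (cscale c u) = (\<Sum>i\<in>A. cscale (cscale c u i) (b i))"
    by (rule lin_ext_superset[OF A]) (auto simp: A_def cscale_def)
  also have "\<dots> = cscale c (lin_ext b u)"
    by (simp add: lin_ext_def A_def cfun.scale_sum_right) (simp add: cscale_def mult.assoc)
  finally show "lin_ext b (cscale c u) = cscale c (lin_ext b u)" .
qed simp


subsection \<open>Tensor products\<close>

text \<open>
  The algebraic tensor product of function spaces \<open>V\<close> on \<open>X\<close> and \<open>W\<close> on \<open>Y\<close> is realised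
  as the span of the functions \<open>(x, y) \<mapsto> f x * g y\<close> on \<open>X \<times> Y\<close>. The lemma \<open>tensor_indep\<close>
  is what makes this legitimate: the canonical map from the abstract tensor product
  into functions on \<open>X \<times> Y\<close> is injective.
\<close>

definition tensor :: "('x \<Rightarrow> complex) \<Rightarrow> ('y \<Rightarrow> complex) \<Rightarrow> 'x \<times> 'y \<Rightarrow> complex" where
  "tensor f g = (\<lambda>(x, y). f x * g y)"

definition tensor_space ::
  "('x \<Rightarrow> complex) set \<Rightarrow> ('y \<Rightarrow> complex) set \<Rightarrow> ('x \<times> 'y \<Rightarrow> complex) set" where
  "tensor_space V W = cfun.span {tensor f g | f g. f \<in> V \<and> g \<in> W}"

lemma sum_fun_apply: "(\<Sum>i\<in>A. F i) x = (\<Sum>i\<in>A. F i x)"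
  by (induction A rule: infinite_finite_induct) auto

lemma tensor_indep:
  assumes "finite B" "cfun.independent B"
    and zero: "(\<Sum>b\<in>B. tensor b (h b)) = 0" and "b \<in> B"
  shows "h b = 0"
proof
  fix y
  have "(\<Sum>b\<in>B. cscale (h b y) b) = 0"
  proof
    fix x
    have "(\<Sum>b\<in>B. tensor b (h b)) (x, y) = 0" by (simp add: zero)
    then show "(\<Sum>b\<in>B. cscale (h b y) b) x = 0 x"
      by (simp add: sum_fun_apply tensor_def cscale_def mult.commute)
  qed
  with assms show "h b y = 0 y"
    by (auto dest: cfun.independentD[OF _ _ subset_refl])
qed


subsection \<open>Direct sums\<close>

definition slice :: "('i \<times> 'x \<Rightarrow> complex) \<Rightarrow> 'i \<Rightarrow> 'x \<Rightarrow> complex" where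
  "slice F i = (\<lambda>x. F (i, x))"

definition summand :: "'i \<Rightarrow> ('x \<Rightarrow> complex) \<Rightarrow> 'i \<times> 'x \<Rightarrow> complex" where
  "summand i u = (\<lambda>(j, x). if j = i then u x else 0)"

definition direct_sum :: "'i set \<Rightarrow> ('i \<Rightarrow> ('x \<Rightarrow> complex) set) \<Rightarrow> ('i \<times> 'x \<Rightarrow> complex) set" where
  "direct_sum I V =
     {F. finite {i. slice F i \<noteq> 0} \<and> (\<forall>i\<in>I. slice F i \<in> V i) \<and> (\<forall>i. i \<notin> I \<longrightarrow> slice F i = 0)}"


section \<open>Modules over \<open>sl\<^sub>2\<close>\<close>

record 'x sl2_rep =
  vecs :: "('x \<Rightarrow> complex) set"
  actD :: "('x \<Rightarrow> complex) \<Rightarrow> 'x \<Rightarrow> complex"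
  actd :: "('x \<Rightarrow> complex) \<Rightarrow> 'x \<Rightarrow> complex"
  actH :: "('x \<Rightarrow> complex) \<Rightarrow> 'x \<Rightarrow> complex"

text \<open>The three operators give the action of the basis \<open>D\<close>, \<open>\<delta>\<close>, \<open>H\<close> of \<open>sl\<^sub>2\<close>.\<close>

definition sl2_module :: "'x sl2_rep \<Rightarrow> bool" where
  "sl2_module R \<longleftrightarrow>
     cfun.subspace (vecs R) \<and>
     linear_between (vecs R) (vecs R) (actD R) \<and>
     linear_between (vecs R) (vecs R) (actd R) \<and>
     linear_between (vecs R) (vecs R) (actH R) \<and>
     (\<forall>v\<in>vecs R.
        actH R (actD R v) - actD R (actH R v) = cscale 2 (actD R v) \<and>
        actH R (actd R v) - actd R (actH R v) = cscale (-2) (actd R v) \<and>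
        actd R (actD R v) - actD R (actd R v) = actH R v)"

definition sl2_iso ::
  "(('x \<Rightarrow> complex) \<Rightarrow> 'y \<Rightarrow> complex) \<Rightarrow> 'x sl2_rep \<Rightarrow> 'y sl2_rep \<Rightarrow> bool" where
  "sl2_iso T R S \<longleftrightarrow>
     sl2_module R \<and> sl2_module S \<and>
     linear_between (vecs R) (vecs S) T \<and> bij_betw T (vecs R) (vecs S) \<and>
     (\<forall>v\<in>vecs R.
        T (actD R v) = actD S (T v) \<and>
        T (actd R v) = actd S (T v) \<and>
        T (actH R v) = actH S (T v))"

definition sl2_sum :: "'i set \<Rightarrow> ('i \<Rightarrow> 'x sl2_rep) \<Rightarrow> ('i \<times> 'x) sl2_rep" where
  "sl2_sum I R =
     \<lparr>vecs = direct_sum I (\<lambda>i. vecs (R i)),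
      actD = (\<lambda>F (i, x). actD (R i) (slice F i) x),
      actd = (\<lambda>F (i, x). actd (R i) (slice F i) x),
      actH = (\<lambda>F (i, x). actH (R i) (slice F i) x)\<rparr>"

definition in_left :: "('x \<Rightarrow> complex) \<Rightarrow> 'x + 'y \<Rightarrow> complex" where
  "in_left u = case_sum u (\<lambda>_. 0)"

definition in_right :: "('y \<Rightarrow> complex) \<Rightarrow> 'x + 'y \<Rightarrow> complex" where
  "in_right v = case_sum (\<lambda>_. 0) v"

definition sl2_plus :: "'x sl2_rep \<Rightarrow> 'y sl2_rep \<Rightarrow> ('x + 'y) sl2_rep" where
  "sl2_plus R S =
     \<lparr>vecs = {F. F \<circ> Inl \<in> vecs R \<and> F \<circ> Inr \<in> vecs S},
      actD = (\<lambda>F. case_sum (actD R (F \<circ> Inl)) (actD S (F \<circ> Inr))),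
      actd = (\<lambda>F. case_sum (actd R (F \<circ> Inl)) (actd S (F \<circ> Inr))),
      actH = (\<lambda>F. case_sum (actH R (F \<circ> Inl)) (actH S (F \<circ> Inr)))\<rparr>"

text \<open>\<open>V \<otimes> R\<close> for a vector space \<open>V\<close> and a module \<open>R\<close>: each \<open>X\<close> acts as \<open>id \<otimes> X\<close>,
  that is, on the second variable.\<close>

definition sl2_tensor :: "('x \<Rightarrow> complex) set \<Rightarrow> 'y sl2_rep \<Rightarrow> ('x \<times> 'y) sl2_rep" where
  "sl2_tensor V R =
     \<lparr>vecs = tensor_space V (vecs R),
      actD = (\<lambda>T (x, y). actD R (slice T x) y),
      actd = (\<lambda>T (x, y). actd R (slice T x) y),
      actH = (\<lambda>T (x, y). actH R (slice T x) y)\<rparr>"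

text \<open>The module \<open>U\<^sub>k\<close> with basis \<open>x\<^sub>j = bvec j\<close>; for \<open>k = 0\<close> the trivial module spanned
  by \<open>bvec 0\<close>.\<close>

definition U_mod :: "int \<Rightarrow> nat sl2_rep" where
  "U_mod k =
     (if k = 0 then
        \<lparr>vecs = cfun.span {bvec 0}, actD = (\<lambda>_. 0), actd = (\<lambda>_. 0), actH = (\<lambda>_. 0)\<rparr>
      else
        \<lparr>vecs = finsupp,
         actD = lin_ext (\<lambda>j. bvec (j + 1)),
         actd = lin_ext (\<lambda>j. if j = 0 then 0
                             else cscale (of_nat j * (of_int k + of_nat j - 1)) (bvec (j - 1))),
         actH = lin_ext (\<lambda>j. cscale (of_int k + 2 * of_nat j) (bvec j))\<rparr>)"

text \<open>The extension of \<open>U\<^sub>2\<close> by the trivial module: \<open>bvec None\<close> is the vector \<open>1\<close>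
  (killed by \<open>sl\<^sub>2\<close>) and \<open>bvec (Some j)\<close> is the \<open>j\<close>-th generator.\<close>

definition U2hat :: "nat option sl2_rep" where
  "U2hat =
     \<lparr>vecs = finsupp,
      actD = lin_ext (\<lambda>i. case i of None \<Rightarrow> 0 | Some j \<Rightarrow> bvec (Some (j + 1))),
      actd = lin_ext (\<lambda>i. case i of None \<Rightarrow> 0
                | Some j \<Rightarrow> if j = 0 then bvec None
                            else cscale (of_nat j * (of_nat j + 1)) (bvec (Some (j - 1)))),
      actH = lin_ext (\<lambda>i. case i of None \<Rightarrow> 0
                | Some j \<Rightarrow> cscale (2 + 2 * of_nat j) (bvec (Some j)))\<rparr>"


section \<open>Discrete subgroups of \<open>PSL(2,R)\<close>\<close>

definition SL2R :: "(real^2^2) monoid" where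
  "SL2R = \<lparr>carrier = {A. det A = 1}, mult = (**), one = mat 1\<rparr>"

definition PSL2R :: "(real^2^2) set monoid" where
  "PSL2R = SL2R Mod {mat 1, - mat 1}"

lemma carrier_PSL2R: "carrier PSL2R = {{A, - A} | A. det A = 1}"
proof -
  have neg: "(- mat 1) ** A = - A" for A :: "real^2^2"
    by (simp add: vec_eq_iff matrix_matrix_mult_def mat_def sum_2 forall_2)
  show ?thesis
    by (auto simp: PSL2R_def carrier_FactGroup SL2R_def r_coset_def neg image_iff)
qed

lemma PSL2R_cosets_disjoint:
  assumes "X \<in> carrier PSL2R" "Y \<in> carrier PSL2R" "A \<in> X" "A \<in> Y"
  shows "X = Y"
  using assms by (auto simp: carrier_PSL2R)

text \<open>The quotient topology; cosets are sets of matrices, so \<open>\<Union>U\<close> is the preimage of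
  \<open>U\<close> under the projection.\<close>

definition PSL2R_topology :: "(real^2^2) set topology" where
  "PSL2R_topology =
     topology (\<lambda>U. U \<subseteq> carrier PSL2R \<and> openin (top_of_set (carrier SL2R)) (\<Union>U))"

lemma openin_PSL2R_topology:
  "openin PSL2R_topology U \<longleftrightarrow>
     U \<subseteq> carrier PSL2R \<and> openin (top_of_set (carrier SL2R)) (\<Union>U)"
proof -
  have "istopology (\<lambda>U. U \<subseteq> carrier PSL2R \<and> openin (top_of_set (carrier SL2R)) (\<Union>U))"
    unfolding istopology_def
  proof (intro conjI allI impI)
    fix S T :: "(real^2^2) set set"
    assume S: "S \<subseteq> carrier PSL2R \<and> openin (top_of_set (carrier SL2R)) (\<Union>S)"
      and T: "T \<subseteq> carrier PSL2R \<and> openin (top_of_set (carrier SL2R)) (\<Union>T)"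
    have "\<Union>(S \<inter> T) = \<Union>S \<inter> \<Union>T"
    proof (intro subset_antisym subsetI)
      fix A assume "A \<in> \<Union>S \<inter> \<Union>T"
      then obtain X Y where XY: "X \<in> S" "Y \<in> T" "A \<in> X" "A \<in> Y" by blast
      then have "X = Y" using S T by (intro PSL2R_cosets_disjoint) auto
      with XY show "A \<in> \<Union>(S \<inter> T)" by auto
    qed auto
    then show "S \<inter> T \<subseteq> carrier PSL2R" "openin (top_of_set (carrier SL2R)) (\<Union>(S \<inter> T))"
      using S T by (auto intro: openin_Int)
  next
    fix K :: "(real^2^2) set set set"
    assume K: "\<forall>S\<in>K. S \<subseteq> carrier PSL2R \<and> openin (top_of_set (carrier SL2R)) (\<Union>S)"
    then show "\<Union>K \<subseteq> carrier PSL2R" by auto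
    have "\<Union>(\<Union>K) = \<Union>((\<lambda>S. \<Union>S) ` K)" by auto
    then show "openin (top_of_set (carrier SL2R)) (\<Union>(\<Union>K))"
      using K by (metis (no_types, lifting) imageE openin_Union)
  qed
  then show ?thesis by (simp add: PSL2R_topology_def topology_inverse')
qed

definition discrete_subgroup :: "(real^2^2) set set \<Rightarrow> bool" where
  "discrete_subgroup \<Gamma> \<longleftrightarrow>
     subgroup \<Gamma> PSL2R \<and> subtopology PSL2R_topology \<Gamma> = discrete_topology \<Gamma>"

definition uhp :: "complex set" where
  "uhp = {z. Im z > 0}"

definition moebius :: "real^2^2 \<Rightarrow> complex \<Rightarrow> complex" where
  "moebius A z = (of_real (A$1$1) * z + of_real (A$1$2)) / (of_real (A$2$1) * z + of_real (A$2$2))"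

text \<open>For a subgroup \<open>\<Gamma>\<close> of \<^const>\<open>PSL2R\<close>, \<open>A \<in> \<Union>\<Gamma>\<close> says that the matrix \<open>A\<close>
  represents an element of \<open>\<Gamma>\<close>. The covolume is the hyperbolic area of a Borel set that
  meets every \<open>\<Gamma>\<close>-orbit in exactly one point; for discrete \<open>\<Gamma>\<close> such a set exists and its
  area does not depend on the choice.\<close>

definition finite_covolume :: "(real^2^2) set set \<Rightarrow> bool" where
  "finite_covolume \<Gamma> \<longleftrightarrow>
     (\<exists>F \<in> sets borel. F \<subseteq> uhp \<and>
        (\<forall>z\<in>uhp. \<exists>!w. w \<in> F \<and> (\<exists>A\<in>\<Union>\<Gamma>. w = moebius A z)) \<and>
        (\<integral>\<^sup>+z\<in>F. ennreal (1 / (Im z)\<^sup>2) \<partial>lborel) < \<infinity>)"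


section \<open>Modular and quasimodular forms\<close>

definition aut_factor :: "real^2^2 \<Rightarrow> complex \<Rightarrow> complex" where
  "aut_factor A z = of_real (A$2$1) * z + of_real (A$2$2)"

text \<open>Moderate growth: at most polynomial in \<open>(1 + |z|\<^sup>2) / Im z\<close>. This condition is invariant
  under the action of \<open>PSL(2,R)\<close>, hence independent of the position of the cusps.\<close>

definition moderate_growth :: "(complex \<Rightarrow> complex) \<Rightarrow> bool" where
  "moderate_growth f \<longleftrightarrow>
     (\<exists>(C::real) (N::nat). \<forall>z\<in>uhp. cmod (f z) \<le> C * ((1 + (cmod z)\<^sup>2) / Im z) ^ N)"

text \<open>Functions on the upper half plane are represented by total functions vanishing
  outside it.\<close>

definition on_uhp :: "(complex \<Rightarrow> complex) \<Rightarrow> bool" where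
  "on_uhp f \<longleftrightarrow> (\<forall>z. z \<notin> uhp \<longrightarrow> f z = 0)"

definition one_uhp :: "complex \<Rightarrow> complex" where
  "one_uhp = (\<lambda>z. if z \<in> uhp then 1 else 0)"

definition modular_forms :: "(real^2^2) set set \<Rightarrow> int \<Rightarrow> (complex \<Rightarrow> complex) set" where
  "modular_forms \<Gamma> k =
     {f. on_uhp f \<and> f holomorphic_on uhp \<and> moderate_growth f \<and>
         (\<forall>A\<in>\<Union>\<Gamma>. \<forall>z\<in>uhp. aut_factor A z powi (- k) * f (moebius A z) = f z)}"

text \<open>\<open>fs 0, \<dots>, fs p\<close> are the coefficient functions of \<open>f\<close>; the sequence is padded by zero.\<close>

definition quasi_expansion ::
  "(real^2^2) set set \<Rightarrow> int \<Rightarrow> nat \<Rightarrow> (complex \<Rightarrow> complex) \<Rightarrow> (nat \<Rightarrow> complex \<Rightarrow> complex) \<Rightarrow> bool" where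
  "quasi_expansion \<Gamma> k p f fs \<longleftrightarrow>
     (\<forall>j. on_uhp (fs j)) \<and> (\<forall>j>p. fs j = 0) \<and>
     (\<forall>A\<in>\<Union>\<Gamma>. \<forall>z\<in>uhp.
        aut_factor A z powi (- k) * f (moebius A z) =
        (\<Sum>j\<le>p. fs j z * (of_real (A$2$1) / aut_factor A z) ^ j))"

definition quasimodular_forms :: "(real^2^2) set set \<Rightarrow> int \<Rightarrow> (complex \<Rightarrow> complex) set" where
  "quasimodular_forms \<Gamma> k =
     {f. on_uhp f \<and> f holomorphic_on uhp \<and> moderate_growth f \<and>
         (\<exists>p fs. quasi_expansion \<Gamma> k p f fs)}"

definition D_uhp :: "(complex \<Rightarrow> complex) \<Rightarrow> complex \<Rightarrow> complex" where
  "D_uhp f = (\<lambda>z. if z \<in> uhp then deriv f z else 0)"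

definition delta :: "(real^2^2) set set \<Rightarrow> int \<Rightarrow> (complex \<Rightarrow> complex) \<Rightarrow> complex \<Rightarrow> complex" where
  "delta \<Gamma> k f = (THE g. \<exists>p fs. quasi_expansion \<Gamma> k p f fs \<and> g = fs 1)"

text \<open>The graded space of all quasimodular forms of nonnegative weight. The grading is
  indexed by all integers (with zero components in negative weights) so that stability under
  \<open>\<delta>\<close>, which lowers the weight by \<open>2\<close>, is a property and not built into the definition.\<close>

definition quasi_rep :: "(real^2^2) set set \<Rightarrow> (int \<times> complex) sl2_rep" where
  "quasi_rep \<Gamma> =
     \<lparr>vecs = direct_sum {0..} (quasimodular_forms \<Gamma>),
      actD = (\<lambda>F (k, z). D_uhp (slice F (k - 2)) z),
      actd = (\<lambda>F (k, z). delta \<Gamma> (k + 2) (slice F (k + 2)) z),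
      actH = (\<lambda>F (k, z). of_int k * F (k, z))\<rparr>"

end

theory Submission
  imports Defs
begin

text \<open>Write \<open>X\<^sub>A(z) = c / (c z + d)\<close> for a matrix \<open>A\<close> of \<open>\<Gamma>\<close>; a quasimodular form \<open>f\<close> transforms by
  \<open>(c z + d) powi (- k) * f (A z) = (\<Sum>j\<le>p. f\<^sub>j(z) X\<^sub>A(z)\<^sup>j)\<close>. The theorem follows from two properties of
  \<open>\<Gamma>\<close>, both consequences of finite area, and a triangularity argument.

  The first property is that there are no modular forms of negative weight, and only constants in weight
  \<open>0\<close> (\<open>no_negative_weight\<close>). If \<open>f\<close> has weight \<open>- m\<close>, then \<open>u = ln (1 + \<bar>f\<bar>\<^sup>2 y\<^sup>-\<^sup>m)\<close> is \<open>\<Gamma>\<close>-invariant, and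
  unless \<open>f\<close> is zero, or constant with \<open>m = 0\<close>, its mean over every hyperbolic disc of a fixed radius
  exceeds its value at the centre (\<open>log_norm_strictly_subharmonic\<close>). Averaging over discs is a symmetric
  operator on the quotient (\<open>fund_swap\<close>), so the integral of the excess against a cutoff is
  controlled by the variation of the cutoff. By moderate growth \<open>u\<close> grows at most linearly in the
  hyperbolic distance; a cutoff at distance \<open>r\<close> has variation \<open>O(1/r)\<close> where \<open>u = O(r)\<close>, and the error is at
  most a constant times the area beyond distance \<open>r\<close>, which tends to \<open>0\<close>. This is the lemma
  \<open>liouville\<close>.

  The second property is that for fixed \<open>z\<close> the numbers \<open>X\<^sub>A(z)\<close> form an infinite set
  (\<open>infinite_aut_quot\<close>). If there were only finitely many, the product of the corresponding linear
  functions \<open>c z + d\<close> would give a function whose logarithmic norm is strictly subharmonic and changes by a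
  constant under each element of \<open>\<Gamma>\<close>; its increments over discs then form an antisymmetric invariant kernel
  with positive integral, which is impossible in finite area. Infinitely many values mean that a
  polynomial identity in \<open>X\<^sub>A(z)\<close> can be read off coefficientwise. Hence the \<open>f\<^sub>j\<close> are determined by \<open>f\<close>
  (\<open>QE_unique\<close>), are holomorphic of moderate growth because they are obtained by interpolation
  (\<open>QE_moderate\<close>), and are quasimodular of weight \<open>k - 2j\<close> with coefficients
  \<open>binomial (j + m) j * f\<^sub>j\<^sub>+\<^sub>m\<close> (\<open>QE_coefficient\<close>). Differentiating the transformation law gives the
  coefficients of \<open>D f\<close> (\<open>QE_deriv\<close>), and with them \<open>[\<delta>, D] = H\<close>.

  For the decomposition let \<open>f\<close> have weight \<open>k\<close> and depth \<open>p\<close>. Its last coefficient \<open>f\<^sub>p\<close> is a modular form of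
  weight \<open>k - 2p\<close>, so \<open>2p \<le> k\<close> by the first property. If \<open>g\<close> is modular of weight \<open>l > 0\<close>, the last
  coefficient of \<open>D\<^sup>p g\<close> is \<open>l (l + 1) \<cdots> (l + p - 1) g\<close>, a nonzero multiple of \<open>g\<close>
  (\<open>qcoef_Dpow\<close>). Therefore, if \<open>2p < k\<close>, subtracting a multiple of \<open>D\<^sup>p f\<^sub>p\<close> from \<open>f\<close> lowers its depth. There remains
  \<open>2p = k\<close>, where \<open>f\<^sub>p\<close> is a constant. For \<open>p > 0\<close> the form \<open>f\<^sub>p\<^sub>-\<^sub>1\<close> has weight \<open>2\<close> and
  \<open>\<delta> f\<^sub>p\<^sub>-\<^sub>1 = p f\<^sub>p\<close>; so \<open>f\<^sub>p = 0\<close> if \<open>\<delta>\<close> vanishes on weight \<open>2\<close>, and otherwise \<open>D\<^sup>p\<^sup>-\<^sup>1 \<phi>\<close>, whose last coefficient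
  is \<open>(p - 1)!\<close>, removes it. The same comparison of last coefficients shows that the decomposition is
  unique (\<open>decomposition_exists\<close>, \<open>decomposition_unique\<close>). The actions of \<open>D\<close>, \<open>\<delta>\<close>, \<open>H\<close> on \<open>D\<^sup>j g\<close> and
  \<open>D\<^sup>j \<phi>\<close> are those of the standard bases, so the decomposition is an isomorphism of modules.\<close>

(* The dollar sign denotes matrix entries throughout, not coefficients of power series. *)
no_notation fps_nth (infixl "$" 75)

section \<open>Moebius transformations of the upper half plane\<close>

lemma uhp_iff [simp]: "z \<in> uhp \<longleftrightarrow> Im z > 0"
  by (simp add: uhp_def)

lemma open_uhp: "open uhp"
  unfolding uhp_def by (rule open_halfspace_Im_gt)

lemma convex_uhp: "convex uhp"
  unfolding uhp_def by (rule convex_halfspace_Im_gt)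

lemma det2: "det (A::real^2^2) = A$1$1 * A$2$2 - A$1$2 * A$2$1"
  by (rule det_2)

lemma matrix_mult_2:
  fixes A B :: "real^2^2"
  shows "(A ** B)$i$j = A$i$1 * B$1$j + A$i$2 * B$2$j"
  by (simp add: matrix_matrix_mult_def sum_2)

lemma mat_1_2:
  "(mat 1 :: real^2^2)$1$1 = 1" "(mat 1 :: real^2^2)$1$2 = 0"
  "(mat 1 :: real^2^2)$2$1 = 0" "(mat 1 :: real^2^2)$2$2 = 1"
  by (simp_all add: mat_def)

lemma matrix_eq_2:
  fixes A B :: "real^2^2"
  shows "A = B \<longleftrightarrow> A$1$1 = B$1$1 \<and> A$1$2 = B$1$2 \<and> A$2$1 = B$2$1 \<and> A$2$2 = B$2$2"
  by (simp add: vec_eq_iff forall_2 conj_assoc)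

lemma aut_factor_nz:
  assumes "det A = 1" "z \<in> uhp"
  shows "aut_factor A z \<noteq> 0"
proof
  assume "aut_factor A z = 0"
  then have "A$2$1 * Im z = 0" "A$2$1 * Re z + A$2$2 = 0"
    by (auto simp: aut_factor_def complex_eq_iff)
  then have "A$2$1 = 0" "A$2$2 = 0" using assms by auto
  then show False using assms(1) by (simp add: det2)
qed

lemma moebius_aut: "moebius A z = (of_real (A$1$1) * z + of_real (A$1$2)) / aut_factor A z"
  by (simp add: moebius_def aut_factor_def)

lemma moebius_diff:
  assumes "det A = 1" "z \<in> uhp" "w \<in> uhp"
  shows "moebius A z - moebius A w = (z - w) / (aut_factor A z * aut_factor A w)"
proof -
  have [simp]: "aut_factor A z \<noteq> 0" "aut_factor A w \<noteq> 0" using assms aut_factor_nz by auto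
  have d: "of_real (A$1$1) * of_real (A$2$2) - of_real (A$1$2) * of_real (A$2$1) = (1::complex)"
    using arg_cong[OF assms(1)[unfolded det2], of complex_of_real] by simp
  have "moebius A z - moebius A w = 
    ((of_real (A$1$1) * z + of_real (A$1$2)) * aut_factor A w - (of_real (A$1$1) * w + of_real (A$1$2)) * aut_factor A z)
      / (aut_factor A z * aut_factor A w)"
    by (simp add: moebius_aut divide_simps)
  also have "(of_real (A$1$1) * z + of_real (A$1$2)) * aut_factor A w - (of_real (A$1$1) * w + of_real (A$1$2)) * aut_factor A z
    = (z - w) * (of_real (A$1$1) * of_real (A$2$2) - of_real (A$1$2) * of_real (A$2$1))"
    unfolding aut_factor_def by (simp add: algebra_simps)
  finally show ?thesis by (simp add: d)
qed

lemma Im_moebius: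
  assumes "det A = 1" "z \<in> uhp"
  shows "Im (moebius A z) = Im z / (cmod (aut_factor A z))\<^sup>2"
proof -
  have "Im (moebius A z) = Im ((of_real (A$1$1) * z + of_real (A$1$2)) * cnj (aut_factor A z)) / (cmod (aut_factor A z))\<^sup>2"
    by (simp add: moebius_aut complex_div_cnj[of _ "aut_factor A z"])
  also have "Im ((of_real (A$1$1) * z + of_real (A$1$2)) * cnj (aut_factor A z)) = Im z * det A"
    by (simp add: aut_factor_def det2 algebra_simps)
  finally show ?thesis using assms by simp
qed

lemma moebius_uhp [simp]:
  assumes "det A = 1" "Im z > 0"
  shows "Im (moebius A z) > 0"
  using assms Im_moebius[of A z] aut_factor_nz[of A z] by simp

lemma aut_factor_mult:
  assumes "det B = 1" "z \<in> uhp"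
  shows "aut_factor (A ** B) z = aut_factor A (moebius B z) * aut_factor B z"
proof -
  have [simp]: "aut_factor B z \<noteq> 0" using assms aut_factor_nz by auto
  have "aut_factor A (moebius B z) * aut_factor B z
     = of_real (A$2$1) * (of_real (B$1$1) * z + of_real (B$1$2)) + of_real (A$2$2) * aut_factor B z"
    by (simp add: aut_factor_def[of A] moebius_aut field_simps)
  then show ?thesis by (simp add: aut_factor_def matrix_mult_2 algebra_simps)
qed

lemma moebius_mult:
  assumes "det A = 1" "det B = 1" "z \<in> uhp"
  shows "moebius (A ** B) z = moebius A (moebius B z)"
proof -
  have nz [simp]: "aut_factor B z \<noteq> 0" "aut_factor A (moebius B z) \<noteq> 0"
    using assms aut_factor_nz[of B z] aut_factor_nz[of A "moebius B z"] by auto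
  have "moebius A (moebius B z) * aut_factor A (moebius B z) * aut_factor B z
     = of_real (A$1$1) * (of_real (B$1$1) * z + of_real (B$1$2)) + of_real (A$1$2) * aut_factor B z"
  proof -
    have "moebius A (moebius B z) * aut_factor A (moebius B z) = of_real (A$1$1) * moebius B z + of_real (A$1$2)"
      using nz(2) by (simp add: moebius_aut[of A])
    moreover have "moebius B z * aut_factor B z = of_real (B$1$1) * z + of_real (B$1$2)"
      by (simp add: moebius_aut[of B])
    ultimately show ?thesis by (simp add: distrib_right mult.assoc)
  qed
  also have "\<dots> = of_real ((A**B)$1$1) * z + of_real ((A**B)$1$2)"
    by (simp add: aut_factor_def matrix_mult_2 algebra_simps)
  finally show ?thesis
    using assms by (simp add: moebius_aut[of "A**B"] aut_factor_mult field_simps)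
qed

lemma moebius_1 [simp]: "moebius (mat 1) z = z"
  by (simp add: moebius_def mat_1_2)

lemma aut_factor_1 [simp]: "aut_factor (mat 1) z = 1"
  by (simp add: aut_factor_def mat_1_2)

lemma moebius_uminus [simp]: "moebius (- A) z = moebius A z"
proof -
  have "moebius (- A) z = (- (of_real (A$1$1) * z + of_real (A$1$2))) / (- (of_real (A$2$1) * z + of_real (A$2$2)))"
    by (simp add: moebius_def)
  then show ?thesis unfolding moebius_def by (simp only: minus_divide_divide)
qed

text \<open>A fixed point in the upper half plane determines its complex conjugate as the second fixed point, so a
  matrix with two fixed points in the half plane acts trivially.\<close>

lemma moebius_two_fixed_points:
  assumes "det A = 1" "z \<in> uhp" "w \<in> uhp" "z \<noteq> w" "moebius A z = z" "moebius A w = w"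
  shows "A = mat 1 \<or> A = - mat 1"
proof -
  have eq: "of_real (A$1$1) * u + of_real (A$1$2) = u * aut_factor A u"
    if "u \<in> uhp" "moebius A u = u" for u
    using that aut_factor_nz[OF assms(1) that(1)] by (simp add: moebius_aut field_simps)
  have "of_real (A$1$1) * (z - w) = (z - w) * (of_real (A$2$1) * (z + w) + of_real (A$2$2))"
  proof -
    have "of_real (A$1$1) * (z - w) = (of_real (A$1$1) * z + of_real (A$1$2)) - (of_real (A$1$1) * w + of_real (A$1$2))"
      by (simp add: algebra_simps)
    also have "\<dots> = z * aut_factor A z - w * aut_factor A w" using eq[of z] eq[of w] assms by simp
    finally show ?thesis by (simp add: aut_factor_def algebra_simps)
  qed
  then have e: "of_real (A$1$1) = of_real (A$2$1) * (z + w) + (of_real (A$2$2) :: complex)"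
    using assms(4) by (metis mult.commute mult_cancel_left right_minus_eq)
  have "A$2$1 * (Im z + Im w) = 0" using arg_cong[OF e, of Im] by simp
  then have c: "A$2$1 = 0" using assms by auto
  have a: "A$1$1 = A$2$2" using arg_cong[OF e, of Re] c by simp
  have b: "A$1$2 = 0" using eq[of z] assms c a by (simp add: aut_factor_def algebra_simps)
  have "A$1$1 * A$1$1 = 1" using assms(1) a b c by (simp add: det2)
  then have "A$1$1 = 1 \<or> A$1$1 = -1" by (metis square_eq_1_iff)
  then show ?thesis using a b c by (auto simp: matrix_eq_2 mat_1_2)
qed

lemma borel_measurable_moebius [measurable]: "moebius A \<in> borel_measurable borel"
  unfolding moebius_def by measurable

section \<open>Hyperbolic area\<close>

definition hyp :: "complex measure" where
  "hyp = density lborel (\<lambda>z. indicator uhp z * ennreal (1 / (Im z)\<^sup>2))"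

lemma uhp_borel [measurable]: "uhp \<in> sets borel"
  using open_uhp by auto

lemma sets_hyp [simp, measurable_cong]: "sets hyp = sets borel"
  and space_hyp [simp]: "space hyp = UNIV"
  by (simp_all add: hyp_def)

lemma nn_integral_hyp:
  assumes [measurable]: "g \<in> borel_measurable borel"
  shows "(\<integral>\<^sup>+z. g z \<partial>hyp) = (\<integral>\<^sup>+z. indicator uhp z * ennreal (1 / (Im z)\<^sup>2) * g z \<partial>lborel)"
  unfolding hyp_def by (subst nn_integral_density) (auto simp: )

lemma sigma_finite_hyp: "sigma_finite_measure hyp"
  unfolding hyp_def
  by (subst sigma_finite_measure.sigma_finite_iff_density_finite[OF sigma_finite_lborel])
     (auto simp: ennreal_mult_eq_top_iff split: split_indicator)

interpretation hyp: sigma_finite_measure hyp by (rule sigma_finite_hyp)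
interpretation hyp2: pair_sigma_finite hyp hyp ..

lemma AE_hyp_uhp: "AE z in hyp. z \<in> uhp"
  unfolding hyp_def by (subst AE_density) (auto simp: indicator_def split: if_splits)

lemma lborel_complex: "lborel = distr (lborel \<Otimes>\<^sub>M lborel) borel (\<lambda>(x, y). Complex x y)"
proof (rule lborel_eqI)
  have [measurable]: "(\<lambda>(x, y). Complex x y) \<in> borel_measurable (lborel \<Otimes>\<^sub>M lborel)"
    unfolding Complex_eq case_prod_unfold by measurable
  fix l u :: complex assume le: "\<And>b. b \<in> Basis \<Longrightarrow> l \<bullet> b \<le> u \<bullet> b"
  have le': "Re l \<le> Re u" "Im l \<le> Im u"
    using le[of 1] le[of \<i>] by (auto simp: Basis_complex_def inner_complex_def)
  have vim: "(\<lambda>(x, y). Complex x y) -` box l u = {Re l<..<Re u} \<times> {Im l<..<Im u}"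
    by (auto simp: in_box_complex_iff)
  show "emeasure (distr (lborel \<Otimes>\<^sub>M lborel) borel (\<lambda>(x, y). Complex x y)) (box l u) = (\<Prod>b\<in>Basis. (u - l) \<bullet> b)"
    using le'
    by (subst emeasure_distr)
       (auto simp: vim space_pair_measure lborel.emeasure_pair_measure_Times Basis_complex_def inner_complex_def ennreal_mult)
qed simp

lemma nn_integral_lborel_complex:
  assumes [measurable]: "g \<in> borel_measurable borel"
  shows "(\<integral>\<^sup>+z. g z \<partial>lborel) = (\<integral>\<^sup>+y. \<integral>\<^sup>+x. g (Complex x y) \<partial>lborel \<partial>lborel)"
proof -
  have [measurable]: "(\<lambda>(x, y). Complex x y) \<in> borel_measurable (lborel \<Otimes>\<^sub>M lborel)"
    unfolding Complex_eq case_prod_unfold by measurable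
  have "(\<integral>\<^sup>+z. g z \<partial>lborel) = (\<integral>\<^sup>+p. g (case p of (x, y) \<Rightarrow> Complex x y) \<partial>(lborel \<Otimes>\<^sub>M lborel))"
    by (subst lborel_complex, subst nn_integral_distr) auto
  also have "\<dots> = (\<integral>\<^sup>+y. \<integral>\<^sup>+x. g (Complex x y) \<partial>lborel \<partial>lborel)"
    by (subst lborel_pair.nn_integral_snd[symmetric]) auto
  finally show ?thesis .
qed

text \<open>Substitution is available on compact intervals; monotone convergence extends it to the half line.\<close>

lemma nn_integral_exp:
  fixes h :: "real \<Rightarrow> ennreal"
  assumes [measurable]: "h \<in> borel_measurable borel"
  shows "(\<integral>\<^sup>+y. indicator {0<..} y * ennreal (1 / y) * h y \<partial>lborel) = (\<integral>\<^sup>+t. h (exp t) \<partial>lborel)"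
proof -
  define f where "f y = indicator {0<..} y * ennreal (1 / y) * h y" for y :: real
  have [measurable]: "f \<in> borel_measurable borel" unfolding f_def by measurable
  have step: "(\<integral>\<^sup>+y. f y * indicator {exp (- real n)..exp (real n)} y \<partial>lborel) =
      (\<integral>\<^sup>+t. h (exp t) * indicator {- real n..real n} t \<partial>lborel)" for n
  proof (cases "n = 0")
    case True
    have "(\<integral>\<^sup>+y. f y * indicator {1::real} y \<partial>lborel) = 0"
      by (subst nn_integral_0_iff_AE) (auto intro!: AE_I[of _ _ "{1::real}"] simp: indicator_def)
    moreover have "(\<integral>\<^sup>+t. h (exp t) * indicator {0::real} t \<partial>lborel) = 0"
      by (subst nn_integral_0_iff_AE) (auto intro!: AE_I[of _ _ "{0::real}"] simp: indicator_def)
    ultimately show ?thesis using True by simp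
  next
    case False
    have "(\<integral>\<^sup>+y. f y * indicator {exp (- real n)..exp (real n)} y \<partial>lborel) =
       (\<integral>\<^sup>+t. f (exp t) * exp t * indicator {- real n..real n} t \<partial>lborel)"
      using False by (intro nn_integral_substitution_aux) (auto intro!: derivative_eq_intros continuous_intros)
    also have "\<dots> = (\<integral>\<^sup>+t. h (exp t) * indicator {- real n..real n} t \<partial>lborel)"
    proof (intro nn_integral_cong)
      fix t :: real
      have "ennreal (1 / exp t) * ennreal (exp t) = 1"
        by (subst ennreal_mult[symmetric]) auto
      then show "f (exp t) * exp t * indicator {- real n..real n} t = h (exp t) * indicator {- real n..real n} t"
        unfolding f_def by (simp add: mult_ac) (metis mult.assoc mult.commute mult.right_neutral)
    qed
    finally show ?thesis .
  qed
  have incseq_ind: "incseq (\<lambda>n y. F y * indicator (S n) y)" if "\<And>m n. m \<le> n \<Longrightarrow> S m \<subseteq> S n"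
    for F :: "real \<Rightarrow> ennreal" and S :: "nat \<Rightarrow> real set"
    using that unfolding incseq_def le_fun_def by (intro allI impI mult_left_mono) (auto simp: indicator_def)
  have "(\<integral>\<^sup>+y. f y \<partial>lborel) = (\<integral>\<^sup>+y. (SUP n::nat. f y * indicator {exp (- real n)..exp (real n)} y) \<partial>lborel)"
  proof (intro nn_integral_cong antisym)
    fix y :: real
    show "f y \<le> (SUP n::nat. f y * indicator {exp (- real n)..exp (real n)} y)"
    proof (cases "y > 0")
      case True
      obtain n :: nat where n: "\<bar>ln y\<bar> \<le> real n" using real_arch_simple by blast
      have "exp (- real n) \<le> exp (ln y)" "exp (ln y) \<le> exp (real n)" using n by (auto simp del: exp_ln)
      then have "y \<in> {exp (- real n)..exp (real n)}" using True by simp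
      then show ?thesis by (intro SUP_upper2[of n]) auto
    qed (simp add: f_def)
    show "(SUP n::nat. f y * indicator {exp (- real n)..exp (real n)} y) \<le> f y"
      by (intro SUP_least) (auto simp: indicator_def)
  qed
  also have "\<dots> = (SUP n::nat. \<integral>\<^sup>+y. f y * indicator {exp (- real n)..exp (real n)} y \<partial>lborel)"
    by (intro nn_integral_monotone_convergence_SUP incseq_ind) auto
  also have "\<dots> = (SUP n::nat. \<integral>\<^sup>+t. h (exp t) * indicator {- real n..real n} t \<partial>lborel)"
    by (simp add: step)
  also have "\<dots> = (\<integral>\<^sup>+t. (SUP n::nat. h (exp t) * indicator {- real n..real n} t) \<partial>lborel)"
    by (intro nn_integral_monotone_convergence_SUP[symmetric] incseq_ind) auto
  also have "\<dots> = (\<integral>\<^sup>+t. h (exp t) \<partial>lborel)"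
  proof (intro nn_integral_cong antisym)
    fix t :: real
    obtain n :: nat where n: "\<bar>t\<bar> \<le> real n" using real_arch_simple by blast
    then show "h (exp t) \<le> (SUP n::nat. h (exp t) * indicator {- real n..real n} t)"
      by (intro SUP_upper2[of n]) (auto simp: indicator_def abs_le_iff)
    show "(SUP n::nat. h (exp t) * indicator {- real n..real n} t) \<le> h (exp t)"
      by (intro SUP_least) (auto simp: indicator_def)
  qed
  finally show ?thesis unfolding f_def .
qed

text \<open>Turns a strict inequality between continuous functions at one point into one between integrals.\<close>

lemma emeasure_hyp_open_pos:
  assumes "open U" "U \<subseteq> uhp" "U \<noteq> {}"
  shows "emeasure hyp U > 0"
proof (rule ccontr)
  have [measurable]: "U \<in> sets borel" using assms by auto
  assume "\<not> emeasure hyp U > 0"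
  then have "AE z in hyp. z \<notin> U" by (intro AE_not_in) (auto simp: null_sets_def)
  then have "AE z in lborel. z \<notin> U"
    unfolding hyp_def using assms(2)
    by (subst (asm) AE_density) (auto simp: indicator_def elim!: eventually_mono)
  then have "emeasure lborel U = 0"
    by (subst (asm) AE_iff_null_sets[symmetric]) (auto simp: null_sets_def)
  moreover obtain z e where e: "e > 0" "ball z e \<subseteq> U" using assms open_contains_ball by blast
  then have "emeasure lborel (ball z e) \<le> emeasure lborel U" by (intro emeasure_mono) auto
  moreover have "emeasure lborel (ball z e) > 0"
    using e by (subst emeasure_ball) (auto simp: unit_ball_vol_pos)
  ultimately show False by simp
qed

text \<open>In the coordinates \<open>x = s e\<^sup>t\<close>, \<open>y = e\<^sup>t\<close> the area \<open>dx dy / y\<^sup>2\<close> is Lebesgue measure \<open>ds dt\<close>, and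
  translations, dilations and the inversion become maps that visibly preserve it.\<close>

definition ray_point :: "real \<Rightarrow> real \<Rightarrow> complex" where
  "ray_point s t = Complex (s * exp t) (exp t)"

lemma ray_point_measurable [measurable]: "(\<lambda>p. ray_point (f p) (g p)) \<in> borel_measurable M"
  if [measurable]: "f \<in> borel_measurable M" "g \<in> borel_measurable M"
  unfolding ray_point_def Complex_eq by measurable

lemma nn_integral_hyp_ray_point:
  assumes [measurable]: "g \<in> borel_measurable borel"
  shows "(\<integral>\<^sup>+z. g z \<partial>hyp) = (\<integral>\<^sup>+t. \<integral>\<^sup>+s. g (ray_point s t) \<partial>lborel \<partial>lborel)"
proof -
  have [measurable]: "(\<lambda>p. Complex (f p) (g p)) \<in> borel_measurable M" 
    if [measurable]: "f \<in> borel_measurable M" "g \<in> borel_measurable M" for f g and M :: "'a measure"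
    unfolding Complex_eq by measurable
  have "(\<integral>\<^sup>+z. g z \<partial>hyp) = (\<integral>\<^sup>+z. indicator uhp z * ennreal (1 / (Im z)\<^sup>2) * g z \<partial>lborel)"
    by (rule nn_integral_hyp) fact
  also have "\<dots> = (\<integral>\<^sup>+y. \<integral>\<^sup>+x. indicator {0<..} y * ennreal (1 / y\<^sup>2) * g (Complex x y) \<partial>lborel \<partial>lborel)"
    by (subst nn_integral_lborel_complex) (auto intro!: nn_integral_cong simp: indicator_def)
  also have "\<dots> = (\<integral>\<^sup>+y. indicator {0<..} y * ennreal (1 / y) * (\<integral>\<^sup>+s. g (Complex (s * y) y) \<partial>lborel) \<partial>lborel)"
  proof (intro nn_integral_cong)
    fix y :: real
    show "(\<integral>\<^sup>+x. indicator {0<..} y * ennreal (1 / y\<^sup>2) * g (Complex x y) \<partial>lborel) =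
       indicator {0<..} y * ennreal (1 / y) * (\<integral>\<^sup>+s. g (Complex (s * y) y) \<partial>lborel)"
    proof (cases "y > 0")
      case True
      have "(\<integral>\<^sup>+x. indicator {0<..} y * ennreal (1 / y\<^sup>2) * g (Complex x y) \<partial>lborel) =
          ennreal (1 / y\<^sup>2) * (\<integral>\<^sup>+x. g (Complex x y) \<partial>lborel)"
        using True by (simp add: nn_integral_cmult)
      also have "(\<integral>\<^sup>+x. g (Complex x y) \<partial>lborel) = ennreal y * (\<integral>\<^sup>+s. g (Complex (0 + y * s) y) \<partial>lborel)"
        using True by (subst nn_integral_real_affine[of _ y 0]) auto
      also have "ennreal (1 / y\<^sup>2) * (ennreal y * (\<integral>\<^sup>+s. g (Complex (0 + y * s) y) \<partial>lborel))
         = ennreal (1 / y\<^sup>2 * y) * (\<integral>\<^sup>+s. g (Complex (s * y) y) \<partial>lborel)"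
        using True by (subst ennreal_mult) (auto simp: mult_ac)
      also have "1 / y\<^sup>2 * y = 1 / y" using True by (simp add: power2_eq_square)
      finally show ?thesis using True by simp
    qed simp
  qed
  also have "\<dots> = (\<integral>\<^sup>+t. \<integral>\<^sup>+s. g (ray_point s t) \<partial>lborel \<partial>lborel)"
    by (subst nn_integral_exp) (auto simp: ray_point_def)
  finally show ?thesis .
qed

lemma hyp_translate:
  assumes [measurable]: "g \<in> borel_measurable borel"
  shows "(\<integral>\<^sup>+z. g (z + of_real b) \<partial>hyp) = (\<integral>\<^sup>+z. g z \<partial>hyp)"
proof -
  have ray_point: "ray_point s t + of_real b = ray_point (b * exp (- t) + 1 * s) t" for s t
    by (simp add: ray_point_def complex_eq_iff distrib_right exp_minus)
  have "(\<integral>\<^sup>+s. g (ray_point s t + of_real b) \<partial>lborel) = (\<integral>\<^sup>+s. g (ray_point s t) \<partial>lborel)" for t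
    unfolding ray_point by (subst (2) nn_integral_real_affine[of _ 1 "b * exp (- t)"]) auto
  then show ?thesis by (simp add: nn_integral_hyp_ray_point)
qed

lemma hyp_scale:
  assumes [measurable]: "g \<in> borel_measurable borel" and a: "a > 0"
  shows "(\<integral>\<^sup>+z. g (of_real a * z) \<partial>hyp) = (\<integral>\<^sup>+z. g z \<partial>hyp)"
proof -
  have ray_point: "of_real a * ray_point s t = ray_point s (ln a + 1 * t)" for s t
    using a by (simp add: ray_point_def complex_eq_iff exp_add)
  show ?thesis
    unfolding nn_integral_hyp_ray_point[OF assms(1)]
    by (subst nn_integral_hyp_ray_point, simp, unfold ray_point,
        subst (2) nn_integral_real_affine[of _ 1 "ln a"]) auto
qed

text \<open>In the coordinates \<open>(s, t)\<close> the inversion is \<open>(s, t) \<mapsto> (- s, - t - ln (1 + s\<^sup>2))\<close>: a reflection and a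
  shear.\<close>

lemma hyp_inversion:
  assumes [measurable]: "g \<in> borel_measurable borel"
  shows "(\<integral>\<^sup>+z. g (- 1 / z) \<partial>hyp) = (\<integral>\<^sup>+z. g z \<partial>hyp)"
proof -
  have ray_point: "- 1 / ray_point s t = ray_point (- s) (- ln (1 + s\<^sup>2) + (-1) * t)" for s t
  proof -
    have p: "1 + s\<^sup>2 > 0" by (smt (verit) zero_le_power2)
    define E where "E = exp t"
    have E: "E > 0" by (simp add: E_def)
    have q: "(s * E)\<^sup>2 + E\<^sup>2 = E * (E * (1 + s\<^sup>2))"
      by (simp add: power2_eq_square algebra_simps)
    have e: "exp (- ln (1 + s\<^sup>2) + (-1) * t) = 1 / (E * (1 + s\<^sup>2))"
      using p unfolding exp_add E_def by (simp add: exp_minus field_simps)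
    show ?thesis unfolding ray_point_def e E_def[symmetric]
      using E p by (simp add: complex_eq_iff Re_divide Im_divide q)
  qed
  have sw: "(\<integral>\<^sup>+t. \<integral>\<^sup>+s. h s t \<partial>lborel \<partial>lborel) = (\<integral>\<^sup>+s. \<integral>\<^sup>+t. h s t \<partial>lborel \<partial>lborel)"
    if [measurable]: "case_prod h \<in> borel_measurable (lborel \<Otimes>\<^sub>M lborel)" for h :: "real \<Rightarrow> real \<Rightarrow> ennreal"
    using lborel_pair.Fubini'[of h] by simp
  have "(\<integral>\<^sup>+z. g (- 1 / z) \<partial>hyp) = (\<integral>\<^sup>+s. \<integral>\<^sup>+t. g (ray_point (- s) (- ln (1 + s\<^sup>2) + (-1) * t)) \<partial>lborel \<partial>lborel)"
    by (subst nn_integral_hyp_ray_point, simp, unfold ray_point, subst sw) auto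
  also have "\<dots> = (\<integral>\<^sup>+s. \<integral>\<^sup>+t. g (ray_point (- s) t) \<partial>lborel \<partial>lborel)"
  proof (rule nn_integral_cong)
    fix s :: real
    show "(\<integral>\<^sup>+t. g (ray_point (- s) (- ln (1 + s\<^sup>2) + (-1) * t)) \<partial>lborel) = (\<integral>\<^sup>+t. g (ray_point (- s) t) \<partial>lborel)"
      by (subst (2) nn_integral_real_affine[of _ "-1" "- ln (1 + s\<^sup>2)"]) auto
  qed
  also have "\<dots> = (\<integral>\<^sup>+s. \<integral>\<^sup>+t. g (ray_point s t) \<partial>lborel \<partial>lborel)"
    by (subst (2) nn_integral_real_affine[of _ "-1" 0]) auto
  also have "\<dots> = (\<integral>\<^sup>+z. g z \<partial>hyp)"
    by (subst nn_integral_hyp_ray_point, simp, subst sw) auto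
  finally show ?thesis .
qed

text \<open>Bruhat decomposition: a matrix with \<open>c = 0\<close> is a dilation followed by a translation, and any other one
  is \<open>z \<mapsto> a / c - 1 / (c\<^sup>2 (z + d / c))\<close>.\<close>

lemma hyp_invariant:
  assumes [measurable]: "g \<in> borel_measurable borel" and A: "det A = 1"
  shows "(\<integral>\<^sup>+z. g (moebius A z) \<partial>hyp) = (\<integral>\<^sup>+z. g z \<partial>hyp)"
proof (cases "A$2$1 = 0")
  case True
  then have ad: "A$1$1 * A$2$2 = 1" using A by (simp add: det2)
  then have nz: "A$1$1 \<noteq> 0" "A$2$2 \<noteq> 0" by auto
  then have p: "(A$1$1)\<^sup>2 > 0" by simp
  have d: "A$2$2 = 1 / A$1$1" using ad nz by (simp add: field_simps)
  then have eq: "moebius A z = of_real ((A$1$1)\<^sup>2) * z + of_real (A$1$2 * A$1$1)" for z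
    using nz True by (simp add: moebius_def power2_eq_square d algebra_simps)
  show ?thesis unfolding eq
    using hyp_scale[OF _ p, of "\<lambda>z. g (z + of_real (A$1$2 * A$1$1))"] hyp_translate[of g "A$1$2 * A$1$1"] by simp
next
  case False
  define c d where "c = A$2$1" and "d = A$2$2"
  have c: "c \<noteq> 0" using False by (simp add: c_def)
  then have p: "c\<^sup>2 > 0" by simp
  have b: "A$1$2 = (A$1$1 * d - 1) / c" using A c by (simp add: det2 c_def d_def field_simps)
  have eq: "moebius A z = (- 1 / (of_real (c\<^sup>2) * (z + of_real (d / c)))) + of_real (A$1$1 / c)" 
    if "z \<in> uhp" for z
  proof -
    define J where "J = of_real c * z + of_real d"
    have nz: "J \<noteq> 0"
      using aut_factor_nz[OF A that] by (simp add: aut_factor_def c_def d_def J_def)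
    have den: "of_real (c\<^sup>2) * (z + of_real (d / c)) = of_real c * J"
      using c by (simp add: J_def field_simps power2_eq_square)
    have num: "of_real (A$1$1) * z + of_real ((A$1$1 * d - 1) / c) = (of_real (A$1$1) * J - 1) / of_real c"
      using c by (simp add: J_def field_simps)
    have "moebius A z = (of_real (A$1$1) * z + of_real ((A$1$1 * d - 1) / c)) / J"
      unfolding moebius_def b[symmetric] by (simp add: c_def d_def J_def)
    also have "\<dots> = (- 1 / (of_real c * J)) + of_real (A$1$1 / c)"
      unfolding num using nz c by (simp add: field_simps)
    finally show ?thesis unfolding den .
  qed
  have "(\<integral>\<^sup>+z. g (moebius A z) \<partial>hyp) = (\<integral>\<^sup>+z. g ((- 1 / (of_real (c\<^sup>2) * (z + of_real (d / c)))) + of_real (A$1$1 / c)) \<partial>hyp)"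
    by (rule nn_integral_cong_AE, rule AE_mp[OF AE_hyp_uhp]) (auto simp: eq)
  also have "\<dots> = (\<integral>\<^sup>+z. g ((- 1 / (of_real (c\<^sup>2) * z)) + of_real (A$1$1 / c)) \<partial>hyp)"
    using hyp_translate[of "\<lambda>z. g ((- 1 / (of_real (c\<^sup>2) * z)) + of_real (A$1$1 / c))" "d / c"] by simp
  also have "\<dots> = (\<integral>\<^sup>+z. g ((- 1 / z) + of_real (A$1$1 / c)) \<partial>hyp)"
    using hyp_scale[OF _ p, of "\<lambda>z. g ((- 1 / z) + of_real (A$1$1 / c))"] by simp
  also have "\<dots> = (\<integral>\<^sup>+z. g (z + of_real (A$1$1 / c)) \<partial>hyp)"
    using hyp_inversion[of "\<lambda>z. g (z + of_real (A$1$1 / c))"] by simp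
  also have "\<dots> = (\<integral>\<^sup>+z. g z \<partial>hyp)" by (rule hyp_translate) fact
  finally show ?thesis .
qed

section \<open>Discrete groups of finite covolume\<close>

lemma uminus_mat_mult:
  fixes A B :: "real^2^2"
  shows "(- A) ** B = - (A ** B)" "A ** (- B) = - (A ** B)"
  by (simp_all add: matrix_eq_2 matrix_mult_2)

lemma det_uminus_2: "det (- A) = det (A::real^2^2)"
  by (simp add: det2)

lemma not_uminus:
  assumes "det (A::real^2^2) = 1" shows "A \<noteq> - A"
proof
  assume "A = - A"
  have "A$i$j = (- A)$i$j" for i j by (rule arg_cong[OF \<open>A = - A\<close>, of "\<lambda>A. A$i$j"])
  then have "A$i$j = 0" for i j by simp
  then show False using assms by (simp add: det2)
qed

lemma group_SL2R: "group SL2R"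
proof (rule groupI)
  fix A :: "real^2^2" assume "A \<in> carrier SL2R"
  then have d: "det A = 1" by (simp add: SL2R_def)
  then have "invertible A" by (simp add: invertible_det_nz)
  then obtain B where B: "A ** B = mat 1" "B ** A = mat 1" unfolding invertible_def by auto
  have "det (B ** A) = 1" using B by simp
  then have "det B = 1" using d by (simp add: det_mul)
  with B show "\<exists>B\<in>carrier SL2R. B \<otimes>\<^bsub>SL2R\<^esub> A = \<one>\<^bsub>SL2R\<^esub>" by (auto simp: SL2R_def)
qed (auto simp: SL2R_def det_mul matrix_mul_assoc)

lemma group_PSL2R: "group PSL2R"
proof -
  interpret group SL2R by (rule group_SL2R)
  have inv_neg: "inv\<^bsub>SL2R\<^esub> (- mat 1) = - mat 1"
    by (rule inv_equality) (auto simp: SL2R_def uminus_mat_mult det_uminus_2)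
  have sub: "subgroup {mat 1, - mat 1} SL2R"
  proof (rule subgroupI)
    fix A assume "A \<in> {mat 1, - mat 1::real^2^2}"
    then show "inv\<^bsub>SL2R\<^esub> A \<in> {mat 1, - mat 1}"
      using inv_one inv_neg by (auto simp: SL2R_def)
  qed (auto simp: SL2R_def det_uminus_2 uminus_mat_mult)
  have "{mat 1, - mat 1} \<lhd> SL2R"
    unfolding normal_inv_iff
  proof (intro conjI sub ballI)
    fix X A assume X: "X \<in> carrier SL2R" and A: "A \<in> {mat 1, - mat 1::real^2^2}"
    have "X ** inv\<^bsub>SL2R\<^esub> X = mat 1" using r_inv[OF X] by (simp add: SL2R_def)
    then show "X \<otimes>\<^bsub>SL2R\<^esub> A \<otimes>\<^bsub>SL2R\<^esub> inv\<^bsub>SL2R\<^esub> X \<in> {mat 1, - mat 1}"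
      using A by (auto simp: SL2R_def uminus_mat_mult)
  qed
  then show ?thesis unfolding PSL2R_def by (rule normal.factorgroup_is_group)
qed

lemma matrix_inv_2:
  assumes "det (A::real^2^2) = 1"
  shows "A ** matrix_inv A = mat 1" "matrix_inv A ** A = mat 1" "det (matrix_inv A) = 1"
proof -
  have i: "invertible A" using assms by (simp add: invertible_det_nz)
  show "A ** matrix_inv A = mat 1" "matrix_inv A ** A = mat 1"
    using i unfolding invertible_def matrix_inv_def by (metis (mono_tags, lifting) someI_ex)+
  then have "det (A ** matrix_inv A) = 1" by simp
  then show "det (matrix_inv A) = 1" using assms by (simp add: det_mul)
qed

lemma moebius_inv:
  assumes "det A = 1" "z \<in> uhp"
  shows "moebius A (moebius (matrix_inv A) z) = z" "moebius (matrix_inv A) (moebius A z) = z"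
  using assms matrix_inv_2[OF assms(1)] moebius_mult[of A "matrix_inv A" z] moebius_mult[of "matrix_inv A" A z]
  by auto

text \<open>The group is kept as a set of cosets \<open>{A, - A}\<close>; all computations take place in the set \<open>G\<close> of their
  representatives, where each element of the group occurs twice.\<close>

locale fuchsian =
  fixes \<Gamma> :: "(real^2^2) set set"
  assumes discrete: "discrete_subgroup \<Gamma>" and covolume: "finite_covolume \<Gamma>"
begin

abbreviation G :: "(real^2^2) set" where "G \<equiv> \<Union>\<Gamma>"

lemma subgroup_Gamma: "subgroup \<Gamma> PSL2R"
  using discrete by (simp add: discrete_subgroup_def)

lemma coset_Gamma: "X \<in> \<Gamma> \<Longrightarrow> \<exists>A. X = {A, - A} \<and> det A = 1"
  using subgroup.subset[OF subgroup_Gamma] by (auto simp: carrier_PSL2R)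

lemma coset_of_G:
  assumes "A \<in> G" shows "{A, - A} \<in> \<Gamma>"
proof -
  obtain X where X: "X \<in> \<Gamma>" "A \<in> X" using assms by blast
  then obtain B where "X = {B, - B}" using coset_Gamma by blast
  then have "X = {A, - A}" using X by auto
  then show ?thesis using X by simp
qed

lemma det_G [simp]: "A \<in> G \<Longrightarrow> det A = 1"
  using coset_Gamma det_uminus_2 by (metis UnionE insertE singletonD)

lemma uminus_G: "A \<in> G \<Longrightarrow> - A \<in> G"
  using coset_of_G by blast

lemma one_G: "mat 1 \<in> G"
  using subgroup.one_closed[OF subgroup_Gamma] by (auto simp: PSL2R_def FactGroup_def)

lemma mult_PSL: "X \<otimes>\<^bsub>PSL2R\<^esub> Y = {A ** B | A B. A \<in> X \<and> B \<in> Y}"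
  by (auto simp: PSL2R_def FactGroup_def set_mult_def SL2R_def)

lemma mult_G: 
  assumes "A \<in> G" "B \<in> G" shows "A ** B \<in> G"
proof -
  have "{A, - A} \<otimes>\<^bsub>PSL2R\<^esub> {B, - B} \<in> \<Gamma>"
    using assms coset_of_G subgroup.m_closed[OF subgroup_Gamma] by blast
  then show ?thesis unfolding mult_PSL by blast
qed

lemma inv_G:
  assumes "A \<in> G" shows "matrix_inv A \<in> G"
proof -
  interpret group PSL2R by (rule group_PSL2R)
  have X: "{A, - A} \<in> \<Gamma>" using coset_of_G assms by blast
  then have Xc: "{A, - A} \<in> carrier PSL2R" using subgroup.subset[OF subgroup_Gamma] by blast
  have inv: "inv\<^bsub>PSL2R\<^esub> {A, - A} \<in> \<Gamma>" using subgroup.m_inv_closed[OF subgroup_Gamma X] .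
  then obtain B where B: "inv\<^bsub>PSL2R\<^esub> {A, - A} = {B, - B}" "B \<in> G" using coset_Gamma by blast
  have "{A, - A} \<otimes>\<^bsub>PSL2R\<^esub> {B, - B} = {mat 1, - mat 1}"
    using r_inv[OF Xc] B by (simp add: PSL2R_def FactGroup_def)
  then have "A ** B \<in> {mat 1, - mat 1}" unfolding mult_PSL by blast
  then obtain C where C: "C \<in> G" "A ** C = mat 1"
  proof (cases "A ** B = mat 1")
    case True
    then show ?thesis using B that by blast
  next
    case False
    then have "A ** (- B) = mat 1" using \<open>A ** B \<in> {mat 1, - mat 1}\<close> by (simp add: uminus_mat_mult)
    then show ?thesis using B uminus_G that by blast
  qed
  then have "matrix_inv A ** (A ** C) = matrix_inv A" by simp
  then have "C = matrix_inv A" using matrix_inv_2(2)[of A] assms det_G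
    unfolding matrix_mul_assoc by simp
  then show ?thesis using C by simp
qed

text \<open>A discrete subspace of a second countable space is countable. Countability is what permits the
  exchange of sums over the group with integrals, and makes infima over the group measurable.\<close>

lemma countable_G: "countable G"
proof -
  have iso: "openin (top_of_set G) {A}" if A: "A \<in> G" for A
  proof -
    have X: "{A, - A} \<in> \<Gamma>" using coset_of_G A by blast
    then have "openin (subtopology PSL2R_topology \<Gamma>) {{A, - A}}"
      using discrete by (simp add: discrete_subgroup_def)
    then obtain U where U: "openin PSL2R_topology U" "{{A, - A}} = U \<inter> \<Gamma>"
      unfolding openin_subtopology by blast
    then obtain V where V: "open V" "\<Union>U = carrier SL2R \<inter> V" "U \<subseteq> carrier PSL2R"
      unfolding openin_PSL2R_topology openin_open by blast
    have "V \<inter> G \<subseteq> {A, - A}"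
    proof
      fix B assume B: "B \<in> V \<inter> G"
      then obtain Y where Y: "Y \<in> \<Gamma>" "B \<in> Y" by blast
      have "det B = 1" using B det_G by blast
      then have "B \<in> \<Union>U" using B unfolding V(2) by (simp add: SL2R_def)
      then obtain Z where Z: "Z \<in> U" "B \<in> Z" by blast
      have "Y = Z" using Y Z V(3) subgroup.subset[OF subgroup_Gamma] by (intro PSL2R_cosets_disjoint[of Y Z B]) (blast+)
      then show "B \<in> {A, - A}" proof -
        have "Y \<in> U \<inter> \<Gamma>" using Y Z \<open>Y = Z\<close> by simp
        then have "Y = {A, - A}" unfolding U(2)[symmetric] by simp
        then show ?thesis using Y by simp
      qed
    qed
    moreover have "A \<in> V"
    proof -
      have "{A, - A} \<in> U" using U(2) by blast
      then have "A \<in> \<Union>U" by blast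
      then show ?thesis unfolding V(2) by simp
    qed
    \<comment> \<open>The coset \<open>{A, - A}\<close> is open in \<open>\<Gamma>\<close>; removing \<open>- A\<close> isolates the matrix \<open>A\<close>.\<close>
    moreover have "A \<noteq> - A" by (rule not_uminus[OF det_G[OF A]])
    ultimately have "{A} = G \<inter> (V - {- A})" using A
      by (intro equalityI subsetI) (simp_all only: Int_iff Diff_iff singleton_iff subset_iff insert_iff, auto)
    moreover have "openin (top_of_set G) (G \<inter> (V - {- A}))"
      using V(1) by (intro openin_open_Int open_delete)
    ultimately show ?thesis by (simp only:)
  qed
  have "top_of_set G = discrete_topology G"
    by (rule sym, subst discrete_topology_unique) (simp add: iso del: Union_iff)
  moreover have "second_countable (top_of_set G)"
  proof (rule second_countable_subtopology)
    obtain B :: "(real^2^2) set set" where B: "countable B" "topological_basis B"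
      using ex_countable_basis by blast
    show "second_countable (euclidean :: (real^2^2) topology)"
      unfolding second_countable_def
    proof (intro exI[of _ B] conjI B ballI allI impI)
      show "openin euclidean V" if "V \<in> B" for V using topological_basis_open[OF B(2) that] by simp
      fix U and x :: "real^2^2" assume "openin euclidean U \<and> x \<in> U"
      then show "\<exists>V\<in>B. x \<in> V \<and> V \<subseteq> U"
        by (auto elim: topological_basisE[OF B(2)])
    qed
  qed
  ultimately show ?thesis by (simp only: second_countable_discrete_topology)
qed

definition fund :: "complex set" where
  "fund = (SOME F. F \<in> sets borel \<and> F \<subseteq> uhp \<and>
        (\<forall>z\<in>uhp. \<exists>!w. w \<in> F \<and> (\<exists>A\<in>\<Union>\<Gamma>. w = moebius A z)) \<and>
        (\<integral>\<^sup>+z\<in>F. ennreal (1 / (Im z)\<^sup>2) \<partial>lborel) < \<infinity>)"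

lemma fund_props:
  shows fund_borel [measurable]: "fund \<in> sets borel"
    and fund_uhp: "fund \<subseteq> uhp"
    and fund_unique: "\<And>z. z \<in> uhp \<Longrightarrow> \<exists>!w. w \<in> fund \<and> (\<exists>A\<in>G. w = moebius A z)"
    and fund_area': "(\<integral>\<^sup>+z\<in>fund. ennreal (1 / (Im z)\<^sup>2) \<partial>lborel) < \<infinity>"
proof -
  have "\<exists>F. F \<in> sets borel \<and> F \<subseteq> uhp \<and>
        (\<forall>z\<in>uhp. \<exists>!w. w \<in> F \<and> (\<exists>A\<in>\<Union>\<Gamma>. w = moebius A z)) \<and>
        (\<integral>\<^sup>+z\<in>F. ennreal (1 / (Im z)\<^sup>2) \<partial>lborel) < \<infinity>"
    using covolume unfolding finite_covolume_def by blast
  from someI_ex[OF this] show "fund \<in> sets borel" "fund \<subseteq> uhp"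
    "\<And>z. z \<in> uhp \<Longrightarrow> \<exists>!w. w \<in> fund \<and> (\<exists>A\<in>G. w = moebius A z)"
    "(\<integral>\<^sup>+z\<in>fund. ennreal (1 / (Im z)\<^sup>2) \<partial>lborel) < \<infinity>"
    unfolding fund_def[symmetric] by blast+
qed

lemma fund_area: "emeasure hyp fund < \<infinity>"
proof -
  have "emeasure hyp fund = (\<integral>\<^sup>+z. indicator fund z \<partial>hyp)" by simp
  also have "\<dots> = (\<integral>\<^sup>+z. indicator uhp z * ennreal (1 / (Im z)\<^sup>2) * indicator fund z \<partial>lborel)"
    by (rule nn_integral_hyp) simp
  also have "\<dots> = (\<integral>\<^sup>+z\<in>fund. ennreal (1 / (Im z)\<^sup>2) \<partial>lborel)"
    using fund_uhp by (intro nn_integral_cong) (auto simp: indicator_def)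
  finally show ?thesis using fund_area' by simp
qed

lemma countable_stabilized: "countable {z \<in> uhp. \<exists>A\<in>G. A \<noteq> mat 1 \<and> A \<noteq> - mat 1 \<and> moebius A z = z}"
proof -
  have "{z \<in> uhp. \<exists>A\<in>G. A \<noteq> mat 1 \<and> A \<noteq> - mat 1 \<and> moebius A z = z} =
    (\<Union>A\<in>G - {mat 1, - mat 1}. {z \<in> uhp. moebius A z = z})" by blast
  moreover have "countable {z \<in> uhp. moebius A z = z}" if "A \<in> G - {mat 1, - mat 1}" for A
  proof (cases "{z \<in> uhp. moebius A z = z} = {}")
    case True
    show ?thesis unfolding True by simp
  next
    case False
    then obtain z where z: "z \<in> uhp" "moebius A z = z" by blast
    then have "{z \<in> uhp. moebius A z = z} \<subseteq> {z}"
      using moebius_two_fixed_points[of A z] that det_G[of A] by blast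
    then show ?thesis by (meson countable_empty countable_insert countable_subset)
  qed
  ultimately show ?thesis using countable_G by (metis (no_types, lifting) countable_Diff countable_UN)
qed

text \<open>Every orbit meets \<open>fund\<close>, and two elements carrying \<open>w\<close> to the same point differ by an element of the
  stabiliser of \<open>w\<close>, which is \<open>{1, - 1}\<close> outside a countable set.\<close>

lemma AE_two_elements: "AE w in hyp. w \<in> uhp \<and> card {A \<in> G. moebius A w \<in> fund} = 2"
proof -
  define N where "N = {z \<in> uhp. \<exists>A\<in>G. A \<noteq> mat 1 \<and> A \<noteq> - mat 1 \<and> moebius A z = z}"
  have "N \<in> null_sets lborel"
    unfolding N_def using countable_stabilized by (rule countable_imp_null_set_lborel)
  then have "AE w in lborel. w \<notin> N" by (rule AE_not_in)
  then have "AE w in hyp. w \<notin> N"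
    unfolding hyp_def by (subst AE_density) auto
  then show ?thesis using AE_hyp_uhp
  proof (eventually_elim)
    fix w assume N: "w \<notin> N" and w: "w \<in> uhp"
    obtain A where A: "A \<in> G" "moebius A w \<in> fund" using fund_unique[OF w] by blast
    have "{B \<in> G. moebius B w \<in> fund} = {A, - A}"
    proof (intro equalityI subsetI)
      fix B assume "B \<in> {A, - A}"
      then show "B \<in> {B \<in> G. moebius B w \<in> fund}" using A uminus_G by auto
    next
      fix B assume "B \<in> {B \<in> G. moebius B w \<in> fund}"
      then have B: "B \<in> G" "moebius B w \<in> fund" by auto
      have eq: "moebius B w = moebius A w" using fund_unique[OF w] A B by blast
      define C where "C = matrix_inv A ** B"
      have C: "C \<in> G" unfolding C_def using A B inv_G mult_G by blast
      have "moebius C w = w"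
        unfolding C_def using moebius_mult[of "matrix_inv A" B w] moebius_inv(2)[of A w] A B w eq matrix_inv_2(3)[of A] by simp
      then have "C = mat 1 \<or> C = - mat 1" using N C w unfolding N_def by blast
      moreover have "A ** C = B"
        unfolding C_def using matrix_inv_2[of A] A by (simp add: matrix_mul_assoc)
      ultimately show "B \<in> {A, - A}" by (auto simp: uminus_mat_mult)
    qed
    moreover have "A \<noteq> - A" by (rule not_uminus[OF det_G[OF A(1)]])
    ultimately show "w \<in> uhp \<and> card {A \<in> G. moebius A w \<in> fund} = 2" using w by simp
  qed
qed

text \<open>Almost every point is carried into the fundamental set by exactly two matrices, which accounts for
  the factor \<open>2\<close>.\<close>

lemma integral_unfolding:
  assumes [measurable]: "g \<in> borel_measurable borel"
  shows "2 * (\<integral>\<^sup>+w. g w \<partial>hyp) = (\<integral>\<^sup>+A. \<integral>\<^sup>+w. indicator fund w * g (moebius (matrix_inv A) w) \<partial>hyp \<partial>count_space G)"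
proof -
  have "2 * (\<integral>\<^sup>+w. g w \<partial>hyp) = (\<integral>\<^sup>+w. (\<integral>\<^sup>+A. indicator fund (moebius A w) * g w \<partial>count_space G) \<partial>hyp)"
  proof (subst nn_integral_cmult[symmetric], simp, rule nn_integral_cong_AE, use AE_two_elements in eventually_elim)
    fix w assume w: "w \<in> uhp \<and> card {A \<in> G. moebius A w \<in> fund} = 2"
    define S where "S = {A \<in> G. moebius A w \<in> fund}"
    have fin: "finite S" 
    proof (rule ccontr)
      assume "infinite S"
      then have "card S = 0" by simp
      then show False using w unfolding S_def by simp
    qed
    have "(\<integral>\<^sup>+A. indicator fund (moebius A w) * g w \<partial>count_space G) = (\<integral>\<^sup>+A. g w * indicator S A \<partial>count_space G)"
      by (intro nn_integral_cong) (auto simp: S_def indicator_def)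
    also have "\<dots> = g w * emeasure (count_space G) S"
      by (subst nn_integral_cmult_indicator) (auto simp: S_def)
    also have "emeasure (count_space G) S = ennreal (card S)"
      using fin by (subst emeasure_count_space_finite) (auto simp: S_def ennreal_of_nat_eq_real_of_nat)
    also have "card S = 2" using w unfolding S_def by simp
    finally show "2 * g w = (\<integral>\<^sup>+A. indicator fund (moebius A w) * g w \<partial>count_space G)" by (simp add: mult.commute)
  qed
  also have "\<dots> = (\<integral>\<^sup>+A. (\<integral>\<^sup>+w. indicator fund (moebius A w) * g w \<partial>hyp) \<partial>count_space G)"
    by (rule nn_integral_count_space_nn_integral[OF countable_G]) auto
  also have "\<dots> = (\<integral>\<^sup>+A. \<integral>\<^sup>+w. indicator fund w * g (moebius (matrix_inv A) w) \<partial>hyp \<partial>count_space G)"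
  proof (rule nn_integral_cong)
    fix A assume "A \<in> space (count_space G)"
    then have A: "A \<in> G" by simp
    have "(\<integral>\<^sup>+w. indicator fund (moebius A w) * g w \<partial>hyp) = (\<integral>\<^sup>+w. indicator fund (moebius A (moebius (matrix_inv A) w)) * g (moebius (matrix_inv A) w) \<partial>hyp)"
      using matrix_inv_2[of A] A by (intro hyp_invariant[of "\<lambda>w. indicator fund (moebius A w) * g w" "matrix_inv A", symmetric]) auto
    also have "\<dots> = (\<integral>\<^sup>+w. indicator fund w * g (moebius (matrix_inv A) w) \<partial>hyp)"
      by (rule nn_integral_cong_AE, rule AE_mp[OF AE_hyp_uhp]) (use A in \<open>auto simp: moebius_inv\<close>)
    finally show "(\<integral>\<^sup>+w. indicator fund (moebius A w) * g w \<partial>hyp) = (\<integral>\<^sup>+w. indicator fund w * g (moebius (matrix_inv A) w) \<partial>hyp)" .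
  qed
  finally show ?thesis .
qed

lemma bij_inv_G: "bij_betw matrix_inv G G"
proof (rule bij_betwI[where g = matrix_inv])
  have "matrix_inv (matrix_inv A) = A" if "A \<in> G" for A
  proof -
    have "matrix_inv (matrix_inv A) = matrix_inv (matrix_inv A) ** (matrix_inv A ** A)"
      using matrix_inv_2(2)[of A] that by simp
    also have "\<dots> = A" using matrix_inv_2(2)[of "matrix_inv A"] matrix_inv_2(3)[of A] that
      unfolding matrix_mul_assoc by simp
    finally show ?thesis .
  qed
  then show "\<And>A. A \<in> G \<Longrightarrow> matrix_inv (matrix_inv A) = A" by blast
  then show "\<And>A. A \<in> G \<Longrightarrow> matrix_inv (matrix_inv A) = A" by blast
qed (use inv_G in auto)

text \<open>Integration over the quotient is symmetric: unfolding the inner integral gives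
  \<open>\<Sum>A. \<integral>\<^sub>F \<integral>\<^sub>F K(z, A w)\<close>, and invariance turns \<open>K(z, A w)\<close> into \<open>K(A\<inverse> z, w)\<close>, so that
  exchanging the variables only replaces \<open>A\<close> by \<open>A\<inverse>\<close>.\<close>

lemma fund_swap:
  fixes K :: "complex \<Rightarrow> complex \<Rightarrow> ennreal"
  assumes [measurable]: "case_prod K \<in> borel_measurable (borel \<Otimes>\<^sub>M borel)"
    and inv: "\<And>A z w. A \<in> G \<Longrightarrow> z \<in> uhp \<Longrightarrow> w \<in> uhp \<Longrightarrow> K (moebius A z) (moebius A w) = K z w"
  shows "(\<integral>\<^sup>+z. indicator fund z * (\<integral>\<^sup>+w. K z w \<partial>hyp) \<partial>hyp) = (\<integral>\<^sup>+z. indicator fund z * (\<integral>\<^sup>+w. K w z \<partial>hyp) \<partial>hyp)"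
proof -
  define J where "J A = (\<integral>\<^sup>+z. \<integral>\<^sup>+w. indicator fund z * (indicator fund w * K z (moebius A w)) \<partial>hyp \<partial>hyp)" for A
  define J' where "J' A = (\<integral>\<^sup>+z. \<integral>\<^sup>+w. indicator fund z * (indicator fund w * K (moebius A w) z) \<partial>hyp \<partial>hyp)" for A
  have JJ': "J A = J' (matrix_inv A)" if A: "A \<in> G" for A
  proof -
    have "J A = (\<integral>\<^sup>+w. \<integral>\<^sup>+z. indicator fund z * (indicator fund w * K z (moebius A w)) \<partial>hyp \<partial>hyp)"
      unfolding J_def by (rule hyp2.Fubini'[symmetric]) measurable
    also have "\<dots> = J' (matrix_inv A)"
      unfolding J'_def
    proof (rule nn_integral_cong, rule nn_integral_cong)
      fix w z
      have "K z (moebius A w) = K (moebius (matrix_inv A) z) w" if "z \<in> uhp" "w \<in> uhp"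
        using inv[of "matrix_inv A" z "moebius A w"] that A inv_G moebius_inv[of A] by simp
      then show "indicator fund z * (indicator fund w * K z (moebius A w)) = indicator fund w * (indicator fund z * K (moebius (matrix_inv A) z) w)"
        using subsetD[OF fund_uhp, of z] subsetD[OF fund_uhp, of w] by (auto simp: indicator_def)
    qed
    finally show ?thesis .
  qed
  have cm: "c * 2 * a = 2 * (c * a)" for a c :: ennreal by (simp add: mult_ac)
  have "2 * (\<integral>\<^sup>+z. indicator fund z * (\<integral>\<^sup>+w. K z w \<partial>hyp) \<partial>hyp) = (\<integral>\<^sup>+z. indicator fund z * (2 * (\<integral>\<^sup>+w. K z w \<partial>hyp)) \<partial>hyp)"
    by (subst nn_integral_cmult[symmetric]) (auto simp: mult_ac)
  also have "\<dots> = (\<integral>\<^sup>+z. (\<integral>\<^sup>+A. \<integral>\<^sup>+w. indicator fund z * (indicator fund w * K z (moebius (matrix_inv A) w)) \<partial>hyp \<partial>count_space G) \<partial>hyp)"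
    by (subst integral_unfolding, simp, subst nn_integral_cmult[symmetric], simp, subst nn_integral_cmult[symmetric]) auto
  also have "\<dots> = (\<integral>\<^sup>+A. J (matrix_inv A) \<partial>count_space G)"
    unfolding J_def by (rule nn_integral_count_space_nn_integral[OF countable_G]) measurable
  also have "\<dots> = (\<integral>\<^sup>+A. J A \<partial>count_space G)"
    by (rule nn_integral_bij_count_space[OF bij_inv_G])
  also have "\<dots> = (\<integral>\<^sup>+A. J' (matrix_inv A) \<partial>count_space G)"
    by (rule nn_integral_cong) (simp add: JJ')
  also have "\<dots> = (\<integral>\<^sup>+z. (\<integral>\<^sup>+A. \<integral>\<^sup>+w. indicator fund z * (indicator fund w * K (moebius (matrix_inv A) w) z) \<partial>hyp \<partial>count_space G) \<partial>hyp)"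
    unfolding J'_def by (rule nn_integral_count_space_nn_integral[OF countable_G, symmetric]) measurable
  also have "\<dots> = (\<integral>\<^sup>+z. indicator fund z * (2 * (\<integral>\<^sup>+w. K w z \<partial>hyp)) \<partial>hyp)"
    by (subst integral_unfolding, simp, subst nn_integral_cmult[symmetric], simp, subst nn_integral_cmult[symmetric]) auto
  also have "\<dots> = 2 * (\<integral>\<^sup>+z. indicator fund z * (\<integral>\<^sup>+w. K w z \<partial>hyp) \<partial>hyp)"
    by (subst (2) nn_integral_cmult[symmetric]) (auto simp: mult_ac)
  finally show ?thesis by (simp add: ennreal_mult_cancel_left)
qed

lemma fund_pos: "emeasure hyp fund > 0"
proof (rule ccontr)
  assume "\<not> emeasure hyp fund > 0"
  then have 0: "fund \<in> null_sets hyp" by (simp add: null_sets_def)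
  have "2 * (\<integral>\<^sup>+w. indicator uhp w \<partial>hyp) = (\<integral>\<^sup>+A. \<integral>\<^sup>+w. indicator fund w * indicator uhp (moebius (matrix_inv A) w) \<partial>hyp \<partial>count_space G)"
    by (rule integral_unfolding) simp
  also have "\<dots> = (\<integral>\<^sup>+(A::real^2^2). 0 \<partial>count_space G)"
  proof (rule nn_integral_cong)
    fix A
    have "AE w in hyp. w \<notin> fund" using 0 by (rule AE_not_in)
    then have "AE w in hyp. indicator fund w * indicator uhp (moebius (matrix_inv A) w) = (0::ennreal)"
      by eventually_elim simp
    then show "(\<integral>\<^sup>+w. indicator fund w * indicator uhp (moebius (matrix_inv A) w) \<partial>hyp) = 0"
      by (subst nn_integral_0_iff_AE) auto
  qed
  finally have "emeasure hyp uhp = 0" by simp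
  moreover have "emeasure hyp uhp > 0"
    using uhp_iff[of \<i>] by (intro emeasure_hyp_open_pos[OF open_uhp]) (auto simp del: uhp_iff)
  ultimately show False by simp
qed

end

section \<open>Averaging over hyperbolic discs\<close>

text \<open>Since \<open>cosh d(z, w) = 1 + \<bar>z - w\<bar>\<^sup>2 / (2 Im z Im w)\<close>, this is the open hyperbolic disc of centre \<open>z\<close>
  with \<open>cosh d < 3 / 2\<close>.\<close>

definition hdisc :: "complex \<Rightarrow> complex set" where
  "hdisc z = {w \<in> uhp. (cmod (w - z))\<^sup>2 < Im w * Im z}"

lemma hdisc_uhp: "w \<in> hdisc z \<Longrightarrow> Im w > 0"
  by (simp add: hdisc_def)

lemma hdisc_sym: "z \<in> uhp \<Longrightarrow> w \<in> hdisc z \<Longrightarrow> z \<in> hdisc w"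
  by (auto simp: hdisc_def norm_minus_commute mult.commute)

lemma hdisc_moebius:
  assumes "det A = 1" "z \<in> uhp" "w \<in> uhp"
  shows "moebius A w \<in> hdisc (moebius A z) \<longleftrightarrow> w \<in> hdisc z"
proof -
  have nz: "cmod (aut_factor A z) > 0" "cmod (aut_factor A w) > 0" using aut_factor_nz assms by auto
  have "(cmod (moebius A w - moebius A z))\<^sup>2 = (cmod (w - z))\<^sup>2 / ((cmod (aut_factor A w))\<^sup>2 * (cmod (aut_factor A z))\<^sup>2)"
    using assms by (simp add: moebius_diff norm_divide norm_mult power_divide power_mult_distrib)
  moreover have "Im (moebius A w) * Im (moebius A z) = Im w * Im z / ((cmod (aut_factor A w))\<^sup>2 * (cmod (aut_factor A z))\<^sup>2)"
    using assms by (simp add: Im_moebius)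
  moreover have "a / X < b / X \<longleftrightarrow> a < b" if "X > 0" for a b X :: real
    using that by (simp add: divide_less_cancel)
  moreover have "0 < (cmod (aut_factor A w))\<^sup>2 * (cmod (aut_factor A z))\<^sup>2" using nz by simp
  ultimately show ?thesis using assms by (simp add: hdisc_def)
qed

lemma hdisc_Im:
  assumes "w \<in> hdisc z" "z \<in> uhp"
  shows "Im w \<le> 3 * Im z" "Im z \<le> 3 * Im w"
proof -
  have *: "b \<le> 3 * a" if "a > 0" "b > 0" "(b - a)\<^sup>2 < b * a" for a b :: real
  proof (rule ccontr)
    assume "\<not> ?thesis"
    then have "b * (b - 3 * a) \<ge> 0" using that by auto
    moreover have "b * (b - 3 * a) + a * a < 0" using that(3) by (simp add: power2_eq_square algebra_simps)
    moreover have "a * a > 0" using that by simp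
    ultimately show False by linarith
  qed
  have "(Im w - Im z)\<^sup>2 \<le> (cmod (w - z))\<^sup>2" 
    using abs_Im_le_cmod[of "w - z"] by (simp add: abs_le_square_iff[symmetric])
  then have "(Im w - Im z)\<^sup>2 < Im w * Im z" using assms by (simp add: hdisc_def)
  then show "Im w \<le> 3 * Im z" "Im z \<le> 3 * Im w"
    using *[of "Im z" "Im w"] *[of "Im w" "Im z"] assms hdisc_uhp[OF assms(1)] by (auto simp: power2_commute mult.commute)
qed

text \<open>Twice the hyperbolic cosine of the distance from \<open>\<i>\<close>, and the quantity in terms of which moderate growth
  is defined; its logarithm is comparable to that distance.\<close>

definition height :: "complex \<Rightarrow> real" where
  "height z = (1 + (cmod z)\<^sup>2) / Im z"

lemma height_ge: 
  assumes "z \<in> uhp" 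
  shows "1 \<le> height z" "1 / Im z \<le> height z" "cmod z \<le> height z" "Im z \<le> height z"
proof -
  have y: "Im z > 0" "Im z \<le> cmod z" using assms abs_Im_le_cmod[of z] by auto
  have yy: "Im z * cmod z \<le> (cmod z)\<^sup>2" using mult_right_mono[OF y(2), of "cmod z"] by (simp add: power2_eq_square)
  show "1 / Im z \<le> height z" using y by (simp add: height_def divide_right_mono)
  show "cmod z \<le> height z" using y yy by (simp add: height_def pos_le_divide_eq mult.commute)
  then show "Im z \<le> height z" using y by simp
  have "0 \<le> (1 - cmod z)\<^sup>2" by simp
  then have "2 * cmod z \<le> 1 + (cmod z)\<^sup>2" unfolding power2_diff by simp
  then show "1 \<le> height z" using y by (simp add: height_def pos_le_divide_eq)
qed

text \<open>On a disc of fixed radius the height varies by a bounded factor: \<open>1 + \<bar>w\<bar>\<^sup>2\<close> changes by at most \<open>8\<close> and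
  the imaginary part by at most \<open>3\<close>.\<close>

lemma height_hdisc:
  assumes "w \<in> hdisc z" "z \<in> uhp"
  shows "height w \<le> 24 * height z"
proof -
  have y: "Im z > 0" "Im w > 0" using assms hdisc_uhp by auto
  have i: "Im w \<le> 3 * Im z" "Im z \<le> 3 * Im w" using hdisc_Im[OF assms] by auto
  have "Im w * Im z \<le> 3 * (Im z * Im z)" using i y by (simp add: mult.assoc[symmetric])
  also have "Im z * Im z \<le> cmod z * cmod z" using abs_Im_le_cmod[of z] y by (intro mult_mono) auto
  finally have a: "(cmod (w - z))\<^sup>2 \<le> 3 * (cmod z)\<^sup>2" using assms by (simp add: hdisc_def power2_eq_square)
  have "cmod w \<le> cmod z + cmod (w - z)" using norm_triangle_ineq[of z "w - z"] by simp
  then have "(cmod w)\<^sup>2 \<le> (cmod z + cmod (w - z))\<^sup>2" by (intro power_mono) auto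
  also have "\<dots> \<le> 2 * (cmod z)\<^sup>2 + 2 * (cmod (w - z))\<^sup>2"
    using sum_squares_bound[of "cmod z" "cmod (w - z)"] by (simp add: power2_sum)
  finally have b: "1 + (cmod w)\<^sup>2 \<le> 8 * (1 + (cmod z)\<^sup>2)" using a by simp
  have "height w \<le> 8 * (1 + (cmod z)\<^sup>2) / Im w"
    unfolding height_def using y b by (intro divide_right_mono) auto
  also have "\<dots> \<le> 8 * (1 + (cmod z)\<^sup>2) / (Im z / 3)"
    using y i by (intro divide_left_mono) (auto intro: add_pos_nonneg)
  finally show ?thesis by (simp add: height_def)
qed

text \<open>An element of the group \<open>SL\<^sub>2(\<real>)\<close> that moves \<open>\<i>\<close> to \<open>z\<close>; it reduces statements about discs to discs around \<open>\<i>\<close>.\<close>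

definition trans_to :: "complex \<Rightarrow> real^2^2" where
  "trans_to z = vector [vector [sqrt (Im z), Re z / sqrt (Im z)], vector [0, 1 / sqrt (Im z)]]"

lemma trans_to:
  assumes "z \<in> uhp"
  shows "det (trans_to z) = 1" "moebius (trans_to z) w = of_real (Im z) * w + of_real (Re z)"
    "moebius (trans_to z) \<i> = z"
proof -
  have s: "complex_of_real (sqrt (Im z)) * of_real (sqrt (Im z)) = of_real (Im z)"
    unfolding of_real_mult[symmetric] using assms by simp
  have c: "complex_of_real (sqrt (Im z)) \<noteq> 0" using assms by simp
  show "det (trans_to z) = 1" using assms by (simp add: trans_to_def det2)
  show *: "moebius (trans_to z) w = of_real (Im z) * w + of_real (Re z)" for w
    using c by (simp add: trans_to_def moebius_def s[symmetric] field_simps)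
  show "moebius (trans_to z) \<i> = z" unfolding * by (simp add: complex_eq_iff)
qed

definition rotation :: "real \<Rightarrow> real^2^2" where
  "rotation t = vector [vector [cos t, sin t], vector [- sin t, cos t]]"

text \<open>The Cayley transform from the unit disc, in which the rotations about \<open>\<i>\<close> become \<open>\<zeta> \<mapsto> e\<^bsup>2it\<^esup> \<zeta>\<close> and
  the disc about \<open>\<i>\<close> becomes \<open>5 \<bar>\<zeta>\<bar>\<^sup>2 < 1\<close>.\<close>

definition cay :: "complex \<Rightarrow> complex" where
  "cay \<zeta> = \<i> * (1 + \<zeta>) / (1 - \<zeta>)"

definition cay_inv :: "complex \<Rightarrow> complex" where
  "cay_inv w = (w - \<i>) / (w + \<i>)"

lemma cay_0 [simp]: "cay 0 = \<i>" by (simp add: cay_def)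

lemma plus_i_nz: "w \<in> uhp \<Longrightarrow> w + \<i> \<noteq> 0"
  by (auto simp: complex_eq_iff)

lemma one_minus_nz: "cmod \<zeta> < 1 \<Longrightarrow> 1 - \<zeta> \<noteq> 0"
  by auto

lemma Im_cay: "cmod \<zeta> < 1 \<Longrightarrow> Im (cay \<zeta>) = (1 - (cmod \<zeta>)\<^sup>2) / (cmod (1 - \<zeta>))\<^sup>2"
proof -
  have "Im (\<i> * (1 + \<zeta>) * cnj (1 - \<zeta>)) = 1 - (cmod \<zeta>)\<^sup>2"
    by (simp add: cmod_power2) (simp add: power2_eq_square algebra_simps)
  then show ?thesis unfolding cay_def complex_div_cnj[of _ "1 - \<zeta>"]
    by (simp add: Im_divide_of_real[symmetric] del: of_real_power)
qed

lemma cay_uhp: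
  assumes "cmod \<zeta> < 1" shows "cay \<zeta> \<in> uhp"
proof -
  have "(cmod \<zeta>)\<^sup>2 < 1" using assms by (simp add: power_less_one_iff abs_square_less_1)
  then show ?thesis using assms one_minus_nz[OF assms] by (simp add: Im_cay)
qed

lemma cay_cay_inv:
  assumes "w \<in> uhp" shows "cay (cay_inv w) = w"
proof -
  have "1 - cay_inv w = 2 * \<i> / (w + \<i>)" "1 + cay_inv w = 2 * w / (w + \<i>)"
    using plus_i_nz[OF assms] by (simp_all add: cay_inv_def field_simps)
  then show ?thesis using plus_i_nz[OF assms] by (simp add: cay_def)
qed

lemma cay_inv_cay:
  assumes "cmod \<zeta> < 1" shows "cay_inv (cay \<zeta>) = \<zeta>"
proof -
  have "cay \<zeta> - \<i> = 2 * \<i> * \<zeta> / (1 - \<zeta>)" "cay \<zeta> + \<i> = 2 * \<i> / (1 - \<zeta>)"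
    using one_minus_nz[OF assms] by (simp_all add: cay_def field_simps)
  then show ?thesis using one_minus_nz[OF assms] by (simp add: cay_inv_def)
qed

lemma cay_inv_less: 
  assumes "w \<in> uhp" shows "cmod (cay_inv w) < 1"
proof -
  have "(cmod (w - \<i>))\<^sup>2 < (cmod (w + \<i>))\<^sup>2"
    using assms by (simp add: cmod_power2) (simp add: power2_eq_square algebra_simps)
  then have "cmod (w - \<i>) < cmod (w + \<i>)" by (rule power_less_imp_less_base) simp
  then show ?thesis using plus_i_nz[OF assms] by (simp add: cay_inv_def norm_divide)
qed

lemma hdisc_cay:
  assumes "cmod \<zeta> < 1" shows "cay \<zeta> \<in> hdisc \<i> \<longleftrightarrow> 5 * (cmod \<zeta>)\<^sup>2 < 1"
proof -
  have nz: "cmod (1 - \<zeta>) > 0" using one_minus_nz[OF assms] by simp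
  have "cay \<zeta> - \<i> = 2 * \<i> * \<zeta> / (1 - \<zeta>)"
    using one_minus_nz[OF assms] by (simp_all add: cay_def field_simps)
  then have "(cmod (cay \<zeta> - \<i>))\<^sup>2 = 4 * (cmod \<zeta>)\<^sup>2 / (cmod (1 - \<zeta>))\<^sup>2"
    by (simp add: norm_divide norm_mult power_divide power_mult_distrib)
  then show ?thesis
    using cay_uhp[OF assms] nz by (simp add: hdisc_def Im_cay assms divide_less_cancel) 
qed

lemma cay_inv_half:
  assumes "w \<in> hdisc \<i>" shows "cmod (cay_inv w) < 1/2"
proof -
  have w: "w \<in> uhp" using assms hdisc_uhp by simp
  have "5 * (cmod (cay_inv w))\<^sup>2 < 1"
    using hdisc_cay[of "cay_inv w"] cay_inv_less[OF w] cay_cay_inv[OF w] assms by simp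
  then have "(cmod (cay_inv w))\<^sup>2 < (1/2)\<^sup>2" by (simp add: power2_eq_square)
  then show ?thesis by (rule power_less_imp_less_base) simp
qed

lemma rotation:
  shows "det (rotation t) = 1" "moebius (rotation t) \<i> = \<i>"
    and moebius_rotation_cay: "w \<in> uhp \<Longrightarrow> moebius (rotation t) w = cay (cis (2 * t) * cay_inv w)"
proof -
  show d: "det (rotation t) = 1"
    by (simp add: rotation_def det2)
  have c: "of_real (cos t) + \<i> * of_real (sin t) = cis t" "of_real (cos t) - \<i> * of_real (sin t) = cis (- t)"
    by (auto simp: complex_eq_iff)
  have m: "moebius (rotation t) w = (of_real (cos t) * w + of_real (sin t)) / (of_real (cos t) - of_real (sin t) * w)" for w
    by (simp add: rotation_def moebius_def)
  have ci: "cay_inv (moebius (rotation t) w) = cis (2 * t) * cay_inv w" if w: "w \<in> uhp" for w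
  proof -
    have j: "of_real (cos t) - of_real (sin t) * w \<noteq> 0"
      using aut_factor_nz[OF d w] by (simp add: aut_factor_def rotation_def)
    have "moebius (rotation t) w - \<i> = cis t * (w - \<i>) / (of_real (cos t) - of_real (sin t) * w)"
      unfolding m c[symmetric] using j by (simp add: field_simps)
    moreover have "moebius (rotation t) w + \<i> = cis (- t) * (w + \<i>) / (of_real (cos t) - of_real (sin t) * w)"
      unfolding m c[symmetric] using j by (simp add: field_simps)
    ultimately have "cay_inv (moebius (rotation t) w) = (cis t / cis (- t)) * cay_inv w"
      using j by (simp add: cay_inv_def)
    also have "cis t / cis (- t) = cis (2 * t)" by (simp add: cis_divide)
    finally show ?thesis .
  qed
  show "moebius (rotation t) w = cay (cis (2 * t) * cay_inv w)" if w: "w \<in> uhp"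
    using cay_cay_inv[of "moebius (rotation t) w"] ci[OF w] d w by simp
  have u: "moebius (rotation t) \<i> \<in> uhp" using d by simp
  have "cay_inv (moebius (rotation t) \<i>) = 0" using ci[of \<i>] by (simp add: cay_inv_def)
  then show "moebius (rotation t) \<i> = \<i>" using cay_cay_inv[OF u] by simp
qed

lemma hdisc_borel [measurable]: "hdisc z \<in> sets borel"
  unfolding hdisc_def uhp_def by measurable

lemma hdisc_rel_borel [measurable]: "{p. fst p \<in> hdisc (snd p)} \<in> sets (borel \<Otimes>\<^sub>M borel)"
proof -
  have "{p \<in> space (borel \<Otimes>\<^sub>M borel :: (complex \<times> complex) measure). Im (fst p) > 0 \<and> (cmod (fst p - snd p))\<^sup>2 < Im (fst p) * Im (snd p)} \<in> sets (borel \<Otimes>\<^sub>M borel)"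
    by measurable
  then show ?thesis by (simp add: hdisc_def space_pair_measure)
qed

definition disc_area :: real where
  "disc_area = measure hyp (hdisc \<i>)"

lemma open_hdisc: "open (hdisc z)"
proof -
  have "open {w. (cmod (w - z))\<^sup>2 < Im w * Im z}"
    by (intro open_Collect_less continuous_intros)
  moreover have "hdisc z = uhp \<inter> {w. (cmod (w - z))\<^sup>2 < Im w * Im z}" by (auto simp: hdisc_def)
  ultimately show ?thesis using open_uhp by auto
qed

lemma emeasure_hdisc_i: "emeasure hyp (hdisc \<i>) = ennreal disc_area" and disc_area_pos: "disc_area > 0"
proof -
  have "emeasure hyp (hdisc \<i>) = (\<integral>\<^sup>+z. indicator uhp z * ennreal (1 / (Im z)\<^sup>2) * indicator (hdisc \<i>) z \<partial>lborel)"
    using nn_integral_hyp[of "indicator (hdisc \<i>)"] by simp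
  also have "\<dots> \<le> (\<integral>\<^sup>+z. 9 * indicator (cball \<i> 2) z \<partial>lborel)"
  proof (rule nn_integral_mono)
    fix z
    show "indicator uhp z * ennreal (1 / (Im z)\<^sup>2) * indicator (hdisc \<i>) z \<le> 9 * indicator (cball \<i> 2) z"
    proof (cases "z \<in> hdisc \<i>")
      case True
      have i: "Im z \<le> 3" "1/3 \<le> Im z" using hdisc_Im[OF True] by auto
      have "(cmod (z - \<i>))\<^sup>2 < Im z" using True by (simp add: hdisc_def)
      then have "(cmod (z - \<i>))\<^sup>2 < 2\<^sup>2" using i by simp
      then have "cmod (z - \<i>) < 2" by (rule power_less_imp_less_base) simp
      then have "z \<in> cball \<i> 2" by (simp add: dist_norm norm_minus_commute)
      moreover have "1 / (Im z)\<^sup>2 \<le> 1 / (1/3)\<^sup>2" using i by (intro divide_left_mono power_mono) auto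
      then have "ennreal (1 / (Im z)\<^sup>2) \<le> ennreal 9" by (intro ennreal_leI) (simp add: power2_eq_square)
      ultimately show ?thesis using True hdisc_uhp[OF True] by simp
    qed simp
  qed
  also have "\<dots> = 9 * emeasure lborel (cball \<i> (2::real))" by (rule nn_integral_cmult_indicator) simp
  also have "\<dots> < \<infinity>" using emeasure_bounded_finite[of "cball \<i> (2::real)"] by (simp add: ennreal_mult_less_top)
  finally show *: "emeasure hyp (hdisc \<i>) = ennreal disc_area"
    unfolding disc_area_def by (intro emeasure_eq_ennreal_measure) auto
  have "emeasure hyp (hdisc \<i>) > 0"
    by (rule emeasure_hyp_open_pos[OF open_hdisc]) (auto simp: hdisc_def intro!: exI[of _ \<i>])
  then show "disc_area > 0" unfolding * by simp
qed

lemma hdisc_transport: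
  assumes [measurable]: "h \<in> borel_measurable borel" and A: "det A = 1" and z: "z \<in> uhp"
  shows "(\<integral>\<^sup>+w. indicator (hdisc (moebius A z)) w * h w \<partial>hyp) = (\<integral>\<^sup>+w. indicator (hdisc z) w * h (moebius A w) \<partial>hyp)"
proof -
  have "(\<integral>\<^sup>+w. indicator (hdisc (moebius A z)) w * h w \<partial>hyp) = 
     (\<integral>\<^sup>+w. indicator (hdisc (moebius A z)) (moebius A w) * h (moebius A w) \<partial>hyp)"
    by (rule hyp_invariant[symmetric]) (use A in auto)
  also have "\<dots> = (\<integral>\<^sup>+w. indicator (hdisc z) w * h (moebius A w) \<partial>hyp)"
    by (rule nn_integral_cong_AE, rule AE_mp[OF AE_hyp_uhp]) (use A z hdisc_moebius in \<open>auto simp: indicator_def\<close>)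
  finally show ?thesis .
qed

lemma emeasure_hdisc: "z \<in> uhp \<Longrightarrow> emeasure hyp (hdisc z) = ennreal disc_area"
  using hdisc_transport[of "\<lambda>_. 1" "trans_to z" \<i>] trans_to[of z] emeasure_hdisc_i by simp

lemma prod_roots_shift:
  fixes g :: "complex \<Rightarrow> complex"
  assumes n: "n > 0"
  defines "Q \<equiv> \<lambda>\<eta>. \<Prod>j<n. g (cis (2 * pi * real j / real n) * \<eta>)"
  shows "Q (cis (2 * pi * real l / real n) * \<eta>) = Q \<eta>"
proof -
  have step: "Q (cis (2 * pi / real n) * \<eta>) = Q \<eta>" for \<eta>
  proof -
    define h where "h j = g (cis (2 * pi * real j / real n) * \<eta>)" for j :: nat
    have "Q (cis (2 * pi / real n) * \<eta>) = (\<Prod>j<n. h (Suc j))"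
      unfolding Q_def h_def
    proof (intro prod.cong refl arg_cong[of _ _ g])
      fix j
      have "2 * pi * real j / real n + 2 * pi / real n = 2 * pi * real (Suc j) / real n"
        by (simp add: add_divide_distrib distrib_left)
      then show "cis (2 * pi * real j / real n) * (cis (2 * pi / real n) * \<eta>) = cis (2 * pi * real (Suc j) / real n) * \<eta>"
        by (simp add: mult.assoc[symmetric] cis_mult)
    qed
    moreover have "h n = h 0" using n by (simp add: h_def)
    moreover have "h 0 * (\<Prod>j<n. h (Suc j)) = (\<Prod>j<n. h j) * h n"
      using prod.lessThan_Suc_shift[of h n] by simp
    moreover have "(\<Prod>j<n. h (Suc j)) = (\<Prod>j<n. h j)"
    proof -
      obtain m where m: "n = Suc m" using n by (cases n) auto
      show ?thesis using \<open>h n = h 0\<close> unfolding m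
        by (subst (2) prod.lessThan_Suc_shift) (simp add: mult.commute)
    qed
    ultimately show ?thesis unfolding Q_def h_def by simp
  qed
  show ?thesis
  proof (induction l)
    case (Suc l)
    have "2 * pi * real (Suc l) / real n = 2 * pi / real n + 2 * pi * real l / real n"
      by (simp add: add_divide_distrib distrib_left)
    then have *: "cis (2 * pi * real (Suc l) / real n) = cis (2 * pi / real n) * cis (2 * pi * real l / real n)"
      by (simp only: cis_mult)
    show ?case unfolding * mult.assoc[of "cis (2 * pi / real n)"] step Suc ..
  qed simp
qed

lemma cis_diff_le: "cmod (cis a - 1) \<le> \<bar>a\<bar>"
proof -
  have "cmod (cis a - 1) = 2 * \<bar>sin (a / 2)\<bar>"
    by (metis cis_conv_exp dist_exp_i_1 norm_minus_commute)
  also have "\<dots> \<le> \<bar>a\<bar>" using abs_sin_x_le_abs_x[of "a / 2"] by simp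
  finally show ?thesis .
qed

text \<open>A discrete substitute for Jensen's inequality \<open>ln \<bar>g 0\<bar> \<le> mean of ln \<bar>g\<bar>\<close>: the function
  \<open>Q \<eta> = (\<Prod>j<n. g (\<omega>\<^sup>j \<eta>))\<close> with \<open>\<omega> = e\<^bsup>2\<pi>i/n\<^esup>\<close> is holomorphic with \<open>Q 0 = g 0 ^ n\<close>, so by the maximum
  principle it is at least that large somewhere on the circle through \<open>\<zeta>\<close>. As \<open>Q\<close> is invariant under
  \<open>\<omega>\<close>, such a point exists within the angle \<open>2 \<pi> / n\<close> of \<open>\<zeta>\<close>.\<close>

lemma rotated_product_large:
  fixes g :: "complex \<Rightarrow> complex"
  assumes g: "g holomorphic_on ball 0 1" and n: "n > 0" and z: "cmod \<zeta> < 1"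
  shows "\<exists>\<psi>. 0 \<le> \<psi> \<and> \<psi> \<le> 2 * pi / real n \<and>
    cmod (g 0) ^ n \<le> (\<Prod>j<n. cmod (g (cis (2 * pi * real j / real n) * (cis \<psi> * \<zeta>))))"
proof (cases "\<zeta> = 0")
  case True
  then show ?thesis using n by (intro exI[of _ 0]) auto
next
  case False
  define Q where "Q \<eta> = (\<Prod>j<n. g (cis (2 * pi * real j / real n) * \<eta>))" for \<eta>
  have Q: "Q holomorphic_on ball 0 1"
    unfolding Q_def
  proof (rule holomorphic_on_prod)
    fix j
    show "(\<lambda>\<eta>. g (cis (2 * pi * real j / real n) * \<eta>)) holomorphic_on ball 0 1"
      by (rule holomorphic_on_compose_gen[OF _ g, unfolded o_def])
         (auto intro!: holomorphic_intros simp: norm_mult)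
  qed
  define r where "r = cmod \<zeta>"
  have r: "0 < r" "r < 1" using False z by (auto simp: r_def)
  have "\<exists>\<eta>\<in>sphere 0 r. cmod (Q 0) \<le> cmod (Q \<eta>)"
  proof (rule ccontr)
    assume no: "\<not> ?thesis"
    have lt: "cmod (Q \<eta>) < cmod (Q 0)" if "\<eta> \<in> sphere 0 r" for \<eta> using no that by (meson not_le)
    have cont: "continuous_on (cball 0 r) Q"
      using r by (intro holomorphic_on_imp_continuous_on holomorphic_on_subset[OF Q]) auto
    have "\<exists>m\<in>sphere 0 r. \<forall>\<eta>\<in>sphere 0 r. cmod (Q \<eta>) \<le> cmod (Q m)"
    proof (rule continuous_attains_sup)
      show "sphere (0::complex) r \<noteq> {}" using r by simp
      show "continuous_on (sphere 0 r) (\<lambda>\<eta>. cmod (Q \<eta>))"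
        by (intro continuous_on_norm continuous_on_subset[OF cont]) auto
    qed simp
    then obtain m where m: "m \<in> sphere 0 r" "\<And>\<eta>. \<eta> \<in> sphere 0 r \<Longrightarrow> cmod (Q \<eta>) \<le> cmod (Q m)"
      by blast
    have "cmod (Q 0) \<le> cmod (Q m)"
    proof (rule maximum_modulus_frontier[of Q "cball 0 r"])
      show "Q holomorphic_on interior (cball 0 r)"
        using r by (intro holomorphic_on_subset[OF Q]) auto
    qed (use r cont m in auto)
    then show False using lt[OF m(1)] by simp
  qed
  then obtain \<eta> where \<eta>: "cmod \<eta> = r" "cmod (Q 0) \<le> cmod (Q \<eta>)" by auto
  define \<phi> where "\<phi> = Arg2pi (\<eta> / \<zeta>)"
  have \<phi>: "0 \<le> \<phi>" "\<phi> < 2 * pi" unfolding \<phi>_def using Arg2pi_ge_0 Arg2pi_lt_2pi by blast+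
  have "\<eta> / \<zeta> = of_real (cmod (\<eta> / \<zeta>)) * cis \<phi>"
    unfolding \<phi>_def cis_conv_exp by (rule Arg2pi_eq)
  moreover have "cmod (\<eta> / \<zeta>) = 1" using \<eta> r by (simp add: norm_divide r_def)
  ultimately have e: "\<eta> = cis \<phi> * \<zeta>" using False by (simp add: field_simps)
  \<comment> \<open>The multiple of \<open>2 \<pi> / n\<close> to be removed from the angle \<open>\<phi>\<close>.\<close>
  define l where "l = nat \<lfloor>\<phi> * real n / (2 * pi)\<rfloor>"
  define \<psi> where "\<psi> = \<phi> - 2 * pi * real l / real n"
  have fl: "real l \<le> \<phi> * real n / (2 * pi)" "\<phi> * real n / (2 * pi) \<le> real l + 1"
    using \<phi> unfolding l_def by (auto simp: of_nat_nat)
  have "2 * pi * real l / real n \<le> \<phi>" using fl(1) n by (simp add: field_simps)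
  then have p1: "0 \<le> \<psi>" by (simp add: \<psi>_def)
  have "\<phi> \<le> 2 * pi * (real l + 1) / real n" using fl(2) n by (simp add: field_simps)
  then have p2: "\<psi> \<le> 2 * pi / real n" by (simp add: \<psi>_def add_divide_distrib distrib_left)
  have "\<eta> = cis (2 * pi * real l / real n) * (cis \<psi> * \<zeta>)"
    unfolding e by (simp add: mult.assoc[symmetric] cis_mult \<psi>_def)
  then have "Q \<eta> = Q (cis \<psi> * \<zeta>)" using prod_roots_shift[OF n, of g l "cis \<psi> * \<zeta>"] by (simp add: Q_def)
  moreover have "cmod (Q 0) = cmod (g 0) ^ n" by (simp add: Q_def norm_power)
  ultimately have "cmod (g 0) ^ n \<le> cmod (Q (cis \<psi> * \<zeta>))" using \<eta> by simp
  then show ?thesis using p1 p2 by (auto simp: Q_def prod_norm[symmetric])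
qed

lemma cay_continuous: "continuous_on (ball 0 1) cay"
  unfolding cay_def by (auto intro!: continuous_intros)

text \<open>The integral over the disc is unchanged by rotations, so it equals the mean of its \<open>n\<close> rotated
  versions. Pointwise, that mean is nearly the mean of \<open>L\<close> over a regular \<open>n\<close>-gon chosen by
  \<open>rotated_product_large\<close>, which is at least \<open>ln \<bar>g 0\<bar>\<close>; the small angle costs at most \<open>\<epsilon>\<close> by uniform
  continuity.\<close>

lemma submean_i:
  fixes L :: "complex \<Rightarrow> real" and g :: "complex \<Rightarrow> complex"
  assumes L [measurable]: "L \<in> borel_measurable borel" and Lc: "continuous_on uhp L"
    and pos: "\<And>w. w \<in> hdisc \<i> \<Longrightarrow> 0 \<le> L w"
    and g: "g holomorphic_on ball 0 1" and le: "\<And>\<zeta>. cmod \<zeta> < 1 \<Longrightarrow> cmod (g \<zeta>) \<le> exp (L (cay \<zeta>))"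
  shows "ennreal (disc_area * ln (cmod (g 0))) \<le> (\<integral>\<^sup>+w. indicator (hdisc \<i>) w * ennreal (L w) \<partial>hyp)"
proof (cases "cmod (g 0) > 1")
  case False
  then have "ln (cmod (g 0)) \<le> 0" by (cases "g 0 = 0") auto
  then have "disc_area * ln (cmod (g 0)) \<le> 0" using disc_area_pos by (simp add: mult_nonneg_nonpos)
  then show ?thesis by (simp add: ennreal_neg)
next
  case True
  define I where "I = (\<integral>\<^sup>+w. indicator (hdisc \<i>) w * ennreal (L w) \<partial>hyp)"
  define l where "l = ln (cmod (g 0))"
  have l: "l > 0" using True by (simp add: l_def ln_gt_zero)
  have I_rot: "I = (\<integral>\<^sup>+w. indicator (hdisc \<i>) w * ennreal (L (moebius (rotation t) w)) \<partial>hyp)" for t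
    using hdisc_transport[of "\<lambda>w. ennreal (L w)" "rotation t" \<i>] rotation[of t] by (simp add: I_def)
  have eps: "ennreal (disc_area * (l - \<epsilon>)) \<le> I" if e: "\<epsilon> > 0" for \<epsilon>
  proof -
    define M where "M \<zeta> = L (cay \<zeta>)" for \<zeta>
    have "continuous_on (cball 0 (1/2)) M"
      unfolding M_def
      by (rule continuous_on_compose2[OF Lc continuous_on_subset[OF cay_continuous]]) (auto simp: cay_uhp simp del: uhp_iff)
    then have "uniformly_continuous_on (cball 0 (1/2)) M"
      by (intro compact_uniformly_continuous) auto
    then obtain d where d: "d > 0" "\<And>x y. x \<in> cball 0 (1/2) \<Longrightarrow> y \<in> cball 0 (1/2) \<Longrightarrow> dist x y < d \<Longrightarrow> dist (M x) (M y) < \<epsilon>"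
      using e unfolding uniformly_continuous_on_def by metis
    \<comment> \<open>Large enough for an angle of \<open>2 \<pi> / n\<close> to move points by less than the modulus of continuity \<open>d\<close>.\<close>
    obtain n where n2: "2 * pi / d < real n" using reals_Archimedean2 by blast
    moreover have "2 * pi / d > 0" using d(1) by simp
    ultimately have "real n > 0" by linarith
    then have n: "n > 0" "2 * pi / d < real n" using n2 by auto
    have key: "real n * (l - \<epsilon>) \<le> (\<Sum>j<n. L (moebius (rotation (pi * real j / real n)) w))" if w: "w \<in> hdisc \<i>" for w
    proof -
      have wu: "w \<in> uhp" using w hdisc_uhp by simp
      define \<zeta> where "\<zeta> = cay_inv w"
      define \<omega> where "\<omega> j = cis (2 * pi * real j / real n)" for j
      have z: "cmod \<zeta> < 1/2" using cay_inv_half[OF w] by (simp add: \<zeta>_def)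
      obtain \<psi> where \<psi>: "0 \<le> \<psi>" "\<psi> \<le> 2 * pi / real n" "cmod (g 0) ^ n \<le> (\<Prod>j<n. cmod (g (\<omega> j * (cis \<psi> * \<zeta>))))"
        using rotated_product_large[OF g n(1), of \<zeta>] z unfolding \<omega>_def by auto
      have "exp (real n * l) = cmod (g 0) ^ n"
      proof -
        have "exp l = cmod (g 0)" unfolding l_def using True by (intro exp_ln) linarith
        then show ?thesis by (simp add: exp_of_nat_mult)
      qed
      also have "\<dots> \<le> (\<Prod>j<n. exp (M (\<omega> j * (cis \<psi> * \<zeta>))))"
        by (rule order_trans[OF \<psi>(3)], rule prod_mono) (use z le in \<open>auto simp: M_def norm_mult \<omega>_def\<close>)
      also have "\<dots> = exp (\<Sum>j<n. M (\<omega> j * (cis \<psi> * \<zeta>)))" by (simp add: exp_sum)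
      finally have a: "real n * l \<le> (\<Sum>j<n. M (\<omega> j * (cis \<psi> * \<zeta>)))" by simp
      have b: "M (\<omega> j * (cis \<psi> * \<zeta>)) \<le> M (\<omega> j * \<zeta>) + \<epsilon>" for j
      proof -
        have "dist (\<omega> j * (cis \<psi> * \<zeta>)) (\<omega> j * \<zeta>) = cmod (\<omega> j * ((cis \<psi> - 1) * \<zeta>))"
          by (simp add: dist_norm algebra_simps)
        also have "\<dots> = cmod (cis \<psi> - 1) * cmod \<zeta>" by (simp add: norm_mult \<omega>_def)
        also have "\<dots> \<le> \<psi> * 1" using cis_diff_le[of \<psi>] \<psi>(1) z by (intro mult_mono) auto
        also have "\<dots> < d"
        proof -
          have "2 * pi / real n < d" using n d(1) by (simp add: field_simps)
          then show ?thesis using \<psi>(2) by simp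
        qed
        finally have "dist (M (\<omega> j * (cis \<psi> * \<zeta>))) (M (\<omega> j * \<zeta>)) < \<epsilon>"
          using z by (intro d(2)) (auto simp: norm_mult \<omega>_def)
        then show ?thesis by (simp add: dist_real_def)
      qed
      have "moebius (rotation (pi * real j / real n)) w = cay (\<omega> j * \<zeta>)" for j
        using moebius_rotation_cay[OF wu, of "pi * real j / real n"] by (simp add: \<omega>_def \<zeta>_def mult.assoc)
      then have "(\<Sum>j<n. L (moebius (rotation (pi * real j / real n)) w)) = (\<Sum>j<n. M (\<omega> j * \<zeta>))"
        by (simp add: M_def)
      moreover have "(\<Sum>j<n. M (\<omega> j * (cis \<psi> * \<zeta>))) \<le> (\<Sum>j<n. M (\<omega> j * \<zeta>) + \<epsilon>)"
        by (intro sum_mono b)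
      ultimately show ?thesis using a by (simp add: sum.distrib right_diff_distrib)
    qed
    have posr: "0 \<le> L (moebius (rotation t) w)" if "w \<in> hdisc \<i>" for w t
      using hdisc_moebius[of "rotation t" \<i> w] rotation[of t] that hdisc_uhp[OF that] by (intro pos) simp
    have "ennreal (real n) * ennreal (disc_area * (l - \<epsilon>)) = ennreal (real n * (l - \<epsilon>)) * emeasure hyp (hdisc \<i>)"
      unfolding emeasure_hdisc_i using disc_area_pos
      by (cases "l - \<epsilon> \<ge> 0") (auto simp: ennreal_mult[symmetric] mult_ac ennreal_neg mult_nonneg_nonpos)
    also have "\<dots> = (\<integral>\<^sup>+w. ennreal (real n * (l - \<epsilon>)) * indicator (hdisc \<i>) w \<partial>hyp)"
      by (subst nn_integral_cmult_indicator) auto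
    also have "\<dots> \<le> (\<integral>\<^sup>+w. (\<Sum>j<n. indicator (hdisc \<i>) w * ennreal (L (moebius (rotation (pi * real j / real n)) w))) \<partial>hyp)"
    proof (rule nn_integral_mono)
      fix w
      show "ennreal (real n * (l - \<epsilon>)) * indicator (hdisc \<i>) w \<le> (\<Sum>j<n. indicator (hdisc \<i>) w * ennreal (L (moebius (rotation (pi * real j / real n)) w)))"
        using key[of w] posr[of w] by (cases "w \<in> hdisc \<i>") (auto simp: sum_ennreal intro!: ennreal_leI)
    qed
    also have "\<dots> = (\<Sum>j<n. \<integral>\<^sup>+w. indicator (hdisc \<i>) w * ennreal (L (moebius (rotation (pi * real j / real n)) w)) \<partial>hyp)"
      by (rule nn_integral_sum) measurable
    also have "\<dots> = ennreal (real n) * I"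
      using I_rot by (simp add: ennreal_of_nat_eq_real_of_nat)
    finally show ?thesis
      using n(1) by (subst (asm) ennreal_mult_le_mult_iff) auto
  qed
  show ?thesis
  proof (cases "I = \<infinity>")
    case False
    then obtain r where r: "r \<ge> 0" "I = ennreal r" by (cases I) auto
    have "disc_area * l \<le> r"
    proof (rule ccontr)
      assume c: "\<not> ?thesis"
      define \<epsilon> where "\<epsilon> = (disc_area * l - r) / (2 * disc_area)"
      have "\<epsilon> > 0" using c disc_area_pos by (simp add: \<epsilon>_def)
      then have "disc_area * (l - \<epsilon>) \<le> r" using eps[of \<epsilon>] r by simp
      moreover have "disc_area * (l - \<epsilon>) = (disc_area * l + r) / 2"
        using disc_area_pos by (simp add: \<epsilon>_def field_simps)
      ultimately show False using c by simp
    qed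
    then show ?thesis unfolding I_def[symmetric] r l_def[symmetric] by (rule ennreal_leI)
  qed (simp add: I_def)
qed

text \<open>The function \<open>ln (max 1 \<bar>g\<bar>)\<close> lies below \<open>L\<close>, satisfies the mean value inequality with the same value at
  the centre, and is strictly smaller than \<open>L\<close> near the point \<open>cay \<xi>\<close>.\<close>

lemma submean_strict_i:
  fixes L :: "complex \<Rightarrow> real" and g :: "complex \<Rightarrow> complex"
  assumes L [measurable]: "L \<in> borel_measurable borel" and Lc: "continuous_on uhp L"
    and pos: "\<And>w. w \<in> hdisc \<i> \<Longrightarrow> 0 \<le> L w"
    and g: "g holomorphic_on ball 0 1" and le: "\<And>\<zeta>. cmod \<zeta> < 1 \<Longrightarrow> cmod (g \<zeta>) \<le> exp (L (cay \<zeta>))"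
    and centre: "cmod (g 0) = exp (L \<i>)"
    and strict: "5 * (cmod \<xi>)\<^sup>2 < 1" "max 1 (cmod (g \<xi>)) < exp (L (cay \<xi>))"
  shows "ennreal (disc_area * L \<i>) < (\<integral>\<^sup>+w. indicator (hdisc \<i>) w * ennreal (L w) \<partial>hyp)"
proof -
  define L' where "L' w = indicator uhp w *\<^sub>R ln (max 1 (cmod (g (cay_inv w))))" for w
  have civ: "cay_inv ` uhp \<subseteq> ball 0 1" using cay_inv_less by (auto simp del: uhp_iff)
  have cont: "continuous_on uhp (\<lambda>w. ln (max 1 (cmod (g (cay_inv w)))))"
  proof (intro continuous_on_ln continuous_on_max continuous_on_const continuous_on_norm)
    have "continuous_on uhp cay_inv"
      unfolding cay_inv_def using plus_i_nz by (auto intro!: continuous_intros simp del: uhp_iff)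
    then show "continuous_on uhp (\<lambda>w. g (cay_inv w))"
      using continuous_on_compose2[OF holomorphic_on_imp_continuous_on[OF g] _ civ] by blast
  qed auto
  have L'm [measurable]: "L' \<in> borel_measurable borel"
    unfolding L'_def by (rule borel_measurable_continuous_on_indicator[OF uhp_borel cont])
  have L'c: "continuous_on uhp L'"
    by (rule continuous_on_eq[OF cont]) (simp add: L'_def)
  have L'cay: "L' (cay \<zeta>) = ln (max 1 (cmod (g \<zeta>)))" if "cmod \<zeta> < 1" for \<zeta>
    using cay_uhp[OF that] cay_inv_cay[OF that] by (simp add: L'_def)
  have L'pos: "0 \<le> L' w" for w by (simp add: L'_def)
  have L'le: "L' w \<le> L w" if w: "w \<in> hdisc \<i>" for w
  proof -
    have wu: "w \<in> uhp" using w hdisc_uhp by simp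
    have "cmod (g (cay_inv w)) \<le> exp (L w)" using le[OF cay_inv_less[OF wu]] cay_cay_inv[OF wu] by simp
    moreover have "1 \<le> exp (L w)" using pos[OF w] by simp
    ultimately have "ln (max 1 (cmod (g (cay_inv w)))) \<le> ln (exp (L w))" by (intro ln_mono) auto
    then show ?thesis using wu by (simp add: L'_def)
  qed
  have 1: "ennreal (disc_area * L \<i>) \<le> (\<integral>\<^sup>+w. indicator (hdisc \<i>) w * ennreal (L' w) \<partial>hyp)"
  proof -
    have "cmod (g \<zeta>) \<le> exp (L' (cay \<zeta>))" if "cmod \<zeta> < 1" for \<zeta>
      using that by (simp add: L'cay)
    from submean_i[OF L'm L'c L'pos g this] show ?thesis using centre by simp
  qed
  have "cmod \<xi> * cmod \<xi> < 1 * 1" using strict(1) by (simp add: power2_eq_square)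
  then have z0: "cmod \<xi> < 1" by (metis mult_strict_mono' norm_ge_zero not_le_imp_less mult_mono zero_le_one not_less)
  define P where "P = {w \<in> hdisc \<i>. L' w < L w}"
  have "open P"
  proof -
    have "continuous_on (hdisc \<i>) (\<lambda>w. L w - L' w)"
      using hdisc_uhp by (intro continuous_on_diff continuous_on_subset[OF Lc] continuous_on_subset[OF L'c]) auto
    then have "open ((\<lambda>w. L w - L' w) -` {0<..} \<inter> hdisc \<i>)"
      using open_hdisc by (subst (asm) continuous_on_open_vimage) auto
    moreover have "(\<lambda>w. L w - L' w) -` {0<..} \<inter> hdisc \<i> = P" by (auto simp: P_def)
    ultimately show ?thesis by simp
  qed
  moreover have "cay \<xi> \<in> P"
  proof -
    have "ln (max 1 (cmod (g \<xi>))) < ln (exp (L (cay \<xi>)))" by (subst ln_less_cancel_iff) (use strict(2) in auto)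
    then show ?thesis using strict(1) z0 by (simp add: P_def hdisc_cay L'cay)
  qed
  moreover have "P \<subseteq> uhp" using hdisc_uhp by (auto simp: P_def)
  ultimately have Ppos: "emeasure hyp P > 0" by (intro emeasure_hyp_open_pos) auto
  have "P \<in> sets borel" using \<open>open P\<close> by simp
  define I where "I = (\<integral>\<^sup>+w. indicator (hdisc \<i>) w * ennreal (L' w) \<partial>hyp)"
  define R where "R = (\<integral>\<^sup>+w. indicator (hdisc \<i>) w * ennreal (L w - L' w) \<partial>hyp)"
  have IR: "(\<integral>\<^sup>+w. indicator (hdisc \<i>) w * ennreal (L w) \<partial>hyp) = I + R"
    unfolding I_def R_def
  proof (subst nn_integral_add[symmetric], simp, simp, rule nn_integral_cong)
    fix w
    show "indicator (hdisc \<i>) w * ennreal (L w) = indicator (hdisc \<i>) w * ennreal (L' w) + indicator (hdisc \<i>) w * ennreal (L w - L' w)"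
      using L'le[of w] L'pos[of w] by (cases "w \<in> hdisc \<i>") (auto simp: ennreal_plus[symmetric] simp del: ennreal_plus)
  qed
  have "R \<noteq> 0"
  proof
    assume "R = 0"
    then have "AE w in hyp. indicator (hdisc \<i>) w * ennreal (L w - L' w) = 0"
      unfolding R_def by (subst (asm) nn_integral_0_iff_AE) auto
    then have "AE w in hyp. w \<notin> P"
      by eventually_elim (auto simp: P_def indicator_def ennreal_eq_0_iff split: if_splits)
    then have "emeasure hyp P = 0"
      using \<open>P \<in> sets borel\<close> by (subst (asm) AE_iff_null_sets[symmetric]) (auto simp: null_sets_def)
    then show False using Ppos by simp
  qed
  then have "R > 0" by (simp add: zero_less_iff_neq_zero)
  show ?thesis
  proof (cases "I = \<infinity>")
    case True
    then show ?thesis unfolding IR by simp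
  next
    case False
    have "ennreal (disc_area * L \<i>) \<le> I" using 1 by (simp add: I_def)
    also have "I < I + R"
    proof -
      have "I + 0 < I + R" using False \<open>R > 0\<close> by (subst ennreal_add_left_cancel_less) auto
      then show ?thesis by simp
    qed
    finally show ?thesis unfolding IR .
  qed
qed

text \<open>The general centre is moved to \<open>\<i>\<close> by \<open>trans_to z\<close>.\<close>

lemma submean_strict:
  fixes L :: "complex \<Rightarrow> real" and g :: "complex \<Rightarrow> complex"
  assumes L [measurable]: "L \<in> borel_measurable borel" and Lc: "continuous_on uhp L" and z: "z \<in> uhp"
    and pos: "\<And>w. w \<in> hdisc z \<Longrightarrow> 0 \<le> L w"
    and g: "g holomorphic_on ball 0 1"
    and le: "\<And>\<zeta>. cmod \<zeta> < 1 \<Longrightarrow> cmod (g \<zeta>) \<le> exp (L (of_real (Im z) * cay \<zeta> + of_real (Re z)))"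
    and centre: "cmod (g 0) = exp (L z)"
    and strict: "5 * (cmod \<xi>)\<^sup>2 < 1" "max 1 (cmod (g \<xi>)) < exp (L (of_real (Im z) * cay \<xi> + of_real (Re z)))"
  shows "ennreal (disc_area * L z) < (\<integral>\<^sup>+w. indicator (hdisc z) w * ennreal (L w) \<partial>hyp)"
proof -
  define A where "A = trans_to z"
  have A: "det A = 1" "moebius A \<i> = z" "moebius A w = of_real (Im z) * w + of_real (Re z)" for w
    using trans_to[OF z] by (auto simp: A_def)
  have "ennreal (disc_area * L (moebius A \<i>)) < (\<integral>\<^sup>+w. indicator (hdisc \<i>) w * ennreal (L (moebius A w)) \<partial>hyp)"
  proof (rule submean_strict_i[where L = "\<lambda>w. L (moebius A w)" and g = g and \<xi> = \<xi>])
    show "continuous_on uhp (\<lambda>w. L (moebius A w))"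
    proof (rule continuous_on_compose2[OF Lc])
      show "continuous_on uhp (moebius A)" unfolding A(3)[abs_def] by (intro continuous_intros)
      show "moebius A ` uhp \<subseteq> uhp" using A(1) by auto
    qed
    show "0 \<le> L (moebius A w)" if "w \<in> hdisc \<i>" for w
      using hdisc_moebius[of A \<i> w] A that hdisc_uhp[OF that] by (intro pos) simp
    show "cmod (g \<zeta>) \<le> exp (L (moebius A (cay \<zeta>)))" if "cmod \<zeta> < 1" for \<zeta>
      unfolding A(3) by (rule le[OF that])
    show "max 1 (cmod (g \<xi>)) < exp (L (moebius A (cay \<xi>)))" unfolding A(3) by (rule strict(2))
  qed (use g centre A strict in \<open>auto\<close>)
  also have "\<dots> = (\<integral>\<^sup>+w. indicator (hdisc (moebius A \<i>)) w * ennreal (L w) \<partial>hyp)"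
    by (rule hdisc_transport[symmetric]) (use A in auto)
  finally show ?thesis unfolding A(2) .
qed

section \<open>A Liouville theorem on quotients of finite area\<close>

lemma indicator_hdisc_measurable [measurable (raw)]:
  assumes [measurable]: "f \<in> borel_measurable M" "g \<in> borel_measurable M"
  shows "(\<lambda>p. indicator (hdisc (g p)) (f p) :: ennreal) \<in> borel_measurable M"
proof -
  have "(\<lambda>p. indicator {q. fst q \<in> hdisc (snd q)} (f p, g p) :: ennreal) \<in> borel_measurable M"
    by measurable
  then show ?thesis by (simp add: indicator_def)
qed

context fuchsian
begin

text \<open>Up to bounded error, the distance of \<open>z\<close> from the orbit of \<open>\<i>\<close>, that is, the distance on the quotient.
  In the upper half plane the height is at least \<open>1\<close>; outside of it the maximum with \<open>0\<close> bounds the infimum.\<close>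

definition cusp_distance :: "complex \<Rightarrow> real" where
  "cusp_distance z = (INF A\<in>G. max 0 (ln (height (moebius A z))))"

lemma bdd_cusp: "bdd_below ((\<lambda>A. max 0 (ln (height (moebius A z)))) ` G)"
  by (intro bdd_belowI[of _ 0]) auto

lemma cusp_measurable [measurable]: "cusp_distance \<in> borel_measurable borel"
proof -
  have [measurable]: "(\<lambda>z. height (moebius A z)) \<in> borel_measurable borel" for A
    unfolding height_def by measurable
  show ?thesis unfolding cusp_distance_def[abs_def]
    by (intro borel_measurable_cINF_real countable_G) measurable
qed

lemma cusp_le:
  assumes "A \<in> G" "z \<in> uhp" shows "cusp_distance z \<le> ln (height (moebius A z))"
proof -
  have "cusp_distance z \<le> max 0 (ln (height (moebius A z)))"
    unfolding cusp_distance_def by (intro cINF_lower bdd_cusp assms)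
  then show ?thesis using height_ge(1)[of "moebius A z"] assms by simp
qed

lemma cusp_ge:
  assumes "z \<in> uhp" "\<And>A. A \<in> G \<Longrightarrow> c \<le> ln (height (moebius A z))"
  shows "c \<le> cusp_distance z"
  unfolding cusp_distance_def using one_G assms(2) by (intro cINF_greatest) (auto simp: le_max_iff_disj)

lemma cusp_invariant:
  assumes "A \<in> G" "z \<in> uhp" shows "cusp_distance (moebius A z) = cusp_distance z"
proof -
  have le: "cusp_distance (moebius A z) \<le> cusp_distance z" if A: "A \<in> G" and z: "z \<in> uhp" for A z
  proof (rule cusp_ge[OF z])
    fix B assume B: "B \<in> G"
    have "cusp_distance (moebius A z) \<le> ln (height (moebius (B ** matrix_inv A) (moebius A z)))"
      using A B z by (intro cusp_le mult_G inv_G) auto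
    also have "moebius (B ** matrix_inv A) (moebius A z) = moebius B z"
      using A B z matrix_inv_2[of A] moebius_inv[of A z] by (subst moebius_mult) auto
    finally show "cusp_distance (moebius A z) \<le> ln (height (moebius B z))" .
  qed
  have "cusp_distance z \<le> cusp_distance (moebius A z)"
    using le[of "matrix_inv A" "moebius A z"] inv_G[OF assms(1)] assms moebius_inv[of A z] by simp
  then show ?thesis using le[OF assms] by simp
qed

text \<open>The distance is Lipschitz at the scale of a disc because the height is.\<close>

lemma cusp_hdisc:
  assumes "w \<in> hdisc z" "z \<in> uhp" shows "cusp_distance w \<le> cusp_distance z + ln 24"
proof -
  have w: "w \<in> uhp" using assms hdisc_uhp by simp
  have "cusp_distance w - ln 24 \<le> cusp_distance z"
  proof (rule cusp_ge[OF assms(2)])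
    fix A assume A: "A \<in> G"
    have z': "moebius A z \<in> uhp" "moebius A w \<in> uhp" using A assms w by auto
    have "height (moebius A w) \<le> 24 * height (moebius A z)"
      using hdisc_moebius[of A z w] A assms w z' by (intro height_hdisc) auto
    then have "ln (height (moebius A w)) \<le> ln (24 * height (moebius A z))"
      using height_ge(1)[OF z'(2)] by (intro ln_mono) auto
    also have "\<dots> = ln 24 + ln (height (moebius A z))"
      using height_ge(1)[OF z'(1)] by (subst ln_mult) auto
    finally show "cusp_distance w - ln 24 \<le> ln (height (moebius A z))"
      using cusp_le[OF A w] by simp
  qed
  then show ?thesis by simp
qed

text \<open>Equal to \<open>1\<close> up to distance \<open>r\<close>, to \<open>0\<close> from distance \<open>2 r\<close> on, and linear in between.\<close>

definition cutoff :: "real \<Rightarrow> complex \<Rightarrow> real" where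
  "cutoff r z = max 0 (min 1 (2 - cusp_distance z / r))"

lemma cutoff_bounds: "0 \<le> cutoff r z" "cutoff r z \<le> 1"
  by (auto simp: cutoff_def)

lemma cutoff_measurable [measurable]: "cutoff r \<in> borel_measurable borel"
  unfolding cutoff_def[abs_def] by measurable

text \<open>Where the cutoff changes between neighbouring points its slope is \<open>1 / r\<close> while \<open>u\<close> is at most of order \<open>r\<close>,
  so the increase of the product is bounded independently of \<open>r\<close>; and it is confined to distances beyond
  \<open>r\<close>.\<close>

lemma cutoff_variation:
  assumes r: "r \<ge> 1" and z: "z \<in> uhp" and w: "w \<in> hdisc z"
    and u: "0 \<le> u" "u \<le> a + b * cusp_distance z" and ab: "a \<ge> 0" "b \<ge> 0"
  shows "cutoff r w * u \<le> cutoff r z * u + ln 24 * (a + b * (2 + ln 24)) * indicator {z. r < cusp_distance z} z"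
proof (cases "cutoff r w \<le> cutoff r z")
  case True
  have "0 \<le> a + b * (2 + ln 24)" using ab by (intro add_nonneg_nonneg mult_nonneg_nonneg) auto
  then have "0 \<le> ln 24 * (a + b * (2 + ln 24)) * indicator {z. r < cusp_distance z} z"
    by (intro mult_nonneg_nonneg) auto
  then show ?thesis using mult_right_mono[OF True u(1)] by linarith
next
  case False
  have wz: "cusp_distance z \<le> cusp_distance w + ln 24"
    using hdisc_sym[OF z w] hdisc_uhp[OF w] by (intro cusp_hdisc) auto
  have "cutoff r z < 1" using False cutoff_bounds[of r w] by simp
  then have "2 - cusp_distance z / r < 1" by (auto simp: cutoff_def max_def min_def split: if_splits)
  then have vz: "r < cusp_distance z" using r by (simp add: field_simps)
  have "0 < cutoff r w" using False cutoff_bounds[of r z] by simp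
  then have "cusp_distance w / r < 2" by (auto simp: cutoff_def max_def min_def split: if_splits)
  then have "cusp_distance w < 2 * r" using r by (simp add: field_simps)
  then have "cusp_distance z \<le> 2 * r + ln 24" using wz by simp
  then have "u \<le> a + b * (2 * r + ln 24)"
    using u(2) ab by (meson add_left_mono mult_left_mono order_trans)
  also have "\<dots> \<le> r * (a + b * (2 + ln 24))"
  proof -
    have "a \<le> r * a" using r ab mult_right_mono[of 1 r a] by simp
    moreover have "b * ln 24 \<le> r * (b * ln 24)" using r ab mult_right_mono[of 1 r "b * ln 24"] by simp
    ultimately show ?thesis by (simp add: algebra_simps)
  qed
  finally have u': "u \<le> r * (a + b * (2 + ln 24))" .
  have "cusp_distance z / r - cusp_distance w / r = (cusp_distance z - cusp_distance w) / r"
    by (simp add: diff_divide_distrib)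
  also have "\<dots> \<le> ln 24 / r" using wz r by (intro divide_right_mono) auto
  finally have ratio: "cusp_distance z / r - cusp_distance w / r \<le> ln 24 / r" .
  have "cutoff r w - cutoff r z \<le> ln 24 / r"
  proof -
    have aux: "max 0 (min 1 (2 - b)) - max 0 (min 1 (2 - a)) \<le> d" if "a - b \<le> d" "0 \<le> d" for a b d :: real
      using that by (auto simp: max_def min_def)
    show ?thesis unfolding cutoff_def by (rule aux[OF ratio]) (use r in simp)
  qed
  then have "(cutoff r w - cutoff r z) * u \<le> (ln 24 / r) * (r * (a + b * (2 + ln 24)))"
    using u' u(1) r by (intro mult_mono) auto
  also have "\<dots> = ln 24 * (a + b * (2 + ln 24))" using r by simp
  finally show ?thesis using vz by (simp add: algebra_simps)
qed

text \<open>These sets decrease to the empty set within a set of finite area.\<close>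

lemma cusp_tail:
  "(\<lambda>n::nat. emeasure hyp (fund \<inter> {z. real n < cusp_distance z})) \<longlonglongrightarrow> 0"
proof -
  have "(\<lambda>n::nat. emeasure hyp (fund \<inter> {z. real n < cusp_distance z})) \<longlonglongrightarrow> emeasure hyp (\<Inter>n. fund \<inter> {z. real n < cusp_distance z})"
  proof (rule Lim_emeasure_decseq)
    show "range (\<lambda>n. fund \<inter> {z. real n < cusp_distance z}) \<subseteq> sets hyp" by (auto intro!: sets.Int)
    show "decseq (\<lambda>n. fund \<inter> {z. real n < cusp_distance z})" by (auto simp: decseq_def)
    fix n
    have "emeasure hyp (fund \<inter> {z. real n < cusp_distance z}) \<le> emeasure hyp fund" by (intro emeasure_mono) auto
    then show "emeasure hyp (fund \<inter> {z. real n < cusp_distance z}) \<noteq> \<infinity>" using fund_area by (auto simp: top_unique)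
  qed
  moreover have "(\<Inter>n::nat. fund \<inter> {z. real n < cusp_distance z}) = {}"
  proof (intro equalityI subsetI)
    fix z assume z: "z \<in> (\<Inter>n::nat. fund \<inter> {z. real n < cusp_distance z})"
    obtain n :: nat where "cusp_distance z \<le> real n" using real_arch_simple by blast
    then show "z \<in> {}" using z by (auto simp: not_less[symmetric])
  qed simp
  ultimately show ?thesis by simp
qed

text \<open>Let \<open>P u\<close> be the integral of \<open>u\<close> over the disc and \<open>e = P u - \<bar>disc\<bar> u > 0\<close>. By symmetry of \<open>P\<close>, the integral
  of \<open>cutoff * P u\<close> over the quotient is that of \<open>P cutoff * u\<close>, which differs from that of
  \<open>\<bar>disc\<bar> cutoff * u\<close> by at most a constant times the area beyond distance \<open>r\<close>. So the integral of
  \<open>cutoff * e\<close> tends to \<open>0\<close> as \<open>r \<rightarrow> \<infinity>\<close>, and \<open>e\<close> vanishes almost everywhere, against its positivity. The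
  cutoff makes the integrals that are subtracted finite.\<close>

lemma liouville:
  assumes um [measurable]: "u \<in> borel_measurable borel"
    and pos: "\<And>z. z \<in> uhp \<Longrightarrow> 0 \<le> u z"
    and inv: "\<And>A z. A \<in> G \<Longrightarrow> z \<in> uhp \<Longrightarrow> u (moebius A z) = u z"
    and growth: "\<And>z. z \<in> uhp \<Longrightarrow> u z \<le> a + b * ln (height z)" and ab: "a \<ge> 0" "b \<ge> 0"
    and sub: "\<And>z. z \<in> uhp \<Longrightarrow> ennreal (disc_area * u z) < (\<integral>\<^sup>+w. indicator (hdisc z) w * ennreal (u w) \<partial>hyp)"
  shows False
proof -
  have growth': "u z \<le> a + b * cusp_distance z" if z: "z \<in> uhp" for z
  proof (cases "b = 0")
    case True
    then show ?thesis using growth[OF z] by simp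
  next
    case False
    have "(u z - a) / b \<le> cusp_distance z"
    proof (rule cusp_ge[OF z])
      fix A assume A: "A \<in> G"
      have "u z \<le> a + b * ln (height (moebius A z))"
        using growth[of "moebius A z"] inv[OF A z] A z by simp
      then show "(u z - a) / b \<le> ln (height (moebius A z))" using False ab by (simp add: field_simps)
    qed
    then show ?thesis using False ab by (simp add: field_simps)
  qed
  define Pu where "Pu z = (\<integral>\<^sup>+w. indicator (hdisc z) w * ennreal (u w) \<partial>hyp)" for z
  have Pm [measurable]: "Pu \<in> borel_measurable borel" unfolding Pu_def by measurable
  define e where "e z = Pu z - ennreal (disc_area * u z)" for z
  have [measurable]: "e \<in> borel_measurable borel" unfolding e_def by measurable
  have Pe: "Pu z = ennreal (disc_area * u z) + e z" and epos: "e z > 0" if "z \<in> uhp" for z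
    using sub[OF that] unfolding e_def Pu_def[symmetric]
    by (auto simp: diff_gr0_ennreal diff_add_cancel_ennreal add.commute[of "ennreal _"] less_imp_le)
  define C where "C = ln 24 * (a + b * (2 + ln 24))"
  have C: "C \<ge> 0" using ab by (simp add: C_def)
  have bound: "(\<integral>\<^sup>+z. indicator fund z * (ennreal (cutoff r z) * e z) \<partial>hyp)
      \<le> ennreal (disc_area * C) * emeasure hyp (fund \<inter> {z. r < cusp_distance z})" if r: "r \<ge> 1" for r
  proof -
    define I where "I = (\<integral>\<^sup>+z. indicator fund z * ennreal (cutoff r z * (disc_area * u z)) \<partial>hyp)"
    have "I \<le> (\<integral>\<^sup>+z. ennreal (disc_area * (a + b * (2 * r))) * indicator fund z \<partial>hyp)"
      unfolding I_def
    proof (rule nn_integral_mono)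
      fix z
      show "indicator fund z * ennreal (cutoff r z * (disc_area * u z)) \<le> ennreal (disc_area * (a + b * (2 * r))) * indicator fund z"
      proof (cases "z \<in> fund")
        case True
        then have z: "z \<in> uhp" using fund_uhp by blast
        have "cutoff r z * (disc_area * u z) \<le> disc_area * (a + b * (2 * r))"
        proof (cases "cusp_distance z \<le> 2 * r")
          case True
          then have "u z \<le> a + b * (2 * r)"
            using growth'[OF z] ab by (meson add_left_mono mult_left_mono order_trans)
          then have "1 * (disc_area * u z) \<le> disc_area * (a + b * (2 * r))" using disc_area_pos by simp
          moreover have "cutoff r z * (disc_area * u z) \<le> 1 * (disc_area * u z)"
            using cutoff_bounds[of r z] pos[OF z] disc_area_pos by (intro mult_right_mono) auto
          ultimately show ?thesis by linarith
        next
          case False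
          then have "2 - cusp_distance z / r < 0" using r by (simp add: field_simps)
          then have "cutoff r z = 0" by (simp add: cutoff_def)
          then show ?thesis using disc_area_pos ab r by simp
        qed
        then show ?thesis using True by (simp add: ennreal_leI)
      qed simp
    qed
    also have "\<dots> < \<infinity>" using fund_area by (subst nn_integral_cmult_indicator) (auto simp: ennreal_mult_less_top)
    finally have Ifin: "I < \<infinity>" .
    have split: "(\<integral>\<^sup>+z. indicator fund z * (ennreal (cutoff r z) * Pu z) \<partial>hyp) = I + (\<integral>\<^sup>+z. indicator fund z * (ennreal (cutoff r z) * e z) \<partial>hyp)"
      unfolding I_def
    proof (subst nn_integral_add[symmetric], simp, simp, rule nn_integral_cong)
      fix z
      show "indicator fund z * (ennreal (cutoff r z) * Pu z) = indicator fund z * ennreal (cutoff r z * (disc_area * u z)) + indicator fund z * (ennreal (cutoff r z) * e z)"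
      proof (cases "z \<in> fund")
        case True
        then have z: "z \<in> uhp" using fund_uhp by blast
        show ?thesis using Pe[OF z] True pos[OF z] disc_area_pos cutoff_bounds[of r z]
          by (simp add: distrib_left ennreal_mult)
      qed simp
    qed
    define K where "K z w = ennreal (cutoff r z) * (indicator (hdisc z) w * ennreal (u w))" for z w
    have "(\<integral>\<^sup>+z. indicator fund z * (ennreal (cutoff r z) * Pu z) \<partial>hyp) = (\<integral>\<^sup>+z. indicator fund z * (\<integral>\<^sup>+w. K z w \<partial>hyp) \<partial>hyp)"
      unfolding Pu_def K_def by (subst nn_integral_cmult[symmetric]) auto
    also have "\<dots> = (\<integral>\<^sup>+z. indicator fund z * (\<integral>\<^sup>+w. K w z \<partial>hyp) \<partial>hyp)"
    proof (rule fund_swap)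
      show "case_prod K \<in> borel_measurable (borel \<Otimes>\<^sub>M borel)" unfolding K_def by measurable
      fix A z w assume "A \<in> G" "z \<in> uhp" "w \<in> uhp"
      then show "K (moebius A z) (moebius A w) = K z w"
        using hdisc_moebius[of A z w] inv[of A w] cusp_invariant[of A z]
        by (simp add: K_def cutoff_def indicator_def)
    qed
    also have "\<dots> \<le> (\<integral>\<^sup>+z. indicator fund z * (\<integral>\<^sup>+w. ennreal (cutoff r z * u z + C * indicator {z. r < cusp_distance z} z) * indicator (hdisc z) w \<partial>hyp) \<partial>hyp)"
    proof (rule nn_integral_mono)
      fix z
      show "indicator fund z * (\<integral>\<^sup>+w. K w z \<partial>hyp) \<le> indicator fund z * (\<integral>\<^sup>+w. ennreal (cutoff r z * u z + C * indicator {z. r < cusp_distance z} z) * indicator (hdisc z) w \<partial>hyp)"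
      proof (cases "z \<in> fund")
        case True
        then have z: "z \<in> uhp" using fund_uhp by blast
        have "(\<integral>\<^sup>+w. K w z \<partial>hyp) \<le> (\<integral>\<^sup>+w. ennreal (cutoff r z * u z + C * indicator {z. r < cusp_distance z} z) * indicator (hdisc z) w \<partial>hyp)"
        proof (rule nn_integral_mono_AE, rule AE_mp[OF AE_hyp_uhp], rule AE_I2, rule impI)
          fix w assume wu: "w \<in> uhp"
          show "K w z \<le> ennreal (cutoff r z * u z + C * indicator {z. r < cusp_distance z} z) * indicator (hdisc z) w"
          proof (cases "w \<in> hdisc z")
            case True
            have "cutoff r w * u z \<le> cutoff r z * u z + C * indicator {z. r < cusp_distance z} z"
              unfolding C_def using cutoff_variation[OF r z True pos[OF z] growth'[OF z] ab] .
            then show ?thesis using True hdisc_sym[OF z True] cutoff_bounds[of r w] pos[OF z]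
              by (simp add: K_def ennreal_mult[symmetric] ennreal_leI)
          next
            case False
            then have "z \<notin> hdisc w" using hdisc_sym[OF wu, of z] by blast
            then show ?thesis by (simp add: K_def)
          qed
        qed
        then show ?thesis using True by simp
      qed simp
    qed
    also have "\<dots> = (\<integral>\<^sup>+z. indicator fund z * ennreal (cutoff r z * (disc_area * u z)) + ennreal (disc_area * C) * indicator (fund \<inter> {z. r < cusp_distance z}) z \<partial>hyp)"
    proof (rule nn_integral_cong)
      fix z
      show "indicator fund z * (\<integral>\<^sup>+w. ennreal (cutoff r z * u z + C * indicator {z. r < cusp_distance z} z) * indicator (hdisc z) w \<partial>hyp)
        = indicator fund z * ennreal (cutoff r z * (disc_area * u z)) + ennreal (disc_area * C) * indicator (fund \<inter> {z. r < cusp_distance z}) z"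
      proof (cases "z \<in> fund")
        case True
        then have z: "z \<in> uhp" using fund_uhp by blast
        have "(\<integral>\<^sup>+w. ennreal (cutoff r z * u z + C * indicator {z. r < cusp_distance z} z) * indicator (hdisc z) w \<partial>hyp)
          = ennreal (cutoff r z * u z + C * indicator {z. r < cusp_distance z} z) * ennreal disc_area"
          using emeasure_hdisc[OF z] by (subst nn_integral_cmult_indicator) auto
        also have "\<dots> = ennreal ((cutoff r z * u z + C * indicator {z. r < cusp_distance z} z) * disc_area)"
          using disc_area_pos by (subst ennreal_mult'') auto
        also have "(cutoff r z * u z + C * indicator {z. r < cusp_distance z} z) * disc_area = cutoff r z * (disc_area * u z) + disc_area * C * indicator {z. r < cusp_distance z} z"
          by (simp add: algebra_simps)
        also have "ennreal \<dots> = ennreal (cutoff r z * (disc_area * u z)) + ennreal (disc_area * C * indicator {z. r < cusp_distance z} z)"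
          using cutoff_bounds[of r z] pos[OF z] disc_area_pos C by (intro ennreal_plus) auto
        finally show ?thesis using True by (auto simp: indicator_def)
      qed simp
    qed
    also have "\<dots> = I + ennreal (disc_area * C) * emeasure hyp (fund \<inter> {z. r < cusp_distance z})"
    proof -
      define S where "S = fund \<inter> {z. r < cusp_distance z}"
      have [measurable]: "S \<in> sets borel" unfolding S_def by (intro sets.Int) auto
      have "(\<integral>\<^sup>+z. ennreal (disc_area * C) * indicator S z \<partial>hyp) = ennreal (disc_area * C) * emeasure hyp S"
        by (rule nn_integral_cmult_indicator) simp
      then show ?thesis unfolding I_def S_def[symmetric] by (subst nn_integral_add) auto
    qed
    finally have "I + (\<integral>\<^sup>+z. indicator fund z * (ennreal (cutoff r z) * e z) \<partial>hyp) \<le> I + ennreal (disc_area * C) * emeasure hyp (fund \<inter> {z. r < cusp_distance z})"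
      unfolding split .
    then show ?thesis using Ifin by (subst (asm) ennreal_add_left_cancel_le) auto
  qed
  have null: "emeasure hyp (fund \<inter> {z. cusp_distance z \<le> real R}) = 0" for R :: nat
  proof -
    define J where "J = (\<integral>\<^sup>+z. indicator (fund \<inter> {z. cusp_distance z \<le> real R}) z * e z \<partial>hyp)"
    have le: "J \<le> ennreal (disc_area * C) * emeasure hyp (fund \<inter> {z. real n < cusp_distance z})" if n: "n \<ge> Suc R" for n
    proof -
      have "J \<le> (\<integral>\<^sup>+z. indicator fund z * (ennreal (cutoff (real n) z) * e z) \<partial>hyp)"
        unfolding J_def
      proof (rule nn_integral_mono)
        fix z
        show "indicator (fund \<inter> {z. cusp_distance z \<le> real R}) z * e z \<le> indicator fund z * (ennreal (cutoff (real n) z) * e z)"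
        proof (cases "z \<in> fund \<inter> {z. cusp_distance z \<le> real R}")
          case True
          then have "cusp_distance z \<le> real n" using n by auto
          then have "cusp_distance z / real n \<le> 1" using n by (simp add: field_simps)
          then have "cutoff (real n) z = 1" by (simp add: cutoff_def)
          then show ?thesis using True by simp
        qed simp
      qed
      also have "\<dots> \<le> ennreal (disc_area * C) * emeasure hyp (fund \<inter> {z. real n < cusp_distance z})"
        using n by (intro bound) simp
      finally show ?thesis .
    qed
    have "(\<lambda>n. ennreal (disc_area * C) * emeasure hyp (fund \<inter> {z. real n < cusp_distance z})) \<longlonglongrightarrow> ennreal (disc_area * C) * 0"
      by (intro ennreal_tendsto_cmult cusp_tail) simp
    then have "J \<le> ennreal (disc_area * C) * 0"
      by (rule LIMSEQ_le_const) (use le in blast)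
    then have "J = 0" by simp
    then have "AE z in hyp. indicator (fund \<inter> {z. cusp_distance z \<le> real R}) z * e z = 0"
      unfolding J_def by (subst (asm) nn_integral_0_iff_AE) auto
    then have "AE z in hyp. z \<notin> fund \<inter> {z. cusp_distance z \<le> real R}"
    proof eventually_elim
      fix z assume 0: "indicator (fund \<inter> {z. cusp_distance z \<le> real R}) z * e z = 0"
      show "z \<notin> fund \<inter> {z. cusp_distance z \<le> real R}"
      proof
        assume z: "z \<in> fund \<inter> {z. cusp_distance z \<le> real R}"
        then have "e z = 0" using 0 by simp
        then show False using epos[of z] z fund_uhp by auto
      qed
    qed
    then show ?thesis
      by (subst (asm) AE_iff_null_sets[symmetric]) (auto simp: null_sets_def intro!: sets.Int)
  qed
  have "fund = (\<Union>R::nat. fund \<inter> {z. cusp_distance z \<le> real R})"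
    using real_arch_simple by auto
  moreover have "emeasure hyp (\<Union>R::nat. fund \<inter> {z. cusp_distance z \<le> real R}) = 0"
    using null by (intro emeasure_UN_eq_0) (auto intro!: sets.Int)
  ultimately show False using fund_pos by simp
qed

lemma on_uhp_measurable:
  assumes "on_uhp f" "continuous_on uhp f" shows "f \<in> borel_measurable borel"
proof -
  have "f = (\<lambda>z. indicator uhp z *\<^sub>R f z)" using assms(1) by (auto simp: on_uhp_def indicator_def fun_eq_iff)
  moreover have "(\<lambda>z. indicator uhp z *\<^sub>R f z) \<in> borel_measurable borel"
    by (rule borel_measurable_continuous_on_indicator[OF uhp_borel assms(2)])
  ultimately show ?thesis by simp
qed

lemma Im_cay_affine:
  assumes "cmod \<zeta> < 1" "Im z > 0"
  shows "Im (of_real (Im z) * cay \<zeta> + of_real (Re z)) = Im z * (1 - (cmod \<zeta>)\<^sup>2) / (cmod (1 - \<zeta>))\<^sup>2"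
  using assms by (simp add: Im_cay)

text \<open>A form \<open>f\<close> of weight \<open>- m\<close> in the disc model centred at \<open>z\<close>: its invariant norm \<open>\<bar>f\<bar> y powr (- m / 2)\<close> becomes
  \<open>\<bar>disc_form m f z \<zeta>\<bar> (1 - \<bar>\<zeta>\<bar>\<^sup>2) powr (- m / 2)\<close>.\<close>

definition disc_form :: "nat \<Rightarrow> (complex \<Rightarrow> complex) \<Rightarrow> complex \<Rightarrow> complex \<Rightarrow> complex" where
  "disc_form m f z \<zeta> = f (of_real (Im z) * cay \<zeta> + of_real (Re z)) * (1 - \<zeta>) ^ m / of_real (sqrt (Im z)) ^ m"

lemma disc_form_norm:
  assumes "cmod \<zeta> < 1" "Im z > 0"
  shows "(cmod (f (of_real (Im z) * cay \<zeta> + of_real (Re z))))\<^sup>2 / Im (of_real (Im z) * cay \<zeta> + of_real (Re z)) ^ m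
    = (cmod (disc_form m f z \<zeta>))\<^sup>2 / (1 - (cmod \<zeta>)\<^sup>2) ^ m"
proof -
  have 1: "1 - \<zeta> \<noteq> 0" using one_minus_nz[OF assms(1)] .
  have "(cmod \<zeta>)\<^sup>2 < 1" using assms by (simp add: abs_square_less_1)
  moreover have "(sqrt (Im z) ^ m)\<^sup>2 = Im z ^ m"
    using assms by (simp add: power_mult[symmetric] mult.commute[of m]) (simp add: power_mult)
  moreover have "(cmod (1 - \<zeta>) ^ m)\<^sup>2 = ((cmod (1 - \<zeta>))\<^sup>2) ^ m"
    by (simp add: power_mult[symmetric] mult.commute[of m])
  ultimately have "(cmod (disc_form m f z \<zeta>))\<^sup>2 = (cmod (f (of_real (Im z) * cay \<zeta> + of_real (Re z))))\<^sup>2 * ((cmod (1 - \<zeta>))\<^sup>2) ^ m / Im z ^ m"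
    unfolding disc_form_def norm_mult norm_divide norm_power power_divide power_mult_distrib norm_of_real
    using assms by simp
  moreover have "(Im z * (1 - (cmod \<zeta>)\<^sup>2) / (cmod (1 - \<zeta>))\<^sup>2) ^ m = Im z ^ m * (1 - (cmod \<zeta>)\<^sup>2) ^ m / ((cmod (1 - \<zeta>))\<^sup>2) ^ m"
    by (simp only: power_mult_distrib power_divide)
  ultimately show ?thesis unfolding Im_cay_affine[OF assms] by (simp add: mult.assoc)
qed

lemma disc_form_holomorphic:
  assumes "f holomorphic_on uhp" "Im z > 0"
  shows "disc_form m f z holomorphic_on ball 0 1"
proof -
  have "(\<lambda>\<zeta>. f (of_real (Im z) * cay \<zeta> + of_real (Re z))) holomorphic_on ball 0 1"
  proof (rule holomorphic_on_compose_gen[OF _ assms(1), unfolded o_def])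
    show "(\<lambda>\<zeta>. of_real (Im z) * cay \<zeta> + of_real (Re z)) holomorphic_on ball 0 1"
      unfolding cay_def using one_minus_nz by (intro holomorphic_intros) auto
    show "(\<lambda>\<zeta>. of_real (Im z) * cay \<zeta> + of_real (Re z)) ` ball 0 1 \<subseteq> uhp"
      using cay_uhp assms by auto
  qed
  then show ?thesis unfolding disc_form_def[abs_def] using assms(2)
    by (intro holomorphic_intros) auto
qed

text \<open>The Cayley transform followed by the affine map \<open>trans_to z\<close> parametrises the disc about \<open>z\<close>.\<close>

lemma hdisc_param:
  assumes "w \<in> hdisc z" "z \<in> uhp"
  obtains \<xi> where "5 * (cmod \<xi>)\<^sup>2 < 1" "w = of_real (Im z) * cay \<xi> + of_real (Re z)" "cmod \<xi> < 1"
proof -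
  have w: "w \<in> uhp" using assms hdisc_uhp by simp
  define A where "A = trans_to z"
  have A: "det A = 1" "moebius A \<i> = z" "moebius A v = of_real (Im z) * v + of_real (Re z)" for v
    using trans_to[OF assms(2)] by (auto simp: A_def)
  define v where "v = moebius (matrix_inv A) w"
  have v: "v \<in> uhp" "moebius A v = w" using moebius_inv(1)[OF A(1) w] matrix_inv_2[OF A(1)] w by (auto simp: v_def)
  have "v \<in> hdisc \<i>" using hdisc_moebius[OF A(1), of \<i> v] v A(2) assms by simp
  then have "5 * (cmod (cay_inv v))\<^sup>2 < 1"
    using hdisc_cay[OF cay_inv_less[OF v(1)]] cay_cay_inv[OF v(1)] by simp
  moreover have "w = of_real (Im z) * cay (cay_inv v) + of_real (Re z)"
    using v A(3)[of v] cay_cay_inv[OF v(1)] by simp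
  ultimately show ?thesis using that cay_inv_less[OF v(1)] by blast
qed

text \<open>Lagrange's identity, the Cauchy-Schwarz inequality for \<open>(1, s)\<close> and \<open>(1, t)\<close> with its defect.\<close>

lemma cauchy_schwarz_2:
  "(1 + (cmod s)\<^sup>2) * (1 + (cmod t)\<^sup>2) = (cmod (1 + cnj s * t))\<^sup>2 + (cmod (t - s))\<^sup>2"
  by (simp add: cmod_power2) (simp add: power2_eq_square algebra_simps)

text \<open>Let \<open>h\<close> be the form in the disc model and \<open>s = h 0\<close>. By the Cauchy-Schwarz inequality
  \<open>\<bar>1 + cnj s h\<bar>\<^sup>2 \<le> (1 + \<bar>s\<bar>\<^sup>2) (1 + \<bar>h\<bar>\<^sup>2)\<close>, the holomorphic function
  \<open>g = (1 + cnj s h)\<^sup>2 / (1 + \<bar>s\<bar>\<^sup>2)\<close> satisfies \<open>\<bar>g\<bar> \<le> 1 + \<bar>h\<bar>\<^sup>2 \<le> exp u\<close>, with equality at the centre; so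
  \<open>submean_strict\<close> applies once the inequality is strict somewhere. For \<open>m > 0\<close> the second step is strict
  off the centre wherever \<open>h \<noteq> 0\<close>. For \<open>m = 0\<close> equality everywhere forces \<open>h\<close> into the two values \<open>0\<close> and \<open>s\<close>,
  hence \<open>f\<close> to be constant.\<close>

lemma log_norm_strictly_subharmonic:
  assumes f: "f holomorphic_on uhp" "on_uhp f" and z: "z \<in> uhp"
    and nz: "\<exists>w\<in>uhp. f w \<noteq> 0" and nc: "m = 0 \<Longrightarrow> \<not> (\<exists>c. \<forall>w\<in>uhp. f w = c)"
  defines "u \<equiv> \<lambda>w. ln (1 + (cmod (f w))\<^sup>2 / Im w ^ m)"
  shows "ennreal (disc_area * u z) < (\<integral>\<^sup>+w. indicator (hdisc z) w * ennreal (u w) \<partial>hyp)"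
proof -
  have fc: "continuous_on uhp f" using f(1) by (rule holomorphic_on_imp_continuous_on)
  have [measurable]: "f \<in> borel_measurable borel" using on_uhp_measurable f(2) fc by blast
  have um: "u \<in> borel_measurable borel" unfolding u_def by measurable
  have arg: "0 \<le> (cmod (f w))\<^sup>2 / Im w ^ m" if "w \<in> uhp" for w using that by simp
  have arg1: "0 < 1 + (cmod (f w))\<^sup>2 / Im w ^ m" if "w \<in> uhp" for w using arg[OF that] by linarith
  have uc: "continuous_on uhp u"
    unfolding u_def
  proof (intro continuous_intros fc ballI)
    fix w assume "w \<in> uhp"
    then show "Im w ^ m \<noteq> 0" by simp
    show "1 + (cmod (f w))\<^sup>2 / Im w ^ m \<noteq> 0" using arg1[OF \<open>w \<in> uhp\<close>] by linarith
  qed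
  have upos: "0 \<le> u w" if "w \<in> uhp" for w
    unfolding u_def using arg[OF that] by (intro ln_ge_zero) linarith
  have y: "Im z > 0" using z by simp
  define h where "h = disc_form m f z"
  define s where "s = h 0"
  define g where "g \<zeta> = (1 + cnj s * h \<zeta>)\<^sup>2 / of_real (1 + (cmod s)\<^sup>2)" for \<zeta>
  have s1: "1 + (cmod s)\<^sup>2 > 0" by (smt (verit) zero_le_power2)
  have eu: "exp (u (of_real (Im z) * cay \<zeta> + of_real (Re z))) = 1 + (cmod (h \<zeta>))\<^sup>2 / (1 - (cmod \<zeta>)\<^sup>2) ^ m" if \<zeta>: "cmod \<zeta> < 1" for \<zeta>
  proof -
    have "of_real (Im z) * cay \<zeta> + of_real (Re z) \<in> uhp" using cay_uhp[OF \<zeta>] y by simp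
    from arg1[OF this] show ?thesis unfolding u_def h_def disc_form_norm[OF \<zeta> y, symmetric] by simp
  qed
  have gn: "cmod (g \<zeta>) = (cmod (1 + cnj s * h \<zeta>))\<^sup>2 / (1 + (cmod s)\<^sup>2)" for \<zeta>
    unfolding g_def norm_divide norm_power norm_of_real using s1 by simp
  have gle: "cmod (g \<zeta>) \<le> 1 + (cmod (h \<zeta>))\<^sup>2" for \<zeta>
    unfolding gn using s1 cauchy_schwarz_2[of s "h \<zeta>"] by (simp add: pos_divide_le_eq mult.commute)
  have dle: "(cmod (h \<zeta>))\<^sup>2 \<le> (cmod (h \<zeta>))\<^sup>2 / (1 - (cmod \<zeta>)\<^sup>2) ^ m" if "cmod \<zeta> < 1" for \<zeta>
  proof -
    have "(cmod \<zeta>)\<^sup>2 < 1" using that by (simp add: abs_square_less_1)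
    then have "0 < (1 - (cmod \<zeta>)\<^sup>2) ^ m" "(1 - (cmod \<zeta>)\<^sup>2) ^ m \<le> 1" by (auto intro!: power_le_one)
    then show ?thesis using mult_left_mono[of "(1 - (cmod \<zeta>)\<^sup>2) ^ m" 1 "(cmod (h \<zeta>))\<^sup>2"] by (simp add: pos_le_divide_eq)
  qed
  have "\<exists>\<xi>. cmod \<xi> < 1 \<and> 5 * (cmod \<xi>)\<^sup>2 < 1 \<and> max 1 (cmod (g \<xi>)) < exp (u (of_real (Im z) * cay \<xi> + of_real (Re z)))"
  proof (rule ccontr)
    assume no: "\<not> ?thesis"
    have no': "1 + (cmod (h \<xi>))\<^sup>2 / (1 - (cmod \<xi>)\<^sup>2) ^ m \<le> max 1 (cmod (g \<xi>))" if "cmod \<xi> < 1" "5 * (cmod \<xi>)\<^sup>2 < 1" for \<xi>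
      using no that eu[OF that(1)] by (metis not_le)
    obtain e where e: "e > 0" "ball z e \<subseteq> hdisc z"
      using open_hdisc[of z] z unfolding open_contains_ball by (auto simp: hdisc_def)
    have eu: "ball z e \<subseteq> uhp" using e hdisc_uhp by auto
    show False
    proof (cases "m = 0")
      case True
      have two: "f w \<in> {0, s}" if w: "w \<in> ball z e" for w
      proof -
        obtain \<xi> where \<xi>: "5 * (cmod \<xi>)\<^sup>2 < 1" "w = of_real (Im z) * cay \<xi> + of_real (Re z)" "cmod \<xi> < 1"
          using hdisc_param[of w z] w e z by blast
        have fw: "h \<xi> = f w" unfolding h_def disc_form_def \<xi>(2) using True by simp
        have le: "1 + (cmod (h \<xi>))\<^sup>2 \<le> max 1 (cmod (g \<xi>))" using no'[OF \<xi>(3,1)] True by simp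
        show ?thesis
        proof (cases "h \<xi> = 0")
          case False
          then have "1 + (cmod (h \<xi>))\<^sup>2 \<le> (cmod (1 + cnj s * h \<xi>))\<^sup>2 / (1 + (cmod s)\<^sup>2)" using le by (auto simp: gn max_def split: if_splits)
          then have "(1 + (cmod s)\<^sup>2) * (1 + (cmod (h \<xi>))\<^sup>2) \<le> (cmod (1 + cnj s * h \<xi>))\<^sup>2"
            using s1 by (simp add: pos_le_divide_eq mult.commute)
          then have "(cmod (h \<xi> - s))\<^sup>2 \<le> 0" unfolding cauchy_schwarz_2 by simp
          then show ?thesis using fw by simp
        qed (use fw in simp)
      qed
      have "f constant_on ball z e"
      proof (rule continuous_finite_range_constant)
        show "continuous_on (ball z e) f" by (rule continuous_on_subset[OF fc eu])
        show "finite (f ` ball z e)" by (rule finite_subset[OF image_subsetI[OF two]]) auto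
      qed simp
      then obtain c where c: "\<And>w. w \<in> ball z e \<Longrightarrow> f w = c" unfolding constant_on_def by blast
      moreover have "connected uhp" using convex_uhp by (rule convex_connected)
      moreover have "ball z e \<noteq> {}" using e by simp
      ultimately have "f w = c" if "w \<in> uhp" for w
        using analytic_continuation_open[of "ball z e" uhp f "\<lambda>_. c" w] open_uhp f(1) that eu
        by (metis holomorphic_on_const open_ball)
      then show False using nc True by blast
    next
      case False
      have "f w = 0" if w: "w \<in> ball z e - {z}" for w
      proof -
        obtain \<xi> where \<xi>: "5 * (cmod \<xi>)\<^sup>2 < 1" "w = of_real (Im z) * cay \<xi> + of_real (Re z)" "cmod \<xi> < 1"
          using hdisc_param[of w z] w e z by blast
        have "\<xi> \<noteq> 0"
        proof
          assume "\<xi> = 0"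
          then have "w = of_real (Im z) * cay 0 + of_real (Re z)" using \<xi>(2) by (simp only:)
          then have "w = z" by (simp add: complex_eq_iff)
          then show False using w by simp
        qed
        then have "0 < (1 - (cmod \<xi>)\<^sup>2) ^ m" "(1 - (cmod \<xi>)\<^sup>2) ^ m < 1"
          using \<xi>(3) False \<open>\<xi> \<noteq> 0\<close> power_strict_decreasing[of 0 m "1 - (cmod \<xi>)\<^sup>2"] by (auto simp: abs_square_less_1)
        then have lt: "h \<xi> \<noteq> 0 \<Longrightarrow> (cmod (h \<xi>))\<^sup>2 < (cmod (h \<xi>))\<^sup>2 / (1 - (cmod \<xi>)\<^sup>2) ^ m"
          using mult_strict_left_mono[of "(1 - (cmod \<xi>)\<^sup>2) ^ m" 1 "(cmod (h \<xi>))\<^sup>2"] by (simp add: pos_less_divide_eq)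
        have "h \<xi> = 0"
        proof (rule ccontr)
          assume hn: "h \<xi> \<noteq> 0"
          have "max 1 (cmod (g \<xi>)) \<le> 1 + (cmod (h \<xi>))\<^sup>2" using gle[of \<xi>] by simp
          then show False using lt[OF hn] no'[OF \<xi>(3,1)] by linarith
        qed
        then show ?thesis using y one_minus_nz[OF \<xi>(3)] unfolding h_def disc_form_def \<xi>(2) by auto
      qed
      moreover have "open (ball z e - {z})" by auto
      moreover have "z + of_real (e/2) \<in> ball z e - {z}" using e by (auto simp: dist_norm)
      then have "ball z e - {z} \<noteq> {}" by blast
      moreover have "ball z e - {z} \<subseteq> uhp" using eu by blast
      moreover have "connected uhp" using convex_uhp by (rule convex_connected)
      ultimately have "f w = 0" if "w \<in> uhp" for w
        using analytic_continuation_open[of "ball z e - {z}" uhp f "\<lambda>_. 0" w] open_uhp f(1) that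
        by (metis holomorphic_on_const)
      then show False using nz by blast
    qed
  qed
  then obtain \<xi> where \<xi>: "cmod \<xi> < 1" "5 * (cmod \<xi>)\<^sup>2 < 1" "max 1 (cmod (g \<xi>)) < exp (u (of_real (Im z) * cay \<xi> + of_real (Re z)))" by blast
  show ?thesis
  proof (rule submean_strict[where L = u and g = g and \<xi> = \<xi>])
    show "0 \<le> u w" if "w \<in> hdisc z" for w using upos[of w] hdisc_uhp[OF that] by simp
    have "h holomorphic_on ball 0 1" unfolding h_def by (rule disc_form_holomorphic[OF f(1) y])
    then show "g holomorphic_on ball 0 1" unfolding g_def[abs_def] using s1
      by (intro holomorphic_intros) (auto simp only: of_real_eq_0_iff)
    show "cmod (g \<zeta>) \<le> exp (u (of_real (Im z) * cay \<zeta> + of_real (Re z)))" if "cmod \<zeta> < 1" for \<zeta>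
      unfolding eu[OF that] using gle[of \<zeta>] dle[OF that] by linarith
    have "1 + cnj s * s = of_real (1 + (cmod s)\<^sup>2)" using complex_norm_square[of s] by (simp add: mult.commute)
    then have "cmod (g 0) = (1 + (cmod s)\<^sup>2)\<^sup>2 / (1 + (cmod s)\<^sup>2)"
      unfolding gn s_def[symmetric] using s1 by (simp only: norm_of_real power2_abs)
    also have "\<dots> = 1 + (cmod s)\<^sup>2" using s1 by (simp add: power2_eq_square)
    also have "\<dots> = exp (u (of_real (Im z) * cay 0 + of_real (Re z)))" using eu[of 0] by (simp add: s_def)
    also have "of_real (Im z) * cay 0 + of_real (Re z) = z" by (simp add: complex_eq_iff)
    finally show "cmod (g 0) = exp (u z)" .
  qed (fact um uc z \<xi>)+
qed

text \<open>Moderate growth of \<open>f\<close> becomes linear growth of \<open>ln (1 + \<bar>f\<bar>\<^sup>2 y\<^sup>-\<^sup>m)\<close> in the logarithm of the height, as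
  \<open>liouville\<close> requires.\<close>

lemma no_negative_weight:
  assumes f: "f \<in> modular_forms \<Gamma> (- int m)" and nz: "\<exists>z\<in>uhp. f z \<noteq> 0"
  shows "m = 0 \<and> (\<exists>c. \<forall>z\<in>uhp. f z = c)"
proof (rule ccontr)
  assume con: "\<not> ?thesis"
  have fh: "f holomorphic_on uhp" and fu: "on_uhp f" and fg: "moderate_growth f"
    and ft: "\<And>A z. A \<in> G \<Longrightarrow> z \<in> uhp \<Longrightarrow> aut_factor A z ^ m * f (moebius A z) = f z"
    using f unfolding modular_forms_def by (auto simp: power_int_def)
  have fc: "continuous_on uhp f" using fh by (rule holomorphic_on_imp_continuous_on)
  have [measurable]: "f \<in> borel_measurable borel" using on_uhp_measurable fu fc by blast
  obtain C N where CN: "\<And>z. z \<in> uhp \<Longrightarrow> cmod (f z) \<le> C * height z ^ N"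
    using fg unfolding moderate_growth_def height_def by blast
  define u where "u w = ln (1 + (cmod (f w))\<^sup>2 / Im w ^ m)" for w
  show False
  proof (rule liouville[of u "ln (1 + C\<^sup>2)" "real (2 * N + m)"])
    show "u \<in> borel_measurable borel" unfolding u_def by measurable
    show "0 \<le> u z" if "z \<in> uhp" for z unfolding u_def using that by (intro ln_ge_zero) simp
    show "u (moebius A z) = u z" if A: "A \<in> G" and z: "z \<in> uhp" for A z
    proof -
      have j: "cmod (aut_factor A z) > 0" using aut_factor_nz[of A z] A z by simp
      have "(cmod (f z))\<^sup>2 = (cmod (aut_factor A z) ^ m)\<^sup>2 * (cmod (f (moebius A z)))\<^sup>2"
        unfolding ft[OF A z, symmetric] by (simp add: norm_mult norm_power power_mult_distrib)
      moreover have "Im (moebius A z) ^ m = Im z ^ m / (cmod (aut_factor A z) ^ m)\<^sup>2"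
        using Im_moebius[of A z] A z by (simp add: power_divide power_mult[symmetric] mult.commute)
      ultimately have "(cmod (f (moebius A z)))\<^sup>2 / Im (moebius A z) ^ m = (cmod (f z))\<^sup>2 / Im z ^ m"
        by (simp add: mult.commute)
      then show ?thesis by (simp add: u_def)
    qed
    show "u z \<le> ln (1 + C\<^sup>2) + real (2 * N + m) * ln (height z)" if z: "z \<in> uhp" for z
    proof -
      have h: "height z \<ge> 1" "1 / Im z \<le> height z" using height_ge[OF z] by auto
      have y: "Im z > 0" using z by simp
      have "(cmod (f z))\<^sup>2 \<le> (C * height z ^ N)\<^sup>2" using CN[OF z] by (intro power_mono) auto
      moreover have "(1 / Im z) ^ m \<le> height z ^ m" using h y by (intro power_mono) auto
      ultimately have "(cmod (f z))\<^sup>2 * (1 / Im z) ^ m \<le> (C * height z ^ N)\<^sup>2 * height z ^ m"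
        using y by (intro mult_mono) auto
      also have "\<dots> = C\<^sup>2 * height z ^ (2 * N + m)"
        by (simp add: power_mult_distrib power_add power_mult[symmetric] mult.commute mult.left_commute)
      finally have "1 + (cmod (f z))\<^sup>2 / Im z ^ m \<le> 1 + C\<^sup>2 * height z ^ (2 * N + m)" by (simp add: power_divide)
      also have "\<dots> \<le> height z ^ (2 * N + m) + C\<^sup>2 * height z ^ (2 * N + m)" using one_le_power[OF h(1)] by simp
      finally have "1 + (cmod (f z))\<^sup>2 / Im z ^ m \<le> (1 + C\<^sup>2) * height z ^ (2 * N + m)" by (simp add: distrib_right)
      moreover have "0 < 1 + (cmod (f z))\<^sup>2 / Im z ^ m" using y by (intro add_pos_nonneg) auto
      ultimately have "u z \<le> ln ((1 + C\<^sup>2) * height z ^ (2 * N + m))"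
        unfolding u_def by (intro ln_mono) auto
      also have "\<dots> = ln (1 + C\<^sup>2) + real (2 * N + m) * ln (height z)"
      proof -
        have "1 + C\<^sup>2 > 0" by (intro add_pos_nonneg) auto
        then show ?thesis using h(1) by (subst ln_mult) (auto simp: ln_realpow)
      qed
      finally show ?thesis .
    qed
    show "0 \<le> ln (1 + C\<^sup>2)" by (intro ln_ge_zero) simp
    show "ennreal (disc_area * u z) < (\<integral>\<^sup>+w. indicator (hdisc z) w * ennreal (u w) \<partial>hyp)" if "z \<in> uhp" for z
      unfolding u_def by (rule log_norm_strictly_subharmonic[OF fh fu that nz]) (use con in auto)
  qed simp
qed

end

section \<open>The orbit of the point at infinity\<close>

text \<open>The logarithmic derivative of the automorphy factor. For \<open>c \<noteq> 0\<close> it is \<open>1 / (z - A\<inverse> \<infinity>)\<close>, so its values at a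
  point parametrise the orbit of \<open>\<infinity>\<close>.\<close>

definition aut_quot :: "real^2^2 \<Rightarrow> complex \<Rightarrow> complex" where
  "aut_quot A z = of_real (A$2$1) / aut_factor A z"

lemma aut_quot_mult:
  assumes "det A = 1" "det B = 1" "z \<in> uhp"
  shows "aut_quot (B ** A) z = aut_quot B (moebius A z) / (aut_factor A z)\<^sup>2 + aut_quot A z"
proof -
  have j: "aut_factor A z \<noteq> 0" using aut_factor_nz assms by blast
  have jB: "aut_factor B (moebius A z) \<noteq> 0" using aut_factor_nz[of B "moebius A z"] assms by simp
  have j2: "aut_factor (B ** A) z = aut_factor B (moebius A z) * aut_factor A z" by (rule aut_factor_mult[OF assms(1,3)])
  have d: "of_real (A$1$1) * of_real (A$2$2) - of_real (A$1$2) * of_real (A$2$1) = (1::complex)"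
    using arg_cong[OF assms(1)[unfolded det2], of complex_of_real] by simp
  have "of_real ((B ** A)$2$1) * aut_factor A z = of_real (B$2$1) * (of_real (A$1$1) * of_real (A$2$2) - of_real (A$1$2) * of_real (A$2$1)) + of_real (A$2$1) * aut_factor (B ** A) z"
    by (simp add: aut_factor_def matrix_mult_2 algebra_simps)
  then have "of_real ((B ** A)$2$1) * aut_factor A z = of_real (B$2$1) + of_real (A$2$1) * (aut_factor B (moebius A z) * aut_factor A z)"
    unfolding d j2 by simp
  then show ?thesis unfolding aut_quot_def j2 using j jB by (simp add: field_simps power2_eq_square)
qed

text \<open>The affine function with value \<open>1\<close> at \<open>\<i>\<close> that vanishes at \<open>A\<inverse> \<infinity>\<close>.\<close>

lemma aut_quot_i:
  assumes "det A = 1" "z \<in> uhp"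
  shows "1 + aut_quot A \<i> * (z - \<i>) = aut_factor A z / aut_factor A \<i>" "aut_quot A z = aut_quot A \<i> / (1 + aut_quot A \<i> * (z - \<i>))"
proof -
  have ji: "aut_factor A \<i> \<noteq> 0" using aut_factor_nz[OF assms(1), of \<i>] by simp
  have jz: "aut_factor A z \<noteq> 0" using aut_factor_nz[OF assms] .
  have "aut_factor A z = aut_factor A \<i> + of_real (A$2$1) * (z - \<i>)" by (simp add: aut_factor_def algebra_simps)
  then show e: "1 + aut_quot A \<i> * (z - \<i>) = aut_factor A z / aut_factor A \<i>"
    using ji by (simp add: aut_quot_def field_simps)
  show "aut_quot A z = aut_quot A \<i> / (1 + aut_quot A \<i> * (z - \<i>))" unfolding e using ji by (simp add: aut_quot_def)
qed

lemma aut_factor_ratio_le: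
  assumes "det A = 1" "z \<in> uhp" "w \<in> hdisc z"
  shows "cmod (aut_factor A w) \<le> 3 * cmod (aut_factor A z)"
proof -
  have "Im w \<le> 3 * Im z" using hdisc_Im[OF assms(3,2)] by simp
  then have "Im w * Im z \<le> (3 * Im z) * Im z" using assms(2) by (intro mult_right_mono) auto
  moreover have "(cmod (w - z))\<^sup>2 < Im w * Im z" using assms(3) by (simp add: hdisc_def)
  moreover have "0 \<le> Im z * Im z" by simp
  ultimately have "(cmod (w - z))\<^sup>2 \<le> 4 * (Im z)\<^sup>2" unfolding power2_eq_square[of "Im z"] mult.assoc by linarith
  then have "(cmod (w - z))\<^sup>2 \<le> (2 * Im z)\<^sup>2" by (simp add: power_mult_distrib)
  then have wz: "cmod (w - z) \<le> 2 * Im z" by (rule power2_le_imp_le) (use assms in simp)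
  have "\<bar>A$2$1\<bar> * Im z = \<bar>Im (aut_factor A z)\<bar>" using assms(2) by (simp add: aut_factor_def abs_mult)
  then have c: "\<bar>A$2$1\<bar> * Im z \<le> cmod (aut_factor A z)" using abs_Im_le_cmod by metis
  have "aut_factor A w = aut_factor A z + of_real (A$2$1) * (w - z)" by (simp add: aut_factor_def algebra_simps)
  then have "cmod (aut_factor A w) \<le> cmod (aut_factor A z) + \<bar>A$2$1\<bar> * cmod (w - z)"
    by (metis norm_mult norm_of_real norm_triangle_ineq)
  also have "\<bar>A$2$1\<bar> * cmod (w - z) \<le> \<bar>A$2$1\<bar> * (2 * Im z)" by (intro mult_left_mono wz) auto
  finally show ?thesis using c by simp
qed

context fuchsian
begin

text \<open>Suppose the set \<open>S\<close> of values at \<open>\<i>\<close> is finite with \<open>n\<close> elements. The product \<open>q\<close> of the affine functions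
  \<open>1 + s (z - \<i>)\<close> has no zeros in the half plane. Right multiplication by \<open>A\<close> permutes \<open>S\<close>, so
  \<open>h = \<bar>q\<bar>\<^sup>2 / y\<^sup>n\<close> is multiplied by a constant under \<open>A\<close>. Consequently
  \<open>L z w = ln (h w) - ln (h z) + C\<close> is invariant, and the kernel \<open>K\<close>, equal to \<open>L\<close> on pairs of points at
  disc distance, has the same integral \<open>E\<close> in either order. As \<open>L z w + L w z = 2 C\<close>, this gives
  \<open>E = C * disc_area * area\<close>. But \<open>ln h\<close> is strictly subharmonic, since \<open>ln \<bar>q\<bar>\<close> is harmonic and \<open>- ln y\<close> strictly
  subharmonic (\<open>n > 0\<close> as the identity contributes \<open>0 \<in> S\<close>), so \<open>E\<close> is larger.\<close>

lemma infinite_aut_quot_i: "infinite ((\<lambda>A. aut_quot A \<i>) ` G)"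
proof
  define S where "S = (\<lambda>A. aut_quot A \<i>) ` G"
  assume "finite ((\<lambda>A. aut_quot A \<i>) ` G)"
  then have fin: "finite S" by (simp add: S_def)
  define n where "n = card S"
  have "S \<noteq> {}" unfolding S_def using one_G by blast
  then have n: "n > 0" unfolding n_def using fin by (simp add: card_gt_0_iff)
  define q where "q z = (\<Prod>s\<in>S. 1 + s * (z - \<i>))" for z
  define h where "h z = (cmod (q z))\<^sup>2 / Im z ^ n" for z
  have fac_nz: "1 + s * (z - \<i>) \<noteq> 0" if s: "s \<in> S" and zu: "z \<in> uhp" for s z
  proof -
    obtain A where A: "A \<in> G" "s = aut_quot A \<i>" using s unfolding S_def by blast
    have "aut_factor A z \<noteq> 0" "aut_factor A \<i> \<noteq> 0" using aut_factor_nz[of A] A zu by auto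
    then show ?thesis unfolding A(2) using aut_quot_i(1)[of A z] A zu by simp
  qed
  have q_nz: "q z \<noteq> 0" if "z \<in> uhp" for z unfolding q_def using fac_nz that fin by (simp add: prod_zero_iff)
  have h_pos: "h z > 0" if "z \<in> uhp" for z unfolding h_def using q_nz[OF that] that by simp
  have q_hol: "q holomorphic_on uhp" unfolding q_def[abs_def] by (intro holomorphic_intros)
  have [measurable]: "q \<in> borel_measurable borel" unfolding q_def[abs_def] by measurable
  have hm [measurable]: "h \<in> borel_measurable borel" unfolding h_def[abs_def] by measurable
  have hc: "continuous_on uhp h" unfolding h_def
    by (intro continuous_intros holomorphic_on_imp_continuous_on[OF q_hol]) auto
  have q_hdisc: "cmod (q w) \<le> 3 ^ n * cmod (q z)" if z: "z \<in> uhp" and w: "w \<in> hdisc z" for w z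
  proof -
    have wu: "w \<in> uhp" using hdisc_uhp[OF w] by simp
    have "cmod (q w) = (\<Prod>s\<in>S. cmod (1 + s * (w - \<i>)))" by (simp add: q_def prod_norm)
    also have "\<dots> \<le> (\<Prod>s\<in>S. 3 * cmod (1 + s * (z - \<i>)))"
    proof (intro prod_mono conjI norm_ge_zero)
      fix s assume "s \<in> S"
      then obtain A where A: "A \<in> G" "s = aut_quot A \<i>" unfolding S_def by blast
      have "cmod (aut_factor A w) \<le> 3 * cmod (aut_factor A z)" using A z w by (intro aut_factor_ratio_le) auto
      then show "cmod (1 + s * (w - \<i>)) \<le> 3 * cmod (1 + s * (z - \<i>))"
        unfolding A(2) using aut_quot_i(1)[of A z] aut_quot_i(1)[of A w] A z wu
        by (simp add: norm_divide divide_right_mono)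
    qed
    also have "\<dots> = 3 ^ n * cmod (q z)" by (simp add: q_def n_def prod.distrib prod_norm)
    finally show ?thesis .
  qed
  have h_hdisc: "h w \<le> 27 ^ n * h z" if z: "z \<in> uhp" and w: "w \<in> hdisc z" for w z
  proof -
    have y: "Im z > 0" "Im w > 0" using z hdisc_uhp[OF w] by auto
    have "(cmod (q w))\<^sup>2 \<le> (3 ^ n * cmod (q z))\<^sup>2" using q_hdisc[OF z w] by (intro power_mono) auto
    moreover have "1 / Im w \<le> 3 / Im z" using y hdisc_Im[OF w z] by (simp add: field_simps)
    then have "(1 / Im w) ^ n \<le> (3 / Im z) ^ n" using y by (intro power_mono) auto
    ultimately have "(cmod (q w))\<^sup>2 * (1 / Im w) ^ n \<le> (3 ^ n * cmod (q z))\<^sup>2 * (3 / Im z) ^ n"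
      using y by (intro mult_mono) auto
    also have "\<dots> = (3 ^ n * 3 ^ n * 3 ^ n) * h z"
      by (simp add: h_def power_divide power_mult_distrib power2_eq_square)
    also have "(3 ^ n * 3 ^ n * 3 ^ n) = (27::real) ^ n" by (simp add: power_mult_distrib[symmetric])
    finally show ?thesis by (simp add: h_def power_divide)
  qed
  \<comment> \<open>By \<open>h_hdisc\<close> the increments of \<open>ln h\<close> over a disc are at most \<open>ln (27 ^ n)\<close>; so \<open>L\<close> is positive there and
      may be integrated as an extended nonnegative function.\<close>
  define C :: real where "C = ln (27 ^ n) + 1"
  define L where "L z w = ln (h w) - ln (h z) + C" for z w
  have Lpos: "0 < L z w" if z: "z \<in> uhp" and w: "w \<in> hdisc z" for z w
  proof -
    have wu: "w \<in> uhp" using hdisc_uhp[OF w] by simp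
    have "h z \<le> 27 ^ n * h w" using h_hdisc[OF wu hdisc_sym[OF z w]] .
    then have "ln (h z) \<le> ln (27 ^ n * h w)" using h_pos z by (intro ln_mono) auto
    also have "\<dots> = ln (27 ^ n) + ln (h w)" using h_pos[OF wu] by (subst ln_mult) auto
    finally show ?thesis by (simp add: L_def C_def)
  qed
  have Linv: "L (moebius A z) (moebius A w) = L z w" if A: "A \<in> G" and z: "z \<in> uhp" and w: "w \<in> uhp" for A z w
  proof -
    \<comment> \<open>The permutation of \<open>S\<close> induced by right multiplication with \<open>A\<close>, by the cocycle relation \<open>aut_quot_mult\<close>.\<close>
    define \<sigma> where "\<sigma> s = s / (1 + s * (moebius A \<i> - \<i>)) / (aut_factor A \<i>)\<^sup>2 + aut_quot A \<i>" for s
    have iu: "\<i> \<in> uhp" "moebius A \<i> \<in> uhp" using A by auto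
    have ji: "aut_factor A \<i> \<noteq> 0" using aut_factor_nz[of A \<i>] A by simp
    have jz: "aut_factor A z \<noteq> 0" "aut_factor A w \<noteq> 0" using aut_factor_nz A z w by auto
    have \<sigma>: "\<sigma> (aut_quot B \<i>) = aut_quot (B ** A) \<i>" if "B \<in> G" for B
      unfolding \<sigma>_def using aut_quot_mult[of A B \<i>] aut_quot_i(2)[of B "moebius A \<i>"] A that iu by simp
    have "inj_on \<sigma> S"
    proof (rule inj_onI)
      fix s t assume s: "s \<in> S" and t: "t \<in> S" and eq: "\<sigma> s = \<sigma> t"
      have "s / (1 + s * (moebius A \<i> - \<i>)) = t / (1 + t * (moebius A \<i> - \<i>))"
        using eq ji unfolding \<sigma>_def add_right_cancel divide_cancel_right by simp
      then have "s * (1 + t * (moebius A \<i> - \<i>)) = t * (1 + s * (moebius A \<i> - \<i>))"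
        using fac_nz[OF s iu(2)] fac_nz[OF t iu(2)] by (simp add: frac_eq_eq)
      then show "s = t" by (simp add: algebra_simps)
    qed
    moreover have "\<sigma> ` S \<subseteq> S"
    proof (rule image_subsetI)
      fix s assume "s \<in> S"
      then obtain B where B: "B \<in> G" "s = aut_quot B \<i>" unfolding S_def by blast
      show "\<sigma> s \<in> S" unfolding B(2) \<sigma>[OF B(1)] S_def using mult_G[OF B(1) A] by blast
    qed
    ultimately have "bij_betw \<sigma> S S" using fin by (simp add: bij_betw_def endo_inj_surj)
    have fac: "(1 + s * (moebius A z - \<i>)) * (1 + \<sigma> s * (w - \<i>)) * aut_factor A z = 
        (1 + s * (moebius A w - \<i>)) * (1 + \<sigma> s * (z - \<i>)) * aut_factor A w" if s: "s \<in> S" for s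
    proof -
      obtain B where B: "B \<in> G" "s = aut_quot B \<i>" using s unfolding S_def by blast
      have BA: "det (B ** A) = 1" using B A mult_G by simp
      have jB: "aut_factor B \<i> \<noteq> 0" "aut_factor (B ** A) \<i> \<noteq> 0" using aut_factor_nz[of _ \<i>] B BA by auto
      have 1: "1 + s * (moebius A v - \<i>) = aut_factor B (moebius A v) / aut_factor B \<i>"
         "1 + \<sigma> s * (v - \<i>) = aut_factor B (moebius A v) * aut_factor A v / aut_factor (B ** A) \<i>" if v: "v \<in> uhp" for v
      proof -
        show "1 + s * (moebius A v - \<i>) = aut_factor B (moebius A v) / aut_factor B \<i>"
          unfolding B(2) using aut_quot_i(1)[of B "moebius A v"] A B v by simp
        show "1 + \<sigma> s * (v - \<i>) = aut_factor B (moebius A v) * aut_factor A v / aut_factor (B ** A) \<i>"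
          unfolding B(2) \<sigma>[OF B(1)] using aut_quot_i(1)[OF BA v] aut_factor_mult[of A v B] A v by simp
      qed
      show ?thesis unfolding 1[OF z] 1[OF w] by simp
    qed
    have qs: "q v = (\<Prod>s\<in>S. 1 + \<sigma> s * (v - \<i>))" for v
      unfolding q_def by (rule prod.reindex_bij_betw[OF \<open>bij_betw \<sigma> S S\<close>, symmetric])
    have "q (moebius A z) * q w * aut_factor A z ^ n = (\<Prod>s\<in>S. (1 + s * (moebius A z - \<i>)) * (1 + \<sigma> s * (w - \<i>)) * aut_factor A z)"
      unfolding qs[of w] q_def[of "moebius A z"] n_def by (simp add: prod.distrib)
    also have "\<dots> = (\<Prod>s\<in>S. (1 + s * (moebius A w - \<i>)) * (1 + \<sigma> s * (z - \<i>)) * aut_factor A w)"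
      by (intro prod.cong refl fac)
    also have "\<dots> = q (moebius A w) * q z * aut_factor A w ^ n"
      unfolding qs[of z] q_def[of "moebius A w"] n_def by (simp add: prod.distrib)
    finally have "(cmod (q (moebius A z) * q w * aut_factor A z ^ n))\<^sup>2 = (cmod (q (moebius A w) * q z * aut_factor A w ^ n))\<^sup>2" by simp
    then have e: "(cmod (q (moebius A z)))\<^sup>2 * (cmod (q w))\<^sup>2 * ((cmod (aut_factor A z))\<^sup>2) ^ n = (cmod (q (moebius A w)))\<^sup>2 * (cmod (q z))\<^sup>2 * ((cmod (aut_factor A w))\<^sup>2) ^ n"
      by (simp add: norm_mult norm_power power_mult_distrib power_mult[symmetric] mult.commute[of n])
    have "h (moebius A v) = (cmod (q (moebius A v)))\<^sup>2 * ((cmod (aut_factor A v))\<^sup>2) ^ n / Im v ^ n" if "v \<in> uhp" for v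
      unfolding h_def using Im_moebius[of A v] A that by (simp add: power_divide)
    then have "h (moebius A z) * h w = h (moebius A w) * h z"
      using e z w by (simp add: h_def mult_ac)
    then have "ln (h (moebius A z) * h w) = ln (h (moebius A w) * h z)" by simp
    moreover have "h (moebius A z) > 0" "h (moebius A w) > 0" "h z > 0" "h w > 0" using h_pos A z w by auto
    ultimately have "ln (h (moebius A z)) + ln (h w) = ln (h (moebius A w)) + ln (h z)" by (simp add: ln_mult)
    then show ?thesis by (simp add: L_def)
  qed
  have strict: "ennreal (disc_area * C) < (\<integral>\<^sup>+w. indicator (hdisc z) w * ennreal (L z w) \<partial>hyp)" if z: "z \<in> uhp" for z
  proof -
    have y: "Im z > 0" using z by simp
    define d where "d = disc_form n q z"
    define g where "g \<zeta> = of_real (exp C / h z) * (d \<zeta>)\<^sup>2" for \<zeta>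
    have hz: "h z > 0" using h_pos[OF z] .
    have eL: "exp (L z (of_real (Im z) * cay \<zeta> + of_real (Re z))) = cmod (g \<zeta>) / (1 - (cmod \<zeta>)\<^sup>2) ^ n" if \<zeta>: "cmod \<zeta> < 1" for \<zeta>
    proof -
      define w where "w = of_real (Im z) * cay \<zeta> + of_real (Re z)"
      have w: "w \<in> uhp" unfolding w_def using cay_uhp[OF \<zeta>] y by simp
      have "exp (L z w) = exp C * h w / h z"
        using h_pos[OF w] hz by (simp add: L_def exp_add exp_diff)
      also have "h w = (cmod (d \<zeta>))\<^sup>2 / (1 - (cmod \<zeta>)\<^sup>2) ^ n"
        unfolding h_def w_def d_def by (rule disc_form_norm[OF \<zeta> y])
      finally show ?thesis using hz unfolding w_def g_def norm_mult norm_of_real norm_power by simp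
    qed
    have Lzz: "L z z = C" by (simp add: L_def)
    have z0: "of_real (Im z) * cay 0 + of_real (Re z) = z" by (simp add: complex_eq_iff)
    have le1: "0 < (1 - (cmod \<zeta>)\<^sup>2) ^ n \<and> (1 - (cmod \<zeta>)\<^sup>2) ^ n \<le> 1" if "cmod \<zeta> < 1" for \<zeta> :: complex
    proof -
      have "(cmod \<zeta>)\<^sup>2 < 1" using that by (simp add: abs_square_less_1)
      then show ?thesis by (auto intro!: power_le_one)
    qed
    \<comment> \<open>Any point of the disc other than its centre would do.\<close>
    define \<xi> :: complex where "\<xi> = of_real (1/4)"
    have \<xi>: "cmod \<xi> = 1/4" unfolding \<xi>_def by (simp only: norm_of_real)
    define w where "w = of_real (Im z) * cay \<xi> + of_real (Re z)"
    have wd: "w \<in> hdisc z"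
      using hdisc_moebius[OF trans_to(1)[OF z], of \<i> "cay \<xi>"] hdisc_cay[of \<xi>] cay_uhp[of \<xi>] \<xi>
      unfolding trans_to(2)[OF z, of "cay \<xi>"] trans_to(3)[OF z] w_def[symmetric] by (simp add: power2_eq_square)
    have "ennreal (disc_area * L z z) < (\<integral>\<^sup>+w. indicator (hdisc z) w * ennreal (L z w) \<partial>hyp)"
    proof (rule submean_strict[where g = g and \<xi> = \<xi>])
      show "L z \<in> borel_measurable borel" unfolding L_def[abs_def] by measurable
      show "continuous_on uhp (L z)" unfolding L_def[abs_def]
        by (intro continuous_intros hc ballI) (use h_pos in fastforce)
      show "0 \<le> L z w" if "w \<in> hdisc z" for w using Lpos[OF z that] by simp
      show "g holomorphic_on ball 0 1"
        unfolding g_def[abs_def] d_def by (intro holomorphic_intros disc_form_holomorphic q_hol y)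
      show "cmod (g \<zeta>) \<le> exp (L z (of_real (Im z) * cay \<zeta> + of_real (Re z)))" if "cmod \<zeta> < 1" for \<zeta>
        unfolding eL[OF that] using le1[OF that] mult_left_mono[of "(1 - (cmod \<zeta>)\<^sup>2) ^ n" 1 "cmod (g \<zeta>)"] by (simp add: pos_le_divide_eq)
      show "cmod (g 0) = exp (L z z)" using eL[of 0] z0 by simp
      show "5 * (cmod \<xi>)\<^sup>2 < 1" unfolding \<xi> by (simp add: power2_eq_square)
      have "1 < exp (L z w)" using Lpos[OF z wd] by simp
      moreover have "cmod (g \<xi>) < exp (L z w)"
      proof -
        have e: "exp (L z w) = cmod (g \<xi>) / (1 - (1/4)\<^sup>2) ^ n" using eL[of \<xi>] \<xi> unfolding w_def by simp
        then have "cmod (g \<xi>) > 0" using exp_gt_zero[of "L z w"] by (cases "g \<xi> = 0") auto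
        moreover have "0 < (1 - (1/4)\<^sup>2 :: real) ^ n" "(1 - (1/4)\<^sup>2 :: real) ^ n < 1"
          using n by (auto simp: power2_eq_square power_less_one_iff)
        ultimately show ?thesis unfolding e
          using mult_strict_left_mono[of "(1 - (1/4)\<^sup>2) ^ n" 1 "cmod (g \<xi>)"] by (simp add: pos_less_divide_eq)
      qed
      ultimately show "max 1 (cmod (g \<xi>)) < exp (L z (of_real (Im z) * cay \<xi> + of_real (Re z)))"
        unfolding w_def by simp
    qed (fact z)
    then show ?thesis unfolding Lzz .
  qed
  define K where "K z w = indicator (hdisc z) w * ennreal (L z w)" for z w
  have Km [measurable]: "case_prod K \<in> borel_measurable (borel \<Otimes>\<^sub>M borel)" unfolding K_def L_def by measurable
  define E where "E = (\<integral>\<^sup>+z. indicator fund z * (\<integral>\<^sup>+w. K z w \<partial>hyp) \<partial>hyp)"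
  have E': "E = (\<integral>\<^sup>+z. indicator fund z * (\<integral>\<^sup>+w. K w z \<partial>hyp) \<partial>hyp)"
    unfolding E_def
  proof (rule fund_swap[OF Km])
    fix A z w assume "A \<in> G" "z \<in> uhp" "w \<in> uhp"
    then show "K (moebius A z) (moebius A w) = K z w"
      using hdisc_moebius[of A z w] Linv[of A z w] by (simp add: K_def indicator_def)
  qed
  have C: "C > 0" unfolding C_def by (simp add: add_nonneg_pos ln_ge_zero)
  have KK: "(\<integral>\<^sup>+w. K z w \<partial>hyp) + (\<integral>\<^sup>+w. K w z \<partial>hyp) = ennreal (2 * C * disc_area)" if z: "z \<in> uhp" for z
  proof -
    have "(\<integral>\<^sup>+w. K z w \<partial>hyp) + (\<integral>\<^sup>+w. K w z \<partial>hyp) = (\<integral>\<^sup>+w. K z w + K w z \<partial>hyp)"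
      by (rule nn_integral_add[symmetric]) measurable
    also have "\<dots> = (\<integral>\<^sup>+w. ennreal (2 * C) * indicator (hdisc z) w \<partial>hyp)"
    proof (rule nn_integral_cong_AE, rule AE_mp[OF AE_hyp_uhp], rule AE_I2, rule impI)
      fix w assume w: "w \<in> uhp"
      show "K z w + K w z = ennreal (2 * C) * indicator (hdisc z) w"
      proof (cases "w \<in> hdisc z")
        case True
        have zw: "z \<in> hdisc w" using hdisc_sym[OF z True] .
        have "ennreal (L z w) + ennreal (L w z) = ennreal (L z w + L w z)"
          using Lpos[OF z True] Lpos[OF w zw] by (intro ennreal_plus[symmetric]) auto
        also have "L z w + L w z = 2 * C" by (simp add: L_def)
        finally show ?thesis using True zw by (simp add: K_def)
      next
        case False
        then have "z \<notin> hdisc w" using hdisc_sym[OF w, of z] by blast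
        then show ?thesis using False by (simp add: K_def)
      qed
    qed
    also have "\<dots> = ennreal (2 * C) * ennreal disc_area"
      using emeasure_hdisc[OF z] by (subst nn_integral_cmult_indicator) auto
    also have "\<dots> = ennreal (2 * C * disc_area)" using C disc_area_pos by (simp add: ennreal_mult)
    finally show ?thesis .
  qed
  obtain \<mu> where \<mu>: "emeasure hyp fund = ennreal \<mu>" "\<mu> > 0"
    using fund_area fund_pos by (cases "emeasure hyp fund") auto
  have "E + E = (\<integral>\<^sup>+z. indicator fund z * (\<integral>\<^sup>+w. K z w \<partial>hyp) + indicator fund z * (\<integral>\<^sup>+w. K w z \<partial>hyp) \<partial>hyp)"
    by (subst nn_integral_add) (use E_def E' in auto)
  also have "\<dots> = (\<integral>\<^sup>+z. ennreal (2 * C * disc_area) * indicator fund z \<partial>hyp)"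
    by (intro nn_integral_cong) (use KK fund_uhp in \<open>auto simp: indicator_def distrib_left[symmetric]\<close>)
  also have "\<dots> = ennreal (2 * C * disc_area) * ennreal \<mu>"
    using \<mu> by (subst nn_integral_cmult_indicator) auto
  also have "\<dots> = ennreal (2 * (disc_area * C * \<mu>))" using C disc_area_pos \<mu> by (subst ennreal_mult[symmetric]) (auto simp: mult_ac)
  finally have EE: "E + E = ennreal (2 * (disc_area * C * \<mu>))" .
  then have "E < \<infinity>" by (cases E) auto
  then obtain x where x: "E = ennreal x" "x \<ge> 0" by (cases E) auto
  have "x + x = 2 * (disc_area * C * \<mu>)"
    using EE x C disc_area_pos \<mu> by (simp add: ennreal_plus[symmetric] del: ennreal_plus)
  then have xe: "x = disc_area * C * \<mu>" by simp
  define e where "e z = (\<integral>\<^sup>+w. K z w \<partial>hyp) - ennreal (disc_area * C)" for z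
  have [measurable]: "e \<in> borel_measurable borel" unfolding e_def by measurable
  have e: "(\<integral>\<^sup>+w. K z w \<partial>hyp) = ennreal (disc_area * C) + e z" "e z > 0" if "z \<in> uhp" for z
    using strict[OF that] unfolding e_def K_def
    by (auto simp: diff_gr0_ennreal diff_add_cancel_ennreal add.commute[of "ennreal _"] less_imp_le)
  define R where "R = (\<integral>\<^sup>+z. indicator fund z * e z \<partial>hyp)"
  have "E = (\<integral>\<^sup>+z. ennreal (disc_area * C) * indicator fund z + indicator fund z * e z \<partial>hyp)"
    unfolding E_def by (intro nn_integral_cong) (use e fund_uhp in \<open>auto simp: indicator_def\<close>)
  also have "\<dots> = ennreal (disc_area * C) * ennreal \<mu> + R"
    unfolding R_def using \<mu> by (subst nn_integral_add) (auto simp: nn_integral_cmult_indicator)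
  also have "ennreal (disc_area * C) * ennreal \<mu> = E" unfolding x xe using C disc_area_pos \<mu> by (simp add: ennreal_mult)
  finally have "E + 0 = E + R" by simp
  then have "R = 0" using \<open>E < \<infinity>\<close> by (metis ennreal_add_left_cancel infinity_ennreal_def less_irrefl)
  then have "AE z in hyp. indicator fund z * e z = 0"
    unfolding R_def by (subst (asm) nn_integral_0_iff_AE) auto
  then have "AE z in hyp. z \<notin> fund"
  proof eventually_elim
    fix z assume 0: "indicator fund z * e z = 0"
    show "z \<notin> fund"
    proof
      assume z: "z \<in> fund"
      then have "e z = 0" using 0 by simp
      then show False using e(2)[of z] z fund_uhp by auto
    qed
  qed
  then have "emeasure hyp fund = 0" by (subst (asm) AE_iff_null_sets[symmetric]) (auto simp: null_sets_def)
  then show False using fund_pos by simp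
qed

text \<open>The values at \<open>z\<close> and at \<open>\<i>\<close> determine each other by \<open>aut_quot_i\<close>.\<close>

lemma infinite_aut_quot:
  assumes z: "z \<in> uhp" shows "infinite ((\<lambda>A. aut_quot A z) ` G)"
proof
  assume "finite ((\<lambda>A. aut_quot A z) ` G)"
  moreover have "(\<lambda>A. aut_quot A \<i>) ` G = (\<lambda>x. x / (1 - x * (z - \<i>))) ` (\<lambda>A. aut_quot A z) ` G"
  proof -
    have "aut_quot A \<i> = aut_quot A z / (1 - aut_quot A z * (z - \<i>))" if "A \<in> G" for A
    proof -
      have j: "aut_factor A z \<noteq> 0" "aut_factor A \<i> \<noteq> 0" using aut_factor_nz[of A] that z by auto
      have "aut_factor A \<i> = aut_factor A z - of_real (A$2$1) * (z - \<i>)" by (simp add: aut_factor_def algebra_simps)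
      then have "1 - aut_quot A z * (z - \<i>) = aut_factor A \<i> / aut_factor A z" using j by (simp add: aut_quot_def field_simps)
      then show ?thesis using j by (simp add: aut_quot_def)
    qed
    then show ?thesis unfolding image_image by (intro image_cong refl)
  qed
  ultimately show False using infinite_aut_quot_i by simp
qed

end

section \<open>Holomorphic functions of moderate growth\<close>

text \<open>The ring in which all coefficient functions live. It contains the automorphy factors and their inverses, is
  stable under the group, and contains \<open>1 / (X\<^sub>A - X\<^sub>B)\<close> for distinct \<open>X\<^sub>A\<close>, \<open>X\<^sub>B\<close>, so that linear systems in the
  powers of the \<open>X\<^sub>A\<close> can be solved within it.\<close>

definition moderate :: "(complex \<Rightarrow> complex) set" where
  "moderate = {f. f holomorphic_on uhp \<and> moderate_growth f}"

lemma moderate_growthE: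
  assumes "moderate_growth f"
  obtains C N where "C \<ge> 0" "\<And>z. z \<in> uhp \<Longrightarrow> cmod (f z) \<le> C * height z ^ N"
proof -
  obtain C N where CN: "\<And>z. z \<in> uhp \<Longrightarrow> cmod (f z) \<le> C * height z ^ N"
    using assms unfolding moderate_growth_def height_def by blast
  have "cmod (f z) \<le> \<bar>C\<bar> * height z ^ N" if "z \<in> uhp" for z
    using CN[OF that] height_ge(1)[OF that] by (smt (verit) mult_right_mono zero_le_power)
  then show ?thesis using that[of "\<bar>C\<bar>"] by auto
qed

lemma moderate_growthI:
  assumes "\<And>z. z \<in> uhp \<Longrightarrow> cmod (f z) \<le> C * height z ^ N"
  shows "moderate_growth f"
  using assms unfolding moderate_growth_def height_def by blast

lemma moderate_cong:
  assumes "f \<in> moderate" "\<And>z. z \<in> uhp \<Longrightarrow> f z = g z"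
  shows "g \<in> moderate"
proof -
  have "g holomorphic_on uhp" using assms holomorphic_cong[of uhp uhp f g] unfolding moderate_def by auto
  moreover have "moderate_growth g" using assms unfolding moderate_def moderate_growth_def by force
  ultimately show ?thesis by (simp add: moderate_def)
qed

lemma moderate_const [intro]: "(\<lambda>_. c) \<in> moderate"
  unfolding moderate_def by (auto intro!: moderate_growthI[of _ "cmod c" 0])

lemma moderate_mult [intro]:
  assumes "f \<in> moderate" "g \<in> moderate" shows "(\<lambda>z. f z * g z) \<in> moderate"
proof -
  obtain C N where C: "C \<ge> 0" "\<And>z. z \<in> uhp \<Longrightarrow> cmod (f z) \<le> C * height z ^ N"
    using assms(1) moderate_growthE unfolding moderate_def by blast
  obtain C' N' where C': "C' \<ge> 0" "\<And>z. z \<in> uhp \<Longrightarrow> cmod (g z) \<le> C' * height z ^ N'"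
    using assms(2) moderate_growthE unfolding moderate_def by blast
  have "cmod (f z * g z) \<le> (C * C') * height z ^ (N + N')" if z: "z \<in> uhp" for z
  proof -
    have "cmod (f z * g z) \<le> (C * height z ^ N) * (C' * height z ^ N')"
      unfolding norm_mult using C(2)[OF z] C'(2)[OF z] C(1) height_ge(1)[OF z]
      by (intro mult_mono) auto
    then show ?thesis by (simp add: power_add mult_ac)
  qed
  then have "moderate_growth (\<lambda>z. f z * g z)" by (rule moderate_growthI)
  then show ?thesis using assms unfolding moderate_def by (auto intro!: holomorphic_intros)
qed

lemma moderate_add [intro]:
  assumes "f \<in> moderate" "g \<in> moderate" shows "(\<lambda>z. f z + g z) \<in> moderate"
proof -
  obtain C N where C: "C \<ge> 0" "\<And>z. z \<in> uhp \<Longrightarrow> cmod (f z) \<le> C * height z ^ N"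
    using assms(1) moderate_growthE unfolding moderate_def by blast
  obtain C' N' where C': "C' \<ge> 0" "\<And>z. z \<in> uhp \<Longrightarrow> cmod (g z) \<le> C' * height z ^ N'"
    using assms(2) moderate_growthE unfolding moderate_def by blast
  have "cmod (f z + g z) \<le> (C + C') * height z ^ (N + N')" if z: "z \<in> uhp" for z
  proof -
    have "height z ^ N \<le> height z ^ (N + N')" "height z ^ N' \<le> height z ^ (N + N')"
      using height_ge(1)[OF z] by (auto intro!: power_increasing)
    then have "C * height z ^ N \<le> C * height z ^ (N + N')" "C' * height z ^ N' \<le> C' * height z ^ (N + N')"
      using C(1) C'(1) by (auto intro!: mult_left_mono)
    then have "cmod (f z) + cmod (g z) \<le> (C + C') * height z ^ (N + N')"
      using C(2)[OF z] C'(2)[OF z] by (simp add: distrib_right)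
    then show ?thesis using norm_triangle_ineq[of "f z" "g z"] by linarith
  qed
  then have "moderate_growth (\<lambda>z. f z + g z)" by (rule moderate_growthI)
  then show ?thesis using assms unfolding moderate_def by (auto intro!: holomorphic_intros)
qed

lemma moderate_cmult: "f \<in> moderate \<Longrightarrow> (\<lambda>z. c * f z) \<in> moderate"
  by (intro moderate_mult moderate_const)

lemma moderate_diff [intro]:
  assumes "f \<in> moderate" "g \<in> moderate" shows "(\<lambda>z. f z - g z) \<in> moderate"
  using moderate_add[OF assms(1) moderate_cmult[OF assms(2), of "-1"]] by simp

lemma moderate_power [intro]: "f \<in> moderate \<Longrightarrow> (\<lambda>z. f z ^ n) \<in> moderate"
  by (induction n) auto

lemma moderate_id: "(\<lambda>z. z) \<in> moderate"
  unfolding moderate_def using height_ge(3) by (auto intro!: moderate_growthI[of _ 1 1] simp del: uhp_iff)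

lemma moderate_aut: "aut_factor A \<in> moderate"
  using moderate_add[OF moderate_cmult[OF moderate_id] moderate_const] by (simp add: aut_factor_def[abs_def])

lemma height_moebius:
  assumes "det A = 1"
  shows "\<exists>K\<ge>0. \<forall>z\<in>uhp. height (moebius A z) \<le> K * height z"
proof -
  define K where "K = 2 * ((A$1$1)\<^sup>2 + (A$1$2)\<^sup>2) + 2 * ((A$2$1)\<^sup>2 + (A$2$2)\<^sup>2)"
  have lin: "(cmod (of_real p * z + of_real q))\<^sup>2 \<le> 2 * (p\<^sup>2 + q\<^sup>2) * (1 + (cmod z)\<^sup>2)" for p q z
  proof -
    have "cmod (of_real p * z + of_real q) \<le> \<bar>p\<bar> * cmod z + \<bar>q\<bar>"
      by (metis norm_mult norm_of_real norm_triangle_ineq)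
    then have "(cmod (of_real p * z + of_real q))\<^sup>2 \<le> (\<bar>p\<bar> * cmod z + \<bar>q\<bar>)\<^sup>2" by (intro power_mono) auto
    also have "\<dots> \<le> 2 * (\<bar>p\<bar> * cmod z)\<^sup>2 + 2 * \<bar>q\<bar>\<^sup>2"
      using sum_squares_bound[of "\<bar>p\<bar> * cmod z" "\<bar>q\<bar>"] by (simp add: power2_sum)
    also have "\<dots> \<le> 2 * (p\<^sup>2 + q\<^sup>2) * (1 + (cmod z)\<^sup>2)"
      by (simp add: power_mult_distrib algebra_simps)
    finally show ?thesis .
  qed
  have "height (moebius A z) \<le> K * height z" if z: "z \<in> uhp" for z
  proof -
    have j: "cmod (aut_factor A z) > 0" using aut_factor_nz[OF assms z] by simp
    have "height (moebius A z) = ((cmod (aut_factor A z))\<^sup>2 + (cmod (of_real (A$1$1) * z + of_real (A$1$2)))\<^sup>2) / Im z"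
      unfolding height_def Im_moebius[OF assms z] using j z by (simp add: moebius_aut norm_divide power_divide field_simps)
    also have "\<dots> \<le> (2 * ((A$2$1)\<^sup>2 + (A$2$2)\<^sup>2) * (1 + (cmod z)\<^sup>2) + 2 * ((A$1$1)\<^sup>2 + (A$1$2)\<^sup>2) * (1 + (cmod z)\<^sup>2)) / Im z"
      using z lin unfolding aut_factor_def by (intro divide_right_mono add_mono) auto
    also have "\<dots> = K * height z" by (simp add: K_def height_def algebra_simps add_divide_distrib)
    finally show ?thesis .
  qed
  moreover have "K \<ge> 0" by (simp add: K_def)
  ultimately show ?thesis by blast
qed

lemma moebius_has_derivative:
  assumes "det A = 1" "z \<in> uhp"
  shows "(moebius A has_field_derivative 1 / (aut_factor A z)\<^sup>2) (at z)"
proof -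
  have j: "aut_factor A z \<noteq> 0" using aut_factor_nz assms by blast
  have d: "of_real (A$1$1) * of_real (A$2$2) - of_real (A$1$2) * of_real (A$2$1) = (1::complex)"
    using arg_cong[OF assms(1)[unfolded det2], of complex_of_real] by simp
  have "of_real (A$1$1) * aut_factor A z - (of_real (A$1$1) * z + of_real (A$1$2)) * of_real (A$2$1) = (1::complex)"
    unfolding d[symmetric] by (simp add: aut_factor_def algebra_simps)
  then show ?thesis
    unfolding moebius_def using j
    by (auto intro!: derivative_eq_intros simp: aut_factor_def power2_eq_square)
qed

lemma aut_factor_has_derivative: "(aut_factor A has_field_derivative of_real (A$2$1)) (at z)"
  unfolding aut_factor_def by (auto intro!: derivative_eq_intros)

lemma moderate_compose:
  assumes "f \<in> moderate" and A: "det A = 1"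
  shows "(\<lambda>z. f (moebius A z)) \<in> moderate"
proof -
  obtain C N where C: "C \<ge> 0" "\<And>z. z \<in> uhp \<Longrightarrow> cmod (f z) \<le> C * height z ^ N"
    using assms(1) moderate_growthE unfolding moderate_def by blast
  obtain K where K: "K \<ge> 0" "\<And>z. z \<in> uhp \<Longrightarrow> height (moebius A z) \<le> K * height z"
    using height_moebius[OF A] by blast
  have "cmod (f (moebius A z)) \<le> (C * K ^ N) * height z ^ N" if z: "z \<in> uhp" for z
  proof -
    have u: "moebius A z \<in> uhp" using A z by simp
    have "cmod (f (moebius A z)) \<le> C * height (moebius A z) ^ N" using C(2)[OF u] .
    also have "\<dots> \<le> C * (K * height z) ^ N"
      using C(1) K(2)[OF z] height_ge(1)[OF u] by (intro mult_left_mono power_mono) auto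
    finally show ?thesis by (simp add: power_mult_distrib mult_ac)
  qed
  then have g: "moderate_growth (\<lambda>z. f (moebius A z))" by (rule moderate_growthI)
  have m: "moebius A holomorphic_on uhp"
    unfolding holomorphic_on_open[OF open_uhp] using moebius_has_derivative[OF A] by blast
  have fh: "f holomorphic_on uhp" using assms(1) by (simp add: moderate_def)
  have "moebius A ` uhp \<subseteq> uhp" using A by auto
  from holomorphic_on_compose_gen[OF m fh this]
  have "(\<lambda>z. f (moebius A z)) holomorphic_on uhp" by (simp only: o_def)
  with g show ?thesis by (simp add: moderate_def)
qed

text \<open>By the cocycle relation the inverse is again an automorphy factor, evaluated at the image point.\<close>

lemma moderate_inverse_aut:
  assumes "det A = 1" shows "(\<lambda>z. inverse (aut_factor A z)) \<in> moderate"
proof -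
  have B: "det (matrix_inv A) = 1" "matrix_inv A ** A = mat 1" using matrix_inv_2[OF assms] by auto
  have "(\<lambda>z. aut_factor (matrix_inv A) (moebius A z)) \<in> moderate"
    by (intro moderate_compose moderate_aut assms)
  then show ?thesis
  proof (rule moderate_cong)
    fix z assume z: "z \<in> uhp"
    have "aut_factor (matrix_inv A) (moebius A z) * aut_factor A z = 1"
      using aut_factor_mult[OF assms z, of "matrix_inv A"] B by simp
    then show "aut_factor (matrix_inv A) (moebius A z) = inverse (aut_factor A z)"
      by (metis inverse_unique mult.commute)
  qed
qed

lemma moderate_aut_powi:
  assumes "det A = 1" shows "(\<lambda>z. aut_factor A z powi n) \<in> moderate"
  using moderate_power[OF moderate_inverse_aut[OF assms]] moderate_power[OF moderate_aut]
  by (cases "n \<ge> 0") (auto simp: power_int_def)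

lemma moderate_aut_quot:
  assumes "det A = 1" shows "aut_quot A \<in> moderate"
  using moderate_cmult[OF moderate_inverse_aut[OF assms], of "of_real (A$2$1)"]
  by (simp add: aut_quot_def[abs_def] divide_inverse)

text \<open>\<open>X\<^sub>A - X\<^sub>B\<close> is a constant divided by the two automorphy factors, so it vanishes everywhere or nowhere.\<close>

lemma moderate_aut_quot_diff:
  assumes "det A = 1" "det B = 1" "aut_quot A \<i> \<noteq> aut_quot B \<i>"
  shows "(\<lambda>z. inverse (aut_quot A z - aut_quot B z)) \<in> moderate" "\<And>z. z \<in> uhp \<Longrightarrow> aut_quot A z \<noteq> aut_quot B z"
proof -
  define e :: complex where "e = of_real (A$2$1 * B$2$2 - B$2$1 * A$2$2)"
  have d: "aut_quot A z - aut_quot B z = e / (aut_factor A z * aut_factor B z)" if "z \<in> uhp" for z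
  proof -
    have j: "aut_factor A z \<noteq> 0" "aut_factor B z \<noteq> 0" using aut_factor_nz assms that by auto
    have "aut_quot A z - aut_quot B z = (of_real (A$2$1) * aut_factor B z - of_real (B$2$1) * aut_factor A z) / (aut_factor A z * aut_factor B z)"
      unfolding aut_quot_def using j by (simp add: field_simps)
    also have "of_real (A$2$1) * aut_factor B z - of_real (B$2$1) * aut_factor A z = e"
      unfolding e_def aut_factor_def by (simp add: algebra_simps)
    finally show ?thesis .
  qed
  have e: "e \<noteq> 0" using d[of \<i>] assms(3) by auto
  show "aut_quot A z \<noteq> aut_quot B z" if "z \<in> uhp" for z
    using d[OF that] e aut_factor_nz assms that by (metis divide_eq_0_iff mult_eq_0_iff right_minus_eq)
  have "(\<lambda>z. inverse e * (aut_factor A z * aut_factor B z)) \<in> moderate"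
    by (intro moderate_cmult moderate_mult moderate_aut)
  then show "(\<lambda>z. inverse (aut_quot A z - aut_quot B z)) \<in> moderate"
    by (rule moderate_cong) (simp only: d, simp add: divide_inverse)
qed

text \<open>If the values of a polynomial of degree at most \<open>p\<close> at \<open>p + 1\<close> points and the inverse differences of these points
  lie in the ring, so do its coefficients. Dividing \<open>a(t) - a(y)\<close> by \<open>t - y\<close>, where \<open>y\<close> is the last
  point, gives a polynomial of smaller degree whose values at the other points are divided differences;
  its coefficients are the tails \<open>b (Suc l)\<close> of Horner's scheme.\<close>

lemma moderate_interpolation:
  fixes a g x :: "nat \<Rightarrow> complex \<Rightarrow> complex"
  assumes "\<And>i. i \<le> p \<Longrightarrow> x i \<in> moderate" "\<And>i. i \<le> p \<Longrightarrow> g i \<in> moderate"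
    and "\<And>i l. i < l \<Longrightarrow> l \<le> p \<Longrightarrow> (\<lambda>z. inverse (x i z - x l z)) \<in> moderate"
    and "\<And>i l z. i < l \<Longrightarrow> l \<le> p \<Longrightarrow> z \<in> uhp \<Longrightarrow> x i z \<noteq> x l z"
    and "\<And>i z. i \<le> p \<Longrightarrow> z \<in> uhp \<Longrightarrow> (\<Sum>j\<le>p. a j z * x i z ^ j) = g i z"
    and "j \<le> p"
  shows "a j \<in> moderate"
  using assms
proof (induction p arbitrary: a g j)
  case 0
  show ?case by (rule moderate_cong[OF "0.prems"(2)[of 0]]) (use 0 in auto)
next
  case (Suc p)
  define y where "y = x (Suc p)"
  define b where "b l z = (\<Sum>i=l..Suc p. a i z * y z ^ (i - l))" for l z
  have y: "y \<in> moderate" using Suc.prems(1)[of "Suc p"] by (simp add: y_def)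
  have rec: "a l z = b l z - y z * b (Suc l) z" if "l \<le> Suc p" for l z
  proof -
    have "b l z = a l z + (\<Sum>i=Suc l..Suc p. a i z * y z ^ (i - l))"
      unfolding b_def using that by (subst sum.atLeast_Suc_atMost) auto
    also have "(\<Sum>i=Suc l..Suc p. a i z * y z ^ (i - l)) = (\<Sum>i=Suc l..Suc p. y z * (a i z * y z ^ (i - Suc l)))"
    proof (intro sum.cong refl)
      fix i assume "i \<in> {Suc l..Suc p}"
      then have "i - l = Suc (i - Suc l)" by auto
      then show "a i z * y z ^ (i - l) = y z * (a i z * y z ^ (i - Suc l))" by simp
    qed
    also have "\<dots> = y z * b (Suc l) z" unfolding b_def by (rule sum_distrib_left[symmetric])
    finally show ?thesis by simp
  qed
  have bS: "b (Suc l) \<in> moderate" if "l \<le> p" for l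
  proof (rule Suc.IH[of "\<lambda>i z. (g i z - g (Suc p) z) * inverse (x i z - y z)" "\<lambda>l. b (Suc l)" l])
    show "x i \<in> moderate" if "i \<le> p" for i using Suc.prems(1)[of i] that by simp
    show "(\<lambda>z. (g i z - g (Suc p) z) * inverse (x i z - y z)) \<in> moderate" if "i \<le> p" for i
      unfolding y_def using Suc.prems(2,3) that by (intro moderate_mult moderate_diff) auto
    show "(\<lambda>z. inverse (x i z - x l z)) \<in> moderate" if "i < l" "l \<le> p" for i l
      using Suc.prems(3) that by simp
    show "x i z \<noteq> x l z" if "i < l" "l \<le> p" "z \<in> uhp" for i l z using Suc.prems(4) that by simp
    show "(\<Sum>l\<le>p. b (Suc l) z * x i z ^ l) = (g i z - g (Suc p) z) * inverse (x i z - y z)" if i: "i \<le> p" and z: "z \<in> uhp" for i z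
    proof -
      have "x i z \<noteq> y z" unfolding y_def using Suc.prems(4)[of i "Suc p" z] i z by simp
      moreover have "g i z - g (Suc p) z = (x i z - y z) * (\<Sum>l\<le>p. b (Suc l) z * x i z ^ l)"
      proof -
        have "g i z - g (Suc p) z = (\<Sum>l\<le>Suc p. a l z * x i z ^ l) - (\<Sum>l\<le>Suc p. a l z * y z ^ l)"
          unfolding y_def using Suc.prems(5)[of i z] Suc.prems(5)[of "Suc p" z] i z by (simp only:)
        also have "\<dots> = (x i z - y z) * (\<Sum>l<Suc p. (\<Sum>i=Suc l..Suc p. a i z * y z ^ (i - l - 1)) * x i z ^ l)"
          by (rule polyfun_diff) simp
        finally show ?thesis unfolding b_def lessThan_Suc_atMost by simp
      qed
      ultimately show ?thesis by simp
    qed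
  qed fact
  have b: "b l \<in> moderate" for l
  proof (cases l)
    case 0
    have "g (Suc p) \<in> moderate" using Suc.prems(2) by simp
    then show ?thesis
    proof (rule moderate_cong)
      fix z assume z: "z \<in> uhp"
      have "(\<Sum>l\<le>Suc p. a l z * y z ^ l) = g (Suc p) z" using Suc.prems(5)[of "Suc p" z] z by (simp add: y_def)
      then show "g (Suc p) z = b l z" unfolding b_def 0 atLeast0AtMost by simp
    qed
  next
    case (Suc l')
    show ?thesis
    proof (cases "l' \<le> p")
      case True
      then show ?thesis using bS Suc by simp
    next
      case False
      then have "b l = (\<lambda>_. 0)" unfolding b_def[abs_def] Suc by simp
      then show ?thesis by auto
    qed
  qed
  show ?case
    by (rule moderate_cong[of "\<lambda>z. b j z - y z * b (Suc j) z"]) (use moderate_diff[OF b moderate_mult[OF y b]] rec[OF Suc.prems(6)] in simp_all)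
qed

text \<open>Cauchy's estimate on the disc of radius \<open>Im z / 2\<close>, which is contained in the hyperbolic disc about \<open>z\<close>, where the
  height is comparable to that of \<open>z\<close>.\<close>

lemma moderate_deriv:
  assumes "f \<in> moderate" shows "D_uhp f \<in> moderate"
proof -
  have fh: "f holomorphic_on uhp" using assms by (simp add: moderate_def)
  obtain C N where C: "C \<ge> 0" "\<And>z. z \<in> uhp \<Longrightarrow> cmod (f z) \<le> C * height z ^ N"
    using assms(1) moderate_growthE unfolding moderate_def by blast
  have "cmod (deriv f z) \<le> (2 * C * 24 ^ N) * height z ^ (N + 1)" if z: "z \<in> uhp" for z
  proof -
    define r where "r = Im z / 2"
    have r: "r > 0" using z by (simp add: r_def)
    have sub: "cball z r \<subseteq> uhp"
    proof
      fix w assume "w \<in> cball z r"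
      then have "\<bar>Im (z - w)\<bar> \<le> r" using abs_Im_le_cmod[of "z - w"] by (simp add: dist_norm)
      moreover have "Im z - Im w \<le> \<bar>Im (z - w)\<bar>" by simp
      ultimately have "Im z - Im w \<le> Im z / 2" unfolding r_def by linarith
      moreover have "Im z > 0" using z by simp
      ultimately have "Im w > 0" by linarith
      then show "w \<in> uhp" by simp
    qed
    have "norm ((deriv ^^ 1) f z) \<le> fact 1 * (C * (24 * height z) ^ N) / r ^ 1"
    proof (rule Cauchy_inequality)
      show "f holomorphic_on ball z r" using fh sub by (meson ball_subset_cball holomorphic_on_subset)
      show "continuous_on (cball z r) f" using holomorphic_on_imp_continuous_on[OF holomorphic_on_subset[OF fh sub]] .
      fix w assume w: "cmod (z - w) = r"
      then have wu: "w \<in> uhp" using sub by (auto simp: dist_norm)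
      have "\<bar>Im (z - w)\<bar> \<le> r" using abs_Im_le_cmod[of "z - w"] w by simp
      moreover have "Im z - Im w \<le> \<bar>Im (z - w)\<bar>" by simp
      ultimately have "r \<le> Im w" unfolding r_def by linarith
      then have "r * (2 * r) \<le> Im w * Im z" using r by (intro mult_mono) (auto simp: r_def)
      moreover have "r * r < r * (2 * r)" using r by simp
      ultimately have "w \<in> hdisc z" using w wu by (simp add: hdisc_def norm_minus_commute power2_eq_square)
      then have "height w \<le> 24 * height z" using height_hdisc z by blast
      then have "C * height w ^ N \<le> C * (24 * height z) ^ N"
        using C(1) height_ge(1)[OF wu] by (intro mult_left_mono power_mono) auto
      then show "cmod (f w) \<le> C * (24 * height z) ^ N" using C(2)[OF wu] by linarith
    qed fact
    also have "\<dots> = (2 * C * 24 ^ N * height z ^ N) * (1 / Im z)"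
      by (simp add: r_def power_mult_distrib)
    also have "\<dots> \<le> (2 * C * 24 ^ N * height z ^ N) * height z"
      using C(1) height_ge[OF z] by (intro mult_left_mono) auto
    finally show ?thesis by (simp add: mult_ac)
  qed
  then have "moderate_growth (deriv f)" by (rule moderate_growthI)
  then have "deriv f \<in> moderate" using holomorphic_deriv[OF fh open_uhp] by (simp add: moderate_def)
  then show ?thesis by (rule moderate_cong) (simp add: D_uhp_def)
qed

section \<open>Quasimodular forms\<close>

context fuchsian
begin

abbreviation "QM \<equiv> quasimodular_forms \<Gamma>"
abbreviation "MF \<equiv> modular_forms \<Gamma>"
abbreviation "QE \<equiv> quasi_expansion \<Gamma>"

lemma QE_def:
  "QE k p f fs \<longleftrightarrow> (\<forall>j. on_uhp (fs j)) \<and> (\<forall>j>p. fs j = 0) \<and>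
     (\<forall>A\<in>G. \<forall>z\<in>uhp. aut_factor A z powi (- k) * f (moebius A z) = (\<Sum>j\<le>p. fs j z * aut_quot A z ^ j))"
  unfolding quasi_expansion_def aut_quot_def by (rule refl)

lemma QE_transform:
  "QE k p f fs \<Longrightarrow> A \<in> G \<Longrightarrow> z \<in> uhp \<Longrightarrow> aut_factor A z powi (- k) * f (moebius A z) = (\<Sum>j\<le>p. fs j z * aut_quot A z ^ j)"
  unfolding QE_def by blast

lemma QE_on_uhp: "QE k p f fs \<Longrightarrow> on_uhp (fs j)"
  and QE_zero: "QE k p f fs \<Longrightarrow> j > p \<Longrightarrow> fs j = 0"
  unfolding QE_def by blast+

lemma QE_mono:
  assumes "QE k p f fs" "p \<le> q" shows "QE k q f fs"
proof -
  have "(\<Sum>j\<le>p. fs j z * aut_quot A z ^ j) = (\<Sum>j\<le>q. fs j z * aut_quot A z ^ j)" for A z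
    using assms QE_zero[OF assms(1)] by (intro sum.mono_neutral_left) auto
  then show ?thesis using assms unfolding QE_def by auto
qed

text \<open>A nonzero polynomial has finitely many roots, whereas \<open>aut_quot A z\<close> takes infinitely many values.\<close>

lemma aut_quot_polynomial_unique:
  assumes z: "z \<in> uhp" and eq: "\<And>A. A \<in> G \<Longrightarrow> (\<Sum>j\<le>p. a j * aut_quot A z ^ j) = (\<Sum>j\<le>p. b j * aut_quot A z ^ j)" and j: "j \<le> p"
  shows "a j = b j"
proof (rule ccontr)
  assume "a j \<noteq> b j"
  then have "finite {x. (\<Sum>j\<le>p. (a j - b j) * x ^ j) = 0}"
    unfolding polyfun_finite_roots using j by (intro exI[of _ j]) auto
  moreover have "(\<lambda>A. aut_quot A z) ` G \<subseteq> {x. (\<Sum>j\<le>p. (a j - b j) * x ^ j) = 0}"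
  proof (rule image_subsetI, rule CollectI)
    fix A assume A: "A \<in> G"
    show "(\<Sum>j\<le>p. (a j - b j) * aut_quot A z ^ j) = 0" using eq[OF A] by (simp add: left_diff_distrib sum_subtractf)
  qed
  ultimately show False using infinite_aut_quot[OF z] finite_subset by blast
qed

lemma on_uhp_eqI:
  assumes "on_uhp f" "on_uhp g" "\<And>z. z \<in> uhp \<Longrightarrow> f z = g z" shows "f = g"
  using assms unfolding on_uhp_def by (metis ext)

lemma QE_unique:
  assumes "QE k p f fs" "QE k q f gs" shows "fs = gs"
proof (rule ext)
  fix j
  define P where "P = max (max p q) j"
  have 1: "QE k P f fs" "QE k P f gs" using assms QE_mono unfolding P_def by auto
  show "fs j = gs j"
  proof (rule on_uhp_eqI)
    fix z assume z: "z \<in> uhp"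
    show "fs j z = gs j z"
    proof (rule aut_quot_polynomial_unique[OF z])
      show "(\<Sum>j\<le>P. fs j z * aut_quot A z ^ j) = (\<Sum>j\<le>P. gs j z * aut_quot A z ^ j)" if "A \<in> G" for A
        using QE_transform[OF 1(1) that z] QE_transform[OF 1(2) that z] by simp
      show "j \<le> P" by (simp add: P_def)
    qed
  qed (use QE_on_uhp assms in auto)
qed

text \<open>The coefficient functions of a quasimodular form, padded by zero; \<open>QE_unique\<close> makes the
  description definite.\<close>

definition qcoef :: "int \<Rightarrow> (complex \<Rightarrow> complex) \<Rightarrow> nat \<Rightarrow> complex \<Rightarrow> complex" where
  "qcoef k f = (THE fs. \<exists>p. QE k p f fs)"

lemma qcoef_eq: "QE k p f fs \<Longrightarrow> qcoef k f = fs"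
  unfolding qcoef_def using QE_unique by blast

lemma delta_eq: "QE k p f fs \<Longrightarrow> delta \<Gamma> k f = fs 1"
  unfolding delta_def using QE_unique by blast

lemma QE_0:
  assumes "QE k p f fs" "on_uhp f" shows "fs 0 = f"
proof (rule on_uhp_eqI[OF QE_on_uhp[OF assms(1)] assms(2)])
  fix z assume z: "z \<in> uhp"
  have x: "aut_quot (mat 1) z = 0" by (simp add: aut_quot_def mat_1_2)
  have "f z = (\<Sum>j\<le>p. fs j z * 0 ^ j)"
    using QE_transform[OF assms(1) one_G z] unfolding x by simp
  also have "\<dots> = fs 0 z" by (simp add: sum.atMost_shift)
  finally show "fs 0 z = f z" by simp
qed

text \<open>Choose \<open>p + 1\<close> matrices with different values of \<open>X\<^sub>A\<close>; the expansion at these is a polynomial interpolation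
  problem with data in the ring of functions of moderate growth.\<close>

lemma QE_moderate:
  assumes Q: "QE k p f fs" and f: "f \<in> moderate" shows "fs j \<in> moderate"
proof (cases "j \<le> p")
  case False
  then have "fs j = (\<lambda>_. 0)" using QE_zero[OF Q] by (auto simp: zero_fun_def)
  then show ?thesis by auto
next
  case True
  obtain S where S: "S \<subseteq> (\<lambda>A. aut_quot A \<i>) ` G" "finite S" "card S = Suc p"
    using infinite_arbitrarily_large[OF infinite_aut_quot_i] by blast
  obtain e where e: "bij_betw e {0..<Suc p} S" using ex_bij_betw_nat_finite[OF S(2)] S(3) by auto
  have "\<exists>A\<in>G. aut_quot A \<i> = e i" if "i \<le> p" for i
  proof -
    have "e i \<in> S" using bij_betwE[OF e] that by auto
    then have "e i \<in> (\<lambda>A. aut_quot A \<i>) ` G" using S(1) by blast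
    then show ?thesis by (metis imageE)
  qed
  then obtain A where A: "\<And>i. i \<le> p \<Longrightarrow> A i \<in> G" "\<And>i. i \<le> p \<Longrightarrow> aut_quot (A i) \<i> = e i" by metis
  have ne: "aut_quot (A i) \<i> \<noteq> aut_quot (A l) \<i>" if "i < l" "l \<le> p" for i l
  proof -
    have "e i \<noteq> e l" using bij_betw_imp_inj_on[OF e] that by (auto dest: inj_onD)
    then show ?thesis using A(2)[of i] A(2)[of l] that by simp
  qed
  have dA: "det (A i) = 1" if "i \<le> p" for i using A(1)[OF that] by (rule det_G)
  show ?thesis
  proof (rule moderate_interpolation[where p = p and x = "\<lambda>i. aut_quot (A i)" and g = "\<lambda>i z. aut_factor (A i) z powi (- k) * f (moebius (A i) z)"])
    show "aut_quot (A i) \<in> moderate" if "i \<le> p" for i using moderate_aut_quot[OF dA[OF that]] .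
    show "(\<lambda>z. aut_factor (A i) z powi (- k) * f (moebius (A i) z)) \<in> moderate" if "i \<le> p" for i
      by (intro moderate_mult moderate_aut_powi moderate_compose f dA[OF that])
    show "(\<lambda>z. inverse (aut_quot (A i) z - aut_quot (A l) z)) \<in> moderate" if "i < l" "l \<le> p" for i l
      using moderate_aut_quot_diff(1)[OF dA dA ne[OF that]] that by simp
    show "aut_quot (A i) z \<noteq> aut_quot (A l) z" if "i < l" "l \<le> p" "z \<in> uhp" for i l z
      using moderate_aut_quot_diff(2)[OF dA dA ne[OF that(1,2)] that(3)] that by simp
    show "(\<Sum>j\<le>p. fs j z * aut_quot (A i) z ^ j) = aut_factor (A i) z powi (- k) * f (moebius (A i) z)" if "i \<le> p" "z \<in> uhp" for i z
      using QE_transform[OF Q A(1)[OF that(1)] that(2)] by simp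
  qed fact
qed

text \<open>Expanding \<open>f (B (A z))\<close> at \<open>A z\<close> and expanding \<open>f ((B A) z)\<close> at \<open>z\<close> gives two polynomials in
  \<open>x = X\<^sub>B(A z)\<close> with the same values for all \<open>B\<close>, because \<open>X\<^sub>B\<^sub>A(z) = x / j(A, z)\<^sup>2 + X\<^sub>A(z)\<close>. Comparing
  coefficients expresses \<open>f\<^sub>i (A z)\<close> through the \<open>f\<^sub>l z\<close>; the binomial coefficients come from expanding the
  powers of this sum.\<close>

lemma QE_coefficient:
  assumes Q: "QE k p f fs"
  shows "QE (k - 2 * int i) p (fs i) (\<lambda>m. cscale (of_nat ((i + m) choose i)) (fs (i + m)))"
  unfolding QE_def
proof (intro conjI allI impI ballI)
  show "on_uhp (cscale (of_nat ((i + m) choose i)) (fs (i + m)))" for m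
    using QE_on_uhp[OF Q] by (auto simp: on_uhp_def cscale_def)
  show "cscale (of_nat ((i + m) choose i)) (fs (i + m)) = 0" if "m > p" for m
    using QE_zero[OF Q, of "i + m"] that by (simp add: cscale_def fun_eq_iff)
next
  fix A z assume A: "A \<in> G" and z: "z \<in> uhp"
  define j where "j = aut_factor A z"
  have j: "j \<noteq> 0" unfolding j_def using aut_factor_nz[of A z] A z by simp
  have mz: "moebius A z \<in> uhp" using A z by simp
  define c where "c i = (\<Sum>l\<le>p. of_nat (l choose i) * fs l z * aut_quot A z ^ (l - i)) / j ^ (2 * i)" for i
  have poly: "(\<Sum>l\<le>p. (j powi (- k) * fs l (moebius A z)) * aut_quot B (moebius A z) ^ l) = (\<Sum>i\<le>p. c i * aut_quot B (moebius A z) ^ i)" if B: "B \<in> G" for B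
  proof -
    define x where "x = aut_quot B (moebius A z)"
    have BA: "B ** A \<in> G" using B A by (rule mult_G)
    have "(\<Sum>l\<le>p. (j powi (- k) * fs l (moebius A z)) * x ^ l) = j powi (- k) * (aut_factor B (moebius A z) powi (- k) * f (moebius B (moebius A z)))"
      unfolding QE_transform[OF Q B mz] x_def by (simp add: sum_distrib_left mult.assoc)
    also have "\<dots> = aut_factor (B ** A) z powi (- k) * f (moebius (B ** A) z)"
      using A B z by (simp add: moebius_mult aut_factor_mult power_int_mult_distrib j_def)
    also have "\<dots> = (\<Sum>l\<le>p. fs l z * aut_quot (B ** A) z ^ l)" by (rule QE_transform[OF Q BA z])
    also have "\<dots> = (\<Sum>l\<le>p. fs l z * (x / j\<^sup>2 + aut_quot A z) ^ l)"
      using aut_quot_mult[of A B z] A B z by (simp add: x_def j_def)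
    also have "\<dots> = (\<Sum>l\<le>p. \<Sum>i\<le>p. of_nat (l choose i) * fs l z * aut_quot A z ^ (l - i) / j ^ (2 * i) * x ^ i)"
    proof (intro sum.cong refl)
      fix l assume l: "l \<in> {..p}"
      have "(x / j\<^sup>2 + aut_quot A z) ^ l = (\<Sum>i\<le>l. of_nat (l choose i) * (x / j\<^sup>2) ^ i * aut_quot A z ^ (l - i))"
        by (rule binomial_ring)
      also have "\<dots> = (\<Sum>i\<le>p. of_nat (l choose i) * (x / j\<^sup>2) ^ i * aut_quot A z ^ (l - i))"
        using l by (intro sum.mono_neutral_left) (auto simp: binomial_eq_0)
      finally have *: "(x / j\<^sup>2 + aut_quot A z) ^ l = (\<Sum>i\<le>p. of_nat (l choose i) * (x / j\<^sup>2) ^ i * aut_quot A z ^ (l - i))" .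
      show "fs l z * (x / j\<^sup>2 + aut_quot A z) ^ l = (\<Sum>i\<le>p. of_nat (l choose i) * fs l z * aut_quot A z ^ (l - i) / j ^ (2 * i) * x ^ i)"
      proof -
        have "(x / j\<^sup>2) ^ i = x ^ i / j ^ (2 * i)" for i by (simp only: power_divide power_mult)
        then show ?thesis unfolding * by (simp add: sum_distrib_left mult_ac)
      qed
    qed
    also have "\<dots> = (\<Sum>i\<le>p. c i * x ^ i)"
      by (subst sum.swap) (simp add: c_def sum_distrib_right sum_divide_distrib)
    finally show ?thesis unfolding x_def .
  qed
  show "aut_factor A z powi (- (k - 2 * int i)) * fs i (moebius A z) = (\<Sum>m\<le>p. cscale (of_nat ((i + m) choose i)) (fs (i + m)) z * aut_quot A z ^ m)"
  proof (cases "i \<le> p")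
    case False
    then show ?thesis using QE_zero[OF Q] by (simp add: cscale_def)
  next
    case True
    have "j powi (- k) * fs i (moebius A z) = c i"
      using aut_quot_polynomial_unique[where p = p and a = "\<lambda>l. j powi (- k) * fs l (moebius A z)" and b = c and j = i, OF mz poly True] .
    moreover have "j powi (- (k - 2 * int i)) = j ^ (2 * i) * j powi (- k)"
    proof -
      have "j powi (- (k - 2 * int i)) = j powi (int (2 * i) + (- k))" by (rule arg_cong[of _ _ "power_int j"]) simp
      also have "\<dots> = j powi int (2 * i) * j powi (- k)" using j by (intro power_int_add) simp
      also have "j powi int (2 * i) = j ^ (2 * i)" by (rule power_int_of_nat)
      finally show ?thesis .
    qed
    ultimately have "j powi (- (k - 2 * int i)) * fs i (moebius A z) = j ^ (2 * i) * c i" by simp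
    also have "\<dots> = (\<Sum>l\<le>p. of_nat (l choose i) * fs l z * aut_quot A z ^ (l - i))" using j by (simp add: c_def)
    also have "\<dots> = (\<Sum>m\<le>p. of_nat ((i + m) choose i) * fs (i + m) z * aut_quot A z ^ m)"
    proof -
      define g where "g l = of_nat (l choose i) * fs l z * aut_quot A z ^ (l - i)" for l
      have "(\<Sum>l\<le>p. g l) = (\<Sum>l\<in>{i..p}. g l)"
        by (rule sum.mono_neutral_right) (auto simp: g_def binomial_eq_0)
      also have "\<dots> = (\<Sum>m\<le>p - i. g (i + m))"
        by (rule sum.reindex_bij_witness[where i = "\<lambda>m. i + m" and j = "\<lambda>l. l - i"]) (use True in auto)
      also have "\<dots> = (\<Sum>m\<le>p. g (i + m))"
      proof (rule sum.mono_neutral_left)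
        show "\<forall>m\<in>{..p} - {..p - i}. g (i + m) = 0"
        proof
          fix m assume "m \<in> {..p} - {..p - i}"
          then have "i + m > p" by auto
          then have "fs (i + m) = 0" by (rule QE_zero[OF Q])
          then show "g (i + m) = 0" by (simp add: g_def)
        qed
      qed auto
      finally show ?thesis by (simp add: g_def)
    qed
    finally show ?thesis by (simp add: j_def cscale_def)
  qed
qed

lemma D_uhp_0: "D_uhp 0 = 0"
  by (simp add: D_uhp_def fun_eq_iff zero_fun_def)

lemma has_field_derivative_uhp:
  "f \<in> moderate \<Longrightarrow> z \<in> uhp \<Longrightarrow> (f has_field_derivative D_uhp f z) (at z)"
  unfolding moderate_def D_uhp_def using holomorphic_derivI[of f uhp z] open_uhp by auto

text \<open>Differentiate the transformation law: \<open>X\<^sub>A' = - X\<^sub>A\<^sup>2\<close>, and the derivative of the factor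
  \<open>j powi (- k)\<close> contributes \<open>- k X\<^sub>A\<close> times the expansion.\<close>

lemma QE_deriv:
  assumes Q: "QE k p f fs" and f: "f \<in> moderate"
  shows "QE (k + 2) (Suc p) (D_uhp f)
    (\<lambda>m. D_uhp (fs m) + (if m = 0 then 0 else cscale (of_int (k - int m + 1)) (fs (m - 1))))"
  unfolding QE_def
proof (intro conjI allI impI ballI)
  show "on_uhp (D_uhp (fs m) + (if m = 0 then 0 else cscale (of_int (k - int m + 1)) (fs (m - 1))))" for m
    using QE_on_uhp[OF Q] by (auto simp: on_uhp_def cscale_def D_uhp_def)
  show "D_uhp (fs m) + (if m = 0 then 0 else cscale (of_int (k - int m + 1)) (fs (m - 1))) = 0" if "m > Suc p" for m
  proof -
    have "fs m = 0" "fs (m - 1) = 0" using that by (auto intro!: QE_zero[OF Q])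
    then show ?thesis by (simp add: D_uhp_0)
  qed
next
  fix A z assume A: "A \<in> G" and z: "z \<in> uhp"
  define j where "j = aut_factor A z"
  define c where "c = complex_of_real (A$2$1)"
  define Y where "Y = aut_quot A z"
  have dA: "det A = 1" using A by (rule det_G)
  have j: "j \<noteq> 0" unfolding j_def by (rule aut_factor_nz[OF dA z])
  have Y: "Y = c / j" by (simp add: Y_def aut_quot_def c_def j_def)
  have mz: "moebius A z \<in> uhp" using dA z by simp
  have fsm: "fs l \<in> moderate" for l by (rule QE_moderate[OF Q f])
  have L: "((\<lambda>z. aut_factor A z powi (- k) * f (moebius A z)) has_field_derivative
      (of_int (- k) * j powi (- k - 1) * c * f (moebius A z) + j powi (- k) * (D_uhp f (moebius A z) * (1 / j\<^sup>2)))) (at z)"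
  proof -
    have 1: "((\<lambda>z. aut_factor A z powi (- k)) has_field_derivative of_int (- k) * j powi (- k - 1) * c) (at z)"
      unfolding j_def c_def
      by (rule DERIV_power_int[OF aut_factor_has_derivative]) (use j j_def in auto)
    have 2: "((\<lambda>z. f (moebius A z)) has_field_derivative D_uhp f (moebius A z) * (1 / j\<^sup>2)) (at z)"
      unfolding j_def by (rule DERIV_chain2[OF has_field_derivative_uhp[OF f mz] moebius_has_derivative[OF dA z]])
    show ?thesis by (rule DERIV_cong[OF DERIV_mult[OF 1 2]]) (simp add: j_def mult_ac)
  qed
  have XD: "(aut_quot A has_field_derivative - Y\<^sup>2) (at z)"
  proof -
    have "((\<lambda>z. c / aut_factor A z) has_field_derivative - Y\<^sup>2) (at z)"
      using j aut_factor_has_derivative[of A z] unfolding Y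
      by (auto intro!: derivative_eq_intros simp: j_def c_def power2_eq_square)
    then show ?thesis by (simp add: aut_quot_def[abs_def] c_def)
  qed
  have R: "((\<lambda>z. \<Sum>l\<le>p. fs l z * aut_quot A z ^ l) has_field_derivative
      (\<Sum>l\<le>p. D_uhp (fs l) z * Y ^ l - of_nat l * fs l z * Y ^ Suc l)) (at z)"
  proof (rule DERIV_sum)
    fix l
    have D: "((\<lambda>z. fs l z * aut_quot A z ^ l) has_field_derivative D_uhp (fs l) z * aut_quot A z ^ l + of_nat l * aut_quot A z ^ (l - Suc 0) * (- Y\<^sup>2) * fs l z) (at z)"
      by (rule DERIV_mult[OF has_field_derivative_uhp[OF fsm z]])
         (use DERIV_power[OF XD, of l] in \<open>simp add: mult_ac\<close>)
    have eq: "of_nat l * aut_quot A z ^ (l - Suc 0) * (- Y\<^sup>2) * fs l z = - (of_nat l * fs l z * Y ^ Suc l)"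
      by (cases l) (auto simp: Y_def power2_eq_square mult_ac)
    show "((\<lambda>z. fs l z * aut_quot A z ^ l) has_field_derivative D_uhp (fs l) z * Y ^ l - of_nat l * fs l z * Y ^ Suc l) (at z)"
      by (rule DERIV_cong[OF D], simp only: eq) (simp add: Y_def)
  qed
  have "((\<lambda>z. \<Sum>l\<le>p. fs l z * aut_quot A z ^ l) has_field_derivative
      (of_int (- k) * j powi (- k - 1) * c * f (moebius A z) + j powi (- k) * (D_uhp f (moebius A z) * (1 / j\<^sup>2)))) (at z)"
    by (rule has_field_derivative_transform_within_open[OF L open_uhp z]) (rule QE_transform[OF Q A])
  then have T1: "of_int (- k) * j powi (- k - 1) * c * f (moebius A z) + j powi (- k) * (D_uhp f (moebius A z) * (1 / j\<^sup>2))
     = (\<Sum>l\<le>p. D_uhp (fs l) z * Y ^ l - of_nat l * fs l z * Y ^ Suc l)"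
    using R by (rule DERIV_unique)
  have T2: "of_int (- k) * j powi (- k - 1) * c * f (moebius A z) = - of_int k * Y * (\<Sum>l\<le>p. fs l z * Y ^ l)"
  proof -
    have "j powi (- k - 1) = j powi (- k) / j" using j by (simp add: power_int_diff)
    then have "of_int (- k) * j powi (- k - 1) * c * f (moebius A z) = - of_int k * Y * (j powi (- k) * f (moebius A z))"
      by (simp add: Y)
    then show ?thesis using QE_transform[OF Q A z] by (simp add: j_def Y_def)
  qed
  have T3: "j powi (- k) * (D_uhp f (moebius A z) * (1 / j\<^sup>2)) = j powi (- (k + 2)) * D_uhp f (moebius A z)"
  proof -
    have "j powi (- (k + 2)) = j powi (- k - 2)" by (rule arg_cong[of _ _ "power_int j"]) simp
    also have "\<dots> = j powi (- k) / j\<^sup>2" using j by (simp add: power_int_diff)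
    finally show ?thesis by simp
  qed
  have "j powi (- (k + 2)) * D_uhp f (moebius A z) = (\<Sum>l\<le>p. D_uhp (fs l) z * Y ^ l - of_nat l * fs l z * Y ^ Suc l) + of_int k * Y * (\<Sum>l\<le>p. fs l z * Y ^ l)"
    unfolding T1[symmetric] T2 T3 by simp
  also have "\<dots> = (\<Sum>l\<le>p. D_uhp (fs l) z * Y ^ l) + (\<Sum>l\<le>p. of_int (k - int l) * fs l z * Y ^ Suc l)"
    by (simp add: sum_distrib_left sum.distrib[symmetric] sum_subtractf algebra_simps)
  also have "(\<Sum>l\<le>p. D_uhp (fs l) z * Y ^ l) = (\<Sum>l\<le>Suc p. D_uhp (fs l) z * Y ^ l)"
    using QE_zero[OF Q, of "Suc p"] by (simp add: D_uhp_def zero_fun_def)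
  also have "(\<Sum>l\<le>p. of_int (k - int l) * fs l z * Y ^ Suc l) = (\<Sum>m\<le>Suc p. (if m = 0 then 0 else cscale (of_int (k - int m + 1)) (fs (m - 1))) z * Y ^ m)"
    by (subst sum.atMost_Suc_shift) (simp add: cscale_def)
  finally show "aut_factor A z powi (- (k + 2)) * D_uhp f (moebius A z) =
     (\<Sum>m\<le>Suc p. (D_uhp (fs m) + (if m = 0 then 0 else cscale (of_int (k - int m + 1)) (fs (m - 1)))) z * aut_quot A z ^ m)"
    by (simp add: j_def Y_def sum.distrib[symmetric] distrib_right del: sum.atMost_Suc)
qed

end

section \<open>The \<open>sl\<^sub>2\<close>-action on quasimodular forms\<close>

context fuchsian
begin

lemma QM_iff: "f \<in> QM k \<longleftrightarrow> on_uhp f \<and> f \<in> moderate \<and> (\<exists>p fs. QE k p f fs)"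
  by (auto simp: quasimodular_forms_def moderate_def)

lemma QE_qcoef:
  assumes "f \<in> QM k" obtains p where "QE k p f (qcoef k f)"
  using assms qcoef_eq unfolding QM_iff by blast

lemma on_uhp_add: "on_uhp f \<Longrightarrow> on_uhp g \<Longrightarrow> on_uhp (f + g)"
  and on_uhp_cscale: "on_uhp f \<Longrightarrow> on_uhp (cscale c f)"
  by (auto simp: on_uhp_def cscale_def)

lemma moderate_plus: "f \<in> moderate \<Longrightarrow> g \<in> moderate \<Longrightarrow> f + g \<in> moderate"
  using moderate_add[of f g] by (simp add: plus_fun_def)

lemma moderate_cscale: "f \<in> moderate \<Longrightarrow> cscale c f \<in> moderate"
  using moderate_cmult[of f c] by (simp add: cscale_def)

lemma QE_add:
  assumes "QE k p f fs" "QE k q g gs" shows "QE k (max p q) (f + g) (\<lambda>j. fs j + gs j)"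
proof -
  have "QE k (max p q) f fs" "QE k (max p q) g gs" using assms QE_mono by auto
  then show ?thesis unfolding QE_def using on_uhp_add
    by (auto simp: distrib_left distrib_right sum.distrib)
qed

lemma QE_cscale:
  assumes "QE k p f fs" shows "QE k p (cscale c f) (\<lambda>j. cscale c (fs j))"
  unfolding QE_def
proof (intro conjI allI impI ballI)
  show "on_uhp (cscale c (fs j))" for j by (intro on_uhp_cscale QE_on_uhp[OF assms])
  show "cscale c (fs j) = 0" if "j > p" for j using QE_zero[OF assms that] by simp
  fix A z assume A: "A \<in> G" and z: "z \<in> uhp"
  have "aut_factor A z powi (- k) * cscale c f (moebius A z) = c * (aut_factor A z powi (- k) * f (moebius A z))"
    by (simp add: cscale_def)
  also have "\<dots> = (\<Sum>j\<le>p. cscale c (fs j) z * aut_quot A z ^ j)"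
    unfolding QE_transform[OF assms A z] by (simp add: cscale_def sum_distrib_left mult.assoc)
  finally show "aut_factor A z powi (- k) * cscale c f (moebius A z) = (\<Sum>j\<le>p. cscale c (fs j) z * aut_quot A z ^ j)" .
qed

lemma QE_zero_form: "QE k 0 0 (\<lambda>_. 0)"
  by (auto simp: QE_def on_uhp_def)

lemma QM_0 [simp]: "0 \<in> QM k"
  unfolding QM_iff using QE_zero_form moderate_const[of 0] by (auto simp: on_uhp_def zero_fun_def)

lemma
  assumes f: "f \<in> QM k" and g: "g \<in> QM k"
  shows QM_add: "f + g \<in> QM k" and qcoef_add: "qcoef k (f + g) j = qcoef k f j + qcoef k g j"
proof -
  obtain p where p: "QE k p f (qcoef k f)" using f by (rule QE_qcoef)
  obtain q where q: "QE k q g (qcoef k g)" using g by (rule QE_qcoef)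
  note QE_add[OF p q]
  then show "f + g \<in> QM k" "qcoef k (f + g) j = qcoef k f j + qcoef k g j"
    using f g qcoef_eq[OF QE_add[OF p q]] unfolding QM_iff by (auto simp: on_uhp_add moderate_plus)
qed

lemma
  assumes f: "f \<in> QM k"
  shows QM_cscale: "cscale c f \<in> QM k" and qcoef_cscale: "qcoef k (cscale c f) j = cscale c (qcoef k f j)"
proof -
  obtain p where p: "QE k p f (qcoef k f)" using f by (rule QE_qcoef)
  show "cscale c f \<in> QM k" "qcoef k (cscale c f) j = cscale c (qcoef k f j)"
    using f QE_cscale[OF p] qcoef_eq[OF QE_cscale[OF p]] unfolding QM_iff by (auto simp: on_uhp_cscale moderate_cscale)
qed

lemma qcoef_zero_form [simp]: "qcoef k 0 j = 0"
  using qcoef_eq[OF QE_zero_form] by simp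

lemma QM_sum:
  assumes "\<And>i. i \<in> I \<Longrightarrow> f i \<in> QM k"
  shows "(\<Sum>i\<in>I. f i) \<in> QM k" and "qcoef k (\<Sum>i\<in>I. f i) j = (\<Sum>i\<in>I. qcoef k (f i) j)"
proof -
  have "(\<Sum>i\<in>I. f i) \<in> QM k \<and> qcoef k (\<Sum>i\<in>I. f i) j = (\<Sum>i\<in>I. qcoef k (f i) j)"
    using assms by (induction I rule: infinite_finite_induct) (simp_all add: QM_add qcoef_add)
  then show "(\<Sum>i\<in>I. f i) \<in> QM k" "qcoef k (\<Sum>i\<in>I. f i) j = (\<Sum>i\<in>I. qcoef k (f i) j)" by auto
qed

lemma qcoef_0: "f \<in> QM k \<Longrightarrow> qcoef k f 0 = f"
  using QE_0 QE_qcoef unfolding QM_iff by metis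

lemma QE_modular:
  assumes "on_uhp f"
  shows "QE k 0 f (\<lambda>j. if j = 0 then f else 0) \<longleftrightarrow> (\<forall>A\<in>G. \<forall>z\<in>uhp. aut_factor A z powi (- k) * f (moebius A z) = f z)"
  using assms unfolding QE_def by (auto simp: on_uhp_def)

lemma MF_iff: "f \<in> MF k \<longleftrightarrow> f \<in> QM k \<and> (\<forall>j>0. qcoef k f j = 0)"
proof
  assume f: "f \<in> MF k"
  then have u: "on_uhp f" "f \<in> moderate" and Q: "QE k 0 f (\<lambda>j. if j = 0 then f else 0)"
    using QE_modular unfolding modular_forms_def moderate_def by auto
  then show "f \<in> QM k \<and> (\<forall>j>0. qcoef k f j = 0)" unfolding QM_iff using qcoef_eq[OF Q] by auto
next
  assume f: "f \<in> QM k \<and> (\<forall>j>0. qcoef k f j = 0)"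
  then have u: "on_uhp f" "f \<in> moderate" unfolding QM_iff by auto
  obtain p where p: "QE k p f (qcoef k f)" using f QE_qcoef by blast
  have eq: "qcoef k f = (\<lambda>j. if j = 0 then f else 0)" using f qcoef_0 by auto
  have "aut_factor A z powi (- k) * f (moebius A z) = f z" if A: "A \<in> G" and z: "z \<in> uhp" for A z
    using QE_transform[OF p A z] unfolding eq by (simp add: sum.atMost_shift)
  then show "f \<in> MF k" using u unfolding modular_forms_def moderate_def by blast
qed

lemma MF_QM: "f \<in> MF k \<Longrightarrow> f \<in> QM k"
  by (simp add: MF_iff)

lemma subspace_MF: "cfun.subspace (MF k)"
  by (rule cfun.subspaceI) (auto simp: MF_iff QM_add QM_cscale qcoef_add qcoef_cscale)

lemma MF_neg: "k < 0 \<Longrightarrow> f \<in> MF k \<Longrightarrow> f = 0"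
proof -
  assume k: "k < 0" and f: "f \<in> MF k"
  have u: "on_uhp f" using f by (simp add: modular_forms_def)
  have "f \<in> MF (- int (nat (- k)))" using f k by simp
  then have "\<forall>z\<in>uhp. f z = 0" using no_negative_weight[of f "nat (- k)"] k by fastforce
  then show "f = 0" using u by (intro on_uhp_eqI) (auto simp: on_uhp_def)
qed

lemma one_MF: "one_uhp \<in> MF 0"
proof -
  have "one_uhp \<in> moderate" by (rule moderate_cong[OF moderate_const[of 1]]) (simp add: one_uhp_def)
  moreover have "aut_factor A z powi (- 0) * one_uhp (moebius A z) = one_uhp z" if "A \<in> G" "z \<in> uhp" for A z
    using that(2) det_G[OF that(1)] by (simp add: one_uhp_def)
  moreover have "on_uhp one_uhp" by (simp add: one_uhp_def on_uhp_def)
  ultimately show ?thesis unfolding modular_forms_def moderate_def by blast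
qed

lemma one_uhp_nz: "one_uhp \<noteq> 0"
proof
  assume "one_uhp = 0"
  then have "one_uhp \<i> = 0" by simp
  then show False by (simp add: one_uhp_def)
qed

lemma MF_0:
  assumes "f \<in> MF 0" obtains c where "f = cscale c one_uhp"
proof -
  have u: "on_uhp f" using assms by (simp add: modular_forms_def)
  have "\<exists>c. \<forall>z\<in>uhp. f z = c"
  proof (cases "\<exists>z\<in>uhp. f z \<noteq> 0")
    case True
    then show ?thesis using no_negative_weight[of f 0] assms by simp
  qed auto
  then obtain c where "\<forall>z\<in>uhp. f z = c" by blast
  then have "f = cscale c one_uhp" using u by (intro on_uhp_eqI) (auto simp: on_uhp_def cscale_def one_uhp_def)
  then show ?thesis by (rule that)
qed

lemma MF_0_span: "MF 0 = cfun.span {one_uhp}"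
proof
  show "MF 0 \<subseteq> cfun.span {one_uhp}"
    by (metis MF_0 cfun.span_base cfun.span_scale insertI1 subsetI)
  show "cfun.span {one_uhp} \<subseteq> MF 0" using one_MF subspace_MF by (intro cfun.span_minimal) auto
qed

lemma qcoef_QM:
  assumes "f \<in> QM k" shows "qcoef k f j \<in> QM (k - 2 * int j)"
    and "qcoef (k - 2 * int j) (qcoef k f j) m = cscale (of_nat ((j + m) choose j)) (qcoef k f (j + m))"
proof -
  obtain p where p: "QE k p f (qcoef k f)" using assms by (rule QE_qcoef)
  have m: "qcoef k f j \<in> moderate" using QE_moderate[OF p] assms by (simp add: QM_iff)
  show "qcoef k f j \<in> QM (k - 2 * int j)" unfolding QM_iff using QE_on_uhp[OF p] m QE_coefficient[OF p] by blast
  show "qcoef (k - 2 * int j) (qcoef k f j) m = cscale (of_nat ((j + m) choose j)) (qcoef k f (j + m))"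
    using qcoef_eq[OF QE_coefficient[OF p]] by simp
qed

lemma qcoef_top:
  assumes "f \<in> QM k" "\<And>m. m > j \<Longrightarrow> qcoef k f m = 0"
  shows "qcoef k f j \<in> MF (k - 2 * int j)"
  unfolding MF_iff using assms qcoef_QM[OF assms(1)] by auto

text \<open>The last nonzero coefficient is modular, so its weight cannot be negative.\<close>

lemma qcoef_vanish:
  assumes f: "f \<in> QM k" and j: "2 * int j > k" shows "qcoef k f j = 0"
proof (rule ccontr)
  assume nz: "qcoef k f j \<noteq> 0"
  obtain p where p: "QE k p f (qcoef k f)" using f by (rule QE_qcoef)
  define S where "S = {m. qcoef k f m \<noteq> 0}"
  have "S \<subseteq> {..p}" unfolding S_def using QE_zero[OF p] by (auto simp: not_le[symmetric])
  then have fin: "finite S" by (rule finite_subset) simp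
  have jS: "j \<in> S" using nz by (simp add: S_def)
  define m where "m = Max S"
  have m: "m \<in> S" "j \<le> m" "\<And>l. l > m \<Longrightarrow> l \<notin> S" 
    unfolding m_def using fin jS by (auto simp: Max_ge not_le[symmetric] intro: Max_in)
  have "qcoef k f m \<in> MF (k - 2 * int m)" using m(3) by (intro qcoef_top f) (auto simp: S_def)
  then have "qcoef k f m = 0" using m(2) j by (intro MF_neg) auto
  then show False using m(1) by (simp add: S_def)
qed

lemma D_QM:
  assumes f: "f \<in> QM k"
  shows "D_uhp f \<in> QM (k + 2)"
    and "qcoef (k + 2) (D_uhp f) j = D_uhp (qcoef k f j) + (if j = 0 then 0 else cscale (of_int (k - int j + 1)) (qcoef k f (j - 1)))"
proof -
  obtain p where p: "QE k p f (qcoef k f)" using f by (rule QE_qcoef)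
  have m: "f \<in> moderate" using f by (simp add: QM_iff)
  show "D_uhp f \<in> QM (k + 2)" unfolding QM_iff using QE_deriv[OF p m] moderate_deriv[OF m]
    by (auto simp: D_uhp_def on_uhp_def)
  show "qcoef (k + 2) (D_uhp f) j = D_uhp (qcoef k f j) + (if j = 0 then 0 else cscale (of_int (k - int j + 1)) (qcoef k f (j - 1)))"
    using qcoef_eq[OF QE_deriv[OF p m]] by simp
qed

lemma D_add: "f \<in> moderate \<Longrightarrow> g \<in> moderate \<Longrightarrow> D_uhp (f + g) = D_uhp f + D_uhp g"
proof (rule on_uhp_eqI)
  fix z assume f: "f \<in> moderate" and g: "g \<in> moderate" and z: "z \<in> uhp"
  have "(f + g has_field_derivative D_uhp f z + D_uhp g z) (at z)"
    unfolding plus_fun_def by (intro DERIV_add has_field_derivative_uhp f g z)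
  then have "deriv (f + g) z = D_uhp f z + D_uhp g z" by (rule DERIV_imp_deriv)
  then show "D_uhp (f + g) z = (D_uhp f + D_uhp g) z" using z by (simp add: D_uhp_def)
qed (auto simp: D_uhp_def on_uhp_def)

lemma D_cscale: "f \<in> moderate \<Longrightarrow> D_uhp (cscale c f) = cscale c (D_uhp f)"
proof (rule on_uhp_eqI)
  fix z assume f: "f \<in> moderate" and z: "z \<in> uhp"
  have "(cscale c f has_field_derivative c * D_uhp f z) (at z)"
    unfolding cscale_def by (intro DERIV_cmult has_field_derivative_uhp f z)
  then have "deriv (cscale c f) z = c * D_uhp f z" by (rule DERIV_imp_deriv)
  then show "D_uhp (cscale c f) z = cscale c (D_uhp f) z" using z by (simp add: D_uhp_def cscale_def)
qed (auto simp: D_uhp_def on_uhp_def cscale_def)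

lemma D_one: "D_uhp one_uhp = 0"
proof (rule on_uhp_eqI)
  fix z assume z: "z \<in> uhp"
  have "(one_uhp has_field_derivative 0) (at z)"
    by (rule has_field_derivative_transform_within_open[OF DERIV_const open_uhp z]) (simp add: one_uhp_def)
  then have "deriv one_uhp z = 0" by (rule DERIV_imp_deriv)
  then show "D_uhp one_uhp z = 0 z" by (simp add: D_uhp_def)
qed (auto simp: D_uhp_def on_uhp_def)

lemma QM_moderate: "f \<in> QM k \<Longrightarrow> f \<in> moderate"
  by (simp add: QM_iff)

lemma delta_QM:
  assumes f: "f \<in> QM k"
  shows "delta \<Gamma> k f = qcoef k f 1" "delta \<Gamma> k f \<in> QM (k - 2)"
proof -
  obtain p where p: "QE k p f (qcoef k f)" using f by (rule QE_qcoef)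
  show 1: "delta \<Gamma> k f = qcoef k f 1" by (rule delta_eq[OF p])
  show "delta \<Gamma> k f \<in> QM (k - 2)" unfolding 1 using qcoef_QM(1)[OF f, of 1] by simp
qed

lemma delta_zero_form [simp]: "delta \<Gamma> k 0 = 0"
  using delta_QM(1)[OF QM_0] by simp

text \<open>The relation \<open>[\<delta>, D] = H\<close>.\<close>

lemma delta_D:
  assumes f: "f \<in> QM k"
  shows "delta \<Gamma> (k + 2) (D_uhp f) = D_uhp (delta \<Gamma> k f) + cscale (of_int k) f"
  unfolding delta_QM(1)[OF f] delta_QM(1)[OF D_QM(1)[OF f]] D_QM(2)[OF f] using qcoef_0[OF f] by simp

lemma Dpow_QM: "f \<in> QM k \<Longrightarrow> (D_uhp ^^ i) f \<in> QM (k + 2 * int i)"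
proof (induction i)
  case (Suc i)
  then show ?case using D_QM(1)[of "(D_uhp ^^ i) f" "k + 2 * int i"] by (simp add: algebra_simps)
qed simp

lemma Dpow_add: "f \<in> QM k \<Longrightarrow> g \<in> QM k \<Longrightarrow> (D_uhp ^^ i) (f + g) = (D_uhp ^^ i) f + (D_uhp ^^ i) g"
  by (induction i) (auto simp: D_add QM_moderate[OF Dpow_QM])

lemma Dpow_cscale: "f \<in> QM k \<Longrightarrow> (D_uhp ^^ i) (cscale c f) = cscale c ((D_uhp ^^ i) f)"
  by (induction i) (auto simp: D_cscale QM_moderate[OF Dpow_QM])

lemma Dpow_0 [simp]: "(D_uhp ^^ i) 0 = 0"
proof (induction i)
  case (Suc i)
  have "(D_uhp ^^ Suc i) 0 = D_uhp ((D_uhp ^^ i) 0)" by simp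
  then show ?case unfolding Suc.IH D_uhp_0 .
qed simp

text \<open>Differentiating \<open>D\<^sup>i f\<close> raises its depth by one and multiplies its last coefficient by \<open>k + i\<close>.\<close>

lemma qcoef_Dpow:
  assumes f: "f \<in> MF k"
  shows "j > i \<Longrightarrow> qcoef (k + 2 * int i) ((D_uhp ^^ i) f) j = 0"
    and "qcoef (k + 2 * int i) ((D_uhp ^^ i) f) i = cscale (pochhammer (of_int k) i) f"
proof -
  have "(\<forall>j>i. qcoef (k + 2 * int i) ((D_uhp ^^ i) f) j = 0) \<and> qcoef (k + 2 * int i) ((D_uhp ^^ i) f) i = cscale (pochhammer (of_int k) i) f"
  proof (induction i)
    case 0
    then show ?case using f qcoef_0[of f k] by (simp add: MF_iff)
  next
    case (Suc i)
    have w: "k + 2 * int (Suc i) = (k + 2 * int i) + 2" by simp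
    note q = D_QM(2)[OF Dpow_QM[OF MF_QM[OF f], of i]]
    have "qcoef (k + 2 * int (Suc i)) ((D_uhp ^^ Suc i) f) j = 0" if j: "j > Suc i" for j
    proof -
      have "qcoef (k + 2 * int i) ((D_uhp ^^ i) f) j = 0" "qcoef (k + 2 * int i) ((D_uhp ^^ i) f) (j - 1) = 0"
        using Suc.IH j by auto
      then show ?thesis using j unfolding w funpow.simps o_apply q by (simp only: D_uhp_0 cfun.scale_zero_right if_cancel add_0)
    qed
    moreover have "qcoef (k + 2 * int (Suc i)) ((D_uhp ^^ Suc i) f) (Suc i) = cscale (pochhammer (of_int k) (Suc i)) f"
    proof -
      have e: "qcoef (k + 2 * int i) ((D_uhp ^^ i) f) (Suc i) = 0" "qcoef (k + 2 * int i) ((D_uhp ^^ i) f) (Suc i - 1) = cscale (pochhammer (of_int k) i) f"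
        using Suc.IH by auto
      have "k + 2 * int i - int (Suc i) + 1 = k + int i" by simp
      then show ?thesis unfolding w funpow.simps o_apply q e D_uhp_0 pochhammer_Suc
        by (simp add: mult.commute)
    qed
    ultimately show ?case by blast
  qed
  then show "j > i \<Longrightarrow> qcoef (k + 2 * int i) ((D_uhp ^^ i) f) j = 0"
    "qcoef (k + 2 * int i) ((D_uhp ^^ i) f) i = cscale (pochhammer (of_int k) i) f" by auto
qed

lemma pochhammer_nz: "k > 0 \<Longrightarrow> pochhammer (of_int k :: complex) i \<noteq> 0"
proof
  assume k: "k > 0" and "pochhammer (of_int k :: complex) i = 0"
  then obtain l where "(of_int k :: complex) = - of_nat l" unfolding pochhammer_eq_0_iff by blast
  then have "(of_int k :: complex) = of_int (- int l)" by simp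
  then have "k = - int l" by (simp only: of_int_eq_iff)
  then show False using k by simp
qed

text \<open>The \<open>sl\<^sub>2\<close>-computation for a lowest weight vector: commute \<open>\<delta>\<close> past \<open>D\<close> repeatedly.\<close>

lemma delta_Dpow:
  assumes f: "f \<in> MF k"
  shows "delta \<Gamma> (k + 2 * int i) ((D_uhp ^^ i) f) = (if i = 0 then 0 else cscale (of_nat i * (of_int k + of_nat i - 1)) ((D_uhp ^^ (i - 1)) f))"
proof (induction i)
  case 0
  then show ?case using f delta_QM(1)[OF MF_QM[OF f]] by (simp add: MF_iff)
next
  case (Suc i)
  have fi: "(D_uhp ^^ i) f \<in> QM (k + 2 * int i)" for i using Dpow_QM[OF MF_QM[OF f]] .
  have w: "k + 2 * int (Suc i) = (k + 2 * int i) + 2" by simp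
  have "delta \<Gamma> (k + 2 * int (Suc i)) ((D_uhp ^^ Suc i) f) = D_uhp (delta \<Gamma> (k + 2 * int i) ((D_uhp ^^ i) f)) + cscale (of_int (k + 2 * int i)) ((D_uhp ^^ i) f)"
    unfolding w using delta_D[OF fi] by simp
  also have "\<dots> = cscale (of_nat (Suc i) * (of_int k + of_nat (Suc i) - 1)) ((D_uhp ^^ i) f)"
  proof (cases i)
    case 0
    then show ?thesis unfolding Suc.IH by (simp add: D_uhp_0)
  next
    case i': (Suc i')
    have "D_uhp (delta \<Gamma> (k + 2 * int i) ((D_uhp ^^ i) f)) = cscale (of_nat i * (of_int k + of_nat i - 1)) ((D_uhp ^^ i) f)"
      unfolding Suc.IH using i' QM_moderate[OF fi] by (simp add: D_cscale)
    then have "D_uhp (delta \<Gamma> (k + 2 * int i) ((D_uhp ^^ i) f)) + cscale (of_int (k + 2 * int i)) ((D_uhp ^^ i) f)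
      = cscale (of_nat i * (of_int k + of_nat i - 1) + of_int (k + 2 * int i)) ((D_uhp ^^ i) f)"
      by (simp only: cfun.scale_left_distrib)
    also have "of_nat i * (of_int k + of_nat i - 1) + of_int (k + 2 * int i) = (of_nat (Suc i) * (of_int k + of_nat (Suc i) - 1) :: complex)"
      by (simp add: algebra_simps)
    finally show ?thesis .
  qed
  finally show ?case by simp
qed

end

section \<open>Decomposition of quasimodular forms\<close>

context fuchsian
begin

lemma QM_neg: "f \<in> QM k \<Longrightarrow> k < 0 \<Longrightarrow> f = 0"
  using qcoef_vanish[of f k 0] qcoef_0[of f k] by simp

text \<open>Coefficients of the expected expansion of a form of weight \<open>m\<close> by derivatives \<open>D\<^sup>j (h j)\<close>. Only positive weights
  \<open>m - 2 j\<close> are admitted: weight \<open>0\<close> is treated separately, as derivatives of constants vanish.\<close>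

definition admissible :: "int \<Rightarrow> (nat \<Rightarrow> complex \<Rightarrow> complex) \<Rightarrow> bool" where
  "admissible m h \<longleftrightarrow> (\<forall>j. h j \<in> MF (m - 2 * int j)) \<and> (\<forall>j. m \<le> 2 * int j \<longrightarrow> h j = 0)"

text \<open>The range of summation exceeds all \<open>j\<close> with \<open>2 j < m\<close>, beyond which an admissible family vanishes; \<open>Dsum_eq\<close>
  enlarges it at will.\<close>

definition Dsum :: "int \<Rightarrow> (nat \<Rightarrow> complex \<Rightarrow> complex) \<Rightarrow> complex \<Rightarrow> complex" where
  "Dsum m h = (\<Sum>j<nat m. (D_uhp ^^ j) (h j))"

lemma admissible_MF: "admissible m h \<Longrightarrow> h j \<in> MF (m - 2 * int j)"
  and admissible_0: "admissible m h \<Longrightarrow> m \<le> 2 * int j \<Longrightarrow> h j = 0"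
  by (auto simp: admissible_def)

lemma admissible_QM: "admissible m h \<Longrightarrow> (D_uhp ^^ j) (h j) \<in> QM m"
  using Dpow_QM[OF MF_QM[OF admissible_MF[of m h j]], of j] by simp

lemma Dsum_QM: "admissible m h \<Longrightarrow> Dsum m h \<in> QM m"
  unfolding Dsum_def by (intro QM_sum admissible_QM)

lemma Dsum_eq:
  assumes "admissible m h" "nat m \<le> N" shows "Dsum m h = (\<Sum>j<N. (D_uhp ^^ j) (h j))"
  unfolding Dsum_def
proof (rule sum.mono_neutral_left)
  show "\<forall>j\<in>{..<N} - {..<nat m}. (D_uhp ^^ j) (h j) = 0"
  proof
    fix j assume "j \<in> {..<N} - {..<nat m}"
    then have "m \<le> 2 * int j" by auto
    then show "(D_uhp ^^ j) (h j) = 0" using admissible_0[OF assms(1)] Dpow_0 by metis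
  qed
qed (use assms in auto)

lemma admissible_add: "admissible m h \<Longrightarrow> admissible m h' \<Longrightarrow> admissible m (\<lambda>j. h j + h' j)"
  unfolding admissible_def using cfun.subspace_add[OF subspace_MF] by simp

lemma Dsum_add: "admissible m h \<Longrightarrow> admissible m h' \<Longrightarrow> Dsum m (\<lambda>j. h j + h' j) = Dsum m h + Dsum m h'"
  unfolding Dsum_def sum.distrib[symmetric]
  by (intro sum.cong refl Dpow_add[OF MF_QM MF_QM]) (auto intro: admissible_MF)

lemma Dsum_cscale: "admissible m h \<Longrightarrow> Dsum m (\<lambda>j. cscale c (h j)) = cscale c (Dsum m h)"
  unfolding Dsum_def cfun.scale_sum_right
  by (intro sum.cong refl Dpow_cscale[OF MF_QM]) (auto intro: admissible_MF)

lemma admissible_single: "b \<in> MF (m - 2 * int p) \<Longrightarrow> 2 * int p < m \<Longrightarrow> admissible m (\<lambda>j. if j = p then b else 0)"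
  unfolding admissible_def using cfun.subspace_0[OF subspace_MF] by auto

lemma Dsum_single: 
  assumes "2 * int p < m" shows "Dsum m (\<lambda>j. if j = p then b else 0) = (D_uhp ^^ p) b"
proof -
  have "Dsum m (\<lambda>j. if j = p then b else 0) = (\<Sum>j<nat m. if j = p then (D_uhp ^^ p) b else 0)"
    unfolding Dsum_def
  proof (intro sum.cong refl)
    fix j show "(D_uhp ^^ j) (if j = p then b else 0) = (if j = p then (D_uhp ^^ p) b else 0)"
      by (cases "j = p") (simp_all only: simp_thms if_True if_False Dpow_0)
  qed
  also have "\<dots> = (D_uhp ^^ p) b" using assms by (subst sum.delta) auto
  finally show ?thesis .
qed

lemma Dsum_0: "Dsum m (\<lambda>_. 0) = 0"
  unfolding Dsum_def by (intro sum.neutral ballI Dpow_0)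

text \<open>The terms with smaller \<open>j\<close> have smaller depth, so the coefficient in degree \<open>J\<close> sees only \<open>h J\<close>. This is the
  triangularity on which existence and uniqueness rest.\<close>

lemma Dsum_qcoef:
  assumes h: "admissible m h" and J: "\<And>j. j > J \<Longrightarrow> h j = 0"
  shows "qcoef m (Dsum m h) J = cscale (pochhammer (of_int (m - 2 * int J)) J) (h J)"
proof -
  define N where "N = max (nat m) (Suc J)"
  have "qcoef m (Dsum m h) J = (\<Sum>j<N. qcoef m ((D_uhp ^^ j) (h j)) J)"
    unfolding Dsum_eq[OF h, of N, unfolded N_def, simplified] N_def by (rule QM_sum(2)) (rule admissible_QM[OF h])
  also have "\<dots> = (\<Sum>j<N. if j = J then cscale (pochhammer (of_int (m - 2 * int J)) J) (h J) else 0)"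
  proof (intro sum.cong refl)
    fix j
    consider "j < J" | "j = J" | "j > J" by linarith
    then show "qcoef m ((D_uhp ^^ j) (h j)) J = (if j = J then cscale (pochhammer (of_int (m - 2 * int J)) J) (h J) else 0)"
    proof cases
      case 1
      then show ?thesis using qcoef_Dpow(1)[OF admissible_MF[OF h], of j J j] by simp
    next
      case 2
      then show ?thesis using qcoef_Dpow(2)[OF admissible_MF[OF h], of j J] by simp
    next
      case 3
      then show ?thesis unfolding J[OF 3] Dpow_0 by simp
    qed
  qed
  also have "\<dots> = cscale (pochhammer (of_int (m - 2 * int J)) J) (h J)"
    by (subst sum.delta) (auto simp: N_def)
  finally show ?thesis .
qed

text \<open>What is missing from the derivatives of forms of positive weight: in each weight at most one form, which
  has the maximal depth \<open>p = m / 2\<close> and whose last coefficient spans the last coefficients of all forms of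
  weight \<open>m\<close>. The two cases of the theorem differ only in this family.\<close>

definition top_family :: "(int \<Rightarrow> complex \<Rightarrow> complex) \<Rightarrow> bool" where
  "top_family e \<longleftrightarrow> (\<forall>m. e m \<in> QM m) \<and>
     (\<forall>m. e m = 0 \<or> (\<exists>p. m = 2 * int p \<and> qcoef m (e m) p \<noteq> 0)) \<and>
     (\<forall>p. \<forall>g\<in>QM (2 * int p). \<exists>c. qcoef (2 * int p) g p = cscale c (qcoef (2 * int p) (e (2 * int p)) p))"

text \<open>Induction on the number \<open>P\<close> of coefficients that may be nonzero; the last one is removed by a derivative if its
  weight \<open>m - 2 p\<close> is positive, by the top term if it is \<open>0\<close>, and is absent if it is negative.\<close>

lemma decomposition_exists:
  assumes e: "top_family e" and g: "g \<in> QM m"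
  shows "\<exists>h c. admissible m h \<and> g = Dsum m h + cscale c (e m)"
proof -
  have em: "e m \<in> QM m" using e by (simp add: top_family_def)
  have main: "\<exists>h c. admissible m h \<and> g = Dsum m h + cscale c (e m)" if "g \<in> QM m" "\<And>j. j \<ge> P \<Longrightarrow> qcoef m g j = 0" for P g
    using that
  proof (induction P arbitrary: g)
    case 0
    then have "g = 0" using qcoef_0[of g m] by (metis le0)
    moreover have "admissible m (\<lambda>_. 0)" unfolding admissible_def using cfun.subspace_0[OF subspace_MF] by simp
    moreover have "Dsum m (\<lambda>_. 0) + cscale 0 (e m) = 0" unfolding Dsum_0 by simp
    ultimately show ?case by metis
  next
    case (Suc p)
    have z: "qcoef m g j = 0" if "j > p" for j by (rule Suc.prems(2)) (use that in simp)
    have a: "qcoef m g p \<in> MF (m - 2 * int p)" using qcoef_top[OF Suc.prems(1) z] .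
    consider "m < 2 * int p" | "m = 2 * int p" | "m > 2 * int p" by linarith
    then show ?case
    proof cases
      case 1
      then have "qcoef m g p = 0" by (intro qcoef_vanish Suc.prems) auto
      then have "qcoef m g j = 0" if "j \<ge> p" for j using z[of j] that by (cases "j = p") auto
      then show ?thesis using Suc.IH[OF Suc.prems(1)] by blast
    next
      case 2
      obtain c where c: "qcoef m g p = cscale c (qcoef m (e m) p)"
        using e Suc.prems(1) unfolding top_family_def 2 by blast
      define g' where "g' = g + cscale (- c) (e m)"
      have g': "g' \<in> QM m" unfolding g'_def by (intro QM_add QM_cscale Suc.prems em)
      have "qcoef m g' j = 0" if j: "j \<ge> p" for j
      proof (cases "j = p")
        case True
        have "qcoef m g' p = cscale c (qcoef m (e m) p) + cscale (- c) (qcoef m (e m) p)"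
          unfolding g'_def using Suc.prems(1) em by (simp only: qcoef_add qcoef_cscale QM_cscale c)
        also have "\<dots> = 0" by simp
        finally show ?thesis using True by simp
      next
        case False
        then show ?thesis using j 2 by (intro qcoef_vanish g') auto
      qed
      then obtain h c' where h: "admissible m h" "g' = Dsum m h + cscale c' (e m)" using Suc.IH[OF g'] by blast
      have "g = g' + cscale c (e m)" unfolding g'_def by simp
      then have "g = Dsum m h + cscale (c' + c) (e m)" unfolding h(2) by (simp add: cfun.scale_left_distrib add.assoc)
      then show ?thesis using h(1) by blast
    next
      case 3
      define q where "q = (pochhammer (of_int (m - 2 * int p)) p :: complex)"
      have q: "q \<noteq> 0" unfolding q_def using 3 by (intro pochhammer_nz) simp
      \<comment> \<open>The form whose \<open>p\<close>-th derivative cancels the last coefficient of \<open>g\<close>.\<close>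
      define b where "b = cscale (- 1 / q) (qcoef m g p)"
      have b: "b \<in> MF (m - 2 * int p)" unfolding b_def by (rule cfun.subspace_scale[OF subspace_MF a])
      have Db: "(D_uhp ^^ p) b \<in> QM m" using Dpow_QM[OF MF_QM[OF b], of p] by simp
      define g' where "g' = g + (D_uhp ^^ p) b"
      have g': "g' \<in> QM m" unfolding g'_def by (intro QM_add Suc.prems Db)
      have "qcoef m g' j = 0" if j: "j \<ge> p" for j
      proof (cases "j = p")
        case True
        have "qcoef m g' p = qcoef m g p + cscale q b"
          unfolding g'_def qcoef_add[OF Suc.prems(1) Db] using qcoef_Dpow(2)[OF b, of p] by (simp add: q_def)
        also have "cscale q b = cscale (-1) (qcoef m g p)" unfolding b_def cfun.scale_scale using q by simp
        also have "qcoef m g p + cscale (-1) (qcoef m g p) = 0" by simp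
        finally show ?thesis using True by simp
      next
        case False
        then have jp: "j > p" using j by simp
        have "qcoef m ((D_uhp ^^ p) b) j = 0" using qcoef_Dpow(1)[OF b jp] by simp
        then show ?thesis unfolding g'_def qcoef_add[OF Suc.prems(1) Db] z[OF jp] by simp
      qed
      then obtain h c where h: "admissible m h" "g' = Dsum m h + cscale c (e m)" using Suc.IH[OF g'] by blast
      have nb: "cscale (-1) b \<in> MF (m - 2 * int p)" by (rule cfun.subspace_scale[OF subspace_MF b])
      define h' where "h' = (\<lambda>j. h j + (if j = p then cscale (-1) b else 0))"
      have "admissible m h'" unfolding h'_def by (intro admissible_add h admissible_single nb 3)
      moreover have "Dsum m h' = Dsum m h + cscale (-1) ((D_uhp ^^ p) b)"
        unfolding h'_def Dsum_add[OF h(1) admissible_single[OF nb 3]] Dsum_single[OF 3] Dpow_cscale[OF MF_QM[OF b]] ..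
      moreover have "g = g' + cscale (-1) ((D_uhp ^^ p) b)" unfolding g'_def by simp
      ultimately have "g = Dsum m h' + cscale c (e m)" unfolding h(2) by simp
      then show ?thesis using \<open>admissible m h'\<close> by blast
    qed
  qed
  obtain p where p: "QE m p g (qcoef m g)" using g by (rule QE_qcoef)
  show ?thesis by (rule main[OF g, of "Suc p"]) (use QE_zero[OF p] in auto)
qed

text \<open>The top term has larger depth than the whole sum of derivatives, so its coefficient vanishes first; then the
  last nonzero \<open>h J\<close> is a last coefficient of \<open>0\<close>.\<close>

lemma decomposition_unique:
  assumes e: "top_family e" and h: "admissible m h" and eq: "Dsum m h + cscale c (e m) = 0"
  shows "h j = 0" "cscale c (e m) = 0"
proof -
  have em: "e m \<in> QM m" using e by (simp add: top_family_def)
  show c0: "cscale c (e m) = 0"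
  proof (cases "e m = 0")
    case False
    then obtain p where p: "m = 2 * int p" "qcoef m (e m) p \<noteq> 0" using e unfolding top_family_def by metis
    have hp: "h j = 0" if "j \<ge> p" for j using admissible_0[OF h, of j] p that by simp
    have "qcoef m (Dsum m h) p = 0" using Dsum_qcoef[OF h, of p] hp by simp
    then have "qcoef m (Dsum m h + cscale c (e m)) p = cscale c (qcoef m (e m) p)"
      by (simp only: qcoef_add[OF Dsum_QM[OF h] QM_cscale[OF em]] qcoef_cscale[OF em] add_0)
    then have "cscale c (qcoef m (e m) p) = 0" unfolding eq by simp
    then have "c = 0" using p(2) by simp
    then show ?thesis by simp
  qed simp
  have l0: "Dsum m h = 0" using eq unfolding c0 by simp
  show "h j = 0"
  proof (rule ccontr)
    assume nz: "h j \<noteq> 0"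
    define S where "S = {j. h j \<noteq> 0}"
    have "S \<subseteq> {..nat m}" unfolding S_def using admissible_0[OF h] by force
    then have fin: "finite S" by (rule finite_subset) simp
    define J where "J = Max S"
    have "j \<in> S" using nz by (simp add: S_def)
    then have J: "J \<in> S" "\<And>l. l > J \<Longrightarrow> l \<notin> S"
      unfolding J_def using fin by (auto simp: not_le[symmetric] intro: Max_in)
    have "cscale (pochhammer (of_int (m - 2 * int J)) J) (h J) = 0"
      using Dsum_qcoef[OF h, of J] J(2) unfolding l0 S_def by simp
    moreover have "m - 2 * int J > 0" using admissible_0[OF h, of J] J(1) unfolding S_def by force
    then have "pochhammer (of_int (m - 2 * int J) :: complex) J \<noteq> 0" by (rule pochhammer_nz)
    ultimately have "h J = 0" unfolding cfun.scale_eq_0_iff by blast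
    then show False using J(1) by (simp add: S_def)
  qed
qed

subsection \<open>The graded decomposition and the action on it\<close>

text \<open>Coordinates on the sum over all weights: \<open>H k j\<close> is the form of weight \<open>k\<close> to be differentiated \<open>j\<close> times. The
  index is the weight of the modular form and not of the derivative, as in \<open>M\<^sub>k \<otimes> U\<^sub>k\<close>.\<close>

definition graded :: "(int \<Rightarrow> nat \<Rightarrow> complex \<Rightarrow> complex) \<Rightarrow> bool" where
  "graded H \<longleftrightarrow> (\<forall>k j. H k j \<in> MF k) \<and> (\<forall>k j. k \<le> 0 \<longrightarrow> H k j = 0) \<and> finite {p. H (fst p) (snd p) \<noteq> 0}"

text \<open>The component of weight \<open>m\<close> of the quasimodular form with coordinates \<open>H\<close> and \<open>c\<close>.\<close>

definition Phi :: "(int \<Rightarrow> complex \<Rightarrow> complex) \<Rightarrow> (int \<Rightarrow> nat \<Rightarrow> complex \<Rightarrow> complex) \<Rightarrow> (int \<Rightarrow> complex) \<Rightarrow> int \<Rightarrow> complex \<Rightarrow> complex" where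
  "Phi e H c m = Dsum m (\<lambda>j. H (m - 2 * int j) j) + cscale (c m) (e m)"

lemma graded_admissible: "graded H \<Longrightarrow> admissible m (\<lambda>j. H (m - 2 * int j) j)"
  by (auto simp: graded_def admissible_def)

lemma Phi_QM: "top_family e \<Longrightarrow> graded H \<Longrightarrow> Phi e H c m \<in> QM m"
  unfolding Phi_def top_family_def by (intro QM_add Dsum_QM graded_admissible QM_cscale) auto

lemma Phi_finite:
  assumes H: "graded H" and c: "finite {m. c m \<noteq> 0}"
  shows "finite {m. Phi e H c m \<noteq> 0}"
proof (rule finite_subset)
  show "{m. Phi e H c m \<noteq> 0} \<subseteq> (\<lambda>p. fst p + 2 * int (snd p)) ` {p. H (fst p) (snd p) \<noteq> 0} \<union> {m. c m \<noteq> 0}"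
  proof (rule subsetI, rule ccontr)
    fix m assume m: "m \<in> {m. Phi e H c m \<noteq> 0}"
      and n: "m \<notin> (\<lambda>p. fst p + 2 * int (snd p)) ` {p. H (fst p) (snd p) \<noteq> 0} \<union> {m. c m \<noteq> 0}"
    have "H (m - 2 * int j) j = 0" for j
    proof (rule ccontr)
      assume "H (m - 2 * int j) j \<noteq> 0"
      then have "m \<in> (\<lambda>p. fst p + 2 * int (snd p)) ` {p. H (fst p) (snd p) \<noteq> 0}"
        by (intro image_eqI[of _ _ "(m - 2 * int j, j)"]) auto
      then show False using n by blast
    qed
    then have "Phi e H c m = 0" using n unfolding Phi_def by (simp add: Dsum_0)
    then show False using m by simp
  qed
qed (use H c in \<open>auto simp: graded_def\<close>)

lemma Phi_add: "graded H \<Longrightarrow> graded H' \<Longrightarrow> Phi e (\<lambda>k j. H k j + H' k j) (\<lambda>m. c m + c' m) m = Phi e H c m + Phi e H' c' m"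
  unfolding Phi_def Dsum_add[OF graded_admissible graded_admissible] cfun.scale_left_distrib by (simp only: add_ac)

lemma Phi_cscale: "graded H \<Longrightarrow> Phi e (\<lambda>k j. cscale a (H k j)) (\<lambda>m. a * c m) m = cscale a (Phi e H c m)"
  unfolding Phi_def Dsum_cscale[OF graded_admissible] cfun.scale_right_distrib cfun.scale_scale ..

lemma Phi_inj:
  assumes e: "top_family e" and H: "graded H" and 0: "\<And>m. Phi e H c m = 0"
  shows "H k j = 0" "cscale (c m) (e m) = 0"
proof -
  show "cscale (c m) (e m) = 0"
    using decomposition_unique(2)[OF e graded_admissible[OF H] 0[of m, unfolded Phi_def]] .
  show "H k j = 0"
    using decomposition_unique(1)[OF e graded_admissible[OF H] 0[of "k + 2 * int j", unfolded Phi_def], of j] by simp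
qed

lemma Phi_surj:
  assumes e: "top_family e" and g: "\<And>m. g m \<in> QM m" and fin: "finite {m. g m \<noteq> 0}"
  shows "\<exists>H c. graded H \<and> finite {m. c m \<noteq> 0} \<and> (\<forall>m. e m = 0 \<longrightarrow> c m = 0) \<and> (\<forall>m. g m = Phi e H c m)"
proof -
  obtain h c where hc: "\<And>m. admissible m (h m)" "\<And>m. g m = Dsum m (h m) + cscale (c m) (e m)"
    using decomposition_exists[OF e g] by metis
  define H where "H k j = h (k + 2 * int j) j" for k j
  define c' where "c' m = (if cscale (c m) (e m) = 0 then 0 else c m)" for m
  have h0: "h m j = 0" if "g m = 0" for m j
    using decomposition_unique(1)[OF e hc(1) hc(2)[of m, unfolded that, symmetric]] .
  have cc: "cscale (c' m) (e m) = cscale (c m) (e m)" for m by (simp add: c'_def)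
  have "graded H"
    unfolding graded_def
  proof (intro conjI allI impI)
    show "H k j \<in> MF k" for k j using admissible_MF[OF hc(1)[of "k + 2 * int j"], of j] by (simp add: H_def)
    show "H k j = 0" if "k \<le> 0" for k j using admissible_0[OF hc(1)[of "k + 2 * int j"], of j] that by (simp add: H_def)
    have "{p. H (fst p) (snd p) \<noteq> 0} \<subseteq> (\<Union>m\<in>{m. g m \<noteq> 0}. (\<lambda>j. (m - 2 * int j, j)) ` {..nat m})"
    proof
      fix p assume p: "p \<in> {p. H (fst p) (snd p) \<noteq> 0}"
      define m where "m = fst p + 2 * int (snd p)"
      have nz: "h m (snd p) \<noteq> 0" using p by (simp add: H_def m_def)
      then have "g m \<noteq> 0" using h0 by blast
      moreover have "2 * int (snd p) < m" using nz admissible_0[OF hc(1)[of m], of "snd p"] by force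
      then have "snd p \<le> nat m" by linarith
      moreover have "p = (m - 2 * int (snd p), snd p)" by (simp add: m_def)
      ultimately show "p \<in> (\<Union>m\<in>{m. g m \<noteq> 0}. (\<lambda>j. (m - 2 * int j, j)) ` {..nat m})" by blast
    qed
    then show "finite {p. H (fst p) (snd p) \<noteq> 0}" by (rule finite_subset) (use fin in auto)
  qed
  moreover have "finite {m. c' m \<noteq> 0}"
  proof (rule finite_subset[OF _ fin])
    show "{m. c' m \<noteq> 0} \<subseteq> {m. g m \<noteq> 0}"
    proof (rule subsetI, rule CollectI, rule notI)
      fix m assume m: "m \<in> {m. c' m \<noteq> 0}" and "g m = 0"
      then have "cscale (c m) (e m) = 0"
        using decomposition_unique(2)[OF e hc(1)[of m], of "c m"] hc(2)[of m] by (simp only:)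
      then show False using m by (simp add: c'_def)
    qed
  qed
  moreover have "c' m = 0" if "e m = 0" for m using that by (simp add: c'_def)
  moreover have "g m = Phi e H c' m" for m unfolding Phi_def cc by (simp add: H_def hc(2))
  ultimately show ?thesis by blast
qed

lemma D_sum: "(\<And>i. i \<in> I \<Longrightarrow> f i \<in> QM k) \<Longrightarrow> D_uhp (\<Sum>i\<in>I. f i) = (\<Sum>i\<in>I. D_uhp (f i))"
proof (induction I rule: infinite_finite_induct)
  case (insert x I)
  have "D_uhp (f x + (\<Sum>i\<in>I. f i)) = D_uhp (f x) + D_uhp (\<Sum>i\<in>I. f i)"
    using insert.prems by (intro D_add QM_moderate[of _ k] QM_sum) auto
  moreover have "D_uhp (\<Sum>i\<in>I. f i) = (\<Sum>i\<in>I. D_uhp (f i))"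
    by (rule insert.IH) (use insert.prems in blast)
  ultimately show ?case unfolding sum.insert[OF insert.hyps(1,2)] by (simp only:)
qed (simp_all add: D_uhp_0)

text \<open>Differentiation shifts the index \<open>j\<close> by one, and acts on the top terms through the factors \<open>d\<close>.\<close>

lemma Phi_D:
  assumes e: "top_family e" and H: "graded H" and d: "\<And>m. D_uhp (e m) = cscale (d m) (e (m + 2))"
  shows "D_uhp (Phi e H c (m - 2)) = Phi e (\<lambda>k j. if j = 0 then 0 else H k (j - 1)) (\<lambda>m. d (m - 2) * c (m - 2)) m"
proof -
  define H' where "H' k j = (if j = 0 then 0 else H k (j - 1))" for k j
  define M where "M = nat m"
  have "admissible m (\<lambda>j. H' (m - 2 * int j) j)"
    using H cfun.subspace_0[OF subspace_MF] unfolding graded_def admissible_def H'_def by auto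
  then have "Dsum m (\<lambda>j. H' (m - 2 * int j) j) = (\<Sum>j<Suc M. (D_uhp ^^ j) (H' (m - 2 * int j) j))"
    by (rule Dsum_eq) (simp add: M_def)
  also have "\<dots> = (\<Sum>j<M. D_uhp ((D_uhp ^^ j) (H (m - 2 - 2 * int j) j)))"
    unfolding sum.lessThan_Suc_shift by (simp add: H'_def algebra_simps)
  also have "\<dots> = D_uhp (\<Sum>j<M. (D_uhp ^^ j) (H (m - 2 - 2 * int j) j))"
    by (rule D_sum[symmetric]) (rule admissible_QM[OF graded_admissible[OF H]])
  also have "(\<Sum>j<M. (D_uhp ^^ j) (H (m - 2 - 2 * int j) j)) = Dsum (m - 2) (\<lambda>j. H (m - 2 - 2 * int j) j)"
    by (rule Dsum_eq[OF graded_admissible[OF H], symmetric]) (simp add: M_def)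
  finally have l: "Dsum m (\<lambda>j. H' (m - 2 * int j) j) = D_uhp (Dsum (m - 2) (\<lambda>j. H (m - 2 - 2 * int j) j))" .
  have em: "e (m - 2) \<in> moderate" using e QM_moderate unfolding top_family_def by blast
  have "D_uhp (Phi e H c (m - 2)) = D_uhp (Dsum (m - 2) (\<lambda>j. H (m - 2 - 2 * int j) j)) + cscale (c (m - 2)) (D_uhp (e (m - 2)))"
    unfolding Phi_def D_cscale[OF em, symmetric]
    by (intro D_add moderate_cscale em QM_moderate[OF Dsum_QM[OF graded_admissible[OF H]]])
  also have "\<dots> = Phi e H' (\<lambda>m. d (m - 2) * c (m - 2)) m"
    unfolding Phi_def l d cfun.scale_scale by (simp add: mult.commute)
  finally show ?thesis unfolding H'_def[abs_def] .
qed

lemma Phi_delta: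
  assumes e: "top_family e" and H: "graded H" and d: "\<And>m. delta \<Gamma> (m + 2) (e (m + 2)) = cscale (d m) (e m)"
  shows "delta \<Gamma> (m + 2) (Phi e H c (m + 2)) =
    Phi e (\<lambda>k j. cscale (of_nat (j + 1) * (of_int k + of_nat j)) (H k (j + 1))) (\<lambda>m. d m * c (m + 2)) m"
proof -
  define H' where "H' k j = cscale (of_nat (j + 1) * (of_int k + of_nat j)) (H k (j + 1))" for k j
  define M where "M = nat (m + 2)"
  have H2: "admissible (m + 2) (\<lambda>j. H (m + 2 - 2 * int j) j)" by (rule graded_admissible[OF H])
  have Hd: "H (m - 2 * int j) (j + 1) \<in> MF (m - 2 * int j)" for j using H by (auto simp: graded_def)
  have em: "e (m + 2) \<in> QM (m + 2)" using e by (simp add: top_family_def)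
  have "admissible m (\<lambda>j. H' (m - 2 * int j) j)"
    using H cfun.subspace_scale[OF subspace_MF] unfolding graded_def admissible_def H'_def by auto
  then have "Dsum m (\<lambda>j. H' (m - 2 * int j) j) = (\<Sum>j<M. (D_uhp ^^ j) (H' (m - 2 * int j) j))"
    by (rule Dsum_eq) (simp add: M_def)
  also have "\<dots> = (\<Sum>j<M. delta \<Gamma> (m + 2) ((D_uhp ^^ Suc j) (H (m + 2 - 2 * int (Suc j)) (Suc j))))"
  proof (intro sum.cong refl)
    fix j
    have w: "m - 2 * int j + 2 * int (Suc j) = m + 2" "m + 2 - 2 * int (Suc j) = m - 2 * int j" by simp_all
    have "delta \<Gamma> (m - 2 * int j + 2 * int (Suc j)) ((D_uhp ^^ Suc j) (H (m - 2 * int j) (j + 1))) =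
       cscale (of_nat (Suc j) * (of_int (m - 2 * int j) + of_nat (Suc j) - 1)) ((D_uhp ^^ j) (H (m - 2 * int j) (j + 1)))"
      using delta_Dpow[OF Hd, of j "Suc j"] by (simp del: funpow.simps)
    then show "(D_uhp ^^ j) (H' (m - 2 * int j) j) = delta \<Gamma> (m + 2) ((D_uhp ^^ Suc j) (H (m + 2 - 2 * int (Suc j)) (Suc j)))"
      unfolding w H'_def Dpow_cscale[OF MF_QM[OF Hd]] by (simp del: funpow.simps)
  qed
  also have "\<dots> = (\<Sum>j<Suc M. delta \<Gamma> (m + 2) ((D_uhp ^^ j) (H (m + 2 - 2 * int j) j)))"
  proof -
    have "H (m + 2) 0 \<in> MF (m + 2)" using H by (simp add: graded_def)
    then have "delta \<Gamma> (m + 2) ((D_uhp ^^ 0) (H (m + 2 - 2 * int 0) 0)) = 0"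
      using delta_Dpow[of "H (m + 2) 0" "m + 2" 0] by simp
    then show ?thesis unfolding sum.lessThan_Suc_shift[of _ M] by (simp only: add_0)
  qed
  also have "\<dots> = (\<Sum>j<Suc M. qcoef (m + 2) ((D_uhp ^^ j) (H (m + 2 - 2 * int j) j)) 1)"
    by (intro sum.cong refl delta_QM(1)[OF admissible_QM[OF H2]])
  also have "\<dots> = qcoef (m + 2) (\<Sum>j<Suc M. (D_uhp ^^ j) (H (m + 2 - 2 * int j) j)) 1"
    by (rule QM_sum(2)[symmetric]) (rule admissible_QM[OF H2])
  also have "(\<Sum>j<Suc M. (D_uhp ^^ j) (H (m + 2 - 2 * int j) j)) = Dsum (m + 2) (\<lambda>j. H (m + 2 - 2 * int j) j)"
    by (rule Dsum_eq[OF H2, symmetric]) (simp add: M_def)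
  finally have l: "Dsum m (\<lambda>j. H' (m - 2 * int j) j) = qcoef (m + 2) (Dsum (m + 2) (\<lambda>j. H (m + 2 - 2 * int j) j)) 1" .
  have "delta \<Gamma> (m + 2) (Phi e H c (m + 2)) = qcoef (m + 2) (Phi e H c (m + 2)) 1"
    by (rule delta_QM(1)[OF Phi_QM[OF e H]])
  also have "\<dots> = Dsum m (\<lambda>j. H' (m - 2 * int j) j) + cscale (c (m + 2)) (delta \<Gamma> (m + 2) (e (m + 2)))"
    unfolding Phi_def qcoef_add[OF Dsum_QM[OF H2] QM_cscale[OF em]] qcoef_cscale[OF em] l delta_QM(1)[OF em] ..
  also have "\<dots> = Phi e H' (\<lambda>m. d m * c (m + 2)) m"
    unfolding Phi_def d cfun.scale_scale by (simp add: mult.commute)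
  finally show ?thesis unfolding H'_def[abs_def] .
qed

lemma Phi_H:
  assumes H: "graded H"
  shows "cscale (of_int m) (Phi e H c m) = Phi e (\<lambda>k j. cscale (of_int k + 2 * of_nat j) (H k j)) (\<lambda>m. of_int m * c m) m"
proof -
  have "(\<lambda>j. cscale (of_int (m - 2 * int j) + 2 * of_nat j) (H (m - 2 * int j) j)) = (\<lambda>j. cscale (of_int m) (H (m - 2 * int j) j))"
    by simp
  then show ?thesis unfolding Phi_def by (simp only: Dsum_cscale[OF graded_admissible[OF H]] cfun.scale_right_distrib cfun.scale_scale)
qed

lemma Phi_single:
  assumes f: "f \<in> MF k" and k: "k > 0"
  shows "Phi e (\<lambda>k' j'. if k' = k \<and> j' = j then f else 0) (\<lambda>_. 0) m = (if m = k + 2 * int j then (D_uhp ^^ j) f else 0)"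
proof (cases "m = k + 2 * int j")
  case True
  have "(\<lambda>j'. if m - 2 * int j' = k \<and> j' = j then f else 0) = (\<lambda>j'. if j' = j then f else 0)"
    using True by auto
  then show ?thesis unfolding Phi_def using Dsum_single[of j m f] True k by simp
next
  case False
  then have "(\<lambda>j'. if m - 2 * int j' = k \<and> j' = j then f else 0) = (\<lambda>_. 0)" by (auto simp: fun_eq_iff)
  then show ?thesis unfolding Phi_def using Dsum_0[of m] False by simp
qed

subsection \<open>The possible top terms\<close>

text \<open>In degree \<open>p\<close> and weight \<open>2 p\<close> the coefficient is modular of weight \<open>0\<close>.\<close>

lemma qcoef_middle:
  assumes "g \<in> QM (2 * int p)" obtains c where "qcoef (2 * int p) g p = cscale c one_uhp"
proof -
  have "qcoef (2 * int p) g p \<in> MF (2 * int p - 2 * int p)"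
    by (rule qcoef_top[OF assms]) (auto intro!: qcoef_vanish assms)
  then have "qcoef (2 * int p) g p \<in> MF 0" by simp
  then show ?thesis using MF_0 that by blast
qed

text \<open>The two families: only the constants in weight \<open>0\<close>, or the constants together with \<open>D\<^sup>i \<phi>\<close> in weight
  \<open>2 + 2 i\<close>, where \<open>i = m div 2 - 1\<close>.\<close>

definition const_top :: "int \<Rightarrow> complex \<Rightarrow> complex" where
  "const_top m = (if m = 0 then one_uhp else 0)"

definition phi_top :: "(complex \<Rightarrow> complex) \<Rightarrow> int \<Rightarrow> complex \<Rightarrow> complex" where
  "phi_top \<phi> m = (if m = 0 then one_uhp else if m > 0 \<and> even m then (D_uhp ^^ (nat (m div 2) - 1)) \<phi> else 0)"

lemma qcoef_one: "qcoef 0 one_uhp 0 = one_uhp"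
  by (rule qcoef_0[OF MF_QM[OF one_MF]])

text \<open>If \<open>g\<close> has weight \<open>2 p > 0\<close>, its coefficient in degree \<open>p - 1\<close> has weight \<open>2\<close>, and \<open>\<delta>\<close> maps it to \<open>p\<close> times the
  coefficient in degree \<open>p\<close>.\<close>

lemma const_top:
  assumes 0: "\<forall>\<phi>\<in>QM 2. delta \<Gamma> 2 \<phi> = 0"
  shows "top_family const_top"
  unfolding top_family_def
proof (intro conjI allI ballI)
  show "const_top m \<in> QM m" for m using MF_QM[OF one_MF] by (simp add: const_top_def)
  show "const_top m = 0 \<or> (\<exists>p. m = 2 * int p \<and> qcoef m (const_top m) p \<noteq> 0)" for m
    using qcoef_one one_uhp_nz by (auto simp: const_top_def intro!: exI[of _ 0])
  fix p g assume g: "g \<in> QM (2 * int p)"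
  show "\<exists>c. qcoef (2 * int p) g p = cscale c (qcoef (2 * int p) (const_top (2 * int p)) p)"
  proof (cases "p = 0")
    case True
    then show ?thesis using qcoef_middle[OF g] qcoef_one by (auto simp: const_top_def)
  next
    case False
    define a where "a = qcoef (2 * int p) g (p - 1)"
    have w: "2 * int p - 2 * int (p - 1) = 2" using False by (simp add: of_nat_diff)
    have a: "a \<in> QM 2" using qcoef_QM(1)[OF g, of "p - 1"] unfolding a_def w .
    have "delta \<Gamma> 2 a = cscale (of_nat ((p - 1 + 1) choose (p - 1))) (qcoef (2 * int p) g (p - 1 + 1))"
      using qcoef_QM(2)[OF g, of "p - 1" 1] delta_QM(1)[OF a] unfolding a_def w by simp
    moreover have "delta \<Gamma> 2 a = 0" using 0 a by blast
    moreover have "p - 1 + 1 = p" using False by simp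
    moreover have "p choose (p - 1) \<noteq> 0" by simp
    ultimately have "qcoef (2 * int p) g p = 0" by simp
    then show ?thesis by (intro exI[of _ 0]) simp
  qed
qed

lemma even_pos_int:
  assumes "m > 0" "even (m::int)" obtains i where "m = 2 + 2 * int i" "nat (m div 2) - 1 = i"
proof -
  obtain n where n: "m = 2 * n" using assms(2) by blast
  have "m = 2 + 2 * int (nat (m div 2) - 1)" using n assms(1) by auto
  then show ?thesis using that by blast
qed

lemma phi_top_even [simp]: "phi_top \<phi> (2 + 2 * int i) = (D_uhp ^^ i) \<phi>"
proof -
  have "nat ((2 + 2 * int i) div 2) - 1 = i" by simp
  then show ?thesis by (simp add: phi_top_def)
qed

context
  fixes \<phi> assumes phi: "\<phi> \<in> QM 2" "delta \<Gamma> 2 \<phi> = one_uhp"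
begin

lemma phi_QM: "(D_uhp ^^ i) \<phi> \<in> QM (2 + 2 * int i)"
  by (rule Dpow_QM[OF phi(1)])

text \<open>As in \<open>qcoef_Dpow\<close>, but starting from depth one: the factors are \<open>1, 2, \<dots>, i\<close>.\<close>

lemma qcoef_phi: "qcoef (2 + 2 * int i) ((D_uhp ^^ i) \<phi>) (Suc i) = cscale (fact i) one_uhp"
proof (induction i)
  case 0
  then show ?case using delta_QM(1)[OF phi(1)] phi(2) by simp
next
  case (Suc i)
  have w: "2 + 2 * int (Suc i) = 2 + 2 * int i + 2" by simp
  have v: "qcoef (2 + 2 * int i) ((D_uhp ^^ i) \<phi>) (Suc (Suc i)) = 0" by (rule qcoef_vanish[OF phi_QM]) simp
  have k: "(of_int (2 + 2 * int i - int (Suc (Suc i)) + 1) :: complex) = of_nat (Suc i)" by simp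
  have "qcoef (2 + 2 * int i + 2) (D_uhp ((D_uhp ^^ i) \<phi>)) (Suc (Suc i)) = cscale (of_nat (Suc i)) (cscale (fact i) one_uhp)"
    unfolding D_QM(2)[OF phi_QM] v D_uhp_0 k using Suc.IH by simp
  then show ?case unfolding w funpow.simps o_apply by (simp only: cfun.scale_scale fact_Suc of_nat_mult of_nat_fact)
qed

text \<open>The form \<open>D\<^sup>i \<phi>\<close> has weight \<open>2 p\<close> and the nonzero constant \<open>i!\<close> in degree \<open>p = i + 1\<close>.\<close>

lemma phi_top: "top_family (phi_top \<phi>)"
  unfolding top_family_def
proof (intro conjI allI ballI)
  show "phi_top \<phi> m \<in> QM m" for m
  proof (cases "m > 0 \<and> even m")
    case True
    then obtain i where "m = 2 + 2 * int i" using even_pos_int by blast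
    then show ?thesis using phi_QM by simp
  next
    case False
    then have "m \<noteq> 0 \<Longrightarrow> phi_top \<phi> m = 0" by (auto simp: phi_top_def)
    then show ?thesis using MF_QM[OF one_MF] by (cases "m = 0") (simp_all add: phi_top_def)
  qed
  show "phi_top \<phi> m = 0 \<or> (\<exists>p. m = 2 * int p \<and> qcoef m (phi_top \<phi> m) p \<noteq> 0)" for m
  proof (cases "m > 0 \<and> even m")
    case True
    then obtain i where i: "m = 2 + 2 * int i" using even_pos_int by blast
    have "qcoef m (phi_top \<phi> m) (Suc i) \<noteq> 0" unfolding i phi_top_even qcoef_phi using one_uhp_nz by simp
    then show ?thesis using i by (intro disjI2 exI[of _ "Suc i"]) simp
  next
    case False
    then have "m \<noteq> 0 \<Longrightarrow> phi_top \<phi> m = 0" by (auto simp: phi_top_def)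
    then show ?thesis using qcoef_one one_uhp_nz by (cases "m = 0") (auto simp: phi_top_def intro!: exI[of _ 0])
  qed
  fix p g assume g: "g \<in> QM (2 * int p)"
  obtain c where c: "qcoef (2 * int p) g p = cscale c one_uhp" by (rule qcoef_middle[OF g])
  show "\<exists>c. qcoef (2 * int p) g p = cscale c (qcoef (2 * int p) (phi_top \<phi> (2 * int p)) p)"
  proof (cases p)
    case 0
    then show ?thesis using c qcoef_one by (intro exI[of _ c]) (simp add: phi_top_def)
  next
    case (Suc i)
    have w: "2 * int p = 2 + 2 * int i" using Suc by simp
    have "qcoef (2 * int p) (phi_top \<phi> (2 * int p)) p = cscale (fact i) one_uhp"
      unfolding w phi_top_even unfolding Suc by (rule qcoef_phi)
    then show ?thesis unfolding c by (intro exI[of _ "c / fact i"]) (simp add: cfun.scale_scale)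
  qed
qed

lemma D_phi_top: "D_uhp (phi_top \<phi> m) = cscale (if m \<le> 0 then 0 else 1) (phi_top \<phi> (m + 2))"
proof (cases "m > 0 \<and> even m")
  case True
  then obtain i where i: "m = 2 + 2 * int i" using even_pos_int by blast
  have w: "2 + 2 * int i + 2 = 2 + 2 * int (Suc i)" by simp
  show ?thesis unfolding i w phi_top_even by simp
next
  case False
  show ?thesis
  proof (cases "m = 0")
    case True
    then show ?thesis using D_one by (simp add: phi_top_def)
  next
    case nz: False
    have "phi_top \<phi> m = 0" using False nz by (auto simp: phi_top_def)
    then have "D_uhp (phi_top \<phi> m) = 0" by (simp only: D_uhp_0)
    moreover have "cscale (if m \<le> 0 then 0 else 1) (phi_top \<phi> (m + 2)) = 0"
    proof (cases "m \<le> 0")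
      case False
      then have "odd m" "m + 2 \<noteq> 0" using \<open>\<not> (m > 0 \<and> even m)\<close> by auto
      then have "phi_top \<phi> (m + 2) = 0" by (simp add: phi_top_def)
      then show ?thesis by simp
    qed simp
    ultimately show ?thesis by simp
  qed
qed

lemma delta_phi: "delta \<Gamma> (2 + 2 * int i) ((D_uhp ^^ i) \<phi>) =
  (if i = 0 then one_uhp else cscale (of_nat i * (of_nat i + 1)) ((D_uhp ^^ (i - 1)) \<phi>))"
proof (induction i)
  case 0
  then show ?case using phi(2) by simp
next
  case (Suc i)
  have w: "2 + 2 * int (Suc i) = 2 + 2 * int i + 2" by simp
  have "delta \<Gamma> (2 + 2 * int (Suc i)) ((D_uhp ^^ Suc i) \<phi>) = D_uhp (delta \<Gamma> (2 + 2 * int i) ((D_uhp ^^ i) \<phi>)) + cscale (of_int (2 + 2 * int i)) ((D_uhp ^^ i) \<phi>)"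
    unfolding w funpow.simps o_apply by (rule delta_D[OF phi_QM])
  also have "D_uhp (delta \<Gamma> (2 + 2 * int i) ((D_uhp ^^ i) \<phi>)) = cscale (of_nat i * (of_nat i + 1)) ((D_uhp ^^ i) \<phi>)"
  proof (cases i)
    case 0
    then show ?thesis unfolding Suc.IH using D_one by simp
  next
    case i': (Suc i')
    then show ?thesis unfolding Suc.IH using QM_moderate[OF phi_QM] by (simp add: D_cscale)
  qed
  also have "cscale (of_nat i * (of_nat i + 1)) ((D_uhp ^^ i) \<phi>) + cscale (of_int (2 + 2 * int i)) ((D_uhp ^^ i) \<phi>)
     = cscale (of_nat i * (of_nat i + 1) + of_int (2 + 2 * int i)) ((D_uhp ^^ i) \<phi>)"
    by (simp only: cfun.scale_left_distrib)
  also have "of_nat i * (of_nat i + 1) + of_int (2 + 2 * int i) = (of_nat (Suc i) * (of_nat (Suc i) + 1) :: complex)"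
    by (simp add: algebra_simps)
  finally show ?case by simp
qed

lemma delta_phi_top:
  "delta \<Gamma> (m + 2) (phi_top \<phi> (m + 2)) =
     cscale (if m = 0 then 1 else if m < 0 then 0 else of_int m / 2 * (of_int m / 2 + 1)) (phi_top \<phi> m)"
proof -
  consider "m = 0" | "m > 0" "even m" | "m > 0" "odd m" | "m = - 2" | "m < 0" "m \<noteq> - 2" by linarith
  then show ?thesis
  proof cases
    case 1
    then show ?thesis using delta_phi[of 0] phi_top_even[of \<phi> 0] by (simp add: phi_top_def)
  next
    case 2
    then obtain i where i: "m = 2 + 2 * int i" using even_pos_int by blast
    have w: "m + 2 = 2 + 2 * int (Suc i)" using i by simp
    have c: "(of_int m / 2 * (of_int m / 2 + 1) :: complex) = of_nat (Suc i) * (of_nat (Suc i) + 1)"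
      unfolding i by (simp add: field_simps)
    have "delta \<Gamma> (m + 2) (phi_top \<phi> (m + 2)) = cscale (of_nat (Suc i) * (of_nat (Suc i) + 1)) ((D_uhp ^^ i) \<phi>)"
      unfolding w phi_top_even delta_phi by simp
    then show ?thesis unfolding c using 2 i phi_top_even[of \<phi> i] by simp
  next
    case 3
    then have "phi_top \<phi> (m + 2) = 0" "phi_top \<phi> m = 0" by (simp_all add: phi_top_def)
    then show ?thesis by simp
  next
    case 4
    then have "delta \<Gamma> (m + 2) (phi_top \<phi> (m + 2)) = delta \<Gamma> 0 one_uhp" by (simp add: phi_top_def)
    also have "\<dots> = 0" using delta_QM(1)[OF MF_QM[OF one_MF]] one_MF by (simp add: MF_iff)
    finally show ?thesis using 4 by simp
  next
    case 5
    have "phi_top \<phi> (m + 2) = 0" using 5 by (auto simp: phi_top_def)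
    then show ?thesis using 5 by simp
  qed
qed

end

lemma D_const_top: "D_uhp (const_top m) = cscale 0 (const_top (m + 2))"
proof (cases "m = 0")
  case True
  then show ?thesis using D_one by (simp add: const_top_def)
next
  case False
  then have "const_top m = 0" by (simp add: const_top_def)
  then show ?thesis by (simp add: D_uhp_0)
qed

lemma delta_const_top: "delta \<Gamma> (m + 2) (const_top (m + 2)) = cscale 0 (const_top m)"
proof (cases "m = - 2")
  case True
  then have "delta \<Gamma> (m + 2) (const_top (m + 2)) = delta \<Gamma> 0 one_uhp" by (simp add: const_top_def)
  also have "\<dots> = 0" using delta_QM(1)[OF MF_QM[OF one_MF]] one_MF by (simp add: MF_iff)
  finally show ?thesis by simp
next
  case False
  then have "const_top (m + 2) = 0" by (simp add: const_top_def)
  then show ?thesis by simp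
qed

text \<open>On weight \<open>2\<close> the map \<open>\<delta>\<close> takes values in the constants, so it is zero or can be normalised to \<open>1\<close>.\<close>

lemma delta_dichotomy:
  "(\<forall>\<phi>\<in>QM 2. delta \<Gamma> 2 \<phi> = 0) \<or> (\<exists>\<phi>\<in>QM 2. delta \<Gamma> 2 \<phi> = one_uhp)"
proof (rule disjCI)
  assume no: "\<not> (\<exists>\<phi>\<in>QM 2. delta \<Gamma> 2 \<phi> = one_uhp)"
  show "\<forall>\<phi>\<in>QM 2. delta \<Gamma> 2 \<phi> = 0"
  proof
    fix \<phi> assume phi: "\<phi> \<in> QM 2"
    have "\<phi> \<in> QM (2 * int 1)" using phi by simp
    then obtain c where "qcoef (2 * int 1) \<phi> 1 = cscale c one_uhp" by (rule qcoef_middle)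
    then have c: "delta \<Gamma> 2 \<phi> = cscale c one_uhp" using delta_QM(1)[OF phi] by simp
    have "c = 0"
    proof (rule ccontr)
      assume nz: "c \<noteq> 0"
      have "delta \<Gamma> 2 (cscale (1 / c) \<phi>) = one_uhp"
        unfolding delta_QM(1)[OF QM_cscale[OF phi]] qcoef_cscale[OF phi] delta_QM(1)[OF phi, symmetric] c
        using nz by (simp add: cfun.scale_scale)
      then show False using no QM_cscale[OF phi] by blast
    qed
    then show "delta \<Gamma> 2 \<phi> = 0" using c by simp
  qed
qed

end

section \<open>The modules in coordinates\<close>

text \<open>In the modules below at most one basis vector has an image with a nonzero coordinate at a given place, which makes
  the actions computable coordinate by coordinate.\<close>

lemma lin_ext_at:
  assumes u: "u \<in> finsupp" and b: "\<And>i. i \<noteq> i0 \<Longrightarrow> b i y = 0"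
  shows "lin_ext b u y = u i0 * b i0 y"
proof -
  have "lin_ext b u = (\<Sum>i\<in>insert i0 {i. u i \<noteq> 0}. cscale (u i) (b i))"
    using u by (intro lin_ext_superset) (auto simp: finsupp_def)
  then have "lin_ext b u y = (\<Sum>i\<in>insert i0 {i. u i \<noteq> 0}. u i * b i y)"
    by (simp only: sum_fun_apply cscale_def)
  also have "\<dots> = (\<Sum>i\<in>{i0}. u i * b i y)"
    using u b by (intro sum.mono_neutral_right) (auto simp: finsupp_def)
  finally show ?thesis by simp
qed

lemma lin_ext_none: "(\<And>i. b i y = 0) \<Longrightarrow> lin_ext b u y = 0"
  unfolding lin_ext_def by (simp add: sum_fun_apply cscale_def)

lemma U_mod_act:
  assumes k: "k \<noteq> 0" and u: "u \<in> finsupp"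
  shows "actD (U_mod k) u j = (if j = 0 then 0 else u (j - 1))"
    and "actd (U_mod k) u j = of_nat (j + 1) * (of_int k + of_nat j) * u (j + 1)"
    and "actH (U_mod k) u j = (of_int k + 2 * of_nat j) * u j"
proof -
  show "actD (U_mod k) u j = (if j = 0 then 0 else u (j - 1))"
  proof (cases "j = 0")
    case True
    have "lin_ext (\<lambda>j. bvec (j + 1)) u j = 0" by (rule lin_ext_none) (simp add: bvec_def True)
    then show ?thesis using k True by (simp add: U_mod_def)
  next
    case False
    have "lin_ext (\<lambda>j. bvec (j + 1)) u j = u (j - 1) * bvec (j - 1 + 1) j"
      by (rule lin_ext_at[OF u]) (use False in \<open>auto simp: bvec_def\<close>)
    then show ?thesis using k False by (simp add: U_mod_def bvec_def)
  qed
  have "lin_ext (\<lambda>j. if j = 0 then 0 else cscale (of_nat j * (of_int k + of_nat j - 1)) (bvec (j - 1))) u j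
    = u (j + 1) * (if j + 1 = 0 then 0 else cscale (of_nat (j + 1) * (of_int k + of_nat (j + 1) - 1)) (bvec (j + 1 - 1))) j"
    by (rule lin_ext_at[OF u]) (auto simp: bvec_def cscale_def)
  then show "actd (U_mod k) u j = of_nat (j + 1) * (of_int k + of_nat j) * u (j + 1)"
    using k by (simp add: U_mod_def bvec_def cscale_def mult_ac)
  have "lin_ext (\<lambda>j. cscale (of_int k + 2 * of_nat j) (bvec j)) u j = u j * cscale (of_int k + 2 * of_nat j) (bvec j) j"
    by (rule lin_ext_at[OF u]) (auto simp: bvec_def cscale_def)
  then show "actH (U_mod k) u j = (of_int k + 2 * of_nat j) * u j"
    using k by (simp add: U_mod_def bvec_def cscale_def mult_ac)
qed

lemma U2hat_act:
  assumes u: "u \<in> finsupp"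
  shows "actD U2hat u None = 0" "actD U2hat u (Some j) = (if j = 0 then 0 else u (Some (j - 1)))"
    and "actd U2hat u None = u (Some 0)" "actd U2hat u (Some j) = of_nat (j + 1) * (of_nat j + 2) * u (Some (j + 1))"
    and "actH U2hat u None = 0" "actH U2hat u (Some j) = (2 + 2 * of_nat j) * u (Some j)"
proof -
  show "actD U2hat u None = 0"
    by (simp add: U2hat_def, rule lin_ext_none) (auto simp: bvec_def split: option.splits)
  show "actD U2hat u (Some j) = (if j = 0 then 0 else u (Some (j - 1)))"
  proof (cases "j = 0")
    case True
    then show ?thesis
      by (simp add: U2hat_def, intro lin_ext_none) (auto simp: bvec_def split: option.splits)
  next
    case False
    have "lin_ext (\<lambda>i. case i of None \<Rightarrow> 0 | Some j \<Rightarrow> bvec (Some (j + 1))) u (Some j)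
      = u (Some (j - 1)) * (case Some (j - 1) of None \<Rightarrow> 0 | Some j \<Rightarrow> bvec (Some (j + 1))) (Some j)"
      by (rule lin_ext_at[OF u]) (use False in \<open>auto simp: bvec_def split: option.splits\<close>)
    then show ?thesis using False by (simp add: U2hat_def bvec_def)
  qed
  have "lin_ext (\<lambda>i. case i of None \<Rightarrow> 0
                | Some j \<Rightarrow> if j = 0 then bvec None
                            else cscale (of_nat j * (of_nat j + 1)) (bvec (Some (j - 1)))) u None
    = u (Some 0) * (case Some 0 of None \<Rightarrow> 0
                | Some j \<Rightarrow> if j = 0 then bvec None
                            else cscale (of_nat j * (of_nat j + 1)) (bvec (Some (j - 1)))) None"
    by (rule lin_ext_at[OF u]) (auto simp: bvec_def cscale_def split: option.splits)
  then show "actd U2hat u None = u (Some 0)" by (simp add: U2hat_def bvec_def)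
  have "lin_ext (\<lambda>i. case i of None \<Rightarrow> 0
                | Some j \<Rightarrow> if j = 0 then bvec None
                            else cscale (of_nat j * (of_nat j + 1)) (bvec (Some (j - 1)))) u (Some j)
    = u (Some (j + 1)) * (case Some (j + 1) of None \<Rightarrow> 0
                | Some j \<Rightarrow> if j = 0 then bvec None
                            else cscale (of_nat j * (of_nat j + 1)) (bvec (Some (j - 1)))) (Some j)"
    by (rule lin_ext_at[OF u]) (auto simp: bvec_def cscale_def split: option.splits)
  then show "actd U2hat u (Some j) = of_nat (j + 1) * (of_nat j + 2) * u (Some (j + 1))"
    by (simp add: U2hat_def bvec_def cscale_def algebra_simps)
  show "actH U2hat u None = 0"
    by (simp add: U2hat_def, rule lin_ext_none) (auto simp: bvec_def cscale_def split: option.splits)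
  have "lin_ext (\<lambda>i. case i of None \<Rightarrow> 0 | Some j \<Rightarrow> cscale (2 + 2 * of_nat j) (bvec (Some j))) u (Some j)
    = u (Some j) * (case Some j of None \<Rightarrow> 0 | Some j \<Rightarrow> cscale (2 + 2 * of_nat j) (bvec (Some j))) (Some j)"
    by (rule lin_ext_at[OF u]) (auto simp: bvec_def cscale_def split: option.splits)
  then show "actH U2hat u (Some j) = (2 + 2 * of_nat j) * u (Some j)"
    by (simp add: U2hat_def bvec_def cscale_def mult_ac)
qed

lemma subspace_finsupp: "cfun.subspace finsupp"
proof (rule cfun.subspaceI)
  fix u v :: "'a \<Rightarrow> complex" and c
  show "(0 :: 'a \<Rightarrow> complex) \<in> finsupp" by (simp add: finsupp_def)
  assume u: "u \<in> finsupp"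
  show "cscale c u \<in> finsupp" 
    using u unfolding finsupp_def by (auto simp: cscale_def elim: rev_finite_subset)
  assume v: "v \<in> finsupp"
  have "{x. (u + v) x \<noteq> 0} \<subseteq> {x. u x \<noteq> 0} \<union> {x. v x \<noteq> 0}" by auto
  then show "u + v \<in> finsupp" using u v unfolding finsupp_def by (auto intro: finite_subset)
qed

lemma U2hat_closed:
  assumes u: "u \<in> finsupp"
  shows "actD U2hat u \<in> finsupp" "actd U2hat u \<in> finsupp" "actH U2hat u \<in> finsupp"
proof -
  have fsI: "w \<in> finsupp" if "\<And>i. w i \<noteq> 0 \<Longrightarrow> \<exists>j. u j \<noteq> 0 \<and> i \<in> t j" "\<And>j. finite (t j)"
    for w :: "nat option \<Rightarrow> complex" and t
  proof -
    have "{i. w i \<noteq> 0} \<subseteq> (\<Union>j\<in>{j. u j \<noteq> 0}. t j)" using that(1) by blast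
    then show ?thesis using u that(2) unfolding finsupp_def by (auto elim!: finite_subset)
  qed
  show "actD U2hat u \<in> finsupp"
  proof (rule fsI[where t = "\<lambda>j. {map_option Suc j}"])
    fix i assume "actD U2hat u i \<noteq> 0"
    then show "\<exists>j. u j \<noteq> 0 \<and> i \<in> {map_option Suc j}"
      by (cases i) (auto simp: U2hat_act[OF u] split: if_splits intro!: exI[of _ "Some (_ - Suc 0)"])
  qed simp
  show "actd U2hat u \<in> finsupp"
  proof (rule fsI[where t = "\<lambda>j. {None, map_option (\<lambda>n. n - 1) j}"])
    fix i assume "actd U2hat u i \<noteq> 0"
    then show "\<exists>j. u j \<noteq> 0 \<and> i \<in> {None, map_option (\<lambda>n. n - 1) j}"
      by (cases i) (auto simp: U2hat_act[OF u] intro: exI[of _ "Some (Suc _)"])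
  qed simp
  show "actH U2hat u \<in> finsupp"
  proof (rule fsI[where t = "\<lambda>j. {j}"])
    fix i assume "actH U2hat u i \<noteq> 0"
    then show "\<exists>j. u j \<noteq> 0 \<and> i \<in> {j}" by (cases i) (auto simp: U2hat_act[OF u])
  qed simp
qed

lemma subspace_sl2_plus:
  assumes R: "cfun.subspace (vecs R)" and S: "cfun.subspace (vecs S)"
  shows "cfun.subspace (vecs (sl2_plus R S))"
proof (rule cfun.subspaceI)
  have ops: "(F + F') \<circ> f = (F \<circ> f) + (F' \<circ> f)" "cscale c F \<circ> f = cscale c (F \<circ> f)" "0 \<circ> f = 0"
    for F F' :: "'c \<Rightarrow> complex" and f :: "'d \<Rightarrow> 'c" and c
    by (auto simp: fun_eq_iff cscale_def)
  have v: "F \<in> vecs (sl2_plus R S) \<longleftrightarrow> F \<circ> Inl \<in> vecs R \<and> F \<circ> Inr \<in> vecs S" for F by (simp add: sl2_plus_def)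
  show "0 \<in> vecs (sl2_plus R S)" unfolding v ops using cfun.subspace_0[OF R] cfun.subspace_0[OF S] by blast
  show "F + F' \<in> vecs (sl2_plus R S)" if "F \<in> vecs (sl2_plus R S)" "F' \<in> vecs (sl2_plus R S)" for F F'
    using that cfun.subspace_add[OF R] cfun.subspace_add[OF S] unfolding v ops by blast
  show "cscale c F \<in> vecs (sl2_plus R S)" if "F \<in> vecs (sl2_plus R S)" for F c
    using that cfun.subspace_scale[OF R] cfun.subspace_scale[OF S] unfolding v ops by blast
qed

text \<open>The operators on \<open>R\<close> are linear and satisfy the commutator relations because both hold after applying the
  injective intertwining map \<open>T\<close>.\<close>

lemma sl2_iso_transport:
  assumes S: "sl2_module S" and sub: "cfun.subspace (vecs R)"
    and lin: "linear_between (vecs R) (vecs S) T" and bij: "bij_betw T (vecs R) (vecs S)"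
    and cl: "\<And>v. v \<in> vecs R \<Longrightarrow> actD R v \<in> vecs R" "\<And>v. v \<in> vecs R \<Longrightarrow> actd R v \<in> vecs R" "\<And>v. v \<in> vecs R \<Longrightarrow> actH R v \<in> vecs R"
    and eq: "\<And>v. v \<in> vecs R \<Longrightarrow> T (actD R v) = actD S (T v)" "\<And>v. v \<in> vecs R \<Longrightarrow> T (actd R v) = actd S (T v)"
      "\<And>v. v \<in> vecs R \<Longrightarrow> T (actH R v) = actH S (T v)"
  shows "sl2_iso T R S"
proof -
  note add = cfun.subspace_add[OF sub] and scale = cfun.subspace_scale[OF sub]
  have T: "T v \<in> vecs S" "T (u + v) = T u + T v" "T (cscale c v) = cscale c (T v)" if "u \<in> vecs R" "v \<in> vecs R" for u v c
    using lin that unfolding linear_between_def by blast+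
  have Tdiff: "T (u - v) = T u - T v" if "u \<in> vecs R" "v \<in> vecs R" for u v
  proof -
    have "T (u + cscale (- 1) v) = T u + cscale (- 1) (T v)" using T scale that by metis
    then show ?thesis by simp
  qed
  have inj: "u = v" if "u \<in> vecs R" "v \<in> vecs R" "T u = T v" for u v
    using bij that unfolding bij_betw_def by (meson inj_onD)
  have act: "linear_between (vecs R) (vecs R) f"
    if f: "\<And>v. v \<in> vecs R \<Longrightarrow> f v \<in> vecs R" "\<And>v. v \<in> vecs R \<Longrightarrow> T (f v) = g (T v)"
      and g: "linear_between (vecs S) (vecs S) g" for f g
    unfolding linear_between_def
  proof (intro conjI ballI allI)
    fix u v c assume u: "u \<in> vecs R" and v: "v \<in> vecs R"
    have g': "g (T u + T v) = g (T u) + g (T v)"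
      using g T(1)[OF u u] T(1)[OF v v] unfolding linear_between_def by blast
    show "f (u + v) = f u + f v"
      by (rule inj) (use u v in \<open>simp_all add: f add T g'\<close>)
  next
    fix v c assume v: "v \<in> vecs R"
    have g': "g (cscale c (T v)) = cscale c (g (T v))" using g T(1)[OF v v] unfolding linear_between_def by blast
    show "f (cscale c v) = cscale c (f v)"
      by (rule inj) (use v in \<open>simp_all add: f scale T(3)[OF v] T(3)[OF f(1)[OF v] f(1)[OF v]] g'\<close>)
  qed (rule f(1))
  have diff: "u - v \<in> vecs R" if "u \<in> vecs R" "v \<in> vecs R" for u v
    by (rule cfun.subspace_diff[OF sub that])
  have "sl2_module R"
    unfolding sl2_module_def
  proof (intro conjI ballI sub)
    show "linear_between (vecs R) (vecs R) (actD R)" "linear_between (vecs R) (vecs R) (actd R)" "linear_between (vecs R) (vecs R) (actH R)"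
      using S unfolding sl2_module_def by (blast intro: act cl eq)+
    fix v assume v: "v \<in> vecs R"
    have "actH S (actD S (T v)) - actD S (actH S (T v)) = cscale 2 (actD S (T v))"
      "actH S (actd S (T v)) - actd S (actH S (T v)) = cscale (- 2) (actd S (T v))"
      "actd S (actD S (T v)) - actD S (actd S (T v)) = actH S (T v)"
      using S T(1)[OF v v] unfolding sl2_module_def by blast+
    note this[folded eq[OF v]]
    note rel = this[folded eq[OF cl(1)[OF v]] eq[OF cl(2)[OF v]] eq[OF cl(3)[OF v]]]
    show "actH R (actD R v) - actD R (actH R v) = cscale 2 (actD R v)"
      by (rule inj) (use v rel in \<open>simp_all add: diff scale cl Tdiff T(3)[OF cl(1) cl(1)]\<close>)
    show "actH R (actd R v) - actd R (actH R v) = cscale (- 2) (actd R v)"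
      by (rule inj) (use v rel in \<open>simp_all add: diff scale cl Tdiff T(3)[OF cl(2) cl(2)] del: cfun.scale_minus_left\<close>)
    show "actd R (actD R v) - actD R (actd R v) = actH R v"
      by (rule inj) (use v rel in \<open>simp_all add: diff cl Tdiff\<close>)
  qed
  then show ?thesis unfolding sl2_iso_def using S lin bij eq by blast
qed

text \<open>A tensor with finitely supported second factor is a finite family of vectors of \<open>V\<close>, its columns.\<close>

lemma tensor_finsupp:
  fixes V :: "('x \<Rightarrow> complex) set"
  assumes V: "cfun.subspace V"
  shows "tensor_space V (finsupp :: ('y \<Rightarrow> complex) set) = {t. (\<forall>j. (\<lambda>x. t (x, j)) \<in> V) \<and> finite {j. \<exists>x. t (x, j) \<noteq> 0}}" (is "_ = ?S")
proof
  have sub: "cfun.subspace ?S"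
  proof (rule cfun.subspaceI)
    show "0 \<in> ?S" using cfun.subspace_0[OF V] by (simp add: zero_fun_def)
    fix s t assume s: "s \<in> ?S" and t: "t \<in> ?S"
    have "(\<lambda>x. (s + t) (x, j)) \<in> V" for j
      using cfun.subspace_add[OF V, of "\<lambda>x. s (x, j)" "\<lambda>x. t (x, j)"] s t by (simp add: plus_fun_def)
    moreover have "{j. \<exists>x. (s + t) (x, j) \<noteq> 0} \<subseteq> {j. \<exists>x. s (x, j) \<noteq> 0} \<union> {j. \<exists>x. t (x, j) \<noteq> 0}" by force
    ultimately show "s + t \<in> ?S" using s t by (auto intro: finite_subset)
  next
    fix c t assume t: "t \<in> ?S"
    have "(\<lambda>x. (cscale c t) (x, j)) \<in> V" for j
      using cfun.subspace_scale[OF V, of "\<lambda>x. t (x, j)" c] t by (simp add: cscale_def)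
    moreover have "{j. \<exists>x. (cscale c t) (x, j) \<noteq> 0} \<subseteq> {j. \<exists>x. t (x, j) \<noteq> 0}" by (auto simp: cscale_def)
    ultimately show "cscale c t \<in> ?S" using t by (auto intro: finite_subset)
  qed
  show "tensor_space V finsupp \<subseteq> ?S"
    unfolding tensor_space_def
  proof (rule cfun.span_minimal[OF _ sub], safe)
    fix f :: "'x \<Rightarrow> complex" and g :: "'y \<Rightarrow> complex" and j assume f: "f \<in> V" and g: "g \<in> finsupp"
    show "(\<lambda>x. tensor f g (x, j)) \<in> V"
      using cfun.subspace_scale[OF V f, of "g j"] by (simp add: tensor_def cscale_def mult.commute)
    have "{j. \<exists>x. tensor f g (x, j) \<noteq> 0} \<subseteq> {j. g j \<noteq> 0}" by (auto simp: tensor_def)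
    then show "finite {j. \<exists>x. tensor f g (x, j) \<noteq> 0}" using g by (auto simp: finsupp_def intro: finite_subset)
  qed
  show "?S \<subseteq> tensor_space V finsupp"
  proof
    fix t assume t: "t \<in> ?S"
    define J where "J = {j. \<exists>x. t (x, j) \<noteq> 0}"
    have J: "finite J" using t by (simp add: J_def)
    have "t = (\<Sum>j\<in>J. tensor (\<lambda>x. t (x, j)) (bvec j))"
    proof
      fix p :: "'x \<times> 'y"
      obtain x y where p: "p = (x, y)" by (cases p)
      have "(\<Sum>j\<in>J. tensor (\<lambda>x. t (x, j)) (bvec j)) (x, y) = (\<Sum>j\<in>J. if y = j then t (x, j) else 0)"
        unfolding sum_fun_apply by (intro sum.cong refl) (simp add: tensor_def bvec_def)
      also have "\<dots> = t (x, y)" using J by (subst sum.delta') (auto simp: J_def)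
      finally show "t p = (\<Sum>j\<in>J. tensor (\<lambda>x. t (x, j)) (bvec j)) p" using p by simp
    qed
    moreover have "(\<Sum>j\<in>J. tensor (\<lambda>x. t (x, j)) (bvec j)) \<in> tensor_space V finsupp"
      unfolding tensor_space_def
    proof (intro cfun.span_sum cfun.span_base CollectI)
      fix j
      have "(\<lambda>x. t (x, j)) \<in> V" using t by simp
      moreover have "(bvec j :: 'y \<Rightarrow> complex) \<in> finsupp" by (simp add: finsupp_def bvec_def)
      ultimately show "\<exists>f g. tensor (\<lambda>x. t (x, j)) (bvec j) = tensor f g \<and> f \<in> V \<and> g \<in> finsupp" by blast
    qed
    ultimately show "t \<in> tensor_space V finsupp" by simp
  qed
qed

lemma tensor_trivial:
  fixes V :: "('x \<Rightarrow> complex) set"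
  assumes V: "cfun.subspace V"
  shows "tensor_space V (cfun.span {bvec (0::nat)}) = {t. (\<forall>j. (\<lambda>x. t (x, j)) \<in> V) \<and> (\<forall>j x. j \<noteq> 0 \<longrightarrow> t (x, j) = 0)}" (is "_ = ?S")
proof
  have sub: "cfun.subspace ?S"
  proof (rule cfun.subspaceI)
    show "0 \<in> ?S" using cfun.subspace_0[OF V] by (simp add: zero_fun_def)
    fix s t assume s: "s \<in> ?S" and t: "t \<in> ?S"
    have "(\<lambda>x. (s + t) (x, j)) \<in> V" for j
      using cfun.subspace_add[OF V, of "\<lambda>x. s (x, j)" "\<lambda>x. t (x, j)"] s t by (simp add: plus_fun_def)
    then show "s + t \<in> ?S" using s t by simp
  next
    fix c t assume t: "t \<in> ?S"
    have "(\<lambda>x. (cscale c t) (x, j)) \<in> V" for j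
      using cfun.subspace_scale[OF V, of "\<lambda>x. t (x, j)" c] t by (simp add: cscale_def)
    then show "cscale c t \<in> ?S" using t by (simp add: cscale_def)
  qed
  show "tensor_space V (cfun.span {bvec 0}) \<subseteq> ?S"
    unfolding tensor_space_def
  proof (rule cfun.span_minimal[OF _ sub], safe)
    fix f :: "'x \<Rightarrow> complex" and g :: "nat \<Rightarrow> complex" and j assume f: "f \<in> V" and g: "g \<in> cfun.span {bvec 0}"
    show "(\<lambda>x. tensor f g (x, j)) \<in> V"
      using cfun.subspace_scale[OF V f, of "g j"] by (simp add: tensor_def cscale_def mult.commute)
    obtain c where c: "g = cscale c (bvec 0)" using g unfolding cfun.span_singleton by blast
    show "tensor f g (x, j) = 0" if "j > 0" for x using that by (simp add: tensor_def c cscale_def bvec_def)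
  qed
  show "?S \<subseteq> tensor_space V (cfun.span {bvec 0})"
  proof
    fix t assume t: "t \<in> ?S"
    have "t = tensor (\<lambda>x. t (x, 0)) (bvec 0)"
    proof
      fix p :: "'x \<times> nat"
      show "t p = tensor (\<lambda>x. t (x, 0)) (bvec 0) p" using t by (cases p) (auto simp: tensor_def bvec_def)
    qed
    moreover have "tensor (\<lambda>x. t (x, 0)) (bvec 0) \<in> tensor_space V (cfun.span {bvec (0::nat)})"
      unfolding tensor_space_def
    proof (intro cfun.span_base CollectI)
      have "(\<lambda>x. t (x, 0)) \<in> V" using t by simp
      moreover have "bvec (0::nat) \<in> cfun.span {bvec 0}" by (rule cfun.span_base) simp
      ultimately show "\<exists>f g. tensor (\<lambda>x. t (x, 0)) (bvec 0) = tensor f g \<and> f \<in> V \<and> g \<in> cfun.span {bvec (0::nat)}" by blast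
    qed
    ultimately show "t \<in> tensor_space V (cfun.span {bvec 0})" by simp
  qed
qed

context fuchsian
begin

abbreviation "modular_module I \<equiv> sl2_sum I (\<lambda>k. sl2_tensor (MF k) (U_mod k))"

text \<open>The modular form that stands in front of the \<open>j\<close>-th basis vector in \<open>M\<^sub>k \<otimes> U\<^sub>k\<close>.\<close>

definition component :: "(int \<times> complex \<times> nat \<Rightarrow> complex) \<Rightarrow> int \<Rightarrow> nat \<Rightarrow> complex \<Rightarrow> complex" where
  "component F k j = (\<lambda>x. F (k, (x, j)))"

lemma component_eqI:
  assumes "\<And>k j. component F k j = component F' k j" shows "F = F'"
proof
  fix p :: "int \<times> complex \<times> nat"
  obtain k x j where p: "p = (k, (x, j))" by (metis prod.collapse)
  show "F p = F' p" using fun_cong[OF assms[of k j], of x] by (simp add: component_def p)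
qed

lemma slice_0_iff: "slice F k = 0 \<longleftrightarrow> (\<forall>j. component F k j = 0)"
  by (auto simp: slice_def component_def fun_eq_iff)

text \<open>For \<open>k = 0\<close> the second factor is one-dimensional, so only the component \<open>j = 0\<close> survives.\<close>

lemma modular_module_iff:
  assumes I: "I \<subseteq> {0..}"
  shows "F \<in> vecs (modular_module I) \<longleftrightarrow> (\<forall>k j. component F k j \<in> MF k) \<and> finite {p. component F (fst p) (snd p) \<noteq> 0} \<and>
    (\<forall>j. j \<noteq> 0 \<longrightarrow> component F 0 j = 0) \<and> (\<forall>k j. k \<notin> I \<longrightarrow> component F k j = 0)"
proof -
  have sl: "(\<lambda>x. slice F k (x, j)) = component F k j" for k j by (simp add: slice_def component_def)
  have ex: "(\<exists>x. slice F k (x, j) \<noteq> 0) \<longleftrightarrow> component F k j \<noteq> 0" for k j by (auto simp: slice_def component_def fun_eq_iff)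
  have V: "slice F k \<in> vecs (sl2_tensor (MF k) (U_mod k)) \<longleftrightarrow>
      (\<forall>j. component F k j \<in> MF k) \<and> (if k = 0 then \<forall>j. j \<noteq> 0 \<longrightarrow> component F k j = 0 else finite {j. component F k j \<noteq> 0})" for k
  proof (cases "k = 0")
    case True
    have "slice F k \<in> tensor_space (MF k) (cfun.span {bvec 0}) \<longleftrightarrow> (\<forall>j. component F k j \<in> MF k) \<and> (\<forall>j. j \<noteq> 0 \<longrightarrow> component F k j = 0)"
      unfolding tensor_trivial[OF subspace_MF] mem_Collect_eq sl using ex by blast
    then show ?thesis using True by (simp add: sl2_tensor_def U_mod_def)
  next
    case False
    have "slice F k \<in> tensor_space (MF k) finsupp \<longleftrightarrow> (\<forall>j. component F k j \<in> MF k) \<and> finite {j. component F k j \<noteq> 0}"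
      unfolding tensor_finsupp[OF subspace_MF] mem_Collect_eq sl ex by (rule refl)
    then show ?thesis using False by (simp add: sl2_tensor_def U_mod_def)
  qed
  have A: "F \<in> vecs (modular_module I) \<longleftrightarrow> finite {k. slice F k \<noteq> 0} \<and> (\<forall>k\<in>I. slice F k \<in> vecs (sl2_tensor (MF k) (U_mod k))) \<and> (\<forall>k. k \<notin> I \<longrightarrow> slice F k = 0)"
    by (simp add: sl2_sum_def direct_sum_def)
  show ?thesis
  proof
    assume "F \<in> vecs (modular_module I)"
    then have F: "finite {k. slice F k \<noteq> 0}" "\<And>k. k \<in> I \<Longrightarrow> slice F k \<in> vecs (sl2_tensor (MF k) (U_mod k))" "\<And>k. k \<notin> I \<Longrightarrow> slice F k = 0"
      unfolding A by auto
    have z: "component F k j = 0" if "k \<notin> I" for k j using F(3)[OF that] slice_0_iff by blast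
    have m: "component F k j \<in> MF k" for k j
      using F(2)[of k] V[of k] z[of k j] cfun.subspace_0[OF subspace_MF] by (cases "k \<in> I") auto
    have z0: "component F 0 j = 0" if "j \<noteq> 0" for j
      using F(2)[of 0] V[of 0] z[of 0 j] that by (cases "0 \<in> I") auto
    have fin: "finite {j. component F k j \<noteq> 0}" for k
    proof (cases "k \<in> I \<and> k \<noteq> 0")
      case True
      then show ?thesis using F(2)[of k] V[of k] by simp
    next
      case False
      then have "{j. component F k j \<noteq> 0} \<subseteq> {0}" using z z0 by auto
      then show ?thesis by (rule finite_subset) simp
    qed
    have "{p. component F (fst p) (snd p) \<noteq> 0} \<subseteq> (SIGMA k:{k. slice F k \<noteq> 0}. {j. component F k j \<noteq> 0})"
      using slice_0_iff by auto
    then have "finite {p. component F (fst p) (snd p) \<noteq> 0}" by (rule finite_subset) (intro finite_SigmaI F fin)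
    then show "(\<forall>k j. component F k j \<in> MF k) \<and> finite {p. component F (fst p) (snd p) \<noteq> 0} \<and> (\<forall>j. j \<noteq> 0 \<longrightarrow> component F 0 j = 0) \<and> (\<forall>k j. k \<notin> I \<longrightarrow> component F k j = 0)"
      using m z z0 by blast
  next
    assume F: "(\<forall>k j. component F k j \<in> MF k) \<and> finite {p. component F (fst p) (snd p) \<noteq> 0} \<and> (\<forall>j. j \<noteq> 0 \<longrightarrow> component F 0 j = 0) \<and> (\<forall>k j. k \<notin> I \<longrightarrow> component F k j = 0)"
    have "{k. slice F k \<noteq> 0} \<subseteq> fst ` {p. component F (fst p) (snd p) \<noteq> 0}"
      using slice_0_iff by (force simp: image_iff)
    then have f1: "finite {k. slice F k \<noteq> 0}" by (rule finite_subset) (use F in auto)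
    have f2: "finite {j. component F k j \<noteq> 0}" for k
    proof (rule finite_subset)
      show "{j. component F k j \<noteq> 0} \<subseteq> snd ` {p. component F (fst p) (snd p) \<noteq> 0}" by (force simp: image_iff)
    qed (use F in auto)
    show "F \<in> vecs (modular_module I)"
      unfolding A V using F f1 f2 slice_0_iff by auto
  qed
qed

lemma subspace_modular_module:
  assumes I: "I \<subseteq> {0..}" shows "cfun.subspace (vecs (modular_module I))"
proof (rule cfun.subspaceI)
  have z: "component 0 k j = 0" for k j by (simp add: component_def fun_eq_iff)
  show "0 \<in> vecs (modular_module I)" unfolding modular_module_iff[OF I] z using cfun.subspace_0[OF subspace_MF] by simp
  fix F F' c
  have a: "component (F + F') k j = component F k j + component F' k j" for k j by (simp add: component_def fun_eq_iff)
  have b: "component (cscale c F) k j = cscale c (component F k j)" for k j by (simp add: component_def cscale_def)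
  assume F: "F \<in> vecs (modular_module I)"
  have "{p. component (cscale c F) (fst p) (snd p) \<noteq> 0} \<subseteq> {p. component F (fst p) (snd p) \<noteq> 0}" unfolding b by auto
  then show "cscale c F \<in> vecs (modular_module I)"
    using F cfun.subspace_scale[OF subspace_MF] unfolding modular_module_iff[OF I] by (auto simp: b intro: finite_subset)
  assume F': "F' \<in> vecs (modular_module I)"
  have "{p. component (F + F') (fst p) (snd p) \<noteq> 0} \<subseteq> {p. component F (fst p) (snd p) \<noteq> 0} \<union> {p. component F' (fst p) (snd p) \<noteq> 0}" unfolding a by auto
  then have "finite {p. component (F + F') (fst p) (snd p) \<noteq> 0}"
    by (rule finite_subset) (use F F' in \<open>simp add: modular_module_iff[OF I]\<close>)
  then show "F + F' \<in> vecs (modular_module I)"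
    using F F' cfun.subspace_add[OF subspace_MF] unfolding modular_module_iff[OF I] by (auto simp: a)
qed

lemma modular_module_act:
  assumes I: "I \<subseteq> {0..}" and F: "F \<in> vecs (modular_module I)"
  shows "actD (modular_module I) F (k, (x, j)) = (if k = 0 \<or> j = 0 then 0 else F (k, (x, j - 1)))"
    and "actd (modular_module I) F (k, (x, j)) = of_nat (j + 1) * (of_int k + of_nat j) * F (k, (x, j + 1))"
    and "actH (modular_module I) F (k, (x, j)) = (of_int k + 2 * of_nat j) * F (k, (x, j))"
proof -
  define u where "u = slice (slice F k) x"
  have u: "u j = F (k, (x, j))" for j by (simp add: u_def slice_def)
  have "{j. u j \<noteq> 0} \<subseteq> snd ` {p. component F (fst p) (snd p) \<noteq> 0}"
  proof
    fix j assume "j \<in> {j. u j \<noteq> 0}"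
    then have "component F k j x \<noteq> 0" by (simp add: u component_def)
    then have "(k, j) \<in> {p. component F (fst p) (snd p) \<noteq> 0}" by (auto simp: fun_eq_iff)
    then show "j \<in> snd ` {p. component F (fst p) (snd p) \<noteq> 0}" by (rule rev_image_eqI) simp
  qed
  then have fin: "u \<in> finsupp" unfolding finsupp_def using F unfolding modular_module_iff[OF I] by (auto intro: finite_subset)
  have e: "actD (modular_module I) F (k, (x, j)) = actD (U_mod k) u j" "actd (modular_module I) F (k, (x, j)) = actd (U_mod k) u j" "actH (modular_module I) F (k, (x, j)) = actH (U_mod k) u j"
    by (simp_all add: sl2_sum_def sl2_tensor_def u_def slice_def)
  have z: "F (0, (x, j)) = 0" if "j \<noteq> 0" for j
  proof -
    have "component F 0 j = 0" using F that unfolding modular_module_iff[OF I] by blast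
    then have "component F 0 j x = 0" by simp
    then show ?thesis by (simp add: component_def)
  qed
  show "actD (modular_module I) F (k, (x, j)) = (if k = 0 \<or> j = 0 then 0 else F (k, (x, j - 1)))"
    "actd (modular_module I) F (k, (x, j)) = of_nat (j + 1) * (of_int k + of_nat j) * F (k, (x, j + 1))"
    "actH (modular_module I) F (k, (x, j)) = (of_int k + 2 * of_nat j) * F (k, (x, j))"
    unfolding e using U_mod_act[OF _ fin, of k] z by (cases "k = 0"; cases "j = 0"; simp add: u U_mod_def)+
qed

lemma component_act:
  assumes I: "I \<subseteq> {0..}" and F: "F \<in> vecs (modular_module I)"
  shows "component (actD (modular_module I) F) k j = (if k = 0 \<or> j = 0 then 0 else component F k (j - 1))"
    and "component (actd (modular_module I) F) k j = cscale (of_nat (j + 1) * (of_int k + of_nat j)) (component F k (j + 1))"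
    and "component (actH (modular_module I) F) k j = cscale (of_int k + 2 * of_nat j) (component F k j)"
  unfolding component_def by (simp_all add: modular_module_act[OF I F] cscale_def fun_eq_iff)

text \<open>All three operators rescale the components and shift the index \<open>j\<close>.\<close>

lemma modular_module_reindexed:
  assumes I: "I \<subseteq> {0..}" and F: "F \<in> vecs (modular_module I)"
    and c: "\<And>k j. component F' k j = cscale (a k j) (component F k (t j))"
    and t: "\<And>n. finite (t -` {n})" "\<And>j. j \<noteq> 0 \<Longrightarrow> a 0 j = 0 \<or> t j \<noteq> 0"
  shows "F' \<in> vecs (modular_module I)"
proof -
  define S where "S = {p. component F (fst p) (snd p) \<noteq> 0}"
  have F1: "component F k j \<in> MF k" and F2: "finite S" and F3: "j \<noteq> 0 \<Longrightarrow> component F 0 j = 0"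
    and F4: "k \<notin> I \<Longrightarrow> component F k j = 0" for k j
    using F unfolding modular_module_iff[OF I] S_def by blast+
  show ?thesis
    unfolding modular_module_iff[OF I] c
  proof (intro conjI allI impI)
    show "cscale (a k j) (component F k (t j)) \<in> MF k" for k j by (rule cfun.subspace_scale[OF subspace_MF F1])
    have "{p. cscale (a (fst p) (snd p)) (component F (fst p) (t (snd p))) \<noteq> 0} \<subseteq> (\<Union>q\<in>S. {fst q} \<times> t -` {snd q})"
      by (auto simp: S_def)
    then show "finite {p. cscale (a (fst p) (snd p)) (component F (fst p) (t (snd p))) \<noteq> 0}"
      by (rule finite_subset) (use F2 t(1) in \<open>auto intro!: finite_UN_I\<close>)
    show "cscale (a 0 j) (component F 0 (t j)) = 0" if "j \<noteq> 0" for j using t(2)[OF that] F3[of "t j"] by auto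
    show "cscale (a k j) (component F k (t j)) = 0" if "k \<notin> I" for k j using F4[OF that] by simp
  qed
qed

lemma modular_module_closed:
  assumes I: "I \<subseteq> {0..}" and F: "F \<in> vecs (modular_module I)"
  shows "actD (modular_module I) F \<in> vecs (modular_module I)" "actd (modular_module I) F \<in> vecs (modular_module I)" "actH (modular_module I) F \<in> vecs (modular_module I)"
proof -
  note c = component_act[OF I F]
  have "(\<lambda>j. j - 1) -` {n} \<subseteq> {0, Suc n}" for n :: nat by auto
  then have t: "finite ((\<lambda>j. j - 1) -` {n})" for n :: nat by (rule finite_subset) simp
  show "actD (modular_module I) F \<in> vecs (modular_module I)"
    by (rule modular_module_reindexed[OF I F, where a = "\<lambda>k j. if k = 0 \<or> j = 0 then 0 else 1" and t = "\<lambda>j. j - 1"])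
       (use t in \<open>simp_all add: c\<close>)
  show "actd (modular_module I) F \<in> vecs (modular_module I)"
    by (rule modular_module_reindexed[OF I F, where t = "\<lambda>j. j + 1"]) (simp_all only: c, auto intro: finite_vimageI)
  show "actH (modular_module I) F \<in> vecs (modular_module I)"
    by (rule modular_module_reindexed[OF I F, where t = "\<lambda>j. j"]) (simp_all only: c, auto intro: finite_vimageI)
qed

lemma quasi_vecs: "F \<in> vecs (quasi_rep \<Gamma>) \<longleftrightarrow> finite {k. slice F k \<noteq> 0} \<and> (\<forall>k. slice F k \<in> QM k)"
  using QM_neg by (auto simp: quasi_rep_def direct_sum_def) (metis QM_0 atLeast_iff not_le)

lemma slice_ops: "slice (F + F') k = slice F k + slice F' k" "slice (F - F') k = slice F k - slice F' k" "slice (cscale c F) k = cscale c (slice F k)" "slice 0 k = 0"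
  by (auto simp: slice_def fun_eq_iff cscale_def)

lemma slice_eqI: "(\<And>k. slice F k = slice F' k) \<Longrightarrow> F = F'"
  unfolding slice_def fun_eq_iff by auto

lemma slice_act:
  shows "slice (actD (quasi_rep \<Gamma>) F) k = D_uhp (slice F (k - 2))"
    and "slice (actd (quasi_rep \<Gamma>) F) k = delta \<Gamma> (k + 2) (slice F (k + 2))"
    and "slice (actH (quasi_rep \<Gamma>) F) k = cscale (of_int k) (slice F k)"
  by (auto simp: quasi_rep_def slice_def cscale_def fun_eq_iff)

lemma delta_add: "f \<in> QM k \<Longrightarrow> g \<in> QM k \<Longrightarrow> delta \<Gamma> k (f + g) = delta \<Gamma> k f + delta \<Gamma> k g"
  using delta_QM(1) QM_add qcoef_add by metis

lemma delta_cscale: "f \<in> QM k \<Longrightarrow> delta \<Gamma> k (cscale c f) = cscale c (delta \<Gamma> k f)"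
  using delta_QM(1) QM_cscale qcoef_cscale by metis

lemma quasi_module: "sl2_module (quasi_rep \<Gamma>)"
proof -
  define R where "R = quasi_rep \<Gamma>"
  note sa = slice_act[folded R_def]
  have v: "F \<in> vecs R \<longleftrightarrow> finite {k. slice F k \<noteq> 0} \<and> (\<forall>k. slice F k \<in> QM k)" for F
    unfolding R_def by (rule quasi_vecs)
  have vQ: "F \<in> vecs R \<Longrightarrow> slice F k \<in> QM k" for F k unfolding v by blast
  have sub: "cfun.subspace (vecs R)"
  proof (rule cfun.subspaceI)
    show "0 \<in> vecs R" unfolding v slice_ops by simp
    fix F F' c assume F: "F \<in> vecs R"
    have "{k. slice (cscale c F) k \<noteq> 0} \<subseteq> {k. slice F k \<noteq> 0}" unfolding slice_ops by auto
    then show "cscale c F \<in> vecs R" using F QM_cscale unfolding v by (auto simp: slice_ops intro: finite_subset)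
    assume F': "F' \<in> vecs R"
    have "{k. slice (F + F') k \<noteq> 0} \<subseteq> {k. slice F k \<noteq> 0} \<union> {k. slice F' k \<noteq> 0}" unfolding slice_ops by auto
    then have "finite {k. slice (F + F') k \<noteq> 0}" by (rule finite_subset) (use F F' in \<open>simp add: v\<close>)
    then show "F + F' \<in> vecs R" using F F' QM_add unfolding v by (auto simp: slice_ops)
  qed
  have D: "actD R F \<in> vecs R" if F: "F \<in> vecs R" for F
    unfolding v sa
  proof (intro conjI allI)
    have "{k. D_uhp (slice F (k - 2)) \<noteq> 0} \<subseteq> (\<lambda>k. k + 2) ` {k. slice F k \<noteq> 0}"
    proof
      fix k assume "k \<in> {k. D_uhp (slice F (k - 2)) \<noteq> 0}"
      then have "slice F (k - 2) \<noteq> 0" using D_uhp_0 by auto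
      then show "k \<in> (\<lambda>k. k + 2) ` {k. slice F k \<noteq> 0}" by (intro image_eqI[of _ _ "k - 2"]) auto
    qed
    then show "finite {k. D_uhp (slice F (k - 2)) \<noteq> 0}" by (rule finite_subset) (use F in \<open>simp add: v\<close>)
    show "D_uhp (slice F (k - 2)) \<in> QM k" for k using D_QM(1)[OF vQ[OF F, of "k - 2"]] by simp
  qed
  have d: "actd R F \<in> vecs R" if F: "F \<in> vecs R" for F
    unfolding v sa
  proof (intro conjI allI)
    have "{k. delta \<Gamma> (k + 2) (slice F (k + 2)) \<noteq> 0} \<subseteq> (\<lambda>k. k - 2) ` {k. slice F k \<noteq> 0}"
    proof
      fix k assume "k \<in> {k. delta \<Gamma> (k + 2) (slice F (k + 2)) \<noteq> 0}"
      then have "slice F (k + 2) \<noteq> 0" using delta_zero_form by auto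
      then show "k \<in> (\<lambda>k. k - 2) ` {k. slice F k \<noteq> 0}" by (intro image_eqI[of _ _ "k + 2"]) auto
    qed
    then show "finite {k. delta \<Gamma> (k + 2) (slice F (k + 2)) \<noteq> 0}" by (rule finite_subset) (use F in \<open>simp add: v\<close>)
    show "delta \<Gamma> (k + 2) (slice F (k + 2)) \<in> QM k" for k using delta_QM(2)[OF vQ[OF F, of "k + 2"]] by simp
  qed
  have H: "actH R F \<in> vecs R" if F: "F \<in> vecs R" for F
    unfolding v sa
  proof (intro conjI allI)
    have "{k. cscale (of_int k) (slice F k) \<noteq> 0} \<subseteq> {k. slice F k \<noteq> 0}" by auto
    then show "finite {k. cscale (of_int k) (slice F k) \<noteq> 0}" by (rule finite_subset) (use F in \<open>simp add: v\<close>)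
    show "cscale (of_int k) (slice F k) \<in> QM k" for k by (rule QM_cscale[OF vQ[OF F]])
  qed
  have "sl2_module R"
    unfolding sl2_module_def
  proof (intro conjI ballI)
    show "cfun.subspace (vecs R)" by (rule sub)
    show "linear_between (vecs R) (vecs R) (actD R)"
      unfolding linear_between_def
      by (intro conjI ballI allI D slice_eqI) (simp_all only: sa slice_ops D_add[OF QM_moderate[OF vQ] QM_moderate[OF vQ]] D_cscale[OF QM_moderate[OF vQ]])
    show "linear_between (vecs R) (vecs R) (actd R)"
      unfolding linear_between_def
      by (intro conjI ballI allI d slice_eqI) (simp_all only: sa slice_ops delta_add[OF vQ vQ] delta_cscale[OF vQ])
    show "linear_between (vecs R) (vecs R) (actH R)"
      unfolding linear_between_def
      by (intro conjI ballI allI H slice_eqI) (simp_all only: sa slice_ops cfun.scale_right_distrib cfun.scale_scale mult.commute)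
    fix F assume F: "F \<in> vecs R"
    show "actH R (actD R F) - actD R (actH R F) = cscale 2 (actD R F)"
    proof (rule slice_eqI)
      fix k
      have "cscale (of_int k) (D_uhp (slice F (k - 2))) - cscale (of_int (k - 2)) (D_uhp (slice F (k - 2))) = cscale 2 (D_uhp (slice F (k - 2)))"
        unfolding cfun.scale_left_diff_distrib[symmetric] by simp
      then show "slice (actH R (actD R F) - actD R (actH R F)) k = slice (cscale 2 (actD R F)) k"
        unfolding slice_ops sa D_cscale[OF QM_moderate[OF vQ[OF F]]] .
    qed
    show "actH R (actd R F) - actd R (actH R F) = cscale (- 2) (actd R F)"
    proof (rule slice_eqI)
      fix k
      have "cscale (of_int k) (delta \<Gamma> (k + 2) (slice F (k + 2))) - cscale (of_int (k + 2)) (delta \<Gamma> (k + 2) (slice F (k + 2))) = cscale (- 2) (delta \<Gamma> (k + 2) (slice F (k + 2)))"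
        unfolding cfun.scale_left_diff_distrib[symmetric] by simp
      then show "slice (actH R (actd R F) - actd R (actH R F)) k = slice (cscale (- 2) (actd R F)) k"
        unfolding slice_ops sa delta_cscale[OF vQ[OF F]] .
    qed
    show "actd R (actD R F) - actD R (actd R F) = actH R F"
    proof (rule slice_eqI)
      fix k :: int
      have w: "k + 2 - 2 = k" "k - 2 + 2 = k" by simp_all
      have "delta \<Gamma> (k + 2) (D_uhp (slice F k)) - D_uhp (delta \<Gamma> k (slice F k)) = cscale (of_int k) (slice F k)"
        unfolding delta_D[OF vQ[OF F]] by simp
      then show "slice (actd R (actD R F) - actD R (actd R F)) k = slice (actH R F) k"
        unfolding slice_ops sa w .
    qed
  qed
  then show ?thesis by (simp add: R_def)
qed

section \<open>The isomorphisms\<close>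

lemma Phi_cong:
  assumes "\<And>k j. H k j = H' k j" "\<And>m. cscale (c m) (e m) = cscale (c' m) (e m)"
  shows "Phi e H c m = Phi e H' c' m"
  using assms unfolding Phi_def by simp

text \<open>A module whose vectors are described by coordinates \<open>Hm v\<close> and \<open>cm v\<close> is isomorphic to the space of quasimodular
  forms as soon as its operators act on these coordinates as \<open>Phi_D\<close>, \<open>Phi_delta\<close> and \<open>Phi_H\<close> prescribe. The
  coordinates \<open>cm v m\<close> matter only where the top term \<open>e m\<close> is nonzero.\<close>

definition assemble :: "(int \<Rightarrow> complex \<Rightarrow> complex) \<Rightarrow> (('x \<Rightarrow> complex) \<Rightarrow> int \<Rightarrow> nat \<Rightarrow> complex \<Rightarrow> complex) \<Rightarrow>
    (('x \<Rightarrow> complex) \<Rightarrow> int \<Rightarrow> complex) \<Rightarrow> ('x \<Rightarrow> complex) \<Rightarrow> int \<times> complex \<Rightarrow> complex" where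
  "assemble e Hm cm v = (\<lambda>(m, z). Phi e (Hm v) (cm v) m z)"

lemma slice_assemble: "slice (assemble e Hm cm v) m = Phi e (Hm v) (cm v) m"
  by (simp add: slice_def assemble_def)

lemma assemble_iso:
  assumes e: "top_family e"
    and De: "\<And>m. D_uhp (e m) = cscale (d m) (e (m + 2))"
    and de: "\<And>m. delta \<Gamma> (m + 2) (e (m + 2)) = cscale (\<gamma> m) (e m)"
    and sub: "cfun.subspace (vecs R)"
    and cl: "\<And>v. v \<in> vecs R \<Longrightarrow> actD R v \<in> vecs R" "\<And>v. v \<in> vecs R \<Longrightarrow> actd R v \<in> vecs R" "\<And>v. v \<in> vecs R \<Longrightarrow> actH R v \<in> vecs R"
    and gr: "\<And>v. v \<in> vecs R \<Longrightarrow> graded (Hm v)" and fin: "\<And>v. v \<in> vecs R \<Longrightarrow> finite {m. cm v m \<noteq> 0}"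
    and Hadd: "\<And>u v k j. u \<in> vecs R \<Longrightarrow> v \<in> vecs R \<Longrightarrow> Hm (u + v) k j = Hm u k j + Hm v k j"
    and Hscale: "\<And>a v k j. v \<in> vecs R \<Longrightarrow> Hm (cscale a v) k j = cscale a (Hm v k j)"
    and cadd: "\<And>u v m. u \<in> vecs R \<Longrightarrow> v \<in> vecs R \<Longrightarrow> cm (u + v) m = cm u m + cm v m"
    and cscale: "\<And>a v m. v \<in> vecs R \<Longrightarrow> cm (cscale a v) m = a * cm v m"
    and inj: "\<And>v. v \<in> vecs R \<Longrightarrow> (\<And>k j. Hm v k j = 0) \<Longrightarrow> (\<And>m. cscale (cm v m) (e m) = 0) \<Longrightarrow> v = 0"
    and surj: "\<And>H c. graded H \<Longrightarrow> finite {m. c m \<noteq> 0} \<Longrightarrow> (\<And>m. e m = 0 \<Longrightarrow> c m = 0) \<Longrightarrow>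
        \<exists>v\<in>vecs R. (\<forall>k j. Hm v k j = H k j) \<and> (\<forall>m. cm v m = c m)"
    and HD: "\<And>v k j. v \<in> vecs R \<Longrightarrow> Hm (actD R v) k j = (if j = 0 then 0 else Hm v k (j - 1))"
    and Hd: "\<And>v k j. v \<in> vecs R \<Longrightarrow> Hm (actd R v) k j = cscale (of_nat (j + 1) * (of_int k + of_nat j)) (Hm v k (j + 1))"
    and HH: "\<And>v k j. v \<in> vecs R \<Longrightarrow> Hm (actH R v) k j = cscale (of_int k + 2 * of_nat j) (Hm v k j)"
    and cD: "\<And>v m. v \<in> vecs R \<Longrightarrow> cscale (cm (actD R v) m) (e m) = cscale (d (m - 2) * cm v (m - 2)) (e m)"
    and cd: "\<And>v m. v \<in> vecs R \<Longrightarrow> cscale (cm (actd R v) m) (e m) = cscale (\<gamma> m * cm v (m + 2)) (e m)"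
    and cH: "\<And>v m. v \<in> vecs R \<Longrightarrow> cscale (cm (actH R v) m) (e m) = cscale (of_int m * cm v m) (e m)"
  shows "sl2_iso (assemble e Hm cm) R (quasi_rep \<Gamma>)"
proof -
  define T where "T = assemble e Hm cm"
  have sT: "slice (T v) m = Phi e (Hm v) (cm v) m" for v m unfolding T_def by (rule slice_assemble)
  have maps: "T v \<in> vecs (quasi_rep \<Gamma>)" if "v \<in> vecs R" for v
    unfolding quasi_vecs sT using Phi_finite[OF gr fin] Phi_QM[OF e gr] that by blast
  have add: "T (u + v) = T u + T v" if u: "u \<in> vecs R" and v: "v \<in> vecs R" for u v
  proof (rule slice_eqI)
    fix m
    have "Phi e (Hm (u + v)) (cm (u + v)) m = Phi e (\<lambda>k j. Hm u k j + Hm v k j) (\<lambda>m. cm u m + cm v m) m"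
      by (rule Phi_cong) (simp_all only: Hadd[OF u v] cadd[OF u v])
    then show "slice (T (u + v)) m = slice (T u + T v) m" unfolding slice_ops sT Phi_add[OF gr[OF u] gr[OF v]] .
  qed
  have scale: "T (cscale a v) = Defs.cscale a (T v)" if v: "v \<in> vecs R" for a v
  proof (rule slice_eqI)
    fix m
    have "Phi e (Hm (cscale a v)) (cm (cscale a v)) m = Phi e (\<lambda>k j. Defs.cscale a (Hm v k j)) (\<lambda>m. a * cm v m) m"
      by (rule Phi_cong) (simp_all only: Hscale[OF v] cscale[OF v])
    then show "slice (T (cscale a v)) m = slice (Defs.cscale a (T v)) m" unfolding slice_ops sT Phi_cscale[OF gr[OF v]] .
  qed
  have lin: "linear_between (vecs R) (vecs (quasi_rep \<Gamma>)) T"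
    unfolding linear_between_def using maps add scale by blast
  have injT: "inj_on T (vecs R)"
  proof (rule inj_onI)
    fix u v assume u: "u \<in> vecs R" and v: "v \<in> vecs R" and eq: "T u = T v"
    have nv: "Defs.cscale (-1) v \<in> vecs R" by (rule cfun.subspace_scale[OF sub v])
    define w where "w = u + Defs.cscale (-1) v"
    have w: "w \<in> vecs R" unfolding w_def by (rule cfun.subspace_add[OF sub u nv])
    have "T w = 0" unfolding w_def add[OF u nv] scale[OF v] eq by simp
    then have 0: "Phi e (Hm w) (cm w) m = 0" for m unfolding sT[symmetric] by (simp add: slice_ops)
    have "w = 0" by (rule inj[OF w Phi_inj[OF e gr[OF w] 0]])
    then show "u = v" unfolding w_def by simp
  qed
  have surjT: "\<exists>v\<in>vecs R. T v = F" if F: "F \<in> vecs (quasi_rep \<Gamma>)" for F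
  proof -
    obtain H c where Hc: "graded H" "finite {m. c m \<noteq> 0}" "\<And>m. e m = 0 \<Longrightarrow> c m = 0" "\<And>m. slice F m = Phi e H c m"
      using Phi_surj[OF e, of "slice F"] F unfolding quasi_vecs by blast
    obtain v where v: "v \<in> vecs R" "\<And>k j. Hm v k j = H k j" "\<And>m. cm v m = c m" using surj[OF Hc(1-3)] by blast
    have "T v = F"
    proof (rule slice_eqI)
      fix m
      show "slice (T v) m = slice F m" unfolding sT Hc(4) by (rule Phi_cong) (simp_all only: v)
    qed
    then show ?thesis using v(1) by blast
  qed
  have bij: "bij_betw T (vecs R) (vecs (quasi_rep \<Gamma>))"
    unfolding bij_betw_def using injT maps surjT by blast
  show ?thesis
    unfolding T_def[symmetric]
  proof (rule sl2_iso_transport[OF quasi_module sub lin bij cl])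
    fix v assume v: "v \<in> vecs R"
    show "T (actD R v) = actD (quasi_rep \<Gamma>) (T v)"
      by (rule slice_eqI, unfold slice_act sT Phi_D[OF e gr[OF v] De], rule Phi_cong) (simp_all only: HD[OF v] cD[OF v])
    show "T (actd R v) = actd (quasi_rep \<Gamma>) (T v)"
      by (rule slice_eqI, unfold slice_act sT Phi_delta[OF e gr[OF v] de], rule Phi_cong) (simp_all only: Hd[OF v] cd[OF v])
    show "T (actH R v) = actH (quasi_rep \<Gamma>) (T v)"
      by (rule slice_eqI, unfold slice_act sT Phi_H[OF gr[OF v]], rule Phi_cong) (simp_all only: HH[OF v] cH[OF v])
  qed
qed

text \<open>The coordinates of positive weight; the constants in weight \<open>0\<close> belong to the top terms.\<close>

definition pos_part :: "(int \<times> complex \<times> nat \<Rightarrow> complex) \<Rightarrow> int \<Rightarrow> nat \<Rightarrow> complex \<Rightarrow> complex" where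
  "pos_part F k j = (if k > 0 then component F k j else 0)"

lemma pos_part_graded:
  assumes I: "I \<subseteq> {0..}" and F: "F \<in> vecs (modular_module I)" shows "graded (pos_part F)"
  unfolding graded_def
proof (intro conjI allI impI)
  have F1: "component F k j \<in> MF k" and F2: "finite {p. component F (fst p) (snd p) \<noteq> 0}" for k j
    using F unfolding modular_module_iff[OF I] by blast+
  show "pos_part F k j \<in> MF k" for k j unfolding pos_part_def using F1 cfun.subspace_0[OF subspace_MF] by simp
  show "pos_part F k j = 0" if "k \<le> 0" for k j using that by (simp add: pos_part_def)
  have "{p. pos_part F (fst p) (snd p) \<noteq> 0} \<subseteq> {p. component F (fst p) (snd p) \<noteq> 0}" by (auto simp: pos_part_def)
  then show "finite {p. pos_part F (fst p) (snd p) \<noteq> 0}" by (rule finite_subset) (rule F2)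
qed

lemma pos_part_act:
  assumes I: "I \<subseteq> {0..}" and F: "F \<in> vecs (modular_module I)"
  shows "pos_part (actD (modular_module I) F) k j = (if j = 0 then 0 else pos_part F k (j - 1))"
    and "pos_part (actd (modular_module I) F) k j = cscale (of_nat (j + 1) * (of_int k + of_nat j)) (pos_part F k (j + 1))"
    and "pos_part (actH (modular_module I) F) k j = cscale (of_int k + 2 * of_nat j) (pos_part F k j)"
  unfolding pos_part_def component_act[OF I F] by (auto simp only: cfun.scale_zero_right split: if_splits)

lemma pos_part_ops: "pos_part (F + F') k j = pos_part F k j + pos_part F' k j" "pos_part (cscale a F) k j = cscale a (pos_part F k j)"
  by (auto simp: pos_part_def component_def fun_eq_iff cscale_def)

text \<open>The vector with prescribed coordinates of positive weight and the constant \<open>a\<close> in weight \<open>0\<close>.\<close>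

definition from_graded :: "complex \<Rightarrow> (int \<Rightarrow> nat \<Rightarrow> complex \<Rightarrow> complex) \<Rightarrow> int \<times> complex \<times> nat \<Rightarrow> complex" where
  "from_graded a H = (\<lambda>(k, x, j). if k = 0 then (if j = 0 then a * one_uhp x else 0) else H k j x)"

lemma from_graded:
  assumes H: "graded H"
  shows "pos_part (from_graded a H) k j = H k j" "from_graded a H \<in> vecs (modular_module {0..})" "from_graded 0 H \<in> vecs (modular_module {1..})"
proof -
  have H1: "H k j \<in> MF k" and H2: "k \<le> 0 \<Longrightarrow> H k j = 0" and H3: "finite {p. H (fst p) (snd p) \<noteq> 0}" for k j
    using H unfolding graded_def by blast+
  have c: "component (from_graded a H) k j = (if k = 0 then (if j = 0 then cscale a one_uhp else 0) else H k j)" for a k j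
    by (auto simp: component_def from_graded_def cscale_def fun_eq_iff)
  show "pos_part (from_graded a H) k j = H k j" using H2[of k j] by (auto simp: pos_part_def c)
  have m: "component (from_graded a H) k j \<in> MF k" for a k j
    unfolding c using H1 cfun.subspace_0[OF subspace_MF] cfun.subspace_scale[OF subspace_MF one_MF] by simp
  have f: "finite {p. component (from_graded a H) (fst p) (snd p) \<noteq> 0}" for a
  proof (rule finite_subset)
    show "{p. component (from_graded a H) (fst p) (snd p) \<noteq> 0} \<subseteq> insert (0, 0) {p. H (fst p) (snd p) \<noteq> 0}"
      unfolding c by (auto split: if_splits)
  qed (use H3 in simp)
  have z: "component (from_graded a H) 0 j = 0" if "j \<noteq> 0" for a j unfolding c using that by simp
  have n: "component (from_graded a H) k j = 0" if "k < 0" for a k j unfolding c using H2[of k j] that by simp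
  have n0: "component (from_graded 0 H) k j = 0" if "k \<le> 0" for k j unfolding c using H2[of k j] that by simp
  show "from_graded a H \<in> vecs (modular_module {0..})"
    by (subst modular_module_iff) (use m f z n in auto)
  show "from_graded 0 H \<in> vecs (modular_module {1..})"
    by (subst modular_module_iff) (use m f z n0 in auto)
qed

lemma pos_part_single:
  "pos_part (summand k (tensor f (bvec j))) k' j' = (if k' = k \<and> j' = j \<and> k > 0 then f else 0)"
  by (auto simp: pos_part_def component_def summand_def tensor_def bvec_def fun_eq_iff)

text \<open>Evaluation at \<open>\<i>\<close> reads off the constant that a form of weight \<open>0\<close> is.\<close>

definition weight_0_coord :: "(int \<times> complex \<times> nat \<Rightarrow> complex) \<Rightarrow> int \<Rightarrow> complex" where
  "weight_0_coord F m = (if m = 0 then F (0, (\<i>, 0)) else 0)"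

lemma assemble_iso_const_top:
  assumes 0: "\<forall>\<phi>\<in>QM 2. delta \<Gamma> 2 \<phi> = 0"
  shows "sl2_iso (assemble const_top pos_part weight_0_coord) (modular_module {0..}) (quasi_rep \<Gamma>)"
proof (rule assemble_iso[where d = "\<lambda>_. 0" and \<gamma> = "\<lambda>_. 0"])
  have I: "{0..} \<subseteq> {0::int..}" by simp
  show "top_family const_top" by (rule const_top[OF 0])
  show "D_uhp (const_top m) = cscale 0 (const_top (m + 2))" for m by (rule D_const_top)
  show "delta \<Gamma> (m + 2) (const_top (m + 2)) = cscale 0 (const_top m)" for m by (rule delta_const_top)
  show "cfun.subspace (vecs (modular_module {0..}))" by (rule subspace_modular_module[OF I])
  show "pos_part (u + v) k j = pos_part u k j + pos_part v k j" for u v k j by (rule pos_part_ops)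
  show "pos_part (cscale a v) k j = cscale a (pos_part v k j)" for a v k j by (rule pos_part_ops)
  show "weight_0_coord (u + v) m = weight_0_coord u m + weight_0_coord v m" for u v m by (simp add: weight_0_coord_def)
  show "weight_0_coord (cscale a v) m = a * weight_0_coord v m" for a v m by (simp add: weight_0_coord_def cscale_def)
  fix v assume v: "v \<in> vecs (modular_module {0..})"
  show "actD (modular_module {0..}) v \<in> vecs (modular_module {0..})" "actd (modular_module {0..}) v \<in> vecs (modular_module {0..})"
    "actH (modular_module {0..}) v \<in> vecs (modular_module {0..})"
    by (rule modular_module_closed[OF I v])+
  show "graded (pos_part v)" by (rule pos_part_graded[OF I v])
  have "{m. weight_0_coord v m \<noteq> 0} \<subseteq> {0}" by (auto simp: weight_0_coord_def)
  then show "finite {m. weight_0_coord v m \<noteq> 0}" by (rule finite_subset) simp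
  show "pos_part (actD (modular_module {0..}) v) k j = (if j = 0 then 0 else pos_part v k (j - 1))"
    "pos_part (actd (modular_module {0..}) v) k j = cscale (of_nat (j + 1) * (of_int k + of_nat j)) (pos_part v k (j + 1))"
    "pos_part (actH (modular_module {0..}) v) k j = cscale (of_int k + 2 * of_nat j) (pos_part v k j)" for k j
    by (rule pos_part_act[OF I v])+
  have z: "weight_0_coord (actD (modular_module {0..}) v) m = 0" "weight_0_coord (actd (modular_module {0..}) v) m = 0" "weight_0_coord (actH (modular_module {0..}) v) m = 0" for m
    unfolding weight_0_coord_def modular_module_act[OF I v] by simp_all
  show "cscale (weight_0_coord (actD (modular_module {0..}) v) m) (const_top m) = cscale (0 * weight_0_coord v (m - 2)) (const_top m)"
    "cscale (weight_0_coord (actd (modular_module {0..}) v) m) (const_top m) = cscale (0 * weight_0_coord v (m + 2)) (const_top m)" for m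
    unfolding z mult_zero_left by (rule refl)+
  have "of_int m * weight_0_coord v m = 0" for m by (simp add: weight_0_coord_def)
  then show "cscale (weight_0_coord (actH (modular_module {0..}) v) m) (const_top m) = cscale (of_int m * weight_0_coord v m) (const_top m)" for m
    unfolding z by (simp only:)
  assume p0: "\<And>k j. pos_part v k j = 0" and c0: "\<And>m. cscale (weight_0_coord v m) (const_top m) = 0"
  have F1: "component v k j \<in> MF k" and F3: "j \<noteq> 0 \<Longrightarrow> component v 0 j = 0" for k j
    using v unfolding modular_module_iff[OF I] by blast+
  have "cscale (v (0, (\<i>, 0))) one_uhp = 0" using c0[of 0] by (simp add: weight_0_coord_def const_top_def)
  then have v0: "v (0, (\<i>, 0)) = 0" using one_uhp_nz by simp
  obtain a where a: "component v 0 0 = cscale a one_uhp" using MF_0[OF F1[of 0 0]] by blast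
  have "a = 0" using fun_cong[OF a, of \<i>] v0 by (simp add: component_def cscale_def one_uhp_def)
  then have v00: "component v 0 0 = 0" using a by simp
  have "component v k j = component 0 k j" for k j
  proof -
    have "component v k j = 0"
    proof (cases "k > 0")
      case True
      then show ?thesis using p0[of k j] by (simp add: pos_part_def)
    next
      case False
      show ?thesis
      proof (cases "k = 0")
        case True
        then show ?thesis using v00 F3[of j] by (cases "j = 0") (simp_all only: simp_thms)
      next
        case F2: False
        then show ?thesis using MF_neg[OF _ F1[of k j]] False by simp
      qed
    qed
    then show ?thesis by (simp add: component_def fun_eq_iff)
  qed
  then show "v = 0" by (rule component_eqI)
next
  fix H and c :: "int \<Rightarrow> complex" assume H: "graded H" and c: "finite {m. c m \<noteq> 0}" "\<And>m. const_top m = 0 \<Longrightarrow> c m = 0"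
  have "weight_0_coord (from_graded (c 0) H) m = c m" for m
    using c(2)[of m] by (auto simp: weight_0_coord_def from_graded_def one_uhp_def const_top_def)
  then show "\<exists>v\<in>vecs (modular_module {0..}). (\<forall>k j. pos_part v k j = H k j) \<and> (\<forall>m. weight_0_coord v m = c m)"
    using from_graded[OF H] by blast
qed

text \<open>The basis vector \<open>None\<close> corresponds to the top term of weight \<open>0\<close>, and \<open>Some i\<close> to that of weight \<open>2 + 2 i\<close>.\<close>

definition hat_coord :: "(nat option \<Rightarrow> complex) \<Rightarrow> int \<Rightarrow> complex" where
  "hat_coord u m = (if m = 0 then u None else if m > 0 \<and> even m then u (Some (nat (m div 2) - 1)) else 0)"

lemma hat_coord_even [simp]: "hat_coord u (2 + 2 * int i) = u (Some i)"
proof -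
  have "nat ((2 + 2 * int i) div 2) - 1 = i" by simp
  then show ?thesis by (simp add: hat_coord_def)
qed

lemma hat_coord_0 [simp]: "hat_coord u 0 = u None"
  by (simp add: hat_coord_def)

lemma hat_coord_other: "m \<noteq> 0 \<Longrightarrow> \<not> (m > 0 \<and> even m) \<Longrightarrow> hat_coord u m = 0"
  by (auto simp: hat_coord_def)

lemma weight_cases:
  obtains "m = 0" | i where "m = 2 + 2 * int i" | "m \<noteq> 0" "\<not> (m > 0 \<and> even m)"
  using even_pos_int by metis

lemma Dpow_phi_nz:
  assumes phi: "\<phi> \<in> QM 2" "delta \<Gamma> 2 \<phi> = one_uhp"
  shows "(D_uhp ^^ i) \<phi> \<noteq> 0"
proof
  assume "(D_uhp ^^ i) \<phi> = 0"
  then have "cscale (fact i) one_uhp = qcoef (2 + 2 * int i) 0 (Suc i)" using qcoef_phi[OF phi, of i] by (simp only:)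
  then show False using one_uhp_nz by simp
qed

lemma assemble_iso_phi_top:
  assumes phi: "\<phi> \<in> QM 2" "delta \<Gamma> 2 \<phi> = one_uhp"
  shows "sl2_iso (assemble (phi_top \<phi>) (\<lambda>v. pos_part (v \<circ> Inl)) (\<lambda>v. hat_coord (v \<circ> Inr))) (sl2_plus (modular_module {1..}) U2hat) (quasi_rep \<Gamma>)"
proof (rule assemble_iso[where d = "\<lambda>m. if m \<le> 0 then 0 else 1" and
      \<gamma> = "\<lambda>m. if m = 0 then 1 else if m < 0 then 0 else of_int m / 2 * (of_int m / 2 + 1)"])
  have I: "{1..} \<subseteq> {0::int..}" by auto
  define R where "R = sl2_plus (modular_module {1..}) U2hat"
  have vR: "v \<in> vecs R \<longleftrightarrow> v \<circ> Inl \<in> vecs (modular_module {1..}) \<and> v \<circ> Inr \<in> finsupp" for v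
    by (simp add: R_def sl2_plus_def U2hat_def)
  have actl: "actD R v \<circ> Inl = actD (modular_module {1..}) (v \<circ> Inl)" "actd R v \<circ> Inl = actd (modular_module {1..}) (v \<circ> Inl)" "actH R v \<circ> Inl = actH (modular_module {1..}) (v \<circ> Inl)" for v
    by (simp_all add: R_def sl2_plus_def fun_eq_iff)
  have actr: "actD R v \<circ> Inr = actD U2hat (v \<circ> Inr)" "actd R v \<circ> Inr = actd U2hat (v \<circ> Inr)" "actH R v \<circ> Inr = actH U2hat (v \<circ> Inr)" for v
    by (simp_all add: R_def sl2_plus_def fun_eq_iff)
  have ops: "(u + v) \<circ> f = (u \<circ> f) + (v \<circ> f)" "cscale a v \<circ> f = cscale a (v \<circ> f)" for u v :: "'c \<Rightarrow> complex" and f :: "'d \<Rightarrow> 'c" and a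
    by (auto simp: fun_eq_iff cscale_def)
  show "top_family (phi_top \<phi>)" by (rule phi_top[OF phi])
  show "D_uhp (phi_top \<phi> m) = cscale (if m \<le> 0 then 0 else 1) (phi_top \<phi> (m + 2))" for m by (rule D_phi_top[OF phi])
  show "delta \<Gamma> (m + 2) (phi_top \<phi> (m + 2)) = cscale (if m = 0 then 1 else if m < 0 then 0 else of_int m / 2 * (of_int m / 2 + 1)) (phi_top \<phi> m)" for m
    by (rule delta_phi_top[OF phi])
  have "vecs U2hat = finsupp" by (simp add: U2hat_def)
  then show "cfun.subspace (vecs (sl2_plus (modular_module {1..}) U2hat))"
    by (intro subspace_sl2_plus subspace_modular_module[OF I]) (simp add: subspace_finsupp)
  show "pos_part ((u + v) \<circ> Inl) k j = pos_part (u \<circ> Inl) k j + pos_part (v \<circ> Inl) k j" for u v :: "_ + nat option \<Rightarrow> complex" and k j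
    unfolding ops by (rule pos_part_ops)
  show "pos_part (cscale a v \<circ> Inl) k j = cscale a (pos_part (v \<circ> Inl) k j)" for a and v :: "_ + nat option \<Rightarrow> complex" and k j
    unfolding ops by (rule pos_part_ops)
  show "hat_coord ((u + v) \<circ> Inr) m = hat_coord (u \<circ> Inr) m + hat_coord (v \<circ> Inr) m" for u v :: "(int \<times> complex \<times> nat) + nat option \<Rightarrow> complex" and m
    by (simp add: hat_coord_def)
  show "hat_coord (cscale a v \<circ> Inr) m = a * hat_coord (v \<circ> Inr) m" for a and v :: "(int \<times> complex \<times> nat) + nat option \<Rightarrow> complex" and m
    by (simp add: hat_coord_def cscale_def)
  {
    fix v assume "v \<in> vecs (sl2_plus (modular_module {1..}) U2hat)"
    then have vl: "v \<circ> Inl \<in> vecs (modular_module {1..})" and vr: "v \<circ> Inr \<in> finsupp" unfolding R_def[symmetric] vR by auto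
    define u where "u = v \<circ> Inr"
    have u: "u \<in> finsupp" using vr by (simp add: u_def)
    show "actD (sl2_plus (modular_module {1..}) U2hat) v \<in> vecs (sl2_plus (modular_module {1..}) U2hat)"
      "actd (sl2_plus (modular_module {1..}) U2hat) v \<in> vecs (sl2_plus (modular_module {1..}) U2hat)"
      "actH (sl2_plus (modular_module {1..}) U2hat) v \<in> vecs (sl2_plus (modular_module {1..}) U2hat)"
      unfolding R_def[symmetric] vR actl actr using modular_module_closed[OF I vl] U2hat_closed[OF vr] by blast+
    show "graded (pos_part (v \<circ> Inl))" by (rule pos_part_graded[OF I vl])
    have "{m. hat_coord u m \<noteq> 0} \<subseteq> (\<lambda>i. case i of None \<Rightarrow> 0 | Some i \<Rightarrow> 2 + 2 * int i) ` {i. u i \<noteq> 0}"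
    proof
      fix m assume "m \<in> {m. hat_coord u m \<noteq> 0}"
      then have nz: "hat_coord u m \<noteq> 0" by simp
      show "m \<in> (\<lambda>i. case i of None \<Rightarrow> 0 | Some i \<Rightarrow> 2 + 2 * int i) ` {i. u i \<noteq> 0}"
      proof (rule weight_cases[of m])
        assume "m = 0" then show ?thesis using nz by (intro image_eqI[of _ _ None]) auto
      next
        fix i assume "m = 2 + 2 * int i" then show ?thesis using nz by (intro image_eqI[of _ _ "Some i"]) auto
      qed (use nz hat_coord_other in blast)
    qed
    then show "finite {m. hat_coord (v \<circ> Inr) m \<noteq> 0}"
      using u unfolding u_def[symmetric] finsupp_def by (auto intro: finite_subset)
    show "pos_part (actD (sl2_plus (modular_module {1..}) U2hat) v \<circ> Inl) k j = (if j = 0 then 0 else pos_part (v \<circ> Inl) k (j - 1))"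
      "pos_part (actd (sl2_plus (modular_module {1..}) U2hat) v \<circ> Inl) k j = cscale (of_nat (j + 1) * (of_int k + of_nat j)) (pos_part (v \<circ> Inl) k (j + 1))"
      "pos_part (actH (sl2_plus (modular_module {1..}) U2hat) v \<circ> Inl) k j = cscale (of_int k + 2 * of_nat j) (pos_part (v \<circ> Inl) k j)" for k j
      unfolding R_def[symmetric] actl by (rule pos_part_act[OF I vl])+
    have cD: "hat_coord (actD U2hat u) m = (if m - 2 \<le> 0 then 0 else 1) * hat_coord u (m - 2)" for m
    proof (rule weight_cases[of m])
      fix i assume m: "m = 2 + 2 * int i"
      show ?thesis
      proof (cases i)
        case (Suc i')
        then have m2: "m - 2 = 2 + 2 * int i'" using m by simp
        show ?thesis unfolding m2 unfolding m hat_coord_even U2hat_act[OF u] using Suc by simp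
      qed (simp add: m U2hat_act[OF u] hat_coord_even[of _ 0, simplified])
    next
      assume m: "m \<noteq> 0" "\<not> (m > 0 \<and> even m)"
      have "m - 2 \<le> 0 \<or> (m - 2 \<noteq> 0 \<and> \<not> (m - 2 > 0 \<and> even (m - 2)))" using m by auto
      then show ?thesis using hat_coord_other[OF m, of "actD U2hat u"] hat_coord_other[of "m - 2" u] by auto
    qed (simp add: U2hat_act[OF u])
    have cH: "hat_coord (actH U2hat u) m = of_int m * hat_coord u m" for m
    proof (rule weight_cases[of m])
      fix i assume m: "m = 2 + 2 * int i"
      show ?thesis unfolding m hat_coord_even U2hat_act[OF u] by simp
    next
      assume m: "m \<noteq> 0" "\<not> (m > 0 \<and> even m)"
      show ?thesis unfolding hat_coord_other[OF m] by simp
    qed (simp add: U2hat_act[OF u])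
    have cd: "cscale (hat_coord (actd U2hat u) m) (phi_top \<phi> m) = cscale ((if m = 0 then 1 else if m < 0 then 0 else of_int m / 2 * (of_int m / 2 + 1)) * hat_coord u (m + 2)) (phi_top \<phi> m)" for m
    proof (rule weight_cases[of m])
      assume "m = 0"
      then show ?thesis using hat_coord_even[of u 0] by (simp add: U2hat_act[OF u])
    next
      fix i assume m: "m = 2 + 2 * int i"
      have m2: "m + 2 = 2 + 2 * int (Suc i)" using m by simp
      have "(of_int m / 2 * (of_int m / 2 + 1) :: complex) = of_nat (i + 1) * (of_nat i + 2)" unfolding m by (simp add: field_simps)
      then show ?thesis unfolding m2 hat_coord_even using m by (simp add: U2hat_act[OF u] hat_coord_even)
    next
      assume m: "m \<noteq> 0" "\<not> (m > 0 \<and> even m)"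
      then have "phi_top \<phi> m = 0" by (auto simp: phi_top_def)
      then show ?thesis by simp
    qed
    show "cscale (hat_coord (actD (sl2_plus (modular_module {1..}) U2hat) v \<circ> Inr) m) (phi_top \<phi> m) = cscale ((if m - 2 \<le> 0 then 0 else 1) * hat_coord (v \<circ> Inr) (m - 2)) (phi_top \<phi> m)" for m
      unfolding R_def[symmetric] actr u_def[symmetric] cD by (rule refl)
    show "cscale (hat_coord (actd (sl2_plus (modular_module {1..}) U2hat) v \<circ> Inr) m) (phi_top \<phi> m) = cscale ((if m = 0 then 1 else if m < 0 then 0 else of_int m / 2 * (of_int m / 2 + 1)) * hat_coord (v \<circ> Inr) (m + 2)) (phi_top \<phi> m)" for m
      unfolding R_def[symmetric] actr u_def[symmetric] by (rule cd)
    show "cscale (hat_coord (actH (sl2_plus (modular_module {1..}) U2hat) v \<circ> Inr) m) (phi_top \<phi> m) = cscale (of_int m * hat_coord (v \<circ> Inr) m) (phi_top \<phi> m)" for m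
      unfolding R_def[symmetric] actr u_def[symmetric] cH by (rule refl)
    assume p0: "\<And>k j. pos_part (v \<circ> Inl) k j = 0" and c0: "\<And>m. cscale (hat_coord (v \<circ> Inr) m) (phi_top \<phi> m) = 0"
    have F4: "k \<notin> {1..} \<Longrightarrow> component (v \<circ> Inl) k j = 0" for k j using vl unfolding modular_module_iff[OF I] by blast
    have "component (v \<circ> Inl) k j = component 0 k j" for k j
    proof -
      have "component (v \<circ> Inl) k j = 0"
      proof (cases "k > 0")
        case True
        then show ?thesis using p0[of k j] by (simp add: pos_part_def)
      qed (rule F4, simp)
      then show ?thesis by (simp add: component_def fun_eq_iff)
    qed
    then have l0: "v \<circ> Inl = 0" by (rule component_eqI)
    have r0: "u i = 0" for i
    proof (cases i)
      case None
      have "cscale (u None) one_uhp = 0" using c0[of 0] unfolding u_def[symmetric] by (simp add: phi_top_def)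
      then show ?thesis using one_uhp_nz None by simp
    next
      case (Some n)
      have "cscale (u (Some n)) ((D_uhp ^^ n) \<phi>) = 0" using c0[of "2 + 2 * int n"] unfolding u_def[symmetric] phi_top_even hat_coord_even .
      then show ?thesis using Dpow_phi_nz[OF phi, of n] Some unfolding cfun.scale_eq_0_iff by blast
    qed
    show "v = 0"
    proof
      fix p show "v p = 0 p"
      proof (cases p)
        case (Inl a)
        then show ?thesis using fun_cong[OF l0, of a] by simp
      next
        case (Inr b)
        then show ?thesis using r0[of b] by (simp add: u_def)
      qed
    qed
  }
  fix H and c :: "int \<Rightarrow> complex" assume H: "graded H" and c: "finite {m. c m \<noteq> 0}" "\<And>m. phi_top \<phi> m = 0 \<Longrightarrow> c m = 0"
  define u :: "nat option \<Rightarrow> complex" where "u i = (case i of None \<Rightarrow> c 0 | Some n \<Rightarrow> c (2 + 2 * int n))" for i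
  have uc: "hat_coord u m = c m" for m
  proof (rule weight_cases[of m])
    assume m: "m \<noteq> 0" "\<not> (m > 0 \<and> even m)"
    then have "phi_top \<phi> m = 0" by (auto simp: phi_top_def)
    then show ?thesis using hat_coord_other[OF m] c(2) by simp
  qed (simp_all add: u_def)
  have "{i. u i \<noteq> 0} \<subseteq> insert None ((\<lambda>m. Some (nat (m div 2) - 1)) ` {m. c m \<noteq> 0})"
  proof
    fix i assume i: "i \<in> {i. u i \<noteq> 0}"
    show "i \<in> insert None ((\<lambda>m. Some (nat (m div 2) - 1)) ` {m. c m \<noteq> 0})"
    proof (cases i)
      case (Some n)
      have "nat ((2 + 2 * int n) div 2) - 1 = n" by simp
      then show ?thesis using i Some by (intro insertI2 image_eqI[of _ _ "2 + 2 * int n"]) (auto simp: u_def)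
    qed simp
  qed
  then have uf: "u \<in> finsupp" unfolding finsupp_def using c(1) by (auto intro: finite_subset)
  define v where "v = case_sum (from_graded 0 H) u"
  have vl: "v \<circ> Inl = from_graded 0 H" and vr: "v \<circ> Inr = u" by (auto simp: v_def fun_eq_iff)
  have "v \<in> vecs R" unfolding vR vl vr using from_graded[OF H] uf by blast
  then show "\<exists>v\<in>vecs (sl2_plus (modular_module {1..}) U2hat). (\<forall>k j. pos_part (v \<circ> Inl) k j = H k j) \<and> (\<forall>m. hat_coord (v \<circ> Inr) m = c m)"
    unfolding R_def[symmetric] by (intro bexI[of _ v]) (auto simp: vl vr uc from_graded(1)[OF H])
qed

lemma assemble_single:
  assumes f: "f \<in> MF k" and k: "k > 0"
    and H: "\<And>k' j'. Hm v k' j' = (if k' = k \<and> j' = j then f else 0)" and c: "\<And>m. cm v m = 0"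
  shows "assemble e Hm cm v = summand (k + 2 * int j) ((D_uhp ^^ j) f)"
proof (rule slice_eqI)
  fix m
  have "Phi e (Hm v) (cm v) m = Phi e (\<lambda>k' j'. if k' = k \<and> j' = j then f else 0) (\<lambda>_. 0) m"
    by (rule Phi_cong) (simp_all only: H c)
  also have "\<dots> = (if m = k + 2 * int j then (D_uhp ^^ j) f else 0)" by (rule Phi_single[OF f k])
  also have "\<dots> = slice (summand (k + 2 * int j) ((D_uhp ^^ j) f)) m" by (simp add: slice_def summand_def fun_eq_iff)
  finally show "slice (assemble e Hm cm v) m = slice (summand (k + 2 * int j) ((D_uhp ^^ j) f)) m" unfolding slice_assemble .
qed

lemma assemble_top:
  assumes H: "\<And>k j. Hm v k j = 0" and c: "\<And>m. cscale (cm v m) (e m) = (if m = w then g else 0)"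
  shows "assemble e Hm cm v = summand w g"
proof (rule slice_eqI)
  fix m
  have "Phi e (Hm v) (cm v) m = (if m = w then g else 0)"
    unfolding Phi_def c H Dsum_0 by simp
  also have "\<dots> = slice (summand w g) m" by (simp add: slice_def summand_def fun_eq_iff)
  finally show "slice (assemble e Hm cm v) m = slice (summand w g) m" unfolding slice_assemble .
qed

lemma isomorphism_without_phi:
  assumes 0: "\<forall>\<phi>\<in>QM 2. delta \<Gamma> 2 \<phi> = 0"
  shows "\<exists>T. sl2_iso T (modular_module {0..}) (quasi_rep \<Gamma>) \<and>
           (\<forall>f\<in>MF 0. T (summand 0 (tensor f (bvec 0))) = summand 0 f) \<and>
           (\<forall>k>0. \<forall>f\<in>MF k. \<forall>j. T (summand k (tensor f (bvec j))) = summand (k + 2 * int j) ((D_uhp ^^ j) f))"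
proof (intro exI conjI ballI allI impI)
  show "sl2_iso (assemble const_top pos_part weight_0_coord) (modular_module {0..}) (quasi_rep \<Gamma>)" by (rule assemble_iso_const_top[OF 0])
  fix f assume f: "f \<in> MF 0"
  obtain a where a: "f = cscale a one_uhp" by (rule MF_0[OF f])
  show "assemble const_top pos_part weight_0_coord (summand 0 (tensor f (bvec 0))) = summand 0 f"
  proof (rule assemble_top)
    show "pos_part (summand 0 (tensor f (bvec 0))) k j = 0" for k j unfolding pos_part_single by simp
    show "cscale (weight_0_coord (summand 0 (tensor f (bvec 0))) m) (const_top m) = (if m = 0 then f else 0)" for m
      by (simp add: weight_0_coord_def summand_def tensor_def bvec_def a cscale_def one_uhp_def const_top_def fun_eq_iff)
  qed
next
  fix k :: int and f j assume k: "0 < k" and f: "f \<in> MF k"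
  show "assemble const_top pos_part weight_0_coord (summand k (tensor f (bvec j))) = summand (k + 2 * int j) ((D_uhp ^^ j) f)"
  proof (rule assemble_single[OF f k])
    show "pos_part (summand k (tensor f (bvec j))) k' j' = (if k' = k \<and> j' = j then f else 0)" for k' j'
      unfolding pos_part_single using k by simp
    show "weight_0_coord (summand k (tensor f (bvec j))) m = 0" for m using k by (simp add: weight_0_coord_def summand_def)
  qed
qed

lemma isomorphism_with_phi:
  assumes phi: "\<phi> \<in> QM 2" "delta \<Gamma> 2 \<phi> = one_uhp"
  shows "\<exists>T. sl2_iso T (sl2_plus (modular_module {1..}) U2hat) (quasi_rep \<Gamma>) \<and>
           (\<forall>k>0. \<forall>f\<in>MF k. \<forall>j. T (in_left (summand k (tensor f (bvec j)))) = summand (k + 2 * int j) ((D_uhp ^^ j) f)) \<and>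
           T (in_right (bvec None)) = summand 0 one_uhp \<and>
           (\<forall>i. T (in_right (bvec (Some i))) = summand (2 + 2 * int i) ((D_uhp ^^ i) \<phi>))"
proof (intro exI conjI ballI allI impI)
  define T where "T = assemble (phi_top \<phi>) (\<lambda>v :: _ + nat option \<Rightarrow> complex. pos_part (v \<circ> Inl)) (\<lambda>v. hat_coord (v \<circ> Inr))"
  have inl: "in_left w \<circ> Inl = w" "in_left w \<circ> Inr = (\<lambda>_. 0)" for w :: "'c \<Rightarrow> complex" by (auto simp: in_left_def fun_eq_iff)
  have inr: "in_right w \<circ> Inr = w" "in_right w \<circ> Inl = (\<lambda>_. 0)" for w :: "'c \<Rightarrow> complex" by (auto simp: in_right_def fun_eq_iff)
  have p0: "pos_part (\<lambda>_. 0) k j = 0" for k j by (simp add: pos_part_def component_def fun_eq_iff)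
  show "sl2_iso T (sl2_plus (modular_module {1..}) U2hat) (quasi_rep \<Gamma>)" unfolding T_def by (rule assemble_iso_phi_top[OF phi])
  show "T (in_left (summand k (tensor f (bvec j)))) = summand (k + 2 * int j) ((D_uhp ^^ j) f)" if k: "0 < k" and f: "f \<in> MF k" for k f j
    unfolding T_def
  proof (rule assemble_single[OF f k])
    show "pos_part (in_left (summand k (tensor f (bvec j))) \<circ> Inl) k' j' = (if k' = k \<and> j' = j then f else 0)" for k' j'
      unfolding inl pos_part_single using k by simp
    show "hat_coord (in_left (summand k (tensor f (bvec j))) \<circ> Inr) m = 0" for m unfolding inl by (simp add: hat_coord_def)
  qed
  show "T (in_right (bvec None)) = summand 0 one_uhp"
    unfolding T_def
  proof (rule assemble_top)
    show "pos_part (in_right (bvec None) \<circ> Inl) k j = 0" for k j unfolding inr by (rule p0)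
    show "cscale (hat_coord (in_right (bvec None) \<circ> Inr) m) (phi_top \<phi> m) = (if m = 0 then one_uhp else 0)" for m
      unfolding inr by (simp add: hat_coord_def bvec_def phi_top_def)
  qed
  show "T (in_right (bvec (Some i))) = summand (2 + 2 * int i) ((D_uhp ^^ i) \<phi>)" for i
    unfolding T_def
  proof (rule assemble_top)
    show "pos_part (in_right (bvec (Some i)) \<circ> Inl) k j = 0" for k j unfolding inr by (rule p0)
    show "cscale (hat_coord (in_right (bvec (Some i)) \<circ> Inr) m) (phi_top \<phi> m) = (if m = 2 + 2 * int i then (D_uhp ^^ i) \<phi> else 0)" for m
      unfolding inr
    proof (rule weight_cases[of m])
      fix n assume m: "m = 2 + 2 * int n"
      show "cscale (hat_coord (bvec (Some i)) m) (phi_top \<phi> m) = (if m = 2 + 2 * int i then (D_uhp ^^ i) \<phi> else 0)"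
        unfolding m hat_coord_even phi_top_even by (simp add: bvec_def)
    next
      assume m: "m \<noteq> 0" "\<not> (m > 0 \<and> even m)"
      then have "m \<noteq> 2 + 2 * int i" by auto
      then show "cscale (hat_coord (bvec (Some i)) m) (phi_top \<phi> m) = (if m = 2 + 2 * int i then (D_uhp ^^ i) \<phi> else 0)"
        unfolding hat_coord_other[OF m] by simp
    qed (simp add: bvec_def)
  qed
qed

end

theorem theorem3:
  fixes \<Gamma> :: "(real^2^2) set set"
  assumes "discrete_subgroup \<Gamma>" and "finite_covolume \<Gamma>"
  shows
    "modular_forms \<Gamma> 0 = cfun.span {one_uhp} \<and>
     ((\<forall>\<phi>\<in>quasimodular_forms \<Gamma> 2. delta \<Gamma> 2 \<phi> = 0) \<or>
      (\<exists>\<phi>\<in>quasimodular_forms \<Gamma> 2. delta \<Gamma> 2 \<phi> = one_uhp)) \<and>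
     ((\<forall>\<phi>\<in>quasimodular_forms \<Gamma> 2. delta \<Gamma> 2 \<phi> = 0) \<longrightarrow>
      (\<exists>T. sl2_iso T
             (sl2_sum {0..} (\<lambda>k. sl2_tensor (modular_forms \<Gamma> k) (U_mod k)))
             (quasi_rep \<Gamma>) \<and>
           (\<forall>f\<in>modular_forms \<Gamma> 0. T (summand 0 (tensor f (bvec 0))) = summand 0 f) \<and>
           (\<forall>k>0. \<forall>f\<in>modular_forms \<Gamma> k. \<forall>j.
              T (summand k (tensor f (bvec j))) =
                summand (k + 2 * int j) ((D_uhp ^^ j) f)))) \<and>
     (\<forall>\<phi>\<in>quasimodular_forms \<Gamma> 2. delta \<Gamma> 2 \<phi> = one_uhp \<longrightarrow>
      (\<exists>T. sl2_iso T
             (sl2_plus (sl2_sum {1..} (\<lambda>k. sl2_tensor (modular_forms \<Gamma> k) (U_mod k))) U2hat)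
             (quasi_rep \<Gamma>) \<and>
           (\<forall>k>0. \<forall>f\<in>modular_forms \<Gamma> k. \<forall>j.
              T (in_left (summand k (tensor f (bvec j)))) =
                summand (k + 2 * int j) ((D_uhp ^^ j) f)) \<and>
           T (in_right (bvec None)) = summand 0 one_uhp \<and>
           (\<forall>i. T (in_right (bvec (Some i))) =
                summand (2 + 2 * int i) ((D_uhp ^^ i) \<phi>))))"
proof -
  interpret fuchsian \<Gamma> using assms by unfold_locales
  show ?thesis
    using MF_0_span delta_dichotomy isomorphism_without_phi isomorphism_with_phi
    by (intro conjI impI ballI) simp_all
qed

end
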